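(* Let $\mathcal{A}\in\mathbb{R}^{I_1\times I_2\times\dots\times I_N}$ and for each $n=1,\dots,N$ let $\mu_n$, $I_n$, $T_n$ and $K$ be positive integers such that $\mu_n<\mu_n+K<\min\{I_n'',I_n''''\}$, where $I_n''=\min\{I_n,T_n\}$ and $I_n''''=\min\{\mu_1\cdots\mu_{n-1}I_{n+1}\cdots I_N,\,T_n\}$. For $\beta>1$, $\gamma>1$ and $0<\delta_n<1$, suppose that $$p=1-\sum_{n=1}^N\left(\frac{1}{4(\gamma^2-1)\sqrt{\pi\max\{I_n''-\mu_n,\mu_n+K\}\gamma^2}}\left(\frac{2\gamma^2}{e^{\gamma^2-1}}\right)^2+\frac{1}{\sqrt{2\pi(K+1)}}\left(\frac{e}{K+1}\right)^{K+1}+\frac{1}{4(\gamma^2-1)\sqrt{\pi I_n\gamma^2}}\left(\frac{2\gamma^2}{e^{\gamma^2-1}}\right)^2+\delta_n\right)$$ is nonnegative. Let $\mathbf{Q}_1,\dots,\mathbf{Q}_N$ be the orthonormal matrices produced, with $q=1$, by the sampled randomized ST-HOSVD algorithm described in the context, with sampling distributions $\mathbf{p}_n$, and let $\widehat{\mathcal{A}}=\mathcal{A}\times_1(\mathbf{Q}_1\mathbf{Q}_1^\top)\cdots\times_N(\mathbf{Q}_N\mathbf{Q}_N^\top)$. Then $$\|\mathcal{A}-\widehat{\mathcal{A}}\|_F^2\leq\sum_{n=1}^N\mathrm{rank}(\mathbf{A}_{(n)})\left(2(1+\lambda_n)I_n\Delta_{\mu_n+1}(\mathbf{A}_{(n)},1)+\phi_n\|\mathcal{A}\|_F^2\right)$$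 holds with probability at least $p$, where $\mathbf{A}_{(n)}$ is the mode-$n$ unfolding of the original tensor $\mathcal{A}$, $$\lambda_n=\left(\sqrt{\max\{I_n''-\mu_n,\mu_n+K\}}+\sqrt{I_n}\right)\sqrt{2(\mu_n+K)}\,\gamma\beta,$$ and where: if the $\mathbf{p}_n$ are nearly optimal probabilities with constant $\beta_0\in(0,1]$, then $$\phi_n=\frac{\eta_n}{\sqrt{\beta_0T_n}},\qquad\eta_n=1+\sqrt{(8/\delta_n)\log(1/\delta_n)};$$ and if the $\mathbf{p}_n$ are the uniform probabilities, then $$\phi_n=1+\sqrt{\frac{I_n''''}{T_n}}+\frac{I_n''''}{\sqrt{T_n}}\sqrt{8\log(1/\delta_n)}.$$
   Context: $\sigma_i(\cdot)$ is the $i$th largest singular value; $\|\cdot\|_F$ is the Frobenius norm of a matrix or tensor. A matrix $\mathbf{Q}$ is orthonormal if $\mathbf{Q}^\top\mathbf{Q}$ is the identity. The mode-$n$ unfolding of a tensor is the matrix whose columns are its mode-$n$ fibers, and $\mathcal{A}\times_n\mathbf{B}$ is the mode-$n$ product, with entries $\sum_{i_n}a_{i_1\dots i_n\dots i_N}b_{j i_n}$. A standard Gaussian matrix has i.i.d. $N(0,1)$ entries. With $I_n'=\min\{I_n,\,I_1\cdots I_{n-1}I_{n+1}\cdots I_N\}$, put $\Delta_{\mu_n+1}(\mathbf{A}_{(n)},1)=\left(\sum_{i=\mu_n+1}^{I_n'}\sigma_i(\mathbf{A}_{(n)})^{4}\right)^{1/2}$. Sampling matrix: for a probability distribution $\mathbf{p}=(p_1,\dots,p_J)$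 and a positive integer $L$, $\mathbf{S}\in\mathbb{R}^{J\times L}\sim\mathrm{RANDSAMPLE}(L,\mathbf{p})$ means that $s_{ij}=1/\sqrt{Lp_i}$ if $\xi_j=i$ and $s_{ij}=0$ otherwise, where $\xi_1,\dots,\xi_L$ are independent with $\mathbb{P}(\xi_j=i)=p_i$. Sampled randomized ST-HOSVD algorithm (power $q\geq 1$, oversampling $K$, sample sizes $T_n$): process $n=1,2,\dots,N$ in this order. At step $n$ let $\mathcal{B}=\mathcal{A}\times_1\mathbf{Q}_1^\top\cdots\times_{n-1}\mathbf{Q}_{n-1}^\top$ (so $\mathcal{B}=\mathcal{A}$ for $n=1$) with mode-$n$ unfolding $\mathbf{B}_{(n)}\in\mathbb{R}^{I_n\times J_n}$, $J_n=\mu_1\cdots\mu_{n-1}I_{n+1}\cdots I_N$; generate $\mathbf{S}_n\in\mathbb{R}^{J_n\times T_n}\sim\mathrm{RANDSAMPLE}(T_n,\mathbf{p}_n)$; set $\mathbf{C}_n'=\mathbf{B}_{(n)}\mathbf{S}_n$; generate a fresh (independent) standard Gaussian matrix $\mathbf{G}_n\in\mathbb{R}^{I_n\times(\mu_n+K)}$; set $\mathbf{C}_n=(\mathbf{C}_n'\mathbf{C}_n'^\top)^q\mathbf{G}_n$; find an orthonormal $\mathbf{Q}_n\in\mathbb{R}^{I_n\times\mu_n}$ for which there exists $\mathbf{R}_n\in\mathbb{R}^{\mu_n\times(\mu_n+K)}$ with $\|\mathbf{Q}_n\mathbf{R}_n-\mathbf{C}_n\|_F\leq\left(\sum_{k=\mu_n+1}^{\mu_n+K}\sigma_k(\mathbf{C}_n)^2\right)^{1/2}$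 (for example, the first $\mu_n$ left singular vectors of $\mathbf{C}_n$). Probabilities $\mathbf{p}_n=(p_{n,1},\dots,p_{n,J_n})$ are nearly optimal with constant $\beta_0\in(0,1]$ (for the product $\mathbf{B}_{(n)}\mathbf{B}_{(n)}^\top$) if $p_{n,i}\geq\beta_0\|\mathbf{B}_{(n)}(:,i)\|_2^2/\|\mathbf{B}_{(n)}\|_F^2$ for all $i$; they are uniform if $p_{n,i}=1/J_n$ for all $i$. *)

theory Defs
  imports
    "HOL-Probability.Probability"
    "Jordan_Normal_Form.Matrix"
    "Jordan_Normal_Form.Char_Poly"
    "Jordan_Normal_Form.DL_Rank"
begin

definition frob_norm :: "real mat \<Rightarrow> real" where
  "frob_norm A = sqrt (\<Sum>i<dim_row A. \<Sum>j<dim_col A. (A $$ (i, j))\<^sup>2)"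

text \<open>
  The singular values of \<open>A\<close>: the square roots of the eigenvalues of \<open>A\<^sup>T A\<close>, with multiplicity,
  in decreasing order. If \<open>A\<close> has more columns than rows, the list is padded with zeros beyond
  the usual \<open>min (dim_row A) (dim_col A)\<close> entries. Singular values are numbered from 1.
\<close>

definition singular_values :: "real mat \<Rightarrow> real list" where
  "singular_values A =
     map sqrt (rev (sorted_list_of_multiset (proots (char_poly (transpose_mat A * A)))))"

definition sigma :: "nat \<Rightarrow> real mat \<Rightarrow> real" where
  "sigma i A =
     (if 1 \<le> i \<and> i \<le> length (singular_values A) then singular_values A ! (i - 1) else 0)"

text \<open>The tail for \<open>q = 1\<close>, hence fourth powers. With \<open>A = A\<^sub>(\<^sub>n\<^sub>)\<close>, the upper summation limit is \<open>I\<^sub>n'\<close>.\<close>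

definition Delta1 :: "nat \<Rightarrow> real mat \<Rightarrow> real" where
  "Delta1 r A = sqrt (\<Sum>i = r..min (dim_row A) (dim_col A). sigma i A ^ 4)"

definition mat_rank :: "real mat \<Rightarrow> nat" where
  "mat_rank A = vec_space.rank (dim_row A) A"

definition orthonormal :: "real mat \<Rightarrow> bool" where
  "orthonormal Q \<longleftrightarrow> transpose_mat Q * Q = 1\<^sub>m (dim_col Q)"

text \<open>
  A tensor of order \<open>N\<close> and dimensions \<open>d 1, \<dots>, d N\<close> is a function on multi-indices; only its values
  on \<open>tensor_index N d\<close> matter. Modes are numbered from 1, positions within a mode from 0.
\<close>

type_synonym tensor = "(nat \<Rightarrow> nat) \<Rightarrow> real"

definition tensor_index :: "nat \<Rightarrow> (nat \<Rightarrow> nat) \<Rightarrow> (nat \<Rightarrow> nat) set" where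
  "tensor_index N d = (\<Pi>\<^sub>E k\<in>{1..N}. {..<d k})"

definition tensor_norm :: "nat \<Rightarrow> (nat \<Rightarrow> nat) \<Rightarrow> tensor \<Rightarrow> real" where
  "tensor_norm N d A = sqrt (\<Sum>i\<in>tensor_index N d. (A i)\<^sup>2)"

definition mode_prod :: "tensor \<Rightarrow> nat \<Rightarrow> real mat \<Rightarrow> tensor" where
  "mode_prod A n B = (\<lambda>i. \<Sum>k<dim_col B. A (i(n := k)) * B $$ (i n, k))"

primrec mode_prods :: "tensor \<Rightarrow> (nat \<Rightarrow> real mat) \<Rightarrow> nat \<Rightarrow> tensor" where
  "mode_prods A B 0 = A"
| "mode_prods A B (Suc n) = mode_prod (mode_prods A B n) (Suc n) (B (Suc n))"

text \<open>
  The columns of the mode-\<open>n\<close> unfolding are the mode-\<open>n\<close> fibers, in the usual order in which the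
  lowest remaining mode varies fastest: the fiber with fixed indices \<open>i k\<close> (\<open>k \<noteq> n\<close>) is the column
  number \<open>\<Sum>k\<noteq>n. i k * (\<Prod>m<k, m\<noteq>n. d m)\<close>, and \<open>fiber_index\<close> decodes this number.
\<close>

definition unfold_cols :: "nat \<Rightarrow> (nat \<Rightarrow> nat) \<Rightarrow> nat \<Rightarrow> nat" where
  "unfold_cols N d n = (\<Prod>k\<in>{1..N} - {n}. d k)"

definition fiber_index :: "nat \<Rightarrow> (nat \<Rightarrow> nat) \<Rightarrow> nat \<Rightarrow> nat \<Rightarrow> nat \<Rightarrow> nat" where
  "fiber_index N d n j = (\<lambda>k\<in>{1..N} - {n}. (j div (\<Prod>m\<in>{1..<k} - {n}. d m)) mod d k)"

definition unfolding_mat :: "nat \<Rightarrow> (nat \<Rightarrow> nat) \<Rightarrow> nat \<Rightarrow> tensor \<Rightarrow> real mat" where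
  "unfolding_mat N d n A =
     mat (d n) (unfold_cols N d n) (\<lambda>(i, j). A ((fiber_index N d n j)(n := i)))"

definition sampling_mat :: "nat \<Rightarrow> nat \<Rightarrow> (nat \<Rightarrow> real) \<Rightarrow> (nat \<Rightarrow> nat) \<Rightarrow> real mat" where
  "sampling_mat J L p \<xi> =
     mat J L (\<lambda>(i, j). if \<xi> j = i then 1 / sqrt (real L * p i) else 0)"

definition prob_vector :: "nat \<Rightarrow> (nat \<Rightarrow> real) \<Rightarrow> bool" where
  "prob_vector J p \<longleftrightarrow> (\<forall>i<J. 0 \<le> p i) \<and> (\<Sum>i<J. p i) = 1"

text \<open>For \<open>B = 0\<close> every distribution is nearly optimal, since \<open>0 / 0 = 0\<close>.\<close>

definition nearly_optimal :: "real \<Rightarrow> real mat \<Rightarrow> (nat \<Rightarrow> real) \<Rightarrow> bool" where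
  "nearly_optimal \<beta>\<^sub>0 B p \<longleftrightarrow>
     (\<forall>i<dim_col B. p i \<ge> \<beta>\<^sub>0 * (\<Sum>k<dim_row B. (B $$ (k, i))\<^sup>2) / (frob_norm B)\<^sup>2)"

definition uniform_probs :: "nat \<Rightarrow> (nat \<Rightarrow> real) \<Rightarrow> bool" where
  "uniform_probs J p \<longleftrightarrow> (\<forall>i<J. p i = 1 / real J)"

definition standard_gaussian_mat :: "'w measure \<Rightarrow> nat \<Rightarrow> nat \<Rightarrow> ('w \<Rightarrow> real mat) \<Rightarrow> bool" where
  "standard_gaussian_mat M m l G \<longleftrightarrow>
     (\<forall>\<omega>\<in>space M. G \<omega> \<in> carrier_mat m l) \<and>
     prob_space.indep_vars M (\<lambda>_. borel) (\<lambda>e \<omega>. G \<omega> $$ e) ({..<m} \<times> {..<l}) \<and>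
     (\<forall>e\<in>{..<m} \<times> {..<l}. distributed M lborel (\<lambda>\<omega>. G \<omega> $$ e) std_normal_density)"

definition step_dims :: "(nat \<Rightarrow> nat) \<Rightarrow> (nat \<Rightarrow> nat) \<Rightarrow> nat \<Rightarrow> nat \<Rightarrow> nat" where
  "step_dims I \<mu> n k = (if k < n then \<mu> k else I k)"

definition step_cols :: "nat \<Rightarrow> (nat \<Rightarrow> nat) \<Rightarrow> (nat \<Rightarrow> nat) \<Rightarrow> nat \<Rightarrow> nat" where
  "step_cols N I \<mu> n = unfold_cols N (step_dims I \<mu> n) n"

definition step_unfolding ::
  "nat \<Rightarrow> (nat \<Rightarrow> nat) \<Rightarrow> (nat \<Rightarrow> nat) \<Rightarrow> tensor \<Rightarrow> (nat \<Rightarrow> real mat) \<Rightarrow> nat \<Rightarrow> real mat" where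
  "step_unfolding N I \<mu> A Q n =
     unfolding_mat N (step_dims I \<mu> n) n (mode_prods A (\<lambda>k. transpose_mat (Q k)) (n - 1))"

text \<open>The admissible outcomes of computing an orthonormal basis from the sketch \<open>C\<close>.\<close>

definition range_basis :: "nat \<Rightarrow> nat \<Rightarrow> real mat \<Rightarrow> real mat \<Rightarrow> bool" where
  "range_basis \<mu> K C Q \<longleftrightarrow>
     Q \<in> carrier_mat (dim_row C) \<mu> \<and> orthonormal Q \<and>
     (\<exists>R\<in>carrier_mat \<mu> (\<mu> + K).
        frob_norm (Q * R - C) \<le> sqrt (\<Sum>k = \<mu> + 1..\<mu> + K. (sigma k C)\<^sup>2))"

definition hosvd_approx :: "nat \<Rightarrow> tensor \<Rightarrow> (nat \<Rightarrow> real mat) \<Rightarrow> tensor" where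
  "hosvd_approx N A Q = mode_prods A (\<lambda>k. Q k * transpose_mat (Q k)) N"

text \<open>
  A run of the algorithm on the probability space \<open>M\<close>. The \<open>\<sigma>\<close>-algebra \<open>H n\<close> is the information
  available at the start of step \<open>n\<close>, and \<open>H' n\<close> the information available once the sampled columns
  \<open>\<xi> n 0, \<dots>, \<xi> n (T n - 1)\<close> are drawn but not yet the Gaussian matrix \<open>G n\<close>. The sampling
  distribution \<open>p n\<close> of step \<open>n\<close> may depend on the past, since the matrix that is sampled does;
  accordingly \<open>draws\<close> says that, conditionally on the past, the \<open>\<xi> n j\<close> are independent with
  distribution \<open>p n\<close>.
\<close>

locale sampled_randomized_sthosvd = prob_space M
  for M :: "'w measure" +
  fixes N :: nat and I \<mu> T :: "nat \<Rightarrow> nat" and K q :: nat and A :: tensor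
    and H H' :: "nat \<Rightarrow> 'w measure"
    and p :: "nat \<Rightarrow> 'w \<Rightarrow> nat \<Rightarrow> real"
    and \<xi> :: "nat \<Rightarrow> nat \<Rightarrow> 'w \<Rightarrow> nat"
    and G Q :: "nat \<Rightarrow> 'w \<Rightarrow> real mat"
  assumes history:
    "\<And>n. n \<in> {1..N} \<Longrightarrow>
       subalgebra (H' n) (H n) \<and> subalgebra (H (Suc n)) (H' n) \<and> subalgebra M (H (Suc n))"
  and probs:
    "\<And>n \<omega>. n \<in> {1..N} \<Longrightarrow> \<omega> \<in> space M \<Longrightarrow> prob_vector (step_cols N I \<mu> n) (p n \<omega>)"
  and probs_measurable:
    "\<And>n i. n \<in> {1..N} \<Longrightarrow> i < step_cols N I \<mu> n \<Longrightarrow> (\<lambda>\<omega>. p n \<omega> i) \<in> borel_measurable (H n)"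
  and draws_measurable:
    "\<And>n j. n \<in> {1..N} \<Longrightarrow> j < T n \<Longrightarrow>
       \<xi> n j \<in> measurable (H' n) (count_space {..<step_cols N I \<mu> n})"
  and draws:
    "\<And>n v. n \<in> {1..N} \<Longrightarrow> v \<in> {..<T n} \<rightarrow> {..<step_cols N I \<mu> n} \<Longrightarrow>
       AE \<omega> in M.
         real_cond_exp M (H n) (indicator {\<omega> \<in> space M. \<forall>j<T n. \<xi> n j \<omega> = v j}) \<omega>
           = (\<Prod>j<T n. p n \<omega> (v j))"
  and gaussian:
    "\<And>n. n \<in> {1..N} \<Longrightarrow> standard_gaussian_mat M (I n) (\<mu> n + K) (G n)"
  and gaussian_measurable:
    "\<And>n e. n \<in> {1..N} \<Longrightarrow> e \<in> {..<I n} \<times> {..<\<mu> n + K} \<Longrightarrow>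
       (\<lambda>\<omega>. G n \<omega> $$ e) \<in> borel_measurable (H (Suc n))"
  and gaussian_fresh:
    "\<And>n. n \<in> {1..N} \<Longrightarrow>
       indep_set (sets (H' n))
         (sets (vimage_algebra (space M) (\<lambda>\<omega>. \<lambda>e\<in>{..<I n} \<times> {..<\<mu> n + K}. G n \<omega> $$ e)
           (\<Pi>\<^sub>M e\<in>{..<I n} \<times> {..<\<mu> n + K}. borel)))"
  and basis:
    "\<And>n \<omega>. n \<in> {1..N} \<Longrightarrow> \<omega> \<in> space M \<Longrightarrow>
       (let B = step_unfolding N I \<mu> A (\<lambda>k. Q k \<omega>) n;
            C' = B * sampling_mat (step_cols N I \<mu> n) (T n) (p n \<omega>) (\<lambda>j. \<xi> n j \<omega>);
            C = (C' * transpose_mat C') ^\<^sub>m q * G n \<omega>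
        in range_basis (\<mu> n) K C (Q n \<omega>))"
  and basis_measurable:
    "\<And>n e. n \<in> {1..N} \<Longrightarrow> e \<in> {..<I n} \<times> {..<\<mu> n} \<Longrightarrow>
       (\<lambda>\<omega>. Q n \<omega> $$ e) \<in> borel_measurable (H (Suc n))"

end

theory Submission
  imports Defs
begin

text \<open>
  Let \<open>B\<close> be the matrix treated at step \<open>n\<close> and \<open>E = 1 - Q\<^sub>n Q\<^sub>n\<^sup>T\<close>. By orthonormality the squared error is exactly
  the sum over \<open>n\<close> of \<open>\<parallel>E B\<parallel>\<^sup>2\<close>, it never exceeds \<open>\<parallel>A\<parallel>\<^sup>2\<close>, and Bessel's inequality gives
  \<open>\<parallel>Z B\<parallel> \<le> \<parallel>Z A\<^sub>(\<^sub>n\<^sub>)\<parallel>\<close> for every matrix \<open>Z\<close>. For uniform probabilities \<open>\<phi>\<^sub>n \<ge> 1\<close>, so the bound is at least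
  \<open>\<parallel>A\<parallel>\<^sup>2\<close> and holds surely; in the nearly optimal case one may assume \<open>rank(A\<^sub>(\<^sub>n\<^sub>)) \<phi>\<^sub>n < 1\<close> for all \<open>n\<close>.

  For one step let \<open>C = B S\<close> be the sampled matrix and \<open>V\<close> the leading left singular vectors of
  \<open>A\<^sub>(\<^sub>n\<^sub>)\<close>. If \<open>U\<close> spans a top eigenspace of \<open>C C\<^sup>T\<close> and \<open>P\<close> is a right inverse of \<open>U\<^sup>T G\<close>, then
  \<open>\<parallel>E C\<parallel>\<^sup>2 \<le> (1 + 2 \<parallel>G\<parallel> \<parallel>P\<parallel>) \<parallel>(1 - U U\<^sup>T) C\<parallel>\<^sup>2\<close>. The rows of \<open>U\<^sup>T G\<close> are independent Gaussian vectors,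
  each of which is unlikely to be close to the span of the others, so a small \<open>P\<close> exists
  with high probability. Hence \<open>\<parallel>E C\<parallel>\<^sup>2 \<le> h \<parallel>(1 - V V\<^sup>T) C\<parallel>\<^sup>2\<close>, while \<open>\<parallel>E B\<parallel>\<^sup>2\<close> exceeds \<open>\<parallel>E C\<parallel>\<^sup>2\<close> by at
  most \<open>rank(A\<^sub>(\<^sub>n\<^sub>))\<^sup>1\<^sup>/\<^sup>2 \<parallel>C C\<^sup>T - B B\<^sup>T\<parallel>\<close>. Near optimality bounds the variance of \<open>\<parallel>(1 - V V\<^sup>T) C\<parallel>\<^sup>2\<close> and the mean square
  of \<open>C C\<^sup>T - B B\<^sup>T\<close> by multiples of \<open>1 / (\<beta>\<^sub>0 T\<^sub>n)\<close>; Markov's inequality (large \<open>\<delta>\<^sub>n\<close>) or Chebyshev's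
  inequality (small \<open>\<delta>\<^sub>n\<close>) concludes.
\<close>

section \<open>Orthonormal families and the spectral theorem\<close>

text \<open>The sketch analysis needs a \<open>U\<close> determined by the sampled matrix alone,
  because only then is it independent of \<open>G\<close>. A top eigenspace jumps at ties between
  eigenvalues, so countably many fixed candidates are used that are eigenspaces only up to
  \<open>\<epsilon>\<close>; this is why \<open>residual_bound\<close> tolerates a nonzero
  off-diagonal block.

  The claim involves \<open>Delta1\<close>, a root of fourth powers, while residuals produce the sum
  \<open>\<tau>\<close> of the squared tail singular values. The factor rank in the claim pays for
  this change, so that the first part of the bound is at least \<open>a * \<tau>\<close> with
  \<open>a = budget_factor\<close>. The constants are arranged so that
  \<open>3 * sketch_factor \<le> a\<close>: one third of the budget absorbs the mean of the sampled
  tail, two thirds remain for its fluctuation.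

  Assuming that rank times \<open>\<phi>\<close> is below 1 does more than exclude a trivial case.
  It bounds \<open>\<kappa> * W / R\<close> by \<open>1 / (r * \<eta>)\<^sup>2\<close>, and so the
  Chebyshev term becomes a multiple of \<open>1 / \<eta>\<^sup>2\<close> free of the data.\<close>

text \<open>Vectors of dimension \<open>n\<close> are functions of which only the values below \<open>n\<close> matter.\<close>

definition ip :: "nat \<Rightarrow> (nat \<Rightarrow> real) \<Rightarrow> (nat \<Rightarrow> real) \<Rightarrow> real" where
  "ip n x y = (\<Sum>i<n. x i * y i)"

definition orthonormal_family :: "nat \<Rightarrow> nat \<Rightarrow> (nat \<Rightarrow> nat \<Rightarrow> real) \<Rightarrow> bool" where
  "orthonormal_family n k w \<longleftrightarrow>
     (\<forall>i<k. \<forall>j<k. ip n (w i) (w j) = (if i = j then 1 else 0))"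

lemma ip_commute: "ip n x y = ip n y x"
  by (simp add: ip_def mult.commute)

lemma ip_add_left: "ip n (\<lambda>i. x i + y i) z = ip n x z + ip n y z"
  by (simp add: ip_def distrib_right sum.distrib)

lemma ip_diff_left: "ip n (\<lambda>i. x i - y i) z = ip n x z - ip n y z"
  by (simp add: ip_def left_diff_distrib sum_subtractf)

lemma ip_scale_left: "ip n (\<lambda>i. c * x i) z = c * ip n x z"
  by (simp add: ip_def sum_distrib_left mult.assoc)

lemma ip_sum_left: "ip n (\<lambda>i. \<Sum>j\<in>J. f j i) z = (\<Sum>j\<in>J. ip n (f j) z)"
  unfolding ip_def sum_distrib_right by (subst sum.swap) simp

lemma ip_add_right: "ip n z (\<lambda>i. x i + y i) = ip n z x + ip n z y"
  by (subst ip_commute, subst ip_add_left, simp add: ip_commute)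

lemma ip_diff_right: "ip n z (\<lambda>i. x i - y i) = ip n z x - ip n z y"
  by (subst ip_commute, subst ip_diff_left, simp add: ip_commute)

lemma ip_scale_right: "ip n z (\<lambda>i. c * x i) = c * ip n z x"
  by (subst ip_commute, subst ip_scale_left, simp add: ip_commute)

lemma ip_sum_right: "ip n z (\<lambda>i. \<Sum>j\<in>J. f j i) = (\<Sum>j\<in>J. ip n z (f j))"
  by (subst ip_commute, subst ip_sum_left, simp add: ip_commute)

lemmas ip_linear = ip_add_left ip_diff_left ip_scale_left ip_sum_left
  ip_add_right ip_diff_right ip_scale_right ip_sum_right

lemma ip_self_nonneg: "0 \<le> ip n x x"
  by (simp add: ip_def sum_nonneg)

lemma ip_self_eq_0: "ip n x x = 0 \<Longrightarrow> i < n \<Longrightarrow> x i = 0"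
  by (simp add: ip_def sum_nonneg_eq_0_iff)

lemma ip_cong: "(\<And>i. i < n \<Longrightarrow> x i = x' i) \<Longrightarrow> (\<And>i. i < n \<Longrightarrow> y i = y' i) \<Longrightarrow> ip n x y = ip n x' y'"
  by (simp add: ip_def)

definition onb_residual :: "nat \<Rightarrow> nat \<Rightarrow> (nat \<Rightarrow> nat \<Rightarrow> real) \<Rightarrow> (nat \<Rightarrow> real) \<Rightarrow> nat \<Rightarrow> real" where
  "onb_residual n k w x = (\<lambda>i. x i - (\<Sum>j<k. ip n (w j) x * w j i))"

lemma ip_onb_residual:
  assumes "orthonormal_family n k w" "j < k"
  shows "ip n (w j) (onb_residual n k w x) = 0"
proof -
  have "(\<Sum>i<k. ip n (w i) x * ip n (w j) (w i)) = (\<Sum>i<k. if i = j then ip n (w i) x else 0)"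
    using assms by (intro sum.cong) (auto simp: orthonormal_family_def)
  then show ?thesis
    using assms by (simp add: onb_residual_def ip_linear)
qed

lemma ip_residual_residual:
  assumes "orthonormal_family n k w"
  shows "ip n (onb_residual n k w x) (onb_residual n k w x) = ip n x x - (\<Sum>j<k. (ip n (w j) x)\<^sup>2)"
proof -
  let ?r = "onb_residual n k w x"
  have "ip n ?r ?r = ip n (\<lambda>i. x i - (\<Sum>j<k. ip n (w j) x * w j i)) ?r"
    by (simp only: onb_residual_def)
  also have "\<dots> = ip n x ?r - (\<Sum>j<k. ip n (w j) x * ip n (w j) ?r)"
    by (simp only: ip_diff_left ip_sum_left ip_scale_left)
  also have "\<dots> = ip n x ?r"
    using ip_onb_residual[OF assms] by simp
  also have "\<dots> = ip n x x - (\<Sum>j<k. (ip n (w j) x)\<^sup>2)"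
    by (simp only: onb_residual_def ip_diff_right ip_sum_right ip_scale_right power2_eq_square) (simp add: ip_commute)
  finally show ?thesis .
qed

lemma bessel:
  assumes "orthonormal_family n k w"
  shows "(\<Sum>j<k. (ip n (w j) x)\<^sup>2) \<le> ip n x x"
  using ip_residual_residual[OF assms, of x] ip_self_nonneg[of n "onb_residual n k w x"] by linarith

definition unit_fun :: "nat \<Rightarrow> nat \<Rightarrow> real" where
  "unit_fun a = (\<lambda>i. if i = a then 1 else 0)"

lemma ip_unit_fun: "a < n \<Longrightarrow> ip n x (unit_fun a) = x a"
  by (simp add: ip_def unit_fun_def if_distrib cong: if_cong)

text \<open>The trace of the orthogonal projection onto the span of the family, read off on
  coordinate vectors. Dimension arguments then reduce to comparing \<open>k\<close> with the number
  of coordinates, since by Bessel each inner sum is at most 1.\<close>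

lemma sum_bessel_unit:
  assumes "orthonormal_family n k w"
  shows "(\<Sum>a<n. \<Sum>j<k. (ip n (w j) (unit_fun a))\<^sup>2) = real k"
proof -
  have "(\<Sum>a<n. \<Sum>j<k. (ip n (w j) (unit_fun a))\<^sup>2) = (\<Sum>j<k. \<Sum>a<n. (w j a)\<^sup>2)"
    by (subst sum.swap) (simp add: ip_unit_fun)
  also have "\<dots> = (\<Sum>j<k. ip n (w j) (w j))"
    by (simp add: ip_def power2_eq_square)
  also have "\<dots> = (\<Sum>j<k. 1)"
    using assms by (intro sum.cong) (auto simp: orthonormal_family_def)
  finally show ?thesis by simp
qed

lemma orthonormal_family_le:
  assumes "orthonormal_family n k w"
  shows "k \<le> n"
proof -
  have "real k = (\<Sum>a<n. \<Sum>j<k. (ip n (w j) (unit_fun a))\<^sup>2)"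
    using sum_bessel_unit[OF assms] by simp
  also have "\<dots> \<le> (\<Sum>a<n. 1)"
  proof (rule sum_mono)
    fix a assume "a \<in> {..<n}"
    then show "(\<Sum>j<k. (ip n (w j) (unit_fun a))\<^sup>2) \<le> 1"
      using bessel[OF assms, of "unit_fun a"] by (simp add: ip_unit_fun) (simp add: unit_fun_def)
  qed
  finally show ?thesis by simp
qed

text \<open>The projections of the \<open>n\<close> coordinate vectors have total squared length
  only \<open>k\<close>, so for \<open>k < n\<close> one of them has length less than 1; its
  residual is nonzero and can be normalized.\<close>

lemma ex_unit_orthogonal:
  assumes w: "orthonormal_family n k w" and kn: "k < n"
  shows "\<exists>v. ip n v v = 1 \<and> (\<forall>j<k. ip n (w j) v = 0)"
proof -
  have "\<exists>a<n. (\<Sum>j<k. (ip n (w j) (unit_fun a))\<^sup>2) < 1"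
  proof (rule ccontr)
    assume "\<not> ?thesis"
    then have "(\<Sum>a<n. 1) \<le> (\<Sum>a<n. \<Sum>j<k. (ip n (w j) (unit_fun a))\<^sup>2)"
      by (intro sum_mono) auto
    then show False using sum_bessel_unit[OF w] kn by simp
  qed
  then obtain a where a: "a < n" "(\<Sum>j<k. (ip n (w j) (unit_fun a))\<^sup>2) < 1" by blast
  define r where "r = onb_residual n k w (unit_fun a)"
  have "ip n (unit_fun a) (unit_fun a) = 1"
    using a(1) by (simp add: ip_unit_fun) (simp add: unit_fun_def)
  then have rpos: "ip n r r > 0"
    using ip_residual_residual[OF w, of "unit_fun a"] a(2) by (simp add: r_def)
  define v where "v = (\<lambda>i. (1 / sqrt (ip n r r)) * r i)"
  have "ip n v v = (1 / sqrt (ip n r r)) * ((1 / sqrt (ip n r r)) * ip n r r)"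
    unfolding v_def by (simp only: ip_scale_left ip_scale_right)
  also have "\<dots> = 1" using rpos by (simp add: field_simps)
  finally have "ip n v v = 1" .
  moreover have "ip n (w j) v = 0" if "j < k" for j
    unfolding v_def by (simp only: ip_scale_right) (simp add: r_def ip_onb_residual[OF w that])
  ultimately show ?thesis by blast
qed

lemma orthonormal_family_Suc:
  assumes "orthonormal_family n k w" "ip n v v = 1" "\<forall>j<k. ip n (w j) v = 0"
  shows "orthonormal_family n (Suc k) (w(k := v))"
  using assms by (auto simp: orthonormal_family_def less_Suc_eq ip_commute)

lemma orthonormal_family_extend:
  assumes "orthonormal_family n k w" "k \<le> k'" "k' \<le> n"
  shows "\<exists>w'. orthonormal_family n k' w' \<and> (\<forall>j<k. w' j = w j)"
  using assms(2,3)
proof (induction k' rule: dec_induct)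
  case base
  then show ?case using assms(1) by blast
next
  case (step i)
  then obtain w' where w': "orthonormal_family n i w'" "\<forall>j<k. w' j = w j" by auto
  obtain v where v: "ip n v v = 1" "\<forall>j<i. ip n (w' j) v = 0"
    using ex_unit_orthogonal[OF w'(1)] step by auto
  have "\<forall>j<k. (w'(i := v)) j = w j" using w'(2) step by auto
  then show ?case using orthonormal_family_Suc[OF w'(1) v] by blast
qed

text \<open>A nonzero residual would, once normalized, extend the family to \<open>n + 1\<close>
  orthonormal vectors in dimension \<open>n\<close>.\<close>

lemma onb_expansion:
  assumes w: "orthonormal_family n n w" and i: "i < n"
  shows "x i = (\<Sum>j<n. ip n (w j) x * w j i)"
proof (rule ccontr)
  assume ne: "x i \<noteq> (\<Sum>j<n. ip n (w j) x * w j i)"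
  define r where "r = onb_residual n n w x"
  have "r i \<noteq> 0" using ne by (simp add: r_def onb_residual_def)
  then have rpos: "ip n r r > 0"
    using ip_self_eq_0[of n r i] i ip_self_nonneg[of n r] by fastforce
  define v where "v = (\<lambda>i. (1 / sqrt (ip n r r)) * r i)"
  have "ip n v v = (1 / sqrt (ip n r r)) * ((1 / sqrt (ip n r r)) * ip n r r)"
    unfolding v_def by (simp only: ip_scale_left ip_scale_right)
  also have "\<dots> = 1" using rpos by (simp add: field_simps)
  finally have v1: "ip n v v = 1" .
  have "\<forall>j<n. ip n (w j) v = 0"
    unfolding v_def by (simp only: ip_scale_right) (simp add: r_def ip_onb_residual[OF w])
  from orthonormal_family_le[OF orthonormal_family_Suc[OF w v1 this]] show False by simp
qed

lemma onb_parseval: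
  assumes w: "orthonormal_family n n w"
  shows "ip n x y = (\<Sum>j<n. ip n (w j) x * ip n (w j) y)"
proof -
  have "ip n x y = ip n (\<lambda>i. \<Sum>j<n. ip n (w j) x * w j i) y"
    by (rule ip_cong) (rule onb_expansion[OF w], simp_all)
  also have "\<dots> = (\<Sum>j<n. ip n (w j) x * ip n (w j) y)"
    by (simp only: ip_sum_left ip_scale_left)
  finally show ?thesis .
qed

section \<open>Spectral theorem for symmetric matrices\<close>

definition mv :: "nat \<Rightarrow> (nat \<Rightarrow> nat \<Rightarrow> real) \<Rightarrow> (nat \<Rightarrow> real) \<Rightarrow> nat \<Rightarrow> real" where
  "mv n S x = (\<lambda>i. \<Sum>k<n. S i k * x k)"

lemma mv_add: "mv n S (\<lambda>i. x i + y i) = (\<lambda>i. mv n S x i + mv n S y i)"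
  by (simp add: mv_def distrib_left sum.distrib)

lemma mv_scale: "mv n S (\<lambda>i. c * x i) = (\<lambda>i. c * mv n S x i)"
  by (simp add: mv_def sum_distrib_left mult.left_commute)

lemma ip_mv_sym:
  assumes "\<forall>i<n. \<forall>j<n. S i j = S j i"
  shows "ip n x (mv n S y) = ip n (mv n S x) y"
proof -
  have "ip n x (mv n S y) = (\<Sum>i<n. \<Sum>k<n. x i * (S i k * y k))"
    by (simp add: ip_def mv_def sum_distrib_left)
  also have "\<dots> = (\<Sum>k<n. \<Sum>i<n. x i * (S i k * y k))" by (rule sum.swap)
  also have "\<dots> = (\<Sum>k<n. \<Sum>i<n. S k i * x i * y k)"
    using assms by (intro sum.cong) auto
  also have "\<dots> = ip n (mv n S x) y"
    by (simp add: ip_def mv_def sum_distrib_right)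
  finally show ?thesis .
qed

text \<open>Vectors being functions on all natural numbers, compactness is taken in the product
  topology; pinning the coordinates from \<open>n\<close> on to 0 keeps every factor
  compact.\<close>

lemma compact_unit_box:
  "compact (Pi\<^sub>E UNIV (\<lambda>i::nat. if i < n then {-1..1::real} else {0}))"
proof -
  have "compactin (product_topology (\<lambda>_. euclidean) UNIV) (Pi\<^sub>E UNIV (\<lambda>i::nat. if i < n then {-1..1::real} else {0}))"
    unfolding compactin_PiE by auto
  then show ?thesis by (simp add: euclidean_product_topology)
qed

lemma continuous_on_ip [continuous_intros]:
  assumes "\<And>i. i < n \<Longrightarrow> continuous_on X (\<lambda>z. f z i)" "\<And>i. i < n \<Longrightarrow> continuous_on X (\<lambda>z. g z i)"
  shows "continuous_on X (\<lambda>z. ip n (f z) (g z))"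
  unfolding ip_def using assms by (intro continuous_on_sum continuous_on_mult) auto

text \<open>The unit sphere of the orthogonal complement, truncated to the first \<open>n\<close>
  coordinates, is compact, so the continuous quadratic form attains its maximum there; homogeneity
  of degree two extends the bound to all \<open>x\<close>.\<close>

lemma rayleigh_max:
  assumes w: "orthonormal_family n k w" and kn: "k < n"
  shows "\<exists>v. ip n v v = 1 \<and> (\<forall>j<k. ip n (w j) v = 0) \<and>
    (\<forall>x. (\<forall>j<k. ip n (w j) x = 0) \<longrightarrow> ip n x (mv n S x) \<le> ip n v (mv n S v) * ip n x x)"
proof -
  define X where "X = Pi\<^sub>E UNIV (\<lambda>i::nat. if i < n then {-1..1::real} else {0}) \<inter>
     {x. ip n x x = 1} \<inter> (\<Inter>j\<in>{..<k}. {x. ip n (w j) x = 0})"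
  have co: "continuous_on Y (\<lambda>z::nat\<Rightarrow>real. z i)" for i Y
    by (rule continuous_on_subset[OF continuous_on_product_coordinates]) simp
  have "compact X"
    unfolding X_def
  proof (intro compact_Int_closed compact_unit_box closed_INT ballI)
    show "closed {x. ip n x x = 1}"
      by (intro closed_Collect_eq continuous_intros co)
    show "closed {x. ip n (w j) x = 0}" for j
      by (intro closed_Collect_eq continuous_intros co)
  qed
  have box: "\<bar>x i\<bar> \<le> 1" if "ip n x x = 1" "i < n" for x i
  proof -
    have "(x i)\<^sup>2 \<le> (\<Sum>i<n. (x i)\<^sup>2)" using that by (intro member_le_sum) auto
    then show ?thesis using that by (simp add: ip_def power2_eq_square[symmetric] abs_square_le_1)
  qed
  \<comment> \<open>Truncation changes no inner product, so every unit vector of the complement has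
    a representative in the compact set.\<close>
  have restr: "(\<lambda>i. if i < n then x i else 0) \<in> X"
    if "ip n x x = 1" "\<forall>j<k. ip n (w j) x = 0" for x
  proof -
    have "ip n (w j) (\<lambda>i. if i < n then x i else 0) = ip n (w j) x"
      "ip n (\<lambda>i. if i < n then x i else 0) (\<lambda>i. if i < n then x i else 0) = ip n x x" for j
      by (auto intro!: ip_cong)
    then show ?thesis using that box[OF that(1)] by (fastforce simp: X_def abs_le_iff)
  qed
  obtain v0 where "ip n v0 v0 = 1" "\<forall>j<k. ip n (w j) v0 = 0"
    using ex_unit_orthogonal[OF w kn] by blast
  then have "X \<noteq> {}" using restr by blast
  moreover have "continuous_on X (\<lambda>x. ip n x (mv n S x))"
    unfolding mv_def by (intro continuous_intros co)
  ultimately obtain v where v: "v \<in> X" "\<And>x. x \<in> X \<Longrightarrow> ip n x (mv n S x) \<le> ip n v (mv n S v)"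
    using continuous_attains_sup[OF \<open>compact X\<close>, of "\<lambda>x. ip n x (mv n S x)"] by blast
  have "ip n x (mv n S x) \<le> ip n v (mv n S v) * ip n x x" if x: "\<forall>j<k. ip n (w j) x = 0" for x
  proof (cases "ip n x x = 0")
    case True
    then have "x i = 0" if "i < n" for i using ip_self_eq_0 that by blast
    then have "ip n x (mv n S x) = 0" by (simp add: ip_def)
    then show ?thesis using True by simp
  next
    case False
    then have pos: "ip n x x > 0" using ip_self_nonneg[of n x] by linarith
    define c where "c = 1 / sqrt (ip n x x)"
    have cc: "c * c * ip n x x = 1" using pos by (simp add: c_def)
    define y where "y = (\<lambda>i. c * x i)"
    have "ip n y y = 1" unfolding y_def using cc by (simp add: ip_scale_left ip_scale_right mult.assoc)
    moreover have "\<forall>j<k. ip n (w j) y = 0" unfolding y_def using x by (simp add: ip_scale_right)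
    ultimately have "(\<lambda>i. if i < n then y i else 0) \<in> X" by (rule restr)
    from v(2)[OF this] have "ip n (\<lambda>i. if i < n then y i else 0) (mv n S (\<lambda>i. if i < n then y i else 0)) \<le> ip n v (mv n S v)" .
    also have "ip n (\<lambda>i. if i < n then y i else 0) (mv n S (\<lambda>i. if i < n then y i else 0)) = ip n y (mv n S y)"
      by (intro ip_cong) (auto simp: mv_def)
    also have "\<dots> = c * c * ip n x (mv n S x)"
      unfolding y_def mv_scale by (simp add: ip_scale_left ip_scale_right mult.assoc)
    finally have "c * c * ip n x (mv n S x) * ip n x x \<le> ip n v (mv n S v) * ip n x x"
      using pos by (intro mult_right_mono) auto
    moreover have "c * c * ip n x (mv n S x) * ip n x x = (c * c * ip n x x) * ip n x (mv n S x)"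
      by (simp add: algebra_simps)
    ultimately show ?thesis using cc by simp
  qed
  then show ?thesis using v(1) unfolding X_def by blast
qed

text \<open>The first order condition at a maximum without derivatives: for \<open>t\<close> near 0
  and of suitable sign the linear term dominates. The proof takes \<open>t = b / (2 * c')\<close>
  with \<open>c'\<close> positive and above \<open>c\<close>.\<close>

lemma linear_le_quadratic_imp_zero:
  fixes b c :: real
  assumes "\<And>t. t * b \<le> t\<^sup>2 * c"
  shows "b = 0"
proof (rule ccontr)
  assume b: "b \<noteq> 0"
  define c' where "c' = \<bar>c\<bar> + 1"
  have "c' > 0" "c \<le> c'" by (auto simp: c'_def)
  have "b / (2*c') * b \<le> (b / (2*c'))\<^sup>2 * c" by (rule assms)
  also have "\<dots> \<le> (b / (2*c'))\<^sup>2 * c'" using \<open>c \<le> c'\<close> by (intro mult_left_mono) auto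
  also have "\<dots> = (b / (2 * c') * b) / 2" using \<open>c' > 0\<close> by (simp add: power2_eq_square)
  finally have "b / (2*c') * b \<le> 0" by simp
  moreover have "b / (2*c') * b > 0" using b \<open>c' > 0\<close> by (simp add: zero_less_divide_iff not_less mult_less_0_iff zero_less_mult_iff) (metis linorder_neqE_linordered_idom)
  ultimately show False by simp
qed

text \<open>The next eigenvector maximizes the Rayleigh quotient on the complement of the previous ones.\<close>

lemma spectral_partial:
  assumes S: "\<forall>i<n. \<forall>j<n. S i j = S j i" and "k \<le> n"
  shows "\<exists>w e. orthonormal_family n k w \<and> (\<forall>j<k. \<forall>i<n. mv n S (w j) i = e j * w j i) \<and>
    (\<forall>j<k. \<forall>x. (\<forall>i<j. ip n (w i) x = 0) \<longrightarrow> ip n x (mv n S x) \<le> e j * ip n x x)"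
  using \<open>k \<le> n\<close>
proof (induction k)
  case 0
  then show ?case by (simp add: orthonormal_family_def)
next
  case (Suc k)
  then obtain w e where w: "orthonormal_family n k w"
    and ev: "\<forall>j<k. \<forall>i<n. mv n S (w j) i = e j * w j i"
    and mx: "\<forall>j<k. \<forall>x. (\<forall>i<j. ip n (w i) x = 0) \<longrightarrow> ip n x (mv n S x) \<le> e j * ip n x x"
    by auto
  obtain v where v1: "ip n v v = 1" and v0: "\<forall>j<k. ip n (w j) v = 0"
    and vm: "\<And>x. (\<forall>j<k. ip n (w j) x = 0) \<Longrightarrow> ip n x (mv n S x) \<le> ip n v (mv n S v) * ip n x x"
    using rayleigh_max[OF w, of S] Suc by auto
  define a where "a = ip n v (mv n S v)"
  \<comment> \<open>The maximizer is perturbed to \<open>v + t y\<close> inside the complement. The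
    terms of order \<open>t\<close> must vanish, hence \<open>S v\<close> is orthogonal to every
    admissible \<open>y\<close> that is orthogonal to \<open>v\<close>.\<close>
  have crit: "ip n y (mv n S v) = 0" if y: "\<forall>j<k. ip n (w j) y = 0" and yv: "ip n v y = 0" for y
  proof -
    have "t * (2 * ip n y (mv n S v)) \<le> t\<^sup>2 * (a * ip n y y - ip n y (mv n S y))" for t
    proof -
      have "\<forall>j<k. ip n (w j) (\<lambda>i. v i + t * y i) = 0"
        using v0 y by (simp add: ip_linear)
      from vm[OF this] have "ip n (\<lambda>i. v i + t * y i) (mv n S (\<lambda>i. v i + t * y i))
         \<le> a * ip n (\<lambda>i. v i + t * y i) (\<lambda>i. v i + t * y i)" by (simp add: a_def)
      also have "ip n (\<lambda>i. v i + t * y i) (\<lambda>i. v i + t * y i) = 1 + t\<^sup>2 * ip n y y"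
        using v1 yv ip_commute[of n y v] by (simp add: ip_linear power2_eq_square)
      also have "ip n (\<lambda>i. v i + t * y i) (mv n S (\<lambda>i. v i + t * y i)) =
          a + t * (2 * ip n y (mv n S v)) + t\<^sup>2 * ip n y (mv n S y)"
      proof -
        have "ip n v (mv n S y) = ip n y (mv n S v)"
          using ip_mv_sym[OF S] ip_commute by metis
        then show ?thesis
          by (simp add: mv_add mv_scale ip_linear a_def power2_eq_square algebra_simps)
      qed
      finally show ?thesis by (simp add: algebra_simps)
    qed
    from linear_le_quadratic_imp_zero[OF this] show ?thesis by simp
  qed
  have Swv: "ip n (w j) (mv n S v) = 0" if "j < k" for j
  proof -
    have "ip n (w j) (mv n S v) = ip n (\<lambda>i. e j * w j i) v"
      unfolding ip_mv_sym[OF S] using ev that by (intro ip_cong) auto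
    then show ?thesis using v0 that by (simp add: ip_scale_left)
  qed
  \<comment> \<open>The part of \<open>S v\<close> orthogonal to \<open>v\<close>. It is itself an
    admissible direction, so \<open>crit\<close> makes it orthogonal to \<open>S v\<close>, hence to
    itself, and \<open>v\<close> is an eigenvector.\<close>
  define z where "z = (\<lambda>i. mv n S v i - a * v i)"
  have zw: "\<forall>j<k. ip n (w j) z = 0" using Swv v0 by (simp add: z_def ip_linear)
  have zv: "ip n v z = 0" using v1 by (simp add: z_def ip_linear a_def)
  have "ip n z z = ip n z (mv n S v) - a * ip n v z"
    by (subst (2) z_def) (simp only: ip_diff_right ip_scale_right ip_commute[of n z v])
  then have "ip n z z = 0" using crit[OF zw zv] zv by simp
  then have vev: "mv n S v i = a * v i" if "i < n" for i
    using ip_self_eq_0[of n z i] that by (simp add: z_def)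
  have "orthonormal_family n (Suc k) (w(k := v))"
    by (rule orthonormal_family_Suc[OF w v1 v0])
  moreover have "\<forall>j<Suc k. \<forall>i<n. mv n S ((w(k := v)) j) i = (e(k := a)) j * (w(k := v)) j i"
    using ev vev by (auto simp: less_Suc_eq)
  moreover have "\<forall>j<Suc k. \<forall>x. (\<forall>i<j. ip n ((w(k := v)) i) x = 0) \<longrightarrow>
      ip n x (mv n S x) \<le> (e(k := a)) j * ip n x x"
  proof (intro allI impI)
    fix j x assume j: "j < Suc k" and x: "\<forall>i<j. ip n ((w(k := v)) i) x = 0"
    have x': "\<forall>i<j. ip n (w i) x = 0"
    proof (intro allI impI)
      fix i assume "i < j"
      with x j show "ip n (w i) x = 0" by (metis fun_upd_other less_SucE less_trans nat_neq_iff)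
    qed
    show "ip n x (mv n S x) \<le> (e(k := a)) j * ip n x x"
    proof (cases "j = k")
      case True
      then show ?thesis using vm[of x] x' by (simp add: a_def)
    next
      case False
      then show ?thesis using mx x' j by auto
    qed
  qed
  ultimately show ?case by blast
qed

theorem spectral:
  assumes S: "\<forall>i<n. \<forall>j<n. S i j = S j i"
  shows "\<exists>w e. orthonormal_family n n w \<and> (\<forall>j<n. \<forall>i<n. mv n S (w j) i = e j * w j i) \<and>
    (\<forall>i j. i \<le> j \<longrightarrow> j < n \<longrightarrow> e j \<le> e i)"
proof -
  obtain w e where w: "orthonormal_family n n w"
    and ev: "\<forall>j<n. \<forall>i<n. mv n S (w j) i = e j * w j i"
    and mx: "\<forall>j<n. \<forall>x. (\<forall>i<j. ip n (w i) x = 0) \<longrightarrow> ip n x (mv n S x) \<le> e j * ip n x x"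
    using spectral_partial[OF S order_refl] by auto
  have "e j \<le> e i" if "i \<le> j" "j < n" for i j
  proof -
    have "ip n (w j) (mv n S (w j)) = ip n (w j) (\<lambda>i. e j * w j i)"
      using ev that by (intro ip_cong) auto
    also have "\<dots> = e j" using w that by (simp only: ip_scale_right) (simp add: orthonormal_family_def)
    finally have 1: "ip n (w j) (mv n S (w j)) = e j" .
    have "\<forall>i'<i. ip n (w i') (w j) = 0"
      using w that by (auto simp: orthonormal_family_def)
    with mx that have "ip n (w j) (mv n S (w j)) \<le> e i * ip n (w j) (w j)"
      by (metis le_less_trans)
    then show ?thesis using 1 w that by (simp add: orthonormal_family_def)
  qed
  then show ?thesis using w ev by blast
qed

section \<open>Thin singular value decompositions\<close>

text \<open>Singular values are defined through the roots of a characteristic polynomial, whereas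
  the spectral theorem delivers eigenvectors. The matrix \<open>W\<close> of eigenvectors conjugates
  the Gram matrix to a diagonal one, whose characteristic polynomial splits visibly; the descending
  order of \<open>e\<close> makes the reversed sorted list of roots equal to
  \<open>e\<close>.\<close>

lemma singular_values_of_spectral:
  assumes A: "A \<in> carrier_mat m n"
    and w: "orthonormal_family n n w"
    and ev: "\<forall>j<n. \<forall>i<n. mv n (\<lambda>i k. \<Sum>a<m. A $$ (a, i) * A $$ (a, k)) (w j) i = e j * w j i"
    and srt: "\<forall>i j. i \<le> j \<longrightarrow> j < n \<longrightarrow> e j \<le> e i"
  shows "singular_values A = map (\<lambda>j. sqrt (e j)) [0..<n]"
proof -
  define S where "S = transpose_mat A * A"
  define W where "W = mat n n (\<lambda>(i, j). w j i)"
  define D where "D = mat n n (\<lambda>(i, j). if i = j then e i else 0)"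
  have S: "S \<in> carrier_mat n n" and W: "W \<in> carrier_mat n n" and D: "D \<in> carrier_mat n n"
    using A by (auto simp: S_def W_def D_def)
  have S_entry: "S $$ (i, k) = (\<Sum>a<m. A $$ (a, i) * A $$ (a, k))" if "i < n" "k < n" for i k
    using that A by (simp add: S_def scalar_prod_def lessThan_atLeast0)
  have WW: "transpose_mat W * W = 1\<^sub>m n"
    using w by (intro eq_matI) (auto simp: W_def scalar_prod_def lessThan_atLeast0[symmetric] orthonormal_family_def ip_def)
  have WW': "W * transpose_mat W = 1\<^sub>m n"
    using mat_mult_left_right_inverse[OF _ W WW] W by simp
  have SW: "S * W = W * D"
  proof (rule eq_matI)
    fix i j assume "i < dim_row (W * D)" "j < dim_col (W * D)"
    then have ij: "i < n" "j < n" using W D by auto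
    have "(S * W) $$ (i, j) = (\<Sum>k<n. S $$ (i, k) * w j k)"
      using ij S W by (simp add: scalar_prod_def lessThan_atLeast0 W_def)
    also have "\<dots> = mv n (\<lambda>i k. \<Sum>a<m. A $$ (a, i) * A $$ (a, k)) (w j) i"
      unfolding mv_def using ij S_entry by (intro sum.cong) auto
    also have "\<dots> = e j * w j i" using ev ij by blast
    also have "\<dots> = (\<Sum>k<n. w k i * (if k = j then e k else 0))"
      using ij by (simp add: if_distrib mult.commute cong: if_cong)
    also have "\<dots> = (W * D) $$ (i, j)"
      using ij W D by (simp add: scalar_prod_def lessThan_atLeast0 W_def D_def)
    finally show "(S * W) $$ (i, j) = (W * D) $$ (i, j)" .
  qed (use S W D in auto)
  have "S = S * (W * transpose_mat W)" using S WW' by simp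
  also have "\<dots> = W * D * transpose_mat W"
    using S W D SW by (metis assoc_mult_mat transpose_carrier_mat)
  finally have "similar_mat_wit S D W (transpose_mat W)"
    unfolding similar_mat_wit_def Let_def using S W D WW WW' by auto
  then have "char_poly S = char_poly D"
    by (intro char_poly_similar) (auto simp: similar_mat_def)
  also have "\<dots> = (\<Prod>a\<leftarrow>diag_mat D. [:- a, 1:])"
    by (rule char_poly_upper_triangular[OF D]) (auto simp: D_def)
  also have "diag_mat D = map e [0..<n]"
    by (auto simp: diag_mat_def D_def)
  finally have cp: "char_poly S = (\<Prod>a\<leftarrow>map e [0..<n]. [:- a, 1:])" .
  have "proots (char_poly S) = mset (map e [0..<n])"
  proof -
    have "proots (\<Prod>a\<leftarrow>es. [:- a, 1:]) = mset es" for es :: "real list"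
    proof (induction es)
      case (Cons a es)
      have "(\<Prod>a\<leftarrow>es. [:- a, 1:]) \<noteq> 0"
        by (auto simp: prod_list_zero_iff)
      then show ?case using Cons by (simp add: proots_mult del: mult_pCons_left)
    qed simp
    then show ?thesis by (simp only: cp)
  qed
  then have "sorted_list_of_multiset (proots (char_poly S)) = sort (map e [0..<n])"
    by (simp only: sorted_list_of_multiset_mset)
  also have "\<dots> = rev (map e [0..<n])"
  proof (rule properties_for_sort)
    have "sorted_wrt (\<ge>) (map e [0..<n])"
      using srt by (auto simp: sorted_wrt_iff_nth_less)
    then show "sorted (rev (map e [0..<n]))" by (simp add: sorted_wrt_rev)
  qed simp
  finally show ?thesis
    by (simp add: singular_values_def S_def[symmetric] rev_map[symmetric] comp_def)
qed

text \<open>Orthonormal vectors are linearly independent (pair a vanishing combination with each of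
  them), and the hypothesis \<open>range\<close> places them in the column space, whose dimension is
  the rank.\<close>

lemma card_le_mat_rank:
  assumes A: "A \<in> carrier_mat m n" and u: "orthonormal_family m r u"
    and range: "\<And>j i. j < r \<Longrightarrow> i < m \<Longrightarrow> u j i = (\<Sum>k<n. A $$ (i, k) * c j k)"
  shows "r \<le> mat_rank A"
proof -
  interpret vec_space "TYPE(real)" m .
  define X where "X = (\<lambda>j. vec m (u j)) ` {..<r}"
  have X: "finite X" "X \<subseteq> carrier_vec m" by (auto simp: X_def)
  have inj: "inj_on (\<lambda>j. vec m (u j)) {..<r}"
  proof (rule inj_onI)
    fix i j assume ij: "i \<in> {..<r}" "j \<in> {..<r}" and eq: "vec m (u i) = vec m (u j)"
    have "u i a = u j a" if "a < m" for a
      using arg_cong[OF eq, of "\<lambda>v. v $ a"] that by simp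
    then have "ip m (u i) (u j) = ip m (u j) (u j)" by (intro ip_cong) auto
    then show "i = j" using u ij by (auto simp: orthonormal_family_def split: if_splits)
  qed
  have cardX: "card X = r" by (simp add: X_def card_image[OF inj])
  have li: "lin_indpt X"
  proof (rule finite_lin_indpt2)
    fix a :: "real Matrix.vec \<Rightarrow> real" assume lc: "lincomb a X = 0\<^sub>v m"
    have "a (vec m (u j)) = 0" if j: "j < r" for j
    proof -
      have z: "(\<Sum>k<r. a (vec m (u k)) * u k i) = 0" if i: "i < m" for i
      proof -
        have "(\<Sum>k<r. a (vec m (u k)) * u k i) = (\<Sum>x\<in>X. a x * x $ i)"
          unfolding X_def using i by (subst sum.reindex[OF inj]) simp
        also have "\<dots> = lincomb a X $ i" using lincomb_index[OF i X(2)] by simp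
        also have "\<dots> = 0" using i by (simp add: lc)
        finally show ?thesis .
      qed
      have "0 = ip m (u j) (\<lambda>i. \<Sum>k<r. a (vec m (u k)) * u k i)"
        using z by (simp add: ip_def)
      also have "\<dots> = (\<Sum>k<r. a (vec m (u k)) * ip m (u j) (u k))"
        by (simp only: ip_sum_right ip_scale_right)
      also have "\<dots> = (\<Sum>k<r. if k = j then a (vec m (u k)) else 0)"
        using u j by (intro sum.cong) (auto simp: orthonormal_family_def)
      also have "\<dots> = a (vec m (u j))" using j by simp
      finally show ?thesis by simp
    qed
    then show "\<forall>v\<in>X. a v = 0" by (auto simp: X_def)
  qed (use X in auto)
  have cols: "set (cols A) \<subseteq> carrier_vec m" using A cols_dim by blast
  have XS: "X \<subseteq> span (set (cols A))"
  proof
    fix x assume "x \<in> X"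
    then obtain j where j: "j < r" and x: "x = vec m (u j)" by (auto simp: X_def)
    have "x = A *\<^sub>v vec n (c j)"
      unfolding x using A j range
      by (intro eq_vecI) (auto simp: scalar_prod_def lessThan_atLeast0[symmetric])
    then have "x \<in> col_space A"
      using A by (subst col_space_eq[OF A]) auto
    then show "x \<in> span (set (cols A))" by (simp add: col_space_def)
  qed
  have sub: "submodule class_ring (span (set (cols A))) V"
    by (rule span_is_submodule) (use cols in auto)
  have vs: "vectorspace class_ring (span_vs (set (cols A)))"
    using cols span_is_subspace subspace_def subspace_is_vs by simp
  interpret sp: vectorspace class_ring "span_vs (set (cols A))" by (rule vs)
  have "card X \<le> sp.dim"
  proof (rule sp.li_le_dim(2))
    show "sp.fin_dim" by (rule fin_dim_span_cols[OF A])
    show "X \<subseteq> carrier (span_vs (set (cols A)))" using XS by simp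
    show "\<not> sp.lin_dep X" using li span_li_not_depend(2)[OF XS sub] by simp
  qed
  then show ?thesis using A cardX by (simp add: mat_rank_def rank_def)
qed

text \<open>The final equation is \<open>A A\<^sup>T = \<Sum> s\<^sup>2 u u\<^sup>T\<close>, written
  as a bilinear form. Later uses concern projections acting from the left, for which this form
  suffices without right singular vectors.\<close>

theorem thin_svd:
  assumes A: "A \<in> carrier_mat m n"
  obtains r u s where "orthonormal_family m r u" "r \<le> n" "r \<le> mat_rank A"
    "\<And>j. j < r \<Longrightarrow> 0 < s j" "\<And>i j. i \<le> j \<Longrightarrow> j < r \<Longrightarrow> s j \<le> s i"
    "\<And>j. sigma (Suc j) A = (if j < r then s j else 0)"
    "\<And>x y. (\<Sum>k<n. (\<Sum>a<m. x a * A $$ (a, k)) * (\<Sum>a<m. y a * A $$ (a, k))) =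
       (\<Sum>j<r. (s j)\<^sup>2 * (ip m x (u j) * ip m y (u j)))"
proof -
  define S where "S = (\<lambda>i k. \<Sum>a<m. A $$ (a, i) * A $$ (a, k))"
  have "S i j = S j i" for i j
    unfolding S_def by (intro sum.cong refl mult.commute)
  then have "\<forall>i<n. \<forall>j<n. S i j = S j i" by simp
  from spectral[OF this] obtain w e where we: "orthonormal_family n n w \<and>
      (\<forall>j<n. \<forall>i<n. mv n S (w j) i = e j * w j i) \<and> (\<forall>i j. i \<le> j \<longrightarrow> j < n \<longrightarrow> e j \<le> e i)"
    by (elim exE)
  then have w: "orthonormal_family n n w"
    and ev: "\<forall>j<n. \<forall>i<n. mv n S (w j) i = e j * w j i"
    and srt: "\<forall>i j. i \<le> j \<longrightarrow> j < n \<longrightarrow> e j \<le> e i" by simp_all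
  have sv: "singular_values A = map (\<lambda>j. sqrt (e j)) [0..<n]"
    by (rule singular_values_of_spectral[OF A w ev[unfolded S_def] srt])
  define y where "y = (\<lambda>j a. \<Sum>k<n. A $$ (a, k) * w j k)"
  have yy: "ip m (y i) (y j) = (if i = j then e j else 0)" if "i < n" "j < n" for i j
  proof -
    have "ip m (y i) (y j) = (\<Sum>a<m. \<Sum>k<n. \<Sum>l<n. (A $$ (a, k) * w i k) * (A $$ (a, l) * w j l))"
      by (simp add: ip_def y_def sum_product)
    also have "\<dots> = (\<Sum>k<n. \<Sum>l<n. \<Sum>a<m. (A $$ (a, k) * w i k) * (A $$ (a, l) * w j l))"
      by (subst sum.swap, rule sum.cong[OF refl], rule sum.swap)
    also have "\<dots> = ip n (w i) (mv n S (w j))"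
      by (simp add: ip_def mv_def S_def sum_distrib_left sum_distrib_right mult_ac)
    also have "\<dots> = ip n (w i) (\<lambda>i. e j * w j i)"
      using ev that by (intro ip_cong) auto
    also have "\<dots> = e j * ip n (w i) (w j)" by (rule ip_scale_right)
    finally show ?thesis using w that by (simp add: orthonormal_family_def)
  qed
  have e_nonneg: "0 \<le> e j" if "j < n" for j
    using yy[OF that that] ip_self_nonneg[of m "y j"] by simp
  \<comment> \<open>Since the eigenvalues are sorted and nonnegative, the positive ones are exactly
    those numbered below their count.\<close>
  define r where "r = card {j. j < n \<and> 0 < e j}"
  have below: "0 < e j \<longleftrightarrow> j < r" if "j < n" for j
  proof
    assume "0 < e j"
    then have "{..j} \<subseteq> {j. j < n \<and> 0 < e j}"
      using srt that by (auto intro: less_le_trans)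
    from card_mono[OF _ this] show "j < r" by (simp add: r_def)
  next
    assume jr: "j < r"
    show "0 < e j"
    proof (rule ccontr)
      assume "\<not> 0 < e j"
      moreover have "e i \<le> e j" if "i < n" "\<not> i < j" for i
        using srt that by simp
      ultimately have "{j. j < n \<and> 0 < e j} \<subseteq> {..<j}"
        by (force simp: not_less)
      from card_mono[OF _ this] jr show False by (simp add: r_def)
    qed
  qed
  have rn: "r \<le> n"
  proof -
    have "{j. j < n \<and> 0 < e j} \<subseteq> {..<n}" by auto
    from card_mono[OF _ this] show ?thesis by (simp add: r_def)
  qed
  define s where "s = (\<lambda>j. sqrt (e j))"
  define u where "u = (\<lambda>j a. (1 / s j) * y j a)"
  have s_pos: "0 < s j" if "j < r" for j using below[of j] that rn by (simp add: s_def)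
  have s_sq: "(s j)\<^sup>2 = e j" if "j < n" for j using e_nonneg[OF that] by (simp add: s_def)
  have u: "orthonormal_family m r u"
  proof -
    have "ip m (u i) (u j) = (if i = j then 1 else 0)" if "i < r" "j < r" for i j
    proof -
      have "ip m (u i) (u j) = (1 / s i) * ((1 / s j) * ip m (y i) (y j))"
        unfolding u_def by (simp only: ip_scale_left ip_scale_right)
      then show ?thesis
        using yy[of i j] that rn s_pos[OF that(1)] s_sq[of i]
        by (auto simp: power2_eq_square field_simps)
    qed
    then show ?thesis by (simp add: orthonormal_family_def)
  qed
  have y0: "y j a = 0" if "j < n" "\<not> j < r" "a < m" for j a
    using ip_self_eq_0[of m "y j" a] yy[of j j] below[of j] e_nonneg[of j] that by auto
  have bil: "(\<Sum>k<n. (\<Sum>a<m. x a * A $$ (a, k)) * (\<Sum>a<m. z a * A $$ (a, k))) =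
       (\<Sum>j<r. (s j)\<^sup>2 * (ip m x (u j) * ip m z (u j)))" for x z
  proof -
    have proj: "ip n (w j) (\<lambda>k. \<Sum>a<m. x a * A $$ (a, k)) = ip m x (y j)" for j x
    proof -
      have "ip n (w j) (\<lambda>k. \<Sum>a<m. x a * A $$ (a, k)) = (\<Sum>k<n. \<Sum>a<m. w j k * (x a * A $$ (a, k)))"
        by (simp add: ip_def sum_distrib_left)
      also have "\<dots> = (\<Sum>a<m. \<Sum>k<n. w j k * (x a * A $$ (a, k)))" by (rule sum.swap)
      also have "\<dots> = ip m x (y j)" by (simp add: ip_def y_def sum_distrib_left mult_ac)
      finally show ?thesis .
    qed
    have "(\<Sum>k<n. (\<Sum>a<m. x a * A $$ (a, k)) * (\<Sum>a<m. z a * A $$ (a, k))) =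
       ip n (\<lambda>k. \<Sum>a<m. x a * A $$ (a, k)) (\<lambda>k. \<Sum>a<m. z a * A $$ (a, k))"
      by (simp add: ip_def)
    also have "\<dots> = (\<Sum>j<n. ip m x (y j) * ip m z (y j))"
      by (subst onb_parseval[OF w]) (simp only: proj)
    also have "\<dots> = (\<Sum>j<r. ip m x (y j) * ip m z (y j))"
      using rn y0 by (intro sum.mono_neutral_right) (auto simp: ip_def)
    also have "\<dots> = (\<Sum>j<r. (s j)\<^sup>2 * (ip m x (u j) * ip m z (u j)))"
    proof (rule sum.cong[OF refl])
      fix j assume "j \<in> {..<r}"
      then have "s j > 0" using s_pos by simp
      have "(s j)\<^sup>2 * (ip m x (u j) * ip m z (u j)) =
        (s j)\<^sup>2 * ((1 / s j * ip m x (y j)) * (1 / s j * ip m z (y j)))"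
        unfolding u_def by (simp only: ip_scale_right)
      then show "ip m x (y j) * ip m z (y j) = (s j)\<^sup>2 * (ip m x (u j) * ip m z (u j))"
        using \<open>s j > 0\<close> by (simp add: power2_eq_square)
    qed
    finally show ?thesis .
  qed
  have rank: "r \<le> mat_rank A"
  proof (rule card_le_mat_rank[OF A u])
    fix j i
    show "u j i = (\<Sum>k<n. A $$ (i, k) * (w j k / s j))"
      by (simp add: u_def y_def sum_divide_distrib)
  qed
  have sig: "sigma (Suc j) A = (if j < r then s j else 0)" for j
  proof (cases "j < n")
    case True
    then have "sigma (Suc j) A = s j"
      by (simp add: sigma_def sv s_def)
    moreover have "\<not> j < r \<Longrightarrow> s j = 0"
      using below[OF True] e_nonneg[OF True] by (simp add: s_def)
    ultimately show ?thesis by simp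
  next
    case False
    then show ?thesis using rn by (simp add: sigma_def sv)
  qed
  have anti: "s j \<le> s i" if "i \<le> j" "j < r" for i j
    using srt that rn by (simp add: s_def)
  show thesis by (rule that[OF u rn rank s_pos anti sig bil])
qed

section \<open>Frobenius norm and projections\<close>

text \<open>The Frobenius inner product, that is, the trace of \<open>X\<^sup>T Y\<close>.\<close>

definition fip :: "real mat \<Rightarrow> real mat \<Rightarrow> real" where
  "fip X Y = (\<Sum>i<dim_row X. \<Sum>j<dim_col X. X $$ (i, j) * Y $$ (i, j))"

lemma fip_self: "fip X X = (frob_norm X)\<^sup>2"
  by (simp add: fip_def frob_norm_def sum_nonneg power2_eq_square)

lemma frob_norm_sq: "X \<in> carrier_mat m n \<Longrightarrow> (frob_norm X)\<^sup>2 = (\<Sum>i<m. \<Sum>j<n. (X $$ (i, j))\<^sup>2)"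
  by (simp add: frob_norm_def sum_nonneg)

lemma frob_norm_nonneg [simp]: "0 \<le> frob_norm X"
  by (simp add: frob_norm_def sum_nonneg)

lemma fip_add_left:
  "X \<in> carrier_mat m n \<Longrightarrow> X' \<in> carrier_mat m n \<Longrightarrow> fip (X + X') Y = fip X Y + fip X' Y"
  by (simp add: fip_def distrib_right sum.distrib)

lemma fip_diff_left:
  "X \<in> carrier_mat m n \<Longrightarrow> X' \<in> carrier_mat m n \<Longrightarrow> fip (X - X') Y = fip X Y - fip X' Y"
  by (simp add: fip_def left_diff_distrib sum_subtractf)

lemma fip_add_right:
  "X \<in> carrier_mat m n \<Longrightarrow> Y \<in> carrier_mat m n \<Longrightarrow> Y' \<in> carrier_mat m n \<Longrightarrow>
    fip X (Y + Y') = fip X Y + fip X Y'"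
  by (simp add: fip_def distrib_left sum.distrib)

lemma fip_diff_right:
  "X \<in> carrier_mat m n \<Longrightarrow> Y \<in> carrier_mat m n \<Longrightarrow> Y' \<in> carrier_mat m n \<Longrightarrow>
    fip X (Y - Y') = fip X Y - fip X Y'"
  by (simp add: fip_def right_diff_distrib sum_subtractf)

lemma fip_transpose:
  "X \<in> carrier_mat m n \<Longrightarrow> Y \<in> carrier_mat m n \<Longrightarrow> fip (transpose_mat X) (transpose_mat Y) = fip X Y"
  unfolding fip_def by (simp, subst sum.swap, simp)

lemma frob_norm_transpose: "frob_norm (transpose_mat X) = frob_norm X"
  unfolding frob_norm_def by (simp, subst sum.swap, simp)

lemma mult_entry:
  "A \<in> carrier_mat m n \<Longrightarrow> X \<in> carrier_mat n k \<Longrightarrow> i < m \<Longrightarrow> j < k \<Longrightarrow>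
    (A * X) $$ (i, j) = (\<Sum>l<n. A $$ (i, l) * X $$ (l, j))"
  by (auto simp: scalar_prod_def lessThan_atLeast0)

lemma mult_transpose_entry:
  "A \<in> carrier_mat m n \<Longrightarrow> X \<in> carrier_mat m k \<Longrightarrow> i < n \<Longrightarrow> j < k \<Longrightarrow>
    (transpose_mat A * X) $$ (i, j) = (\<Sum>l<m. A $$ (l, i) * X $$ (l, j))"
  by (auto simp: scalar_prod_def lessThan_atLeast0)

lemma fip_mult_left:
  assumes "A \<in> carrier_mat m n" "X \<in> carrier_mat n k" "Y \<in> carrier_mat m k"
  shows "fip (A * X) Y = fip X (transpose_mat A * Y)"
proof -
  have "fip (A * X) Y = (\<Sum>i<m. \<Sum>j<k. \<Sum>l<n. A $$ (i, l) * X $$ (l, j) * Y $$ (i, j))"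
    unfolding fip_def using assms by (auto simp: mult_entry[OF assms(1,2)] sum_distrib_right simp del: index_mult_mat(1) intro!: sum.cong)
  also have "\<dots> = (\<Sum>i<m. \<Sum>l<n. \<Sum>j<k. A $$ (i, l) * X $$ (l, j) * Y $$ (i, j))"
    by (rule sum.cong[OF refl], rule sum.swap)
  also have "\<dots> = (\<Sum>l<n. \<Sum>i<m. \<Sum>j<k. A $$ (i, l) * X $$ (l, j) * Y $$ (i, j))"
    by (rule sum.swap)
  also have "\<dots> = (\<Sum>l<n. \<Sum>j<k. \<Sum>i<m. A $$ (i, l) * X $$ (l, j) * Y $$ (i, j))"
    by (rule sum.cong[OF refl], rule sum.swap)
  also have "\<dots> = fip X (transpose_mat A * Y)"
    unfolding fip_def using assms
    by (auto simp: mult_entry[of "transpose_mat A" n m Y k] sum_distrib_left mult_ac simp del: index_mult_mat(1) intro!: sum.cong)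
  finally show ?thesis .
qed

lemma fip_mult_right:
  assumes "X \<in> carrier_mat m n" "A \<in> carrier_mat n k" "Y \<in> carrier_mat m k"
  shows "fip (X * A) Y = fip X (Y * transpose_mat A)"
proof -
  have "fip (X * A) Y = fip (transpose_mat (X * A)) (transpose_mat Y)"
    using assms by (intro fip_transpose[symmetric]) auto
  also have "transpose_mat (X * A) = transpose_mat A * transpose_mat X"
    using assms by (intro transpose_mult) auto
  also have "fip (transpose_mat A * transpose_mat X) (transpose_mat Y) = fip (transpose_mat X) (A * transpose_mat Y)"
    using assms by (subst fip_mult_left) auto
  also have "A * transpose_mat Y = transpose_mat (Y * transpose_mat A)"
    using assms by (subst transpose_mult) auto
  also have "fip (transpose_mat X) (transpose_mat (Y * transpose_mat A)) = fip X (Y * transpose_mat A)"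
    using assms by (intro fip_transpose) auto
  finally show ?thesis .
qed

lemma frob_norm_L2: "X \<in> carrier_mat m n \<Longrightarrow> frob_norm X = L2_set (\<lambda>p. X $$ p) ({..<m} \<times> {..<n})"
  by (simp add: frob_norm_def L2_set_def sum.cartesian_product)

lemma fip_Cauchy_Schwarz:
  assumes "X \<in> carrier_mat m n" "Y \<in> carrier_mat m n"
  shows "\<bar>fip X Y\<bar> \<le> frob_norm X * frob_norm Y"
proof -
  have "\<bar>fip X Y\<bar> = \<bar>\<Sum>p\<in>{..<m} \<times> {..<n}. X $$ p * Y $$ p\<bar>"
    using assms by (simp add: fip_def sum.cartesian_product)
  also have "\<dots> \<le> (\<Sum>p\<in>{..<m} \<times> {..<n}. \<bar>X $$ p\<bar> * \<bar>Y $$ p\<bar>)"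
    by (simp add: abs_mult[symmetric])
  also have "\<dots> \<le> L2_set (\<lambda>p. X $$ p) ({..<m} \<times> {..<n}) * L2_set (\<lambda>p. Y $$ p) ({..<m} \<times> {..<n})"
    by (rule L2_set_mult_ineq)
  finally show ?thesis using assms by (simp add: frob_norm_L2)
qed

lemma fip_le: "X \<in> carrier_mat m n \<Longrightarrow> Y \<in> carrier_mat m n \<Longrightarrow> fip X Y \<le> frob_norm X * frob_norm Y"
  using fip_Cauchy_Schwarz[of X m n Y] by simp

lemma frob_norm_add:
  assumes "X \<in> carrier_mat m n" "Y \<in> carrier_mat m n"
  shows "frob_norm (X + Y) \<le> frob_norm X + frob_norm Y"
proof -
  have "frob_norm (X + Y) = L2_set (\<lambda>p. X $$ p + Y $$ p) ({..<m} \<times> {..<n})"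
    using assms by (subst frob_norm_L2[of _ m n]) (auto intro!: L2_set_cong)
  also have "\<dots> \<le> frob_norm X + frob_norm Y"
    using assms L2_set_triangle_ineq[of "\<lambda>p. X $$ p" "\<lambda>p. Y $$ p"] by (simp add: frob_norm_L2)
  finally show ?thesis .
qed

lemma frob_norm_mult:
  assumes X: "X \<in> carrier_mat m n" and Y: "Y \<in> carrier_mat n k"
  shows "frob_norm (X * Y) \<le> frob_norm X * frob_norm Y"
proof -
  have "(frob_norm (X * Y))\<^sup>2 = (\<Sum>i<m. \<Sum>j<k. (\<Sum>l<n. X $$ (i, l) * Y $$ (l, j))\<^sup>2)"
    by (subst frob_norm_sq[OF mult_carrier_mat[OF X Y]], intro sum.cong refl)
      (simp add: mult_entry[OF X Y] del: index_mult_mat)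
  also have "\<dots> \<le> (\<Sum>i<m. \<Sum>j<k. (\<Sum>l<n. (X $$ (i, l))\<^sup>2) * (\<Sum>l<n. (Y $$ (l, j))\<^sup>2))"
    by (intro sum_mono Cauchy_Schwarz_ineq_sum)
  also have "\<dots> = (\<Sum>i<m. \<Sum>l<n. (X $$ (i, l))\<^sup>2) * (\<Sum>j<k. \<Sum>l<n. (Y $$ (l, j))\<^sup>2)"
    by (simp add: sum_product)
  also have "(\<Sum>j<k. \<Sum>l<n. (Y $$ (l, j))\<^sup>2) = (\<Sum>l<n. \<Sum>j<k. (Y $$ (l, j))\<^sup>2)"
    by (rule sum.swap)
  also have "(\<Sum>i<m. \<Sum>l<n. (X $$ (i, l))\<^sup>2) * (\<Sum>l<n. \<Sum>j<k. (Y $$ (l, j))\<^sup>2) = (frob_norm X * frob_norm Y)\<^sup>2"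
    by (simp add: power_mult_distrib frob_norm_sq[OF X] frob_norm_sq[OF Y])
  finally show ?thesis by (rule power2_le_imp_le) simp
qed

text \<open>\<open>(1 - Q Q\<^sup>T) X\<close>, the projection of the columns of \<open>X\<close>
  onto the complement of the range of \<open>Q\<close> when \<open>Q\<close> is orthonormal.
  Avoiding an explicit identity matrix spares a dimension argument.\<close>

definition res :: "real mat \<Rightarrow> real mat \<Rightarrow> real mat" where
  "res Q X = X - Q * (transpose_mat Q * X)"

locale orthonormal_mat =
  fixes m k :: nat and Q :: "real mat"
  assumes Q [simp]: "Q \<in> carrier_mat m k" and QQ: "transpose_mat Q * Q = 1\<^sub>m k"
begin

lemma Qt [simp]: "transpose_mat Q \<in> carrier_mat k m" by simp

lemma Q_mult_carrier [simp]: "X \<in> carrier_mat k n \<Longrightarrow> Q * X \<in> carrier_mat m n"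
  by (rule mult_carrier_mat[OF Q])

lemma Qt_mult_carrier [simp]: "X \<in> carrier_mat m n \<Longrightarrow> transpose_mat Q * X \<in> carrier_mat k n"
  by (rule mult_carrier_mat[OF Qt])

lemma res_carrier [simp]: "X \<in> carrier_mat m n \<Longrightarrow> res Q X \<in> carrier_mat m n"
  unfolding res_def by (intro minus_carrier_mat Q_mult_carrier Qt_mult_carrier)

lemma QtQ_mult: "X \<in> carrier_mat k n \<Longrightarrow> transpose_mat Q * (Q * X) = X"
  by (subst assoc_mult_mat[OF Qt Q, symmetric], assumption) (simp add: QQ left_mult_one_mat)

lemma Qt_res:
  assumes X: "X \<in> carrier_mat m n"
  shows "transpose_mat Q * res Q X = 0\<^sub>m k n"
proof -
  have c: "Q * (transpose_mat Q * X) \<in> carrier_mat m n" "transpose_mat Q * X \<in> carrier_mat k n"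
    by (simp_all only: Q_mult_carrier Qt_mult_carrier X)
  show ?thesis
    unfolding res_def mult_minus_distrib_mat[OF Qt X c(1)] QtQ_mult[OF c(2)]
    by (rule minus_r_inv_mat[OF c(2)])
qed

lemma res_mult:
  assumes X: "X \<in> carrier_mat m n" and Y: "Y \<in> carrier_mat n l"
  shows "res Q (X * Y) = res Q X * Y"
proof -
  have c: "Q * (transpose_mat Q * X) \<in> carrier_mat m n" "transpose_mat Q * X \<in> carrier_mat k n"
    by (simp_all only: Q_mult_carrier Qt_mult_carrier X)
  show ?thesis
    unfolding res_def minus_mult_distrib_mat[OF X c(1) Y] assoc_mult_mat[OF Q c(2) Y]
      assoc_mult_mat[OF Qt X Y] ..
qed

lemma fip_res_sym:
  assumes X: "X \<in> carrier_mat m n" and Y: "Y \<in> carrier_mat m n"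
  shows "fip (res Q X) Y = fip X (res Q Y)"
proof -
  have c: "transpose_mat Q * X \<in> carrier_mat k n" "transpose_mat Q * Y \<in> carrier_mat k n"
    "Q * (transpose_mat Q * X) \<in> carrier_mat m n" "Q * (transpose_mat Q * Y) \<in> carrier_mat m n"
    using X Y by simp_all
  have "fip (Q * (transpose_mat Q * X)) Y = fip (transpose_mat Q * X) (transpose_mat Q * Y)"
    by (rule fip_mult_left[OF Q c(1) Y])
  also have "\<dots> = fip X (Q * (transpose_mat Q * Y))"
    by (subst fip_mult_left[OF Qt X c(2)]) simp
  finally show ?thesis unfolding res_def using X Y c by (simp add: fip_diff_left fip_diff_right)
qed

lemma res_res:
  assumes X: "X \<in> carrier_mat m n"
  shows "res Q (res Q X) = res Q X"
proof -
  have "res Q (res Q X) = res Q X - Q * 0\<^sub>m k n"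
    by (subst res_def) (simp only: Qt_res[OF X])
  also have "\<dots> = res Q X"
    unfolding right_mult_zero_mat[OF Q] using res_carrier[OF X] by (intro eq_matI) auto
  finally show ?thesis .
qed

lemma fip_res_self:
  assumes X: "X \<in> carrier_mat m n"
  shows "fip (res Q X) X = (frob_norm (res Q X))\<^sup>2"
  using fip_res_sym[OF res_carrier[OF X] X] X by (simp add: res_res fip_self[symmetric])

lemma frob_norm_res_sq:
  assumes X: "X \<in> carrier_mat m n"
  shows "(frob_norm (res Q X))\<^sup>2 = (frob_norm X)\<^sup>2 - (frob_norm (transpose_mat Q * X))\<^sup>2"
proof -
  have c: "transpose_mat Q * X \<in> carrier_mat k n" "Q * (transpose_mat Q * X) \<in> carrier_mat m n"
    using X by simp_all
  have "fip (res Q X) X = fip X X - fip (Q * (transpose_mat Q * X)) X"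
    unfolding res_def using X c by (simp add: fip_diff_left)
  also have "fip (Q * (transpose_mat Q * X)) X = fip (transpose_mat Q * X) (transpose_mat Q * X)"
    by (rule fip_mult_left[OF Q c(1) X])
  finally show ?thesis using fip_res_self[OF X] by (simp add: fip_self)
qed

lemma frob_norm_res_le: "X \<in> carrier_mat m n \<Longrightarrow> frob_norm (res Q X) \<le> frob_norm X"
proof (rule power2_le_imp_le)
  assume "X \<in> carrier_mat m n"
  from frob_norm_res_sq[OF this]
  show "(frob_norm (res Q X))\<^sup>2 \<le> (frob_norm X)\<^sup>2"
    using zero_le_power2[of "frob_norm (transpose_mat Q * X)"] by linarith
qed (rule frob_norm_nonneg)

lemma frob_norm_Qt_le: "X \<in> carrier_mat m n \<Longrightarrow> frob_norm (transpose_mat Q * X) \<le> frob_norm X"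
proof (rule power2_le_imp_le)
  assume "X \<in> carrier_mat m n"
  from frob_norm_res_sq[OF this]
  show "(frob_norm (transpose_mat Q * X))\<^sup>2 \<le> (frob_norm X)\<^sup>2"
    using zero_le_power2[of "frob_norm (res Q X)"] by linarith
qed (rule frob_norm_nonneg)

lemma frob_norm_Q_mult:
  assumes X: "X \<in> carrier_mat k n"
  shows "frob_norm (Q * X) = frob_norm X"
proof -
  have "fip (Q * X) (Q * X) = fip X X"
    using X by (subst fip_mult_left[OF Q X]) (auto simp: QtQ_mult)
  then show ?thesis by (simp add: fip_self)
qed

lemma frob_norm_Q: "frob_norm Q = sqrt (real k)"
proof -
  have "(frob_norm Q)\<^sup>2 = fip (Q * 1\<^sub>m k) Q" by (simp add: fip_self right_mult_one_mat[OF Q])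
  also have "\<dots> = fip (1\<^sub>m k) (transpose_mat Q * Q)" by (rule fip_mult_left[OF Q _ Q]) simp
  also have "\<dots> = real k"
    by (simp add: QQ fip_def if_distrib cong: if_cong)
  finally show ?thesis by (metis frob_norm_nonneg real_sqrt_unique)
qed

lemma split_res: "X \<in> carrier_mat m n \<Longrightarrow> X = Q * (transpose_mat Q * X) + res Q X"
  unfolding res_def using carrier_matD[OF Q] by (intro eq_matI) auto

lemma res_diff:
  assumes X: "X \<in> carrier_mat m n" and Y: "Y \<in> carrier_mat m n"
  shows "res Q (X - Y) = res Q X - res Q Y"
proof -
  have c: "transpose_mat Q * X \<in> carrier_mat k n" "transpose_mat Q * Y \<in> carrier_mat k n"
    by (simp_all only: Q_mult_carrier Qt_mult_carrier X Y)
  have d: "Q * (transpose_mat Q * X) \<in> carrier_mat m n" "Q * (transpose_mat Q * Y) \<in> carrier_mat m n"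
    using c by (simp_all only: Q_mult_carrier)
  show ?thesis
    unfolding res_def mult_minus_distrib_mat[OF Qt X Y] mult_minus_distrib_mat[OF Q c]
    using carrier_matD[OF X] carrier_matD[OF Y] carrier_matD[OF Q] d by (intro eq_matI) auto
qed

lemma res_Q_mult:
  assumes R: "R \<in> carrier_mat k n"
  shows "res Q (Q * R) = 0\<^sub>m m n"
  unfolding res_def QtQ_mult[OF R] by (rule minus_r_inv_mat[OF Q_mult_carrier[OF R]])

text \<open>The projection annihilates \<open>Q R\<close> and does not increase norms. This turns
  the factorization demanded by \<open>range_basis\<close> into a statement about
  \<open>res\<close>.\<close>

lemma frob_norm_res_le_dist:
  assumes X: "X \<in> carrier_mat m n" and R: "R \<in> carrier_mat k n"
  shows "frob_norm (res Q X) \<le> frob_norm (Q * R - X)"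
proof -
  have "frob_norm (res Q (Q * R - X)) = frob_norm (res Q X)"
    unfolding res_diff[OF Q_mult_carrier[OF R] X] res_Q_mult[OF R]
    using res_carrier[OF X] by (simp add: frob_norm_def)
  then show ?thesis
    using frob_norm_res_le[OF minus_carrier_mat[OF X, of "Q * R"]] by simp
qed

text \<open>Self-adjointness of the projection as a matrix identity, for use where the other factor
  should absorb the projection before a norm is taken.\<close>

lemma transpose_res_mult:
  assumes X: "X \<in> carrier_mat m n" and Y: "Y \<in> carrier_mat m l"
  shows "transpose_mat (res Q X) * Y = transpose_mat X * res Q Y"
proof -
  have c: "transpose_mat Q * X \<in> carrier_mat k n" "transpose_mat Q * Y \<in> carrier_mat k l"
    "Q * (transpose_mat Q * X) \<in> carrier_mat m n" "Q * (transpose_mat Q * Y) \<in> carrier_mat m l"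
    using X Y by simp_all
  have "transpose_mat (Q * (transpose_mat Q * X)) * Y = transpose_mat X * (Q * (transpose_mat Q * Y))"
  proof -
    have "transpose_mat (Q * (transpose_mat Q * X)) = transpose_mat (transpose_mat Q * X) * transpose_mat Q"
      by (rule transpose_mult[OF Q c(1)])
    also have "transpose_mat (transpose_mat Q * X) = transpose_mat X * Q"
      by (subst transpose_mult[OF Qt X]) simp
    finally show ?thesis
      using X Y c assoc_mult_mat[of "transpose_mat X" n m Q k "transpose_mat Q * Y" l]
        assoc_mult_mat[of "transpose_mat X * Q" n k "transpose_mat Q" m Y l] by simp
  qed
  then show ?thesis
    unfolding res_def transpose_minus[OF X c(3)]
      minus_mult_distrib_mat[OF transpose_carrier_mat[THEN iffD2, OF X] transpose_carrier_mat[THEN iffD2, OF c(3)] Y]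
      mult_minus_distrib_mat[OF transpose_carrier_mat[THEN iffD2, OF X] Y c(4)] by simp
qed

end

section \<open>Ky Fan inequality and top eigenspaces\<close>

definition colf :: "real mat \<Rightarrow> nat \<Rightarrow> nat \<Rightarrow> real" where
  "colf Q j = (\<lambda>i. Q $$ (i, j))"

definition mat_of_family :: "nat \<Rightarrow> nat \<Rightarrow> (nat \<Rightarrow> nat \<Rightarrow> real) \<Rightarrow> real mat" where
  "mat_of_family m k q = mat m k (\<lambda>(i, j). q j i)"

lemma mat_of_family_carrier [simp]: "mat_of_family m k q \<in> carrier_mat m k"
  by (simp add: mat_of_family_def)

lemma orthonormal_mat_of_family:
  assumes "orthonormal_family m k q"
  shows "orthonormal_mat m k (mat_of_family m k q)"
proof
  show "transpose_mat (mat_of_family m k q) * mat_of_family m k q = 1\<^sub>m k"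
    using assms by (intro eq_matI) (auto simp: mat_of_family_def scalar_prod_def lessThan_atLeast0[symmetric] orthonormal_family_def ip_def)
qed simp

lemma (in orthonormal_mat) orthonormal_family_colf: "orthonormal_family m k (colf Q)"
proof -
  have "ip m (colf Q i) (colf Q j) = (if i = j then 1 else 0)" if "i < k" "j < k" for i j
  proof -
    have "ip m (colf Q i) (colf Q j) = (transpose_mat Q * Q) $$ (i, j)"
      using that by (simp add: mult_transpose_entry[OF Q Q] ip_def colf_def del: index_mult_mat)
    then show ?thesis using that by (simp add: QQ)
  qed
  then show ?thesis by (simp add: orthonormal_family_def)
qed

lemma orthonormal_matI: "orthonormal Q \<Longrightarrow> Q \<in> carrier_mat m k \<Longrightarrow> orthonormal_mat m k Q"
  by (auto simp: orthonormal_mat_def orthonormal_def)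

lemma (in orthonormal_mat) frob_norm_QtX_sq:
  assumes X: "X \<in> carrier_mat m n"
  shows "(frob_norm (transpose_mat Q * X))\<^sup>2 = (\<Sum>j<k. \<Sum>c<n. (\<Sum>a<m. Q $$ (a, j) * X $$ (a, c))\<^sup>2)"
  unfolding frob_norm_sq[OF Qt_mult_carrier[OF X]]
  by (intro sum.cong refl) (simp add: mult_transpose_entry[OF Q X] del: index_mult_mat)

text \<open>A fractional knapsack: with weight at most 1 per item and at most \<open>\<mu>\<close>
  in total, nothing beats the \<open>\<mu>\<close> largest values. Subtracting the threshold value
  \<open>e \<mu>\<close> makes this visible termwise.\<close>

lemma weighted_sum_le_top:
  fixes e t :: "nat \<Rightarrow> real"
  assumes srt: "\<And>i j. i \<le> j \<Longrightarrow> j < r \<Longrightarrow> e j \<le> e i" and nn: "\<And>j. j < r \<Longrightarrow> 0 \<le> e j"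
    and t: "\<And>j. j < r \<Longrightarrow> 0 \<le> t j \<and> t j \<le> 1" and st: "(\<Sum>j<r. t j) \<le> real \<mu>"
  shows "(\<Sum>j<r. e j * t j) \<le> (\<Sum>j<min \<mu> r. e j)"
proof (cases "\<mu> < r")
  case False
  have "(\<Sum>j<r. e j * t j) \<le> (\<Sum>j<r. e j * 1)"
    using nn t by (intro sum_mono mult_left_mono) auto
  then show ?thesis using False by (simp add: min_def)
next
  case True
  define c where "c = e \<mu>"
  have "(\<Sum>j<r. e j * t j) = (\<Sum>j<r. (e j - c) * t j) + c * (\<Sum>j<r. t j)"
    by (simp add: left_diff_distrib sum_subtractf sum_distrib_left)
  also have "(\<Sum>j<r. (e j - c) * t j) \<le> (\<Sum>j<r. if j < \<mu> then e j - c else 0)"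
  proof (rule sum_mono)
    fix j assume j: "j \<in> {..<r}"
    show "(e j - c) * t j \<le> (if j < \<mu> then e j - c else 0)"
    proof (cases "j < \<mu>")
      case jm: True
      then have "c \<le> e j" using srt[of j \<mu>] True by (simp add: c_def)
      then show ?thesis using t[of j] j jm mult_left_mono[of "t j" 1 "e j - c"] by simp
    next
      case jm: False
      then have "e j \<le> c" using srt[of \<mu> j] j by (simp add: c_def)
      then show ?thesis using t[of j] j jm by (simp add: mult_nonpos_nonneg)
    qed
  qed
  also have "(\<Sum>j<r. if j < \<mu> then e j - c else 0) = (\<Sum>j<\<mu>. e j - c)"
    using True by (intro sum.mono_neutral_cong_right) auto
  also have "c * (\<Sum>j<r. t j) \<le> c * real \<mu>"
    using st nn[OF True] by (intro mult_left_mono) (auto simp: c_def)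
  finally show ?thesis using True by (simp add: sum_subtractf)
qed

lemma sum_split_min:
  fixes f :: "nat \<Rightarrow> real"
  shows "(\<Sum>j<r. f j) = (\<Sum>j<min \<mu> r. f j) + (\<Sum>j=\<mu>..<r. f j)"
proof -
  have eq: "{..<r} = {..<min \<mu> r} \<union> {\<mu>..<r}" by auto
  show ?thesis by (subst eq, rule sum.union_disjoint) auto
qed

locale thin_svd_loc =
  fixes m n r :: nat and A :: "real mat" and u :: "nat \<Rightarrow> nat \<Rightarrow> real" and s :: "nat \<Rightarrow> real"
  assumes A: "A \<in> carrier_mat m n" and u: "orthonormal_family m r u" and rn: "r \<le> n"
    and rank: "r \<le> mat_rank A"
    and s_pos: "\<And>j. j < r \<Longrightarrow> 0 < s j" and s_anti: "\<And>i j. i \<le> j \<Longrightarrow> j < r \<Longrightarrow> s j \<le> s i"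
    and sig: "\<And>j. sigma (Suc j) A = (if j < r then s j else 0)"
    and bil: "\<And>x y. (\<Sum>k<n. (\<Sum>a<m. x a * A $$ (a, k)) * (\<Sum>a<m. y a * A $$ (a, k))) =
       (\<Sum>j<r. (s j)\<^sup>2 * (ip m x (u j) * ip m y (u j)))"

lemma ex_thin_svd:
  assumes "A \<in> carrier_mat m n"
  shows "\<exists>r u s. thin_svd_loc m n r A u s"
proof (rule thin_svd[OF assms], goal_cases)
  case (1 r u s)
  have "thin_svd_loc m n r A u s" by (rule thin_svd_loc.intro[OF assms 1])
  then show ?case by blast
qed

context thin_svd_loc
begin

lemma rm: "r \<le> m"
  by (rule orthonormal_family_le[OF u])

lemma quad: "(\<Sum>c<n. (\<Sum>a<m. x a * A $$ (a, c))\<^sup>2) = (\<Sum>j<r. (s j)\<^sup>2 * (ip m x (u j))\<^sup>2)"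
  using bil[of x x] by (simp add: power2_eq_square)

lemma frob_norm_sq_A: "(frob_norm A)\<^sup>2 = (\<Sum>j<r. (s j)\<^sup>2)"
proof -
  have "(frob_norm A)\<^sup>2 = (\<Sum>b<m. \<Sum>c<n. (\<Sum>a<m. unit_fun b a * A $$ (a, c))\<^sup>2)"
    unfolding frob_norm_sq[OF A] by (intro sum.cong refl) (simp add: unit_fun_def if_distrib if_distribR cong: if_cong)
  also have "\<dots> = (\<Sum>j<r. (s j)\<^sup>2 * (\<Sum>b<m. (ip m (unit_fun b) (u j))\<^sup>2))"
    unfolding quad by (subst sum.swap) (simp add: sum_distrib_left)
  also have "\<dots> = (\<Sum>j<r. (s j)\<^sup>2 * ip m (u j) (u j))"
    by (intro sum.cong refl) (simp add: ip_commute[of m "unit_fun _"] ip_unit_fun, simp add: ip_def power2_eq_square)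
  also have "\<dots> = (\<Sum>j<r. (s j)\<^sup>2)"
    using u by (intro sum.cong) (auto simp: orthonormal_family_def)
  finally show ?thesis .
qed

lemma frob_norm_QtA_sq:
  assumes "orthonormal_mat m k Q"
  shows "(frob_norm (transpose_mat Q * A))\<^sup>2 = (\<Sum>j<r. (s j)\<^sup>2 * (\<Sum>i<k. (ip m (colf Q i) (u j))\<^sup>2))"
proof -
  interpret orthonormal_mat m k Q by fact
  have "(frob_norm (transpose_mat Q * A))\<^sup>2 = (\<Sum>i<k. \<Sum>c<n. (\<Sum>a<m. colf Q i a * A $$ (a, c))\<^sup>2)"
    by (simp add: frob_norm_QtX_sq[OF A] colf_def)
  also have "\<dots> = (\<Sum>j<r. (s j)\<^sup>2 * (\<Sum>i<k. (ip m (colf Q i) (u j))\<^sup>2))"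
    unfolding quad by (subst sum.swap) (simp add: sum_distrib_left)
  finally show ?thesis .
qed

text \<open>By the bilinear identity the left side is a weighted sum of the squared singular values.
  The weight of \<open>u j\<close> is the squared length of its projection on the columns of
  \<open>Q\<close>: at most 1 by Bessel for \<open>Q\<close>, and at most \<open>k\<close> in total
  by Bessel for \<open>u\<close>.\<close>

lemma ky_fan:
  assumes QA: "orthonormal_mat m k Q" and k: "k \<le> \<mu>"
  shows "(frob_norm (transpose_mat Q * A))\<^sup>2 \<le> (\<Sum>j<min \<mu> r. (s j)\<^sup>2)"
proof -
  interpret orthonormal_mat m k Q by fact
  note onf = orthonormal_family_colf
  show ?thesis
    unfolding frob_norm_QtA_sq[OF QA]
  proof (rule weighted_sum_le_top)
    fix i j assume "i \<le> j" "j < r"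
    then show "(s j)\<^sup>2 \<le> (s i)\<^sup>2" using s_anti[of i j] s_pos[of j] by (intro power_mono) auto
  next
    fix j assume j: "j < r"
    have "(\<Sum>i<k. (ip m (colf Q i) (u j))\<^sup>2) \<le> ip m (u j) (u j)" by (rule bessel[OF onf])
    then show "0 \<le> (\<Sum>i<k. (ip m (colf Q i) (u j))\<^sup>2) \<and> (\<Sum>i<k. (ip m (colf Q i) (u j))\<^sup>2) \<le> 1"
      using u j by (auto simp: orthonormal_family_def sum_nonneg)
  next
    have "(\<Sum>j<r. \<Sum>i<k. (ip m (colf Q i) (u j))\<^sup>2) = (\<Sum>i<k. \<Sum>j<r. (ip m (u j) (colf Q i))\<^sup>2)"
      by (subst sum.swap) (simp add: ip_commute)
    also have "\<dots> \<le> (\<Sum>i<k. ip m (colf Q i) (colf Q i))"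
      by (intro sum_mono bessel[OF u])
    also have "\<dots> = (\<Sum>i<k. 1)" using onf by (intro sum.cong) (auto simp: orthonormal_family_def)
    also have "\<dots> \<le> real \<mu>" using k by simp
    finally show "(\<Sum>j<r. \<Sum>i<k. (ip m (colf Q i) (u j))\<^sup>2) \<le> real \<mu>" .
  qed simp
qed

text \<open>The lower bound of Eckart and Young in projection form: Pythagoras turns the bound on
  the captured energy into one on the residual.\<close>

lemma frob_norm_res_ge:
  assumes QA: "orthonormal_mat m k Q" and k: "k \<le> \<mu>"
  shows "(\<Sum>j=\<mu>..<r. (s j)\<^sup>2) \<le> (frob_norm (res Q A))\<^sup>2"
proof -
  have "(\<Sum>j<r. (s j)\<^sup>2) = (\<Sum>j<min \<mu> r. (s j)\<^sup>2) + (\<Sum>j=\<mu>..<r. (s j)\<^sup>2)"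
    by (rule sum_split_min)
  then show ?thesis
    using ky_fan[OF QA k] orthonormal_mat.frob_norm_res_sq[OF QA A] frob_norm_sq_A by linarith
qed

text \<open>Only the first \<open>min \<mu> r\<close> vectors are prescribed; further ones merely
  enlarge the range, so the family may be padded to a given size when the rank is below
  \<open>\<mu>\<close>.\<close>

lemma top_family:
  assumes k: "min \<mu> r \<le> k" and w: "orthonormal_family m k w" and wu: "\<forall>j<min \<mu> r. w j = u j"
  shows "(frob_norm (res (mat_of_family m k w) A))\<^sup>2 \<le> (\<Sum>j=\<mu>..<r. (s j)\<^sup>2)"
proof -
  let ?Q = "mat_of_family m k w"
  have Q: "orthonormal_mat m k ?Q" by (rule orthonormal_mat_of_family[OF w])
  have "(\<Sum>j<min \<mu> r. (s j)\<^sup>2) \<le> (\<Sum>j<r. (s j)\<^sup>2 * (\<Sum>i<k. (ip m (colf ?Q i) (u j))\<^sup>2))"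
  proof -
    have "(\<Sum>j<min \<mu> r. (s j)\<^sup>2) \<le> (\<Sum>j<min \<mu> r. (s j)\<^sup>2 * (\<Sum>i<k. (ip m (colf ?Q i) (u j))\<^sup>2))"
    proof (rule sum_mono)
      fix j assume j: "j \<in> {..<min \<mu> r}"
      have "ip m (colf ?Q j) (u j) = ip m (u j) (u j)"
        using j k wu by (intro ip_cong) (auto simp: colf_def mat_of_family_def)
      then have "1 = (ip m (colf ?Q j) (u j))\<^sup>2" using u j by (simp add: orthonormal_family_def)
      also have "\<dots> \<le> (\<Sum>i<k. (ip m (colf ?Q i) (u j))\<^sup>2)"
        using j k by (intro member_le_sum) auto
      finally show "(s j)\<^sup>2 \<le> (s j)\<^sup>2 * (\<Sum>i<k. (ip m (colf ?Q i) (u j))\<^sup>2)"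
        using mult_left_mono[of 1 _ "(s j)\<^sup>2"] by simp
    qed
    also have "\<dots> \<le> (\<Sum>j<r. (s j)\<^sup>2 * (\<Sum>i<k. (ip m (colf ?Q i) (u j))\<^sup>2))"
      by (intro sum_mono2) (auto intro!: mult_nonneg_nonneg sum_nonneg)
    finally show ?thesis .
  qed
  moreover have "(\<Sum>j<r. (s j)\<^sup>2) = (\<Sum>j<min \<mu> r. (s j)\<^sup>2) + (\<Sum>j=\<mu>..<r. (s j)\<^sup>2)"
    by (rule sum_split_min)
  ultimately show ?thesis
    using orthonormal_mat.frob_norm_res_sq[OF Q A] frob_norm_QtA_sq[OF Q] frob_norm_sq_A by linarith
qed

end

text \<open>Makes the tolerance in \<open>range_basis\<close> usable: the sketch error it allows
  never exceeds the residual of any competitor with \<open>\<mu>\<close> columns. Singular values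
  count from 1 and the sequence \<open>s\<close> from 0, hence the shift.\<close>

lemma sum_sigma_tail_le:
  assumes Y: "Y \<in> carrier_mat m n" and QA: "orthonormal_mat m \<mu> Q"
  shows "(\<Sum>k=\<mu>+1..\<mu>+K. (sigma k Y)\<^sup>2) \<le> (frob_norm (res Q Y))\<^sup>2"
proof -
  obtain r u s where "thin_svd_loc m n r Y u s" using ex_thin_svd[OF Y] by blast
  then interpret thin_svd_loc m n r Y u s .
  have "(\<Sum>k=\<mu>+1..\<mu>+K. (sigma k Y)\<^sup>2) = (\<Sum>j=\<mu>..<\<mu>+K. (sigma (Suc j) Y)\<^sup>2)"
    using sum.shift_bounds_Suc_ivl[of "\<lambda>k. (sigma k Y)\<^sup>2" \<mu> "\<mu> + K"] by (simp add: atLeastLessThanSuc_atLeastAtMost)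
  also have "\<dots> = (\<Sum>j\<in>{\<mu>..<\<mu>+K} \<inter> {j. j < r}. (s j)\<^sup>2)"
    unfolding sig by (intro sum.mono_neutral_cong_right) auto
  also have "\<dots> \<le> (\<Sum>j=\<mu>..<r. (s j)\<^sup>2)"
    by (intro sum_mono2) auto
  also have "\<dots> \<le> (frob_norm (res Q Y))\<^sup>2" by (rule frob_norm_res_ge[OF QA order_refl])
  finally show ?thesis .
qed

text \<open>Take the leading left singular vectors, completed arbitrarily when the rank is below
  \<open>\<mu>\<close>. Their span is invariant under \<open>X X\<^sup>T\<close>, which is the
  vanishing of the off-diagonal block, and it minimizes the residual by \<open>top_family\<close>
  and \<open>frob_norm_res_ge\<close>.\<close>

lemma ex_top_eigenspace:
  assumes X: "X \<in> carrier_mat m n" and "\<mu> \<le> m"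
  shows "\<exists>U. orthonormal_mat m \<mu> U \<and> res U X * (transpose_mat X * U) = 0\<^sub>m m \<mu> \<and>
    (\<forall>k V. k \<le> \<mu> \<longrightarrow> orthonormal_mat m k V \<longrightarrow> frob_norm (res U X) \<le> frob_norm (res V X))"
proof -
  obtain r u s where "thin_svd_loc m n r X u s" using ex_thin_svd[OF X] by blast
  then interpret thin_svd_loc m n r X u s .
  have uf: "orthonormal_family m (min \<mu> r) u"
    using u by (auto simp: orthonormal_family_def)
  obtain w where w: "orthonormal_family m \<mu> w" and wu: "\<forall>j<min \<mu> r. w j = u j"
    using orthonormal_family_extend[OF uf, of \<mu>] \<open>\<mu> \<le> m\<close> by auto
  define U where "U = mat_of_family m \<mu> w"
  have U: "orthonormal_mat m \<mu> U" unfolding U_def by (rule orthonormal_mat_of_family[OF w])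
  then interpret U: orthonormal_mat m \<mu> U .
  have opt: "frob_norm (res U X) \<le> frob_norm (res V X)" if "k \<le> \<mu>" "orthonormal_mat m k V" for k V
  proof (rule power2_le_imp_le)
    have "min \<mu> r \<le> \<mu>" by simp
    from order_trans[OF top_family[OF this w wu] frob_norm_res_ge[OF that(2,1)]]
    show "(frob_norm (res U X))\<^sup>2 \<le> (frob_norm (res V X))\<^sup>2" by (simp only: U_def)
  qed (rule frob_norm_nonneg)
  have entry: "(res U X * (transpose_mat X * U)) $$ (a, i) = 0" if ai: "a < m" "i < \<mu>" for a i
  proof -
    have Ue: "U $$ (b, l) = w l b" if "b < m" "l < \<mu>" for b l
      using that by (simp add: U_def mat_of_family_def)
    \<comment> \<open>Row \<open>a\<close> of \<open>1 - U U\<^sup>T\<close>; with it the entry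
      becomes an instance of the bilinear identity \<open>bil\<close>.\<close>
    define x where "x = (\<lambda>b. unit_fun a b - (\<Sum>l<\<mu>. w l a * w l b))"
    have rx: "res U X $$ (a, c) = (\<Sum>b<m. x b * X $$ (b, c))" if "c < n" for c
    proof -
      have "(U * (transpose_mat U * X)) $$ (a, c) = (\<Sum>l<\<mu>. w l a * (\<Sum>b<m. w l b * X $$ (b, c)))"
        using ai that
        by (simp add: mult_entry[OF U.Q U.Qt_mult_carrier[OF X]] mult_transpose_entry[OF U.Q X] Ue del: index_mult_mat)
      also have "\<dots> = (\<Sum>b<m. (\<Sum>l<\<mu>. w l a * w l b) * X $$ (b, c))"
        unfolding sum_distrib_left sum_distrib_right mult.assoc[symmetric] by (rule sum.swap)
      finally have 1: "(U * (transpose_mat U * X)) $$ (a, c) = (\<Sum>b<m. (\<Sum>l<\<mu>. w l a * w l b) * X $$ (b, c))" .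
      have 2: "(\<Sum>b<m. unit_fun a b * X $$ (b, c)) = X $$ (a, c)"
        using ai by (simp add: unit_fun_def if_distrib if_distribR cong: if_cong)
      have "res U X $$ (a, c) = X $$ (a, c) - (U * (transpose_mat U * X)) $$ (a, c)"
        unfolding res_def using ai that carrier_matD[OF U.Q_mult_carrier[OF U.Qt_mult_carrier[OF X]]]
        by (intro index_minus_mat(1)) auto
      also have "\<dots> = (\<Sum>b<m. x b * X $$ (b, c))"
        unfolding 1 2[symmetric] x_def left_diff_distrib sum_subtractf ..
      finally show ?thesis .
    qed
    have cc: "transpose_mat X * U \<in> carrier_mat n \<mu>"
      by (rule mult_carrier_mat[OF transpose_carrier_mat[THEN iffD2, OF X] U.Q])
    have "(res U X * (transpose_mat X * U)) $$ (a, i) = (\<Sum>c<n. res U X $$ (a, c) * (transpose_mat X * U) $$ (c, i))"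
      by (rule mult_entry[OF U.res_carrier[OF X] cc ai])
    also have "\<dots> = (\<Sum>c<n. res U X $$ (a, c) * (\<Sum>b<m. w i b * X $$ (b, c)))"
    proof (intro sum.cong refl)
      fix c assume c: "c \<in> {..<n}"
      have "(transpose_mat X * U) $$ (c, i) = (\<Sum>b<m. X $$ (b, c) * U $$ (b, i))"
        using c ai by (intro mult_transpose_entry[OF X U.Q]) auto
      also have "\<dots> = (\<Sum>b<m. w i b * X $$ (b, c))"
        using ai by (intro sum.cong refl) (simp add: Ue)
      finally show "res U X $$ (a, c) * (transpose_mat X * U) $$ (c, i) = res U X $$ (a, c) * (\<Sum>b<m. w i b * X $$ (b, c))"
        by simp
    qed
    also have "\<dots> = (\<Sum>j<r. (s j)\<^sup>2 * (ip m x (u j) * ip m (w i) (u j)))"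
    proof -
      have "(\<Sum>c<n. res U X $$ (a, c) * (\<Sum>b<m. w i b * X $$ (b, c))) =
        (\<Sum>c<n. (\<Sum>b<m. x b * X $$ (b, c)) * (\<Sum>b<m. w i b * X $$ (b, c)))"
        by (intro sum.cong refl) (simp add: rx)
      also have "\<dots> = (\<Sum>j<r. (s j)\<^sup>2 * (ip m x (u j) * ip m (w i) (u j)))" by (rule bil)
      finally show ?thesis .
    qed
    also have "\<dots> = 0"
    proof (rule sum.neutral, intro ballI)
      fix j assume j: "j \<in> {..<r}"
      have xw: "ip m x (w l) = 0" if "l < \<mu>" for l
      proof -
        have "ip m x (w l) = w l a - (\<Sum>l'<\<mu>. w l' a * ip m (w l') (w l))"
          unfolding x_def by (simp only: ip_diff_left ip_sum_left ip_scale_left ip_commute[of m "unit_fun a"] ip_unit_fun[OF ai(1)])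
        also have "(\<Sum>l'<\<mu>. w l' a * ip m (w l') (w l)) = (\<Sum>l'<\<mu>. if l' = l then w l' a else 0)"
          using w that by (intro sum.cong) (auto simp: orthonormal_family_def)
        finally show ?thesis using that by simp
      qed
      show "(s j)\<^sup>2 * (ip m x (u j) * ip m (w i) (u j)) = 0"
      \<comment> \<open>For \<open>j < \<mu>\<close> the vector \<open>u j\<close> is one of the
        \<open>w\<close> and is annihilated by \<open>x\<close>. Otherwise
        \<open>i < \<mu> \<le> j < r\<close>, so \<open>w i = u i\<close> is orthogonal to
        \<open>u j\<close>.\<close>
      proof (cases "j < \<mu>")
        case True
        then show ?thesis using xw[of j] wu j by simp
      next
        case False
        then have "i < min \<mu> r" using ai j by simp
        then have "ip m (w i) (u j) = 0" using wu u j False ai by (auto simp: orthonormal_family_def)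
        then show ?thesis by simp
      qed
    qed
    finally show ?thesis .
  qed
  have c: "res U X * (transpose_mat X * U) \<in> carrier_mat m \<mu>"
    by (rule mult_carrier_mat[OF U.res_carrier[OF X]
      mult_carrier_mat[OF transpose_carrier_mat[THEN iffD2, OF X] U.Q]])
  then have "res U X * (transpose_mat X * U) = 0\<^sub>m m \<mu>"
    using entry by (intro eq_matI) auto
  then show ?thesis using U opt by (intro exI[of _ U] conjI allI impI) simp_all
qed

section \<open>The residual of a sketched range\<close>

text \<open>Gram-Schmidt for vectors that may be dependent: a zero residual adds no basis vector,
  hence \<open>k \<le> card J\<close>. The last clause lets a projection onto the span be rewritten
  as an explicit combination of the \<open>g j\<close>.\<close>

lemma orthonormal_basis_of_span:
  assumes "finite J"
  shows "\<exists>k q. k \<le> card J \<and> orthonormal_family l k q \<and>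
    (\<forall>j\<in>J. \<forall>i<l. g j i = (\<Sum>a<k. ip l (q a) (g j) * q a i)) \<and>
    (\<forall>a<k. \<exists>c. \<forall>i<l. q a i = (\<Sum>j\<in>J. c j * g j i))"
  using assms
proof (induction J rule: finite_induct)
  case empty
  then show ?case by (intro exI[of _ 0]) (simp add: orthonormal_family_def)
next
  case (insert j0 J)
  then obtain k q where kq: "k \<le> card J" "orthonormal_family l k q"
    and ex: "\<And>j i. j \<in> J \<Longrightarrow> i < l \<Longrightarrow> g j i = (\<Sum>a<k. ip l (q a) (g j) * q a i)"
    and sp: "\<forall>a<k. \<exists>c. \<forall>i<l. q a i = (\<Sum>j\<in>J. c j * g j i)" by auto
  have sp': "\<exists>c. \<forall>i<l. q a i = (\<Sum>j\<in>insert j0 J. c j * g j i)" if ak: "a < k" for a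
  proof -
    obtain c where c: "\<forall>i<l. q a i = (\<Sum>j\<in>J. c j * g j i)" using sp ak by blast
    have "(\<Sum>j\<in>insert j0 J. (c(j0 := 0)) j * g j i) = (\<Sum>j\<in>J. c j * g j i)" for i
      using insert by (auto intro!: sum.cong)
    then show ?thesis using c by metis
  qed
  define v where "v = onb_residual l k q (g j0)"
  show ?case
  proof (cases "ip l v v = 0")
    case True
    have "g j0 i = (\<Sum>a<k. ip l (q a) (g j0) * q a i)" if "i < l" for i
      using ip_self_eq_0[OF True that] by (simp add: v_def onb_residual_def)
    then show ?thesis
      using kq ex sp' insert by (intro exI[of _ k] exI[of _ q]) auto
  next
    case False
    then have pos: "ip l v v > 0" using ip_self_nonneg[of l v] by linarith
    define b where "b = 1 / sqrt (ip l v v)"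
    have b: "b * b * ip l v v = 1" "b \<noteq> 0" using pos by (simp_all add: b_def)
    define w where "w = (\<lambda>i. b * v i)"
    have vq: "ip l (q a) v = 0" if "a < k" for a
      unfolding v_def by (rule ip_onb_residual[OF kq(2) that])
    have w1: "ip l w w = 1"
      unfolding w_def using b(1) by (simp add: ip_scale_left ip_scale_right mult.assoc)
    have wq: "\<forall>a<k. ip l (q a) w = 0"
      unfolding w_def using vq by (simp add: ip_scale_right)
    let ?q = "q(k := w)"
    have of: "orthonormal_family l (Suc k) ?q"
      by (rule orthonormal_family_Suc[OF kq(2) w1 wq])
    have gv: "g j0 i = (\<Sum>a<k. ip l (q a) (g j0) * q a i) + v i" for i
      by (simp add: v_def onb_residual_def)
    have wg: "ip l w (g j0) = b * ip l v v"
    proof -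
      have "ip l w (g j0) = ip l w (\<lambda>i. (\<Sum>a<k. ip l (q a) (g j0) * q a i) + v i)"
        by (rule arg_cong[where f = "ip l w"]) (rule ext, rule gv)
      also have "\<dots> = (\<Sum>a<k. ip l (q a) (g j0) * ip l w (q a)) + ip l w v"
        by (simp only: ip_add_right ip_sum_right ip_scale_right)
      also have "\<dots> = ip l w v" using wq ip_commute[of l w] by simp
      also have "\<dots> = b * ip l v v" unfolding w_def by (rule ip_scale_left)
      finally show ?thesis .
    qed
    have wgJ: "ip l w (g j) = 0" if j: "j \<in> J" for j
    proof -
      have "ip l w (g j) = ip l w (\<lambda>i. \<Sum>a<k. ip l (q a) (g j) * q a i)"
        by (rule ip_cong) (auto intro: ex[OF j])
      also have "\<dots> = (\<Sum>a<k. ip l (q a) (g j) * ip l w (q a))"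
        by (simp only: ip_sum_right ip_scale_right)
      also have "\<dots> = 0" using wq ip_commute[of l w] by simp
      finally show ?thesis .
    qed
    have "g j i = (\<Sum>a<Suc k. ip l (?q a) (g j) * ?q a i)" if "j \<in> insert j0 J" "i < l" for j i
    proof -
      have "(\<Sum>a<Suc k. ip l (?q a) (g j) * ?q a i) = (\<Sum>a<k. ip l (q a) (g j) * q a i) + ip l w (g j) * w i"
        by (auto intro!: sum.cong)
      moreover have "ip l w (g j0) * w i = v i" using wg b(1) by (simp add: w_def algebra_simps)
      ultimately show ?thesis using that gv[of i] ex[of j i] wgJ[of j] by auto
    qed
    moreover have "\<exists>c. \<forall>i<l. ?q a i = (\<Sum>j\<in>insert j0 J. c j * g j i)" if "a < Suc k" for a
    proof (cases "a = k")
      case False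
      then show ?thesis using sp'[of a] that by simp
    next
      case True
      have "\<forall>a<k. \<exists>c. \<forall>i<l. q a i = (\<Sum>j\<in>insert j0 J. c j * g j i)" using sp' by blast
      then obtain c where c: "\<And>a i. a < k \<Longrightarrow> i < l \<Longrightarrow> q a i = (\<Sum>j\<in>insert j0 J. c a j * g j i)"
        by metis
      \<comment> \<open>Coefficients of the normalized residual: \<open>g j0\<close> minus its
        projection, whose basis vectors are rewritten through \<open>c\<close>.\<close>
      define d where "d = (\<lambda>j. b * ((if j = j0 then 1 else 0) - (\<Sum>a<k. ip l (q a) (g j0) * c a j)))"
      have "w i = (\<Sum>j\<in>insert j0 J. d j * g j i)" if i: "i < l" for i
      proof -
        have "(\<Sum>j\<in>insert j0 J. d j * g j i) =
          (\<Sum>j\<in>insert j0 J. b * ((if j = j0 then g j i else 0) - (\<Sum>a<k. ip l (q a) (g j0) * (c a j * g j i))))"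
          unfolding d_def by (intro sum.cong refl) (simp add: left_diff_distrib sum_distrib_right mult.assoc)
        also have "\<dots> = b * ((\<Sum>j\<in>insert j0 J. if j = j0 then g j i else 0) -
            (\<Sum>j\<in>insert j0 J. \<Sum>a<k. ip l (q a) (g j0) * (c a j * g j i)))"
          unfolding sum_distrib_left[symmetric] sum_subtractf ..
        also have "(\<Sum>j\<in>insert j0 J. if j = j0 then g j i else 0) = g j0 i"
          using insert(1) by (subst sum.delta) auto
        also have "(\<Sum>j\<in>insert j0 J. \<Sum>a<k. ip l (q a) (g j0) * (c a j * g j i)) =
            (\<Sum>a<k. ip l (q a) (g j0) * (\<Sum>j\<in>insert j0 J. c a j * g j i))"
          unfolding sum_distrib_left by (rule sum.swap)
        also have "\<dots> = (\<Sum>a<k. ip l (q a) (g j0) * q a i)"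
          using c i by (intro sum.cong refl) auto
        finally show ?thesis by (simp add: w_def v_def onb_residual_def)
      qed
      then show ?thesis using True by (intro exI[of _ d]) simp
    qed
    moreover have "Suc k \<le> card (insert j0 J)" using kq(1) insert by simp
    ultimately show ?thesis using of by (intro exI[of _ "Suc k"] exI[of _ ?q] conjI ballI allI impI) blast+
  qed
qed

text \<open>Let \<open>v\<close> be the component of \<open>h\<close> orthogonal to all
  \<open>g j\<close>. Its squared length is one of the values bounded below by \<open>t\<close>, and
  \<open>p = v / \<parallel>v\<parallel>\<^sup>2\<close> has the three properties.\<close>

lemma dual_vector:
  assumes J: "finite J" and t: "0 < t"
    and dist: "\<And>c. t \<le> (\<Sum>b<l. (h b - (\<Sum>j\<in>J. c j * g j b))\<^sup>2)"
  shows "\<exists>p. ip l h p = 1 \<and> (\<forall>j\<in>J. ip l (g j) p = 0) \<and> ip l p p \<le> 1 / t"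
proof -
  obtain k q where q: "orthonormal_family l k q"
    and ex: "\<And>j i. j \<in> J \<Longrightarrow> i < l \<Longrightarrow> g j i = (\<Sum>a<k. ip l (q a) (g j) * q a i)"
    and "\<forall>a<k. \<exists>c. \<forall>i<l. q a i = (\<Sum>j\<in>J. c j * g j i)"
    using orthonormal_basis_of_span[OF J, of l g] by auto
  then obtain c where c: "\<And>a i. a < k \<Longrightarrow> i < l \<Longrightarrow> q a i = (\<Sum>j\<in>J. c a j * g j i)" by metis
  define v where "v = onb_residual l k q h"
  have vq: "ip l (q a) v = 0" if "a < k" for a
    unfolding v_def by (rule ip_onb_residual[OF q that])
  have "v i = h i - (\<Sum>j\<in>J. (\<Sum>a<k. ip l (q a) h * c a j) * g j i)" if "i < l" for i
  proof -
    have "(\<Sum>j\<in>J. (\<Sum>a<k. ip l (q a) h * c a j) * g j i) = (\<Sum>a<k. ip l (q a) h * (\<Sum>j\<in>J. c a j * g j i))"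
      unfolding sum_distrib_left sum_distrib_right mult.assoc by (rule sum.swap)
    also have "\<dots> = (\<Sum>a<k. ip l (q a) h * q a i)" using c that by (intro sum.cong refl) auto
    finally show ?thesis by (simp add: v_def onb_residual_def)
  qed
  then have vv: "t \<le> ip l v v"
    using dist[of "\<lambda>j. \<Sum>a<k. ip l (q a) h * c a j"] by (simp add: ip_def power2_eq_square)
  have vg: "ip l (g j) v = 0" if j: "j \<in> J" for j
  proof -
    have "ip l (g j) v = ip l (\<lambda>i. \<Sum>a<k. ip l (q a) (g j) * q a i) v"
      by (rule ip_cong) (auto intro: ex[OF j])
    also have "\<dots> = (\<Sum>a<k. ip l (q a) (g j) * ip l (q a) v)"
      by (simp only: ip_sum_left ip_scale_left)
    finally show ?thesis using vq by simp
  qed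
  have hv: "ip l h v = ip l v v"
  proof -
    have "ip l h v = ip l (\<lambda>i. (\<Sum>a<k. ip l (q a) h * q a i) + v i) v"
      by (rule ip_cong) (auto simp: v_def onb_residual_def)
    also have "\<dots> = (\<Sum>a<k. ip l (q a) h * ip l (q a) v) + ip l v v"
      by (simp only: ip_add_left ip_sum_left ip_scale_left)
    finally show ?thesis using vq by simp
  qed
  define b where "b = 1 / ip l v v"
  define p where "p = (\<lambda>i. b * v i)"
  have "ip l h p = 1" unfolding p_def ip_scale_right hv b_def using vv t by simp
  moreover have "\<forall>j\<in>J. ip l (g j) p = 0" unfolding p_def ip_scale_right using vg by simp
  moreover have "ip l p p = 1 / ip l v v"
    unfolding p_def ip_scale_left ip_scale_right b_def using vv t by simp
  then have "ip l p p \<le> 1 / t" using vv t by (simp add: frac_le)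
  ultimately show ?thesis by blast
qed

text \<open>The columns of \<open>P\<close> are vectors dual to the rows of
  \<open>U\<^sup>T G\<close>: each pairs to 1 with its own row and to 0 with the others. A row far
  from the span of the others has a short dual vector.\<close>

lemma ex_right_inverse:
  assumes U: "U \<in> carrier_mat m k" and G: "G \<in> carrier_mat m l" and t: "0 < t"
    and dist: "\<And>i c. i < k \<Longrightarrow>
      t \<le> (\<Sum>b<l. ((\<Sum>a<m. U $$ (a, i) * G $$ (a, b)) - (\<Sum>j\<in>{..<k} - {i}. c j * (\<Sum>a<m. U $$ (a, j) * G $$ (a, b))))\<^sup>2)"
  shows "\<exists>P\<in>carrier_mat l k. transpose_mat U * (G * P) = 1\<^sub>m k \<and> (frob_norm P)\<^sup>2 \<le> real k / t"
proof -
  define g where "g = (\<lambda>j b. \<Sum>a<m. U $$ (a, j) * G $$ (a, b))"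
  have "\<exists>p. ip l (g i) p = 1 \<and> (\<forall>j\<in>{..<k} - {i}. ip l (g j) p = 0) \<and> ip l p p \<le> 1 / t" if "i < k" for i
    by (rule dual_vector[OF _ t]) (use dist[OF that] in \<open>auto simp: g_def\<close>)
  then obtain p where p: "\<And>i. i < k \<Longrightarrow> ip l (g i) (p i) = 1"
    "\<And>i j. i < k \<Longrightarrow> j < k \<Longrightarrow> j \<noteq> i \<Longrightarrow> ip l (g j) (p i) = 0"
    "\<And>i. i < k \<Longrightarrow> ip l (p i) (p i) \<le> 1 / t"
    by (metis Diff_iff lessThan_iff singletonD)
  define P where "P = mat l k (\<lambda>(b, i). p i b)"
  have P: "P \<in> carrier_mat l k" by (simp add: P_def)
  have GP: "G * P \<in> carrier_mat m k" by (rule mult_carrier_mat[OF G P])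
  have "transpose_mat U * (G * P) = 1\<^sub>m k"
  proof (rule eq_matI)
    fix j i assume "j < dim_row (1\<^sub>m k)" "i < dim_col (1\<^sub>m k)"
    then have ij: "j < k" "i < k" by auto
    have "(transpose_mat U * (G * P)) $$ (j, i) = (\<Sum>a<m. U $$ (a, j) * (G * P) $$ (a, i))"
      by (rule mult_transpose_entry[OF U GP ij])
    also have "\<dots> = (\<Sum>a<m. U $$ (a, j) * (\<Sum>b<l. G $$ (a, b) * P $$ (b, i)))"
      by (intro sum.cong refl arg_cong2[where f = "(*)"] mult_entry[OF G P]) (use ij in auto)
    also have "\<dots> = (\<Sum>b<l. g j b * p i b)"
      unfolding g_def sum_distrib_left sum_distrib_right
      by (subst sum.swap) (intro sum.cong refl, use ij in \<open>simp add: P_def\<close>)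
    also have "\<dots> = (if j = i then 1 else 0)"
      using p(1)[of i] p(2)[of i j] ij by (auto simp: ip_def)
    finally show "(transpose_mat U * (G * P)) $$ (j, i) = 1\<^sub>m k $$ (j, i)" using ij by simp
  qed (use U GP in auto)
  moreover have "(frob_norm P)\<^sup>2 \<le> real k / t"
  proof -
    have "(frob_norm P)\<^sup>2 = (\<Sum>i<k. \<Sum>b<l. (P $$ (b, i))\<^sup>2)"
      unfolding frob_norm_sq[OF P] by (rule sum.swap)
    also have "\<dots> = (\<Sum>i<k. ip l (p i) (p i))"
      by (intro sum.cong refl) (simp add: P_def ip_def power2_eq_square)
    also have "\<dots> \<le> (\<Sum>i<k. 1 / t)" by (intro sum_mono p(3)) auto
    finally show ?thesis by simp
  qed
  ultimately show ?thesis using P by blast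
qed

text \<open>With \<open>F = P U\<^sup>T\<close> and \<open>R = 1 - U U\<^sup>T\<close>, the hypothesis \<open>inv\<close> splits \<open>C C\<^sup>T\<close> as
  \<open>(C C\<^sup>T G) F + C C\<^sup>T R (1 - G F)\<close>; the off-diagonal block \<open>R C C\<^sup>T U\<close> is controlled by \<open>\<epsilon>\<close>.\<close>

lemma residual_bound:
  assumes QA: "orthonormal_mat m k Q" and UA: "orthonormal_mat m k U"
    and C: "C \<in> carrier_mat m n" and G: "G \<in> carrier_mat m l" and P: "P \<in> carrier_mat l k"
    and inv: "transpose_mat U * (G * P) = 1\<^sub>m k"
    and Y: "frob_norm (res Q (C * (transpose_mat C * G))) \<le> frob_norm (res U (C * (transpose_mat C * G)))"
    and eps: "frob_norm (res U C * (transpose_mat C * U)) \<le> \<epsilon>"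
    and x: "frob_norm P \<le> x" and g: "frob_norm G \<le> g"
  shows "(frob_norm (res Q C))\<^sup>2 \<le> (frob_norm (res U C))\<^sup>2 * (1 + 2 * (g * x)) + \<epsilon> * (sqrt k + g * x + sqrt k * (g * x))"
proof -
  interpret Q: orthonormal_mat m k Q by fact
  interpret U: orthonormal_mat m k U by fact
  note [simp del] = Q.Q_mult_carrier
  have Ct: "transpose_mat C \<in> carrier_mat n m" using C by simp
  have Pt: "transpose_mat P \<in> carrier_mat k l" using P by simp
  define C2 where "C2 = res U C"
  define V where "V = transpose_mat U * C"
  define W where "W = transpose_mat C * U"
  define D where "D = res U (G * P)"
  define YY where "YY = C * (transpose_mat C * G)"
  define E where "E = transpose_mat C2 * D"
  have GP: "G * P \<in> carrier_mat m k" by (rule mult_carrier_mat[OF G P])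
  have C2: "C2 \<in> carrier_mat m n" unfolding C2_def by (rule U.res_carrier[OF C])
  have C2t: "transpose_mat C2 \<in> carrier_mat n m" using C2 by simp
  have V: "V \<in> carrier_mat k n" unfolding V_def by (rule U.Qt_mult_carrier[OF C])
  have W: "W \<in> carrier_mat n k" unfolding W_def by (rule mult_carrier_mat[OF Ct U.Q])
  have D: "D \<in> carrier_mat m k" unfolding D_def by (rule U.res_carrier[OF GP])
  have CtG: "transpose_mat C * G \<in> carrier_mat n l" by (rule mult_carrier_mat[OF Ct G])
  have YYc: "YY \<in> carrier_mat m l" unfolding YY_def by (rule mult_carrier_mat[OF C CtG])
  have Ec: "E \<in> carrier_mat n k" unfolding E_def by (rule mult_carrier_mat[OF C2t D])
  have UV: "U * V \<in> carrier_mat m n" by (rule mult_carrier_mat[OF U.Q V])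
  have Vt: "transpose_mat V = W" unfolding V_def W_def by (subst transpose_mult[OF U.Qt C]) simp
  have Csplit: "C = U * V + C2" unfolding V_def C2_def by (rule U.split_res[OF C])
  \<comment> \<open>By \<open>inv\<close> the component of \<open>G P\<close> along \<open>U\<close>
    is exactly \<open>U\<close>; \<open>D\<close> collects the rest.\<close>
  have GPsplit: "G * P = U + D"
    using U.split_res[OF GP] unfolding inv D_def[symmetric] right_mult_one_mat[OF U.Q] .
  have Usplit: "U = G * P - D"
    unfolding GPsplit using carrier_matD[OF U.Q] carrier_matD[OF D] by (intro eq_matI) auto
  have C2W: "C2 * W \<in> carrier_mat m k" by (rule mult_carrier_mat[OF C2 W])
  have eps': "frob_norm (C2 * W) \<le> \<epsilon>" using eps by (simp add: C2_def W_def)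
  have eps0: "0 \<le> \<epsilon>" using frob_norm_nonneg eps' by (rule order_trans)
  have x0: "0 \<le> x" using frob_norm_nonneg x by (rule order_trans)
  have g0: "0 \<le> g" using frob_norm_nonneg g by (rule order_trans)
  have nD: "frob_norm D \<le> g * x"
  proof -
    have "frob_norm D \<le> frob_norm (G * P)" unfolding D_def by (rule U.frob_norm_res_le[OF GP])
    also have "\<dots> \<le> frob_norm G * frob_norm P" by (rule frob_norm_mult[OF G P])
    also have "\<dots> \<le> g * x" using g x g0 by (intro mult_mono) auto
    finally show ?thesis .
  qed
  have nresU: "frob_norm (res Q U) \<le> sqrt k"
    using Q.frob_norm_res_le[OF U.Q] U.frob_norm_Q by simp
  define t2 where "t2 = (frob_norm C2)\<^sup>2"

  \<comment> \<open>By \<open>Y\<close> it is enough to treat \<open>U\<close> in place of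
    \<open>Q\<close>. The residual of the sketch with respect to \<open>U\<close> is
    \<open>C2 C\<^sup>T G\<close>, and splitting \<open>C\<^sup>T\<close> along \<open>U\<close>
    leaves \<open>\<epsilon>\<close> from the off-diagonal block plus
    \<open>\<parallel>C2\<parallel>\<^sup>2\<close>.\<close>
  have nY: "frob_norm (res Q YY) \<le> (\<epsilon> + t2) * g"
  proof -
    have c1: "C2 * transpose_mat C \<in> carrier_mat m m" by (rule mult_carrier_mat[OF C2 Ct])
    have c2: "(C2 * W) * transpose_mat U \<in> carrier_mat m m" by (rule mult_carrier_mat[OF C2W U.Qt])
    have c3: "C2 * transpose_mat C2 \<in> carrier_mat m m" by (rule mult_carrier_mat[OF C2 C2t])
    have c4: "W * transpose_mat U \<in> carrier_mat n m" by (rule mult_carrier_mat[OF W U.Qt])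
    have "transpose_mat C = W * transpose_mat U + transpose_mat C2"
      by (subst Csplit) (simp only: transpose_add[OF UV C2] transpose_mult[OF U.Q V] Vt)
    then have "C2 * transpose_mat C = C2 * (W * transpose_mat U) + C2 * transpose_mat C2"
      by (simp only: mult_add_distrib_mat[OF C2 c4 C2t])
    also have "C2 * (W * transpose_mat U) = (C2 * W) * transpose_mat U"
      by (rule assoc_mult_mat[OF C2 W U.Qt, symmetric])
    finally have eq: "C2 * transpose_mat C = (C2 * W) * transpose_mat U + C2 * transpose_mat C2" .
    have "frob_norm ((C2 * W) * transpose_mat U) = frob_norm (U * transpose_mat (C2 * W))"
      by (subst frob_norm_transpose[symmetric]) (simp add: transpose_mult[OF C2W U.Qt])
    also have "\<dots> = frob_norm (C2 * W)"
      using C2W by (subst U.frob_norm_Q_mult[of _ m]) (auto simp: frob_norm_transpose)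
    finally have n1: "frob_norm ((C2 * W) * transpose_mat U) \<le> \<epsilon>" using eps' by simp
    have n2: "frob_norm (C2 * transpose_mat C2) \<le> t2"
      using frob_norm_mult[OF C2 C2t] by (simp add: t2_def power2_eq_square frob_norm_transpose)
    have n3: "frob_norm (C2 * transpose_mat C) \<le> \<epsilon> + t2"
      unfolding eq using frob_norm_add[OF c2 c3] n1 n2 by linarith
    have "res U YY = C2 * (transpose_mat C * G)"
      unfolding YY_def C2_def by (rule U.res_mult[OF C CtG])
    also have "\<dots> = (C2 * transpose_mat C) * G" by (rule assoc_mult_mat[OF C2 Ct G, symmetric])
    finally have "frob_norm (res U YY) \<le> frob_norm (C2 * transpose_mat C) * frob_norm G"
      using frob_norm_mult[OF c1 G] by simp
    also have "\<dots> \<le> (\<epsilon> + t2) * g" using n3 g by (intro mult_mono) (auto intro: order_trans[OF frob_norm_nonneg])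
    finally show ?thesis using Y by (simp add: YY_def)
  qed

  have part_Y: "fip (res Q YY * P) U \<le> (\<epsilon> + t2) * g * x"
  proof -
    have rY: "res Q YY \<in> carrier_mat m l" by (rule Q.res_carrier[OF YYc])
    have UP: "U * transpose_mat P \<in> carrier_mat m l" by (rule mult_carrier_mat[OF U.Q Pt])
    have "fip (res Q YY * P) U = fip (res Q YY) (U * transpose_mat P)"
      by (rule fip_mult_right[OF rY P U.Q])
    also have "\<dots> \<le> frob_norm (res Q YY) * frob_norm (U * transpose_mat P)" by (rule fip_le[OF rY UP])
    also have "frob_norm (U * transpose_mat P) = frob_norm P"
      by (simp only: U.frob_norm_Q_mult[OF Pt] frob_norm_transpose)
    also have "frob_norm (res Q YY) * frob_norm P \<le> (\<epsilon> + t2) * g * x"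
      using nY x by (intro mult_mono) (auto intro: order_trans[OF frob_norm_nonneg])
    finally show ?thesis .
  qed

  \<comment> \<open>\<open>D\<close> lies in the complement of the range of \<open>U\<close>, so it
    only meets the part \<open>C2\<close> of \<open>C\<close>.\<close>
  have CtD: "transpose_mat C * D = E"
  proof -
    have "E = transpose_mat C * res U D" unfolding E_def C2_def by (rule U.transpose_res_mult[OF C D])
    also have "res U D = D" unfolding D_def by (rule U.res_res[OF GP])
    finally show ?thesis by simp
  qed

  have part_D: "- fip (res Q (C * E)) U \<le> t2 * (g * x) + sqrt k * \<epsilon> * (g * x)"
  proof -
    have c1: "V * E \<in> carrier_mat k k" by (rule mult_carrier_mat[OF V Ec])
    have c2: "U * (V * E) \<in> carrier_mat m k" by (rule mult_carrier_mat[OF U.Q c1])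
    have c3: "C2 * E \<in> carrier_mat m k" by (rule mult_carrier_mat[OF C2 Ec])
    have c4: "C * E \<in> carrier_mat m k" by (rule mult_carrier_mat[OF C Ec])
    have rU: "res Q U \<in> carrier_mat m k" by (rule Q.res_carrier[OF U.Q])
    have rC2: "res Q C2 \<in> carrier_mat m n" by (rule Q.res_carrier[OF C2])
    have C2rU: "transpose_mat C2 * res Q U \<in> carrier_mat n k" by (rule mult_carrier_mat[OF C2t rU])
    have CE: "C * E = U * (V * E) + C2 * E"
      by (subst Csplit) (simp only: add_mult_distrib_mat[OF UV C2 Ec] assoc_mult_mat[OF U.Q V Ec])
    have "fip (res Q (C * E)) U = fip (C * E) (res Q U)"
      by (rule Q.fip_res_sym[OF c4 U.Q])
    also have "\<dots> = fip (U * (V * E)) (res Q U) + fip (C2 * E) (res Q U)"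
      unfolding CE by (rule fip_add_left[OF c2 c3])
    finally have eq: "fip (res Q (C * E)) U = fip (U * (V * E)) (res Q U) + fip (C2 * E) (res Q U)" .
    have "\<bar>fip (C2 * E) (res Q U)\<bar> = \<bar>fip E (transpose_mat C2 * res Q U)\<bar>"
      by (simp only: fip_mult_left[OF C2 Ec rU])
    also have "\<dots> \<le> frob_norm E * frob_norm (transpose_mat C2 * res Q U)"
      by (rule fip_Cauchy_Schwarz[OF Ec C2rU])
    also have "\<dots> \<le> (frob_norm C2 * (g * x)) * frob_norm C2"
    proof (rule mult_mono)
      have "frob_norm E \<le> frob_norm C2 * frob_norm D"
        using frob_norm_mult[OF C2t D] by (simp add: E_def frob_norm_transpose)
      also have "\<dots> \<le> frob_norm C2 * (g * x)" using nD by (intro mult_left_mono) auto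
      finally show "frob_norm E \<le> frob_norm C2 * (g * x)" .
      \<comment> \<open>Moving the projection from \<open>U\<close> to \<open>C2\<close> gives the
        bound \<open>\<parallel>C2\<parallel>\<close>; estimating \<open>res Q U\<close> by its own
        norm would cost a factor \<open>sqrt k\<close> in the main term.\<close>
      have "transpose_mat C2 * res Q U = transpose_mat (res Q C2) * U"
        by (rule Q.transpose_res_mult[OF C2 U.Q, symmetric])
      also have "frob_norm \<dots> = frob_norm (transpose_mat U * res Q C2)"
        by (subst frob_norm_transpose[symmetric])
          (simp add: transpose_mult[OF transpose_carrier_mat[THEN iffD2, OF rC2] U.Q])
      also have "\<dots> \<le> frob_norm (res Q C2)" by (rule U.frob_norm_Qt_le[OF rC2])
      also have "\<dots> \<le> frob_norm C2" by (rule Q.frob_norm_res_le[OF C2])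
      finally show "frob_norm (transpose_mat C2 * res Q U) \<le> frob_norm C2" .
    qed (use g0 x0 in auto)
    finally have a1: "\<bar>fip (C2 * E) (res Q U)\<bar> \<le> t2 * (g * x)"
      by (simp add: t2_def power2_eq_square algebra_simps)
    have VE: "V * E = transpose_mat (C2 * W) * D"
    proof -
      have "V * E = (V * transpose_mat C2) * D" unfolding E_def by (rule assoc_mult_mat[OF V C2t D, symmetric])
      also have "V * transpose_mat C2 = transpose_mat (C2 * W)"
        unfolding transpose_mult[OF C2 W] by (simp add: Vt[symmetric])
      finally show ?thesis .
    qed
    have "\<bar>fip (U * (V * E)) (res Q U)\<bar> \<le> frob_norm (U * (V * E)) * frob_norm (res Q U)"
      by (rule fip_Cauchy_Schwarz[OF c2 rU])
    also have "frob_norm (U * (V * E)) = frob_norm (V * E)" by (rule U.frob_norm_Q_mult[OF c1])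
    also have "frob_norm (V * E) * frob_norm (res Q U) \<le> (\<epsilon> * (g * x)) * sqrt k"
    proof (rule mult_mono[OF _ nresU])
      have "frob_norm (V * E) \<le> frob_norm (C2 * W) * frob_norm D"
        unfolding VE using frob_norm_mult[OF transpose_carrier_mat[THEN iffD2, OF C2W] D]
        by (simp add: frob_norm_transpose)
      also have "\<dots> \<le> \<epsilon> * (g * x)" using eps' nD eps0 by (intro mult_mono) auto
      finally show "frob_norm (V * E) \<le> \<epsilon> * (g * x)" .
    qed (use eps0 g0 x0 in auto)
    finally have a2: "\<bar>fip (U * (V * E)) (res Q U)\<bar> \<le> sqrt k * \<epsilon> * (g * x)" by (simp add: algebra_simps)
    show ?thesis using eq a1 a2 by linarith
  qed

  have part1: "fip (res Q C) (U * V) \<le> (\<epsilon> + t2) * g * x + t2 * (g * x) + sqrt k * \<epsilon> * (g * x)"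
  proof -
    have rC: "res Q C \<in> carrier_mat m n" by (rule Q.res_carrier[OF C])
    have CtGP: "transpose_mat C * (G * P) \<in> carrier_mat n k" by (rule mult_carrier_mat[OF Ct GP])
    have c1: "YY * P \<in> carrier_mat m k" by (rule mult_carrier_mat[OF YYc P])
    have c2: "C * E \<in> carrier_mat m k" by (rule mult_carrier_mat[OF C Ec])
    have "fip (res Q C) (U * V) = fip (res Q C * W) U"
      by (subst fip_mult_right[OF rC W U.Q]) (simp add: Vt[symmetric])
    also have "res Q C * W = res Q (C * W)" by (rule Q.res_mult[OF C W, symmetric])
    \<comment> \<open>The image of \<open>U\<close> under \<open>C C\<^sup>T\<close> is recovered
      from the sketch through the right inverse, up to the error caused by \<open>D\<close>.\<close>
    also have "C * W = YY * P - C * E"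
    proof -
      have "W = transpose_mat C * (G * P) - transpose_mat C * D"
        unfolding W_def by (subst Usplit) (rule mult_minus_distrib_mat[OF Ct GP D])
      then have "C * W = C * (transpose_mat C * (G * P)) - C * E"
        by (simp only: CtD mult_minus_distrib_mat[OF C CtGP Ec])
      also have "C * (transpose_mat C * (G * P)) = YY * P"
        unfolding YY_def by (simp only: assoc_mult_mat[OF Ct G P, symmetric] assoc_mult_mat[OF C CtG P, symmetric])
      finally show ?thesis .
    qed
    also have "res Q (YY * P - C * E) = res Q YY * P - res Q (C * E)"
      by (simp only: Q.res_diff[OF c1 c2] Q.res_mult[OF YYc P])
    also have "fip (res Q YY * P - res Q (C * E)) U = fip (res Q YY * P) U - fip (res Q (C * E)) U"
      by (rule fip_diff_left[OF mult_carrier_mat[OF Q.res_carrier[OF YYc] P] Q.res_carrier[OF c2]])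
    finally show ?thesis using part_Y part_D by linarith
  qed

  have part2: "fip (res Q C) C2 \<le> t2 + sqrt k * \<epsilon>"
  proof -
    have rC2: "res Q C2 \<in> carrier_mat m n" by (rule Q.res_carrier[OF C2])
    have rU: "res Q U \<in> carrier_mat m k" by (rule Q.res_carrier[OF U.Q])
    have "fip (res Q C) C2 = fip C (res Q C2)" by (rule Q.fip_res_sym[OF C C2])
    also have "\<dots> = fip (U * V) (res Q C2) + fip C2 (res Q C2)"
      by (subst Csplit) (rule fip_add_left[OF UV C2])
    also have "fip C2 (res Q C2) = (frob_norm (res Q C2))\<^sup>2"
      using Q.fip_res_sym[OF C2 C2] Q.fip_res_self[OF C2] by simp
    also have "\<dots> \<le> t2"
      unfolding t2_def using Q.frob_norm_res_le[OF C2] by (intro power_mono) auto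
    also have "fip (U * V) (res Q C2) = fip (res Q U * V) C2"
      by (simp only: Q.fip_res_sym[OF UV C2, symmetric] Q.res_mult[OF U.Q V])
    also have "\<dots> = fip (res Q U) (C2 * W)"
      by (simp only: fip_mult_right[OF rU V C2] Vt)
    also have "\<dots> \<le> frob_norm (res Q U) * frob_norm (C2 * W)" by (rule fip_le[OF rU C2W])
    also have "\<dots> \<le> sqrt k * \<epsilon>" using nresU eps' by (intro mult_mono) auto
    finally show ?thesis by simp
  qed

  \<comment> \<open>The residual is paired with \<open>C\<close> itself, split along
    \<open>U\<close>: the part in the range of \<open>U\<close> yields
    \<open>2 g x \<parallel>C2\<parallel>\<^sup>2\<close>, the complement yields
    \<open>\<parallel>C2\<parallel>\<^sup>2\<close>, and all remaining terms carry
    \<open>\<epsilon>\<close>.\<close>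
  have "(frob_norm (res Q C))\<^sup>2 = fip (res Q C) C" by (rule Q.fip_res_self[OF C, symmetric])
  also have "\<dots> = fip (res Q C) (U * V + C2)" by (rule arg_cong[OF Csplit])
  also have "\<dots> = fip (res Q C) (U * V) + fip (res Q C) C2"
    by (rule fip_add_right[OF Q.res_carrier[OF C] UV C2])
  finally have "(frob_norm (res Q C))\<^sup>2 \<le> (\<epsilon> + t2) * g * x + t2 * (g * x) + sqrt k * \<epsilon> * (g * x) + (t2 + sqrt k * \<epsilon>)"
    using part1 part2 by linarith
  also have "\<dots> = t2 * (1 + 2 * (g * x)) + \<epsilon> * (sqrt k + g * x + sqrt k * (g * x))"
    by (simp add: algebra_simps)
  finally show ?thesis by (simp add: t2_def C2_def)
qed

section \<open>Gaussian vectors\<close>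

definition std_gauss :: "real measure" where
  "std_gauss = density lborel (\<lambda>x. ennreal (std_normal_density x))"

lemma sets_std_gauss [simp, measurable_cong]: "sets std_gauss = sets borel"
  by (simp add: std_gauss_def)

lemma space_std_gauss [simp]: "space std_gauss = UNIV"
  by (simp add: std_gauss_def)

lemma prob_space_std_gauss: "prob_space std_gauss"
  unfolding std_gauss_def by (rule prob_space_normal_density) simp

interpretation std_gauss: prob_space std_gauss
  by (rule prob_space_std_gauss)

interpretation gauss_sf: product_sigma_finite "\<lambda>_. std_gauss"
  by standard

lemma nn_integral_std_gauss:
  assumes [measurable]: "f \<in> borel_measurable borel"
  shows "(\<integral>\<^sup>+x. f x \<partial>std_gauss) = (\<integral>\<^sup>+x. ennreal (std_normal_density x) * f x \<partial>lborel)"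
  unfolding std_gauss_def by (subst nn_integral_density) auto

lemma nn_integral_std_gauss_uminus:
  assumes [measurable]: "f \<in> borel_measurable borel"
  shows "(\<integral>\<^sup>+x. f (- x) \<partial>std_gauss) = (\<integral>\<^sup>+x. f x \<partial>std_gauss)"
proof -
  have "(\<integral>\<^sup>+x. ennreal (std_normal_density x) * f x \<partial>lborel) =
    (\<integral>\<^sup>+x. ennreal (std_normal_density (- x)) * f (- x) \<partial>lborel)"
    by (subst nn_integral_real_affine[where c = "-1" and t = 0]) auto
  then show ?thesis by (simp add: nn_integral_std_gauss std_normal_density_def)
qed

section \<open>Rotation invariance of the Gaussian measure\<close>

text \<open>Two affine substitutions in one variable each, with Fubini in between, undo the
  rotation; their factors \<open>1 / \<bar>c\<bar>\<close> and \<open>\<bar>c\<bar>\<close>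
  cancel.\<close>

lemma nn_integral_rotate_lborel:
  fixes f :: "real \<times> real \<Rightarrow> ennreal"
  assumes [measurable]: "f \<in> borel_measurable (borel \<Otimes>\<^sub>M borel)" and c: "c \<noteq> 0" and cs: "c\<^sup>2 + s\<^sup>2 = (1::real)"
  shows "(\<integral>\<^sup>+y. \<integral>\<^sup>+x. f (c * x + s * y, - s * x + c * y) \<partial>lborel \<partial>lborel) = (\<integral>\<^sup>+y. \<integral>\<^sup>+x. f (x, y) \<partial>lborel \<partial>lborel)"
proof -
  have "(\<integral>\<^sup>+x. f (c * x + s * y, - s * x + c * y) \<partial>lborel) =
    ennreal \<bar>1/c\<bar> * (\<integral>\<^sup>+x. f (x, (y - s * x) / c) \<partial>lborel)" for y
  proof -
    have "(\<integral>\<^sup>+x. f (c * x + s * y, - s * x + c * y) \<partial>lborel) =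
      ennreal \<bar>1/c\<bar> * (\<integral>\<^sup>+x. f (c * (- (s * y) / c + 1 / c * x) + s * y, - s * (- (s * y) / c + 1 / c * x) + c * y) \<partial>lborel)"
      using c by (intro nn_integral_real_affine) auto
    also have "(\<lambda>x. f (c * (- (s * y) / c + 1 / c * x) + s * y, - s * (- (s * y) / c + 1 / c * x) + c * y)) = (\<lambda>x. f (x, (y - s * x) / c))"
    proof
      fix x
      have 1: "c * (- (s * y) / c + 1 / c * x) + s * y = x" using c by (simp add: right_diff_distrib)
      have "- s * (- (s * y) / c + 1 / c * x) + c * y = (s * s * y - s * x) / c + (c * c * y) / c"
        using c by (simp add: diff_divide_distrib right_diff_distrib)
      also have "\<dots> = ((c\<^sup>2 + s\<^sup>2) * y - s * x) / c"
        unfolding add_divide_distrib[symmetric] by (simp add: power2_eq_square algebra_simps)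
      finally have "- s * (- (s * y) / c + 1 / c * x) + c * y = ((c\<^sup>2 + s\<^sup>2) * y - s * x) / c" .
      then have 2: "- s * (- (s * y) / c + 1 / c * x) + c * y = (y - s * x) / c" unfolding cs by simp
      show "f (c * (- (s * y) / c + 1 / c * x) + s * y, - s * (- (s * y) / c + 1 / c * x) + c * y) = f (x, (y - s * x) / c)"
        unfolding 1 2 ..
    qed
    finally show ?thesis .
  qed
  then have "(\<integral>\<^sup>+y. \<integral>\<^sup>+x. f (c * x + s * y, - s * x + c * y) \<partial>lborel \<partial>lborel) =
    (\<integral>\<^sup>+y. ennreal \<bar>1/c\<bar> * (\<integral>\<^sup>+x. f (x, (y - s * x) / c) \<partial>lborel) \<partial>lborel)" by simp
  also have "\<dots> = ennreal \<bar>1/c\<bar> * (\<integral>\<^sup>+y. \<integral>\<^sup>+x. f (x, (y - s * x) / c) \<partial>lborel \<partial>lborel)"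
    by (rule nn_integral_cmult) measurable
  also have "(\<integral>\<^sup>+y. \<integral>\<^sup>+x. f (x, (y - s * x) / c) \<partial>lborel \<partial>lborel) = (\<integral>\<^sup>+x. \<integral>\<^sup>+y. f (x, (y - s * x) / c) \<partial>lborel \<partial>lborel)"
    by (rule lborel_pair.Fubini') measurable
  also have "ennreal \<bar>1/c\<bar> * \<dots> = (\<integral>\<^sup>+x. ennreal \<bar>1/c\<bar> * (\<integral>\<^sup>+y. f (x, (y - s * x) / c) \<partial>lborel) \<partial>lborel)"
    by (rule nn_integral_cmult[symmetric]) measurable
  also have "\<dots> = (\<integral>\<^sup>+x. \<integral>\<^sup>+y. f (x, y) \<partial>lborel \<partial>lborel)"
  proof (rule nn_integral_cong)
    fix x
    have "(\<integral>\<^sup>+y. f (x, (y - s * x) / c) \<partial>lborel) = ennreal \<bar>c\<bar> * (\<integral>\<^sup>+y. f (x, (s * x + c * y - s * x) / c) \<partial>lborel)"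
      using c by (intro nn_integral_real_affine) auto
    also have "\<dots> = ennreal \<bar>c\<bar> * (\<integral>\<^sup>+y. f (x, y) \<partial>lborel)" using c by simp
    finally have "ennreal \<bar>1/c\<bar> * (\<integral>\<^sup>+y. f (x, (y - s * x) / c) \<partial>lborel) = (ennreal \<bar>1/c\<bar> * ennreal \<bar>c\<bar>) * (\<integral>\<^sup>+y. f (x, y) \<partial>lborel)"
      by (simp add: mult.assoc)
    also have "ennreal \<bar>1/c\<bar> * ennreal \<bar>c\<bar> = 1"
      using c by (simp add: ennreal_mult[symmetric] abs_mult[symmetric] del: abs_divide)
    finally show "ennreal \<bar>1/c\<bar> * (\<integral>\<^sup>+y. f (x, (y - s * x) / c) \<partial>lborel) = (\<integral>\<^sup>+y. f (x, y) \<partial>lborel)" by simp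
  qed
  also have "\<dots> = (\<integral>\<^sup>+y. \<integral>\<^sup>+x. f (x, y) \<partial>lborel \<partial>lborel)"
    by (rule lborel_pair.Fubini') measurable
  finally show ?thesis .
qed

text \<open>The joint density depends on \<open>x\<^sup>2 + y\<^sup>2\<close> only, so the
  invariance of Lebesgue measure carries over.\<close>

lemma nn_integral_rotate_std_gauss:
  fixes f :: "real \<times> real \<Rightarrow> ennreal"
  assumes [measurable]: "f \<in> borel_measurable (borel \<Otimes>\<^sub>M borel)" and c: "c \<noteq> 0" and cs: "c\<^sup>2 + s\<^sup>2 = (1::real)"
  shows "(\<integral>\<^sup>+y. \<integral>\<^sup>+x. f (c * x + s * y, - s * x + c * y) \<partial>std_gauss \<partial>std_gauss) = (\<integral>\<^sup>+y. \<integral>\<^sup>+x. f (x, y) \<partial>std_gauss \<partial>std_gauss)"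
proof -
  let ?d = "\<lambda>x. ennreal (std_normal_density x)"
  define g where "g = (\<lambda>(x, y). ?d y * (?d x * f (x, y)))"
  have [measurable]: "g \<in> borel_measurable (borel \<Otimes>\<^sub>M borel)" unfolding g_def by measurable
  have dens: "?d y * ?d x = ?d (- s * x + c * y) * ?d (c * x + s * y)" for x y
  proof -
    have "(- s * x + c * y)\<^sup>2 + (c * x + s * y)\<^sup>2 = (c\<^sup>2 + s\<^sup>2) * (x\<^sup>2 + y\<^sup>2)"
      by (simp add: power2_eq_square algebra_simps)
    then have eq: "(- s * x + c * y)\<^sup>2 + (c * x + s * y)\<^sup>2 = x\<^sup>2 + y\<^sup>2" unfolding cs by simp
    have "- d / 2 + - c / 2 = - a / 2 + - b / 2" if "a + b = c + d" for a b c d :: real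
      using that by linarith
    from this[OF eq] have "- y\<^sup>2 / 2 + - x\<^sup>2 / 2 = - (- s * x + c * y)\<^sup>2 / 2 + - (c * x + s * y)\<^sup>2 / 2" .
    then have "std_normal_density y * std_normal_density x = std_normal_density (- s * x + c * y) * std_normal_density (c * x + s * y)"
      by (simp add: std_normal_density_def exp_add[symmetric])
    then show ?thesis by (simp add: ennreal_mult[symmetric])
  qed
  have dens': "?d (- s * x + c * y) * (?d (c * x + s * y) * a) = ?d y * (?d x * a)" for x y a
    using dens[of y x] by (simp only: mult.assoc[symmetric])
  have "(\<integral>\<^sup>+y. \<integral>\<^sup>+x. h x y \<partial>std_gauss \<partial>std_gauss) = (\<integral>\<^sup>+y. \<integral>\<^sup>+x. ?d y * (?d x * h x y) \<partial>lborel \<partial>lborel)"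
    if [measurable]: "(\<lambda>(x, y). h x y) \<in> borel_measurable (borel \<Otimes>\<^sub>M borel)" for h :: "real \<Rightarrow> real \<Rightarrow> ennreal"
  proof -
    have "(\<integral>\<^sup>+y. \<integral>\<^sup>+x. h x y \<partial>std_gauss \<partial>std_gauss) = (\<integral>\<^sup>+y. ?d y * (\<integral>\<^sup>+x. h x y \<partial>std_gauss) \<partial>lborel)"
      by (rule nn_integral_std_gauss) measurable
    also have "\<dots> = (\<integral>\<^sup>+y. ?d y * (\<integral>\<^sup>+x. ?d x * h x y \<partial>lborel) \<partial>lborel)"
      by (subst nn_integral_std_gauss) measurable
    also have "\<dots> = (\<integral>\<^sup>+y. \<integral>\<^sup>+x. ?d y * (?d x * h x y) \<partial>lborel \<partial>lborel)"
      by (subst nn_integral_cmult) measurable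
    finally show ?thesis .
  qed
  note conv = this
  have "(\<integral>\<^sup>+y. \<integral>\<^sup>+x. f (c * x + s * y, - s * x + c * y) \<partial>std_gauss \<partial>std_gauss) =
     (\<integral>\<^sup>+y. \<integral>\<^sup>+x. ?d y * (?d x * f (c * x + s * y, - s * x + c * y)) \<partial>lborel \<partial>lborel)"
    by (rule conv[of "\<lambda>x y. f (c * x + s * y, - s * x + c * y)"]) measurable
  also have "\<dots> = (\<integral>\<^sup>+y. \<integral>\<^sup>+x. g (c * x + s * y, - s * x + c * y) \<partial>lborel \<partial>lborel)"
    by (simp only: g_def prod.case dens')
  also have "\<dots> = (\<integral>\<^sup>+y. \<integral>\<^sup>+x. g (x, y) \<partial>lborel \<partial>lborel)"
    by (rule nn_integral_rotate_lborel) (use c cs in auto)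
  also have "\<dots> = (\<integral>\<^sup>+y. \<integral>\<^sup>+x. ?d y * (?d x * f (x, y)) \<partial>lborel \<partial>lborel)"
    by (simp only: g_def prod.case)
  also have "\<dots> = (\<integral>\<^sup>+y. \<integral>\<^sup>+x. f (x, y) \<partial>std_gauss \<partial>std_gauss)"
    by (rule conv[of "\<lambda>x y. f (x, y)", symmetric]) (simp add: split_beta)
  finally show ?thesis .
qed

abbreviation gauss :: "'i set \<Rightarrow> ('i \<Rightarrow> real) measure" where
  "gauss J \<equiv> Pi\<^sub>M J (\<lambda>_. std_gauss)"

text \<open>A Givens rotation in the coordinates \<open>p\<close> and \<open>q\<close>, with
  \<open>c\<close> and \<open>s\<close> as cosine and sine.\<close>

definition rot :: "'i \<Rightarrow> 'i \<Rightarrow> real \<Rightarrow> real \<Rightarrow> ('i \<Rightarrow> real) \<Rightarrow> 'i \<Rightarrow> real" where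
  "rot p q c s z = (\<lambda>i. if i = p then c * z p + s * z q else if i = q then - s * z p + c * z q else z i)"

text \<open>Fubini isolates the two coordinates that move; for fixed values of the rest the planar
  case applies.\<close>

lemma nn_integral_gauss_rotate:
  assumes J: "finite J" and pq: "p \<in> J" "q \<in> J" "p \<noteq> q" and f: "f \<in> borel_measurable (gauss J)"
    and c: "c \<noteq> 0" and cs: "c\<^sup>2 + s\<^sup>2 = (1::real)"
  shows "(\<integral>\<^sup>+z. f (rot p q c s z) \<partial>gauss J) = (\<integral>\<^sup>+z. f z \<partial>gauss J)"
proof -
  define K where "K = J - {p, q}"
  have K: "finite K" "q \<notin> K" "p \<notin> insert q K" and JK: "J = insert p (insert q K)"
    using J pq by (auto simp: K_def)
  have comp: "(\<lambda>z. z j) \<in> borel_measurable (gauss J)" if "j \<in> J" for j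
    using measurable_component_singleton[OF that, of "\<lambda>_. std_gauss"]
    by (simp add: measurable_cong_sets[OF refl sets_std_gauss])
  have m: "(\<lambda>z. rot p q c s z) \<in> gauss J \<rightarrow>\<^sub>M gauss J"
  proof (rule measurable_PiM_single')
    fix i assume i: "i \<in> J"
    have [measurable]: "(\<lambda>z. z p) \<in> borel_measurable (gauss J)" "(\<lambda>z. z q) \<in> borel_measurable (gauss J)"
      "(\<lambda>z. z i) \<in> borel_measurable (gauss J)"
      using pq i comp by auto
    have "(\<lambda>z. rot p q c s z i) \<in> borel_measurable (gauss J)"
      unfolding rot_def by measurable
    then show "(\<lambda>z. rot p q c s z i) \<in> gauss J \<rightarrow>\<^sub>M std_gauss"
      by (simp add: measurable_cong_sets[OF refl sets_std_gauss])
  qed (use pq in \<open>auto simp: space_PiM PiE_def extensional_def rot_def\<close>)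
  have splitJ: "(\<integral>\<^sup>+z. h z \<partial>gauss J) = (\<integral>\<^sup>+x. \<integral>\<^sup>+b. \<integral>\<^sup>+a. h (x(q := b, p := a)) \<partial>std_gauss \<partial>std_gauss \<partial>gauss K)"
    if hJ: "h \<in> borel_measurable (gauss J)" for h
  proof -
    have h: "h \<in> borel_measurable (gauss (insert p (insert q K)))" using hJ JK by simp
    have "(\<integral>\<^sup>+z. h z \<partial>gauss J) = (\<integral>\<^sup>+z. \<integral>\<^sup>+a. h (z(p := a)) \<partial>std_gauss \<partial>gauss (insert q K))"
      unfolding JK using K by (intro gauss_sf.product_nn_integral_insert h) auto
    also have "\<dots> = (\<integral>\<^sup>+x. \<integral>\<^sup>+b. \<integral>\<^sup>+a. h (x(q := b, p := a)) \<partial>std_gauss \<partial>std_gauss \<partial>gauss K)"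
    proof (rule gauss_sf.product_nn_integral_insert)
      have "(\<lambda>(z, a). h (z(p := a))) \<in> borel_measurable (gauss (insert q K) \<Otimes>\<^sub>M std_gauss)"
        using measurable_compose[OF measurable_add_dim h] by (simp add: split_beta)
      then show "(\<lambda>z. \<integral>\<^sup>+a. h (z(p := a)) \<partial>std_gauss) \<in> borel_measurable (gauss (insert q K))"
        by (rule std_gauss.borel_measurable_nn_integral)
    qed (use K in auto)
    finally show ?thesis .
  qed
  have "(\<integral>\<^sup>+z. f (rot p q c s z) \<partial>gauss J) =
    (\<integral>\<^sup>+x. \<integral>\<^sup>+b. \<integral>\<^sup>+a. f (x(q := - s * a + c * b, p := c * a + s * b)) \<partial>std_gauss \<partial>std_gauss \<partial>gauss K)"
  proof -
    have "rot p q c s (x(q := b, p := a)) = x(q := - s * a + c * b, p := c * a + s * b)" for x a b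
      using pq(3) by (auto simp: rot_def)
    then show ?thesis by (subst splitJ[OF measurable_compose[OF m f]]) simp
  qed
  also have "\<dots> = (\<integral>\<^sup>+x. \<integral>\<^sup>+b. \<integral>\<^sup>+a. f (x(q := b, p := a)) \<partial>std_gauss \<partial>std_gauss \<partial>gauss K)"
  proof (rule nn_integral_cong)
    fix x assume x: "x \<in> space (gauss K)"
    define h where "h = (\<lambda>ab. f (x(q := snd ab, p := fst ab)))"
    have mm: "(\<lambda>ab. x(q := snd ab, p := fst ab)) \<in> borel \<Otimes>\<^sub>M borel \<rightarrow>\<^sub>M gauss J"
    proof (rule measurable_PiM_single')
      fix i assume i: "i \<in> J"
      have "(\<lambda>ab. (x(q := snd ab, p := fst ab)) i) \<in> borel_measurable (borel \<Otimes>\<^sub>M borel)"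
        by (cases "i = p"; cases "i = q") simp_all
      then show "(\<lambda>ab. (x(q := snd ab, p := fst ab)) i) \<in> borel \<Otimes>\<^sub>M borel \<rightarrow>\<^sub>M std_gauss"
        by (simp add: measurable_cong_sets[OF refl sets_std_gauss])
    qed (use x JK in \<open>auto simp: space_PiM PiE_def extensional_def space_pair_measure\<close>)
    have hm: "h \<in> borel_measurable (borel \<Otimes>\<^sub>M borel)"
      unfolding h_def by (rule measurable_compose[OF mm f])
    have "(\<integral>\<^sup>+b. \<integral>\<^sup>+a. f (x(q := - s * a + c * b, p := c * a + s * b)) \<partial>std_gauss \<partial>std_gauss) =
      (\<integral>\<^sup>+b. \<integral>\<^sup>+a. h (c * a + s * b, - s * a + c * b) \<partial>std_gauss \<partial>std_gauss)"
      unfolding h_def by simp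
    also have "\<dots> = (\<integral>\<^sup>+b. \<integral>\<^sup>+a. h (a, b) \<partial>std_gauss \<partial>std_gauss)"
      by (rule nn_integral_rotate_std_gauss[OF hm c cs])
    finally show "(\<integral>\<^sup>+b. \<integral>\<^sup>+a. f (x(q := - s * a + c * b, p := c * a + s * b)) \<partial>std_gauss \<partial>std_gauss) =
      (\<integral>\<^sup>+b. \<integral>\<^sup>+a. f (x(q := b, p := a)) \<partial>std_gauss \<partial>std_gauss)"
      by (simp add: h_def)
  qed
  also have "\<dots> = (\<integral>\<^sup>+z. f z \<partial>gauss J)" by (rule splitJ[OF f, symmetric])
  finally show ?thesis .
qed

text \<open>The Laplace transform of a squared Gaussian. Both signs of \<open>s\<close> matter:
  positive values serve the lower Chernoff bound, \<open>s = - 1 / 2\<close> the upper one.\<close>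

lemma nn_integral_std_gauss_exp_sq:
  assumes s: "-1 < s"
  shows "(\<integral>\<^sup>+x. ennreal (exp (- s / 2 * x\<^sup>2)) \<partial>std_gauss) = ennreal (1 / sqrt (1 + s))"
proof -
  define \<sigma> where "\<sigma> = 1 / sqrt (1 + s)"
  have \<sigma>: "\<sigma> > 0" "\<sigma>\<^sup>2 = 1 / (1 + s)" using s by (auto simp: \<sigma>_def power_divide)
  have "std_normal_density x * exp (- s / 2 * x\<^sup>2) = \<sigma> * normal_density 0 \<sigma> x" for x
  proof -
    have "- (x - 0)\<^sup>2 / (2 * \<sigma>\<^sup>2) = - x\<^sup>2 / 2 * (1 / \<sigma>\<^sup>2)" by simp
    also have "1 / \<sigma>\<^sup>2 = 1 + s" unfolding \<sigma>(2) by simp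
    also have "- x\<^sup>2 / 2 * (1 + s) = - x\<^sup>2 / 2 + - s / 2 * x\<^sup>2" by (simp add: algebra_simps)
    finally have "- x\<^sup>2 / 2 + - s / 2 * x\<^sup>2 = - (x - 0)\<^sup>2 / (2 * \<sigma>\<^sup>2)" ..
    then have "exp (- x\<^sup>2 / 2) * exp (- s / 2 * x\<^sup>2) = exp (- (x - 0)\<^sup>2 / (2 * \<sigma>\<^sup>2))"
      by (simp only: exp_add[symmetric])
    moreover have "sqrt (2 * pi * \<sigma>\<^sup>2) = sqrt (2 * pi) * \<sigma>" using \<sigma>(1) by (simp add: real_sqrt_mult)
    ultimately show ?thesis using \<sigma>(1) by (simp add: std_normal_density_def normal_density_def)
  qed
  then have "(\<integral>\<^sup>+x. ennreal (exp (- s / 2 * x\<^sup>2)) \<partial>std_gauss) = (\<integral>\<^sup>+x. ennreal \<sigma> * ennreal (normal_density 0 \<sigma> x) \<partial>lborel)"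
    using \<sigma>(1) by (subst nn_integral_std_gauss) (auto simp: ennreal_mult[symmetric])
  also have "\<dots> = ennreal \<sigma> * (\<integral>\<^sup>+x. ennreal (normal_density 0 \<sigma> x) \<partial>lborel)"
    by (rule nn_integral_cmult) simp
  also have "(\<integral>\<^sup>+x. ennreal (normal_density 0 \<sigma> x) \<partial>lborel) = 1"
    using prob_space.emeasure_space_1[OF prob_space_normal_density[OF \<sigma>(1), of 0]]
    by (simp add: emeasure_density)
  finally show ?thesis by (simp add: \<sigma>_def)
qed

lemma nn_integral_gauss_exp_sum_sq:
  assumes "finite L" and s: "-1 < s"
  shows "(\<integral>\<^sup>+z. ennreal (exp (- s / 2 * (\<Sum>k\<in>L. (z k)\<^sup>2))) \<partial>gauss L) = ennreal ((1 / sqrt (1 + s)) ^ card L)"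
proof -
  have "ennreal (exp (- s / 2 * (\<Sum>k\<in>L. (z k)\<^sup>2))) = (\<Prod>k\<in>L. ennreal (exp (- s / 2 * (z k)\<^sup>2)))" for z
    using \<open>finite L\<close> by (simp add: prod_ennreal exp_sum[symmetric] sum_distrib_left)
  then have "(\<integral>\<^sup>+z. ennreal (exp (- s / 2 * (\<Sum>k\<in>L. (z k)\<^sup>2))) \<partial>gauss L) =
    (\<Prod>k\<in>L. \<integral>\<^sup>+x. ennreal (exp (- s / 2 * x\<^sup>2)) \<partial>std_gauss)"
    using \<open>finite L\<close> by (simp only:) (rule gauss_sf.product_nn_integral_prod, auto)
  also have "\<dots> = ennreal ((1 / sqrt (1 + s)) ^ card L)"
    unfolding nn_integral_std_gauss_exp_sq[OF s] prod_constant by (rule ennreal_power) (use s in simp)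
  finally show ?thesis .
qed

section \<open>Orthonormal images of Gaussian vectors\<close>

lemma sum_two_points:
  fixes f :: "'i \<Rightarrow> real"
  assumes "finite J" "p \<in> J" "q \<in> J" "p \<noteq> q"
  shows "(\<Sum>j\<in>J. f j) = f p + f q + (\<Sum>j\<in>J - {p, q}. f j)"
proof -
  have "(\<Sum>j\<in>J. f j) = f p + (\<Sum>j\<in>J - {p}. f j)" by (rule sum.remove) (use assms in auto)
  also have "(\<Sum>j\<in>J - {p}. f j) = f q + (\<Sum>j\<in>J - {p} - {q}. f j)" by (rule sum.remove) (use assms in auto)
  also have "J - {p} - {q} = J - {p, q}" by auto
  finally show ?thesis by simp
qed

lemma sum_mult_rot:
  assumes J: "finite J" "p \<in> J" "q \<in> J" "p \<noteq> q"
  shows "(\<Sum>j\<in>J. v j * rot p q c (- s) z j) = (\<Sum>j\<in>J. rot p q c s v j * z j)"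
proof -
  have "(\<Sum>j\<in>J - {p, q}. v j * rot p q c (- s) z j) = (\<Sum>j\<in>J - {p, q}. rot p q c s v j * z j)"
    by (intro sum.cong) (auto simp: rot_def)
  then show ?thesis
    using J(4) by (subst (1 2) sum_two_points[OF J]) (simp add: rot_def algebra_simps)
qed

lemma sum_rot_rot:
  assumes J: "finite J" "p \<in> J" "q \<in> J" "p \<noteq> q" and cs: "c\<^sup>2 + s\<^sup>2 = (1::real)"
  shows "(\<Sum>j\<in>J. rot p q c s v j * rot p q c s w j) = (\<Sum>j\<in>J. v j * w j)"
proof -
  have "(\<Sum>j\<in>J - {p, q}. rot p q c s v j * rot p q c s w j) = (\<Sum>j\<in>J - {p, q}. v j * w j)"
    by (intro sum.cong) (auto simp: rot_def)
  moreover have "(c * v p + s * v q) * (c * w p + s * w q) + (- s * v p + c * v q) * (- s * w p + c * w q)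
      = (c\<^sup>2 + s\<^sup>2) * (v p * w p + v q * w q)"
    by (simp add: power2_eq_square algebra_simps)
  ultimately show ?thesis
    using J(4) cs by (subst (1 2) sum_two_points[OF J]) (simp add: rot_def)
qed

lemma measurable_gauss_iff: "f \<in> M \<rightarrow>\<^sub>M std_gauss \<longleftrightarrow> f \<in> borel_measurable M"
  by (simp add: measurable_cong_sets[OF refl sets_std_gauss])

lemma measurable_gauss_component: "j \<in> J \<Longrightarrow> (\<lambda>z. z j) \<in> borel_measurable (gauss J)"
  using measurable_component_singleton[of j J "\<lambda>_. std_gauss"] by (simp add: measurable_gauss_iff)

lemma measurable_gauss_linear:
  assumes "finite J"
  shows "(\<lambda>z. \<lambda>k\<in>L. \<Sum>j\<in>J. v k j * z j) \<in> gauss J \<rightarrow>\<^sub>M gauss L"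
proof (rule measurable_restrict)
  fix k
  have "(\<lambda>z. \<Sum>j\<in>J. v k j * z j) \<in> borel_measurable (gauss J)"
    by (intro borel_measurable_sum borel_measurable_times borel_measurable_const measurable_gauss_component)
  then show "(\<lambda>z. \<Sum>j\<in>J. v k j * z j) \<in> gauss J \<rightarrow>\<^sub>M std_gauss" by (simp add: measurable_gauss_iff)
qed

text \<open>Orthonormality for arbitrary index sets, since coordinates are numbered by matrix
  positions for Gaussian matrices and by multi-indices for tensors.\<close>

definition onb_index :: "'k set \<Rightarrow> 'i set \<Rightarrow> ('k \<Rightarrow> 'i \<Rightarrow> real) \<Rightarrow> bool" where
  "onb_index L J v \<longleftrightarrow> (\<forall>k\<in>L. \<forall>k'\<in>L. (\<Sum>j\<in>J. v k j * v k' j) = (if k = k' then 1 else 0))"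

text \<open>Orthonormal vectors are brought to coordinate vectors by plane rotations, under which the
  Gaussian measure is invariant.\<close>

lemma givens_elimination:
  assumes "finite S" and J: "finite J" and "S \<subseteq> J - {j0}" and j0: "j0 \<in> J" and k0: "k0 \<in> L"
    and v: "onb_index L J v" and nz: "v k0 j0 \<noteq> 0"
  shows "\<exists>v'. onb_index L J v' \<and> v' k0 j0 \<noteq> 0 \<and> (\<forall>j\<in>S. v' k0 j = 0) \<and>
    (\<forall>f\<in>borel_measurable (gauss L). (\<integral>\<^sup>+z. f (\<lambda>k\<in>L. \<Sum>j\<in>J. v k j * z j) \<partial>gauss J) =
       (\<integral>\<^sup>+z. f (\<lambda>k\<in>L. \<Sum>j\<in>J. v' k j * z j) \<partial>gauss J))"
  using assms(1,3)
proof (induction S rule: finite_induct)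
  case empty
  then show ?case using v nz by (intro exI[of _ v]) auto
next
  case (insert q S)
  then have "S \<subseteq> J - {j0}" by auto
  from insert(3)[OF this] obtain v' where v'_all: "onb_index L J v' \<and> v' k0 j0 \<noteq> 0 \<and> (\<forall>j\<in>S. v' k0 j = 0) \<and>
    (\<forall>f\<in>borel_measurable (gauss L). (\<integral>\<^sup>+z. f (\<lambda>k\<in>L. \<Sum>j\<in>J. v k j * z j) \<partial>gauss J) =
       (\<integral>\<^sup>+z. f (\<lambda>k\<in>L. \<Sum>j\<in>J. v' k j * z j) \<partial>gauss J))" by (elim exE)
  note v' = v'_all[THEN conjunct1] v'_all[THEN conjunct2, THEN conjunct1] v'_all[THEN conjunct2, THEN conjunct2, THEN conjunct1]
  note int = bspec[OF v'_all[THEN conjunct2, THEN conjunct2, THEN conjunct2]]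
  have q: "q \<in> J" "j0 \<noteq> q" using insert by auto
  define \<rho> where "\<rho> = sqrt ((v' k0 j0)\<^sup>2 + (v' k0 q)\<^sup>2)"
  have \<rho>2: "\<rho>\<^sup>2 = (v' k0 j0)\<^sup>2 + (v' k0 q)\<^sup>2" by (simp add: \<rho>_def)
  have \<rho>: "\<rho> > 0" using v'(2) by (simp add: \<rho>_def sum_power2_gt_zero_iff)
  \<comment> \<open>The angle that sends entry \<open>q\<close> of row \<open>k0\<close> to 0, while
    entry \<open>j0\<close> becomes \<open>\<rho>\<close>. As that entry stays nonzero, so does the
    next cosine, which the rotation lemma demands.\<close>
  define c s where "c = v' k0 j0 / \<rho>" and "s = v' k0 q / \<rho>"
  have c: "c \<noteq> 0" using v'(2) \<rho> by (simp add: c_def)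
  have cs: "c\<^sup>2 + s\<^sup>2 = 1"
  proof -
    have "c\<^sup>2 + s\<^sup>2 = \<rho>\<^sup>2 / \<rho>\<^sup>2" unfolding c_def s_def power_divide add_divide_distrib[symmetric] \<rho>2 ..
    then show ?thesis using \<rho> by simp
  qed
  define v'' where "v'' = (\<lambda>k. rot j0 q c s (v' k))"
  have "onb_index L J v''"
    using v'(1) by (simp add: onb_index_def v''_def sum_rot_rot[OF J j0 q cs])
  moreover have "v'' k0 j0 \<noteq> 0"
  proof -
    have "v'' k0 j0 = ((v' k0 j0)\<^sup>2 + (v' k0 q)\<^sup>2) / \<rho>"
      by (simp add: v''_def rot_def c_def s_def power2_eq_square add_divide_distrib)
    then show ?thesis unfolding \<rho>2[symmetric] using \<rho> by simp
  qed
  moreover have "\<forall>j\<in>insert q S. v'' k0 j = 0"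
    using v'(3) insert q by (auto simp: v''_def rot_def c_def s_def)
  moreover have "\<forall>f\<in>borel_measurable (gauss L). (\<integral>\<^sup>+z. f (\<lambda>k\<in>L. \<Sum>j\<in>J. v k j * z j) \<partial>gauss J) =
       (\<integral>\<^sup>+z. f (\<lambda>k\<in>L. \<Sum>j\<in>J. v'' k j * z j) \<partial>gauss J)"
  proof (rule ballI)
    fix f :: "_ \<Rightarrow> ennreal" assume f: "f \<in> borel_measurable (gauss L)"
    have "(\<integral>\<^sup>+z. f (\<lambda>k\<in>L. \<Sum>j\<in>J. v'' k j * z j) \<partial>gauss J) =
        (\<integral>\<^sup>+z. f (\<lambda>k\<in>L. \<Sum>j\<in>J. v' k j * rot j0 q c (- s) z j) \<partial>gauss J)"
      unfolding v''_def sum_mult_rot[OF J j0 q] ..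
    also have "\<dots> = (\<integral>\<^sup>+z. f (\<lambda>k\<in>L. \<Sum>j\<in>J. v' k j * z j) \<partial>gauss J)"
      by (rule nn_integral_gauss_rotate[OF J j0 q measurable_compose[OF measurable_gauss_linear[OF J] f] c])
        (use cs in simp)
    finally show "(\<integral>\<^sup>+z. f (\<lambda>k\<in>L. \<Sum>j\<in>J. v k j * z j) \<partial>gauss J) =
       (\<integral>\<^sup>+z. f (\<lambda>k\<in>L. \<Sum>j\<in>J. v'' k j * z j) \<partial>gauss J)" using int[OF f] by (simp only:)
  qed
  ultimately show ?case by (intro exI[of _ v''] conjI)
qed

text \<open>Induction on the number of vectors. After elimination the vector \<open>k0\<close> is
  plus or minus a coordinate vector, the others vanish in that coordinate by orthogonality, and
  Fubini splits the coordinate off; a minus sign is absorbed by the symmetry of the Gaussian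
  law.\<close>

theorem nn_integral_gauss_orthonormal:
  assumes "finite L" "finite J" "onb_index L J v" "f \<in> borel_measurable (gauss L)"
  shows "(\<integral>\<^sup>+z. f (\<lambda>k\<in>L. \<Sum>j\<in>J. v k j * z j) \<partial>gauss J) = (\<integral>\<^sup>+z. f z \<partial>gauss L)"
  using assms
proof (induction L arbitrary: J v f rule: finite_induct)
  case empty
  interpret prob_space "gauss J" by (rule prob_space_PiM) (rule prob_space_std_gauss)
  show ?case by (simp add: PiM_empty nn_integral_count_space_finite emeasure_space_1)
next
  case (insert k0 L)
  note J = insert(4)
  have n0: "(\<Sum>j\<in>J. v k0 j * v k0 j) = 1" using insert(5) by (simp add: onb_index_def)
  have "\<exists>j0\<in>J. v k0 j0 \<noteq> 0"
  proof (rule ccontr)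
    assume "\<not> ?thesis"
    then have "(\<Sum>j\<in>J. v k0 j * v k0 j) = 0" by (intro sum.neutral) auto
    then show False using n0 by simp
  qed
  then obtain j0 where j0: "j0 \<in> J" "v k0 j0 \<noteq> 0" by blast
  define J' where "J' = J - {j0}"
  have J': "finite J'" "j0 \<notin> J'" "J = insert j0 J'" using J j0 by (auto simp: J'_def)
  obtain v' where v': "onb_index (insert k0 L) J v'" "v' k0 j0 \<noteq> 0" "\<forall>j\<in>J'. v' k0 j = 0"
    and int: "\<And>f. f \<in> borel_measurable (gauss (insert k0 L)) \<Longrightarrow>
       (\<integral>\<^sup>+z. f (\<lambda>k\<in>insert k0 L. \<Sum>j\<in>J. v k j * z j) \<partial>gauss J) =
       (\<integral>\<^sup>+z. f (\<lambda>k\<in>insert k0 L. \<Sum>j\<in>J. v' k j * z j) \<partial>gauss J)"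
    using givens_elimination[OF J'(1) J _ j0(1) insertI1 insert(5) j0(2)] J'_def by blast
  have split_sum: "(\<Sum>j\<in>J. h j) = h j0 + (\<Sum>j\<in>J'. h j)" for h :: "'b \<Rightarrow> real"
    unfolding J'(3) using J'(1,2) by simp
  define \<sigma> where "\<sigma> = v' k0 j0"
  have "(\<Sum>j\<in>J. v' k0 j * v' k0 j) = 1" using v'(1) by (simp add: onb_index_def)
  then have "\<sigma> * \<sigma> = 1" unfolding split_sum using v'(3) by (simp add: \<sigma>_def)
  then have \<sigma>: "\<sigma> = 1 \<or> \<sigma> = -1" by (simp add: square_eq_1_iff)
  have z0: "v' k j0 = 0" if k: "k \<in> L" for k
  proof -
    have "k \<noteq> k0" using k insert(2) by blast
    then have "(\<Sum>j\<in>J. v' k j * v' k0 j) = 0" using v'(1) k by (simp add: onb_index_def)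
    then have "v' k j0 * v' k0 j0 = 0" unfolding split_sum using v'(3) by simp
    then show ?thesis using v'(2) by simp
  qed
  have onb': "onb_index L J' v'"
    unfolding onb_index_def
  proof (intro ballI)
    fix k k' assume k: "k \<in> L" "k' \<in> L"
    have "(\<Sum>j\<in>J. v' k j * v' k' j) = (if k = k' then 1 else 0)" using v'(1) k by (simp add: onb_index_def)
    then show "(\<Sum>j\<in>J'. v' k j * v' k' j) = (if k = k' then 1 else 0)"
      unfolding split_sum using z0[OF k(1)] by simp
  qed
  have fm: "(\<lambda>z. f (\<lambda>k\<in>insert k0 L. \<Sum>j\<in>J. v' k j * z j)) \<in> borel_measurable (gauss J)"
    by (rule measurable_compose[OF measurable_gauss_linear[OF J] insert(6)])
  have upd: "(\<lambda>k\<in>insert k0 L. \<Sum>j\<in>J. v' k j * (x(j0 := a)) j) = (\<lambda>k\<in>L. \<Sum>j\<in>J'. v' k j * x j)(k0 := \<sigma> * a)" for x a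
  proof
    fix k
    have e: "(\<Sum>j\<in>J'. v' k j * (x(j0 := a)) j) = (\<Sum>j\<in>J'. v' k j * x j)" for k
      using J'(2) by (intro sum.cong) auto
    have e0: "(\<Sum>j\<in>J'. v' k0 j * x j) = 0" using v'(3) by simp
    show "(\<lambda>k\<in>insert k0 L. \<Sum>j\<in>J. v' k j * (x(j0 := a)) j) k = ((\<lambda>k\<in>L. \<Sum>j\<in>J'. v' k j * x j)(k0 := \<sigma> * a)) k"
      unfolding split_sum e using e0 z0 by (auto simp: \<sigma>_def)
  qed
  have fa: "(\<lambda>y. f (y(k0 := b))) \<in> borel_measurable (gauss L)" for b
  proof -
    have "(\<lambda>y. y(k0 := b)) \<in> gauss L \<rightarrow>\<^sub>M gauss (insert k0 L)"
      by (rule measurable_fun_upd[where J = L]) auto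
    from measurable_compose[OF this insert(6)] show ?thesis .
  qed
  have g: "(\<lambda>b. \<integral>\<^sup>+y. f (y(k0 := b)) \<partial>gauss L) \<in> borel_measurable borel"
  proof -
    interpret gL: prob_space "gauss L" by (rule prob_space_PiM) (rule prob_space_std_gauss)
    have "(\<lambda>p. (snd p)(k0 := fst p)) \<in> std_gauss \<Otimes>\<^sub>M gauss L \<rightarrow>\<^sub>M gauss (insert k0 L)"
      by (rule measurable_fun_upd[where J = L]) auto
    from measurable_compose[OF this insert(6)]
    have "(\<lambda>(b, y). f (y(k0 := b))) \<in> borel_measurable (std_gauss \<Otimes>\<^sub>M gauss L)" by (simp add: split_beta fun_upd_def)
    from gL.borel_measurable_nn_integral[OF this] show ?thesis
      by (simp add: measurable_cong_sets[OF sets_std_gauss refl])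
  qed
  have "(\<integral>\<^sup>+z. f (\<lambda>k\<in>insert k0 L. \<Sum>j\<in>J. v k j * z j) \<partial>gauss J) =
      (\<integral>\<^sup>+z. f (\<lambda>k\<in>insert k0 L. \<Sum>j\<in>J. v' k j * z j) \<partial>gauss (insert j0 J'))"
    by (subst int[OF insert(6)]) (simp only: J'(3)[symmetric])
  also have "\<dots> = (\<integral>\<^sup>+a. \<integral>\<^sup>+x. f (\<lambda>k\<in>insert k0 L. \<Sum>j\<in>J. v' k j * (x(j0 := a)) j) \<partial>gauss J' \<partial>std_gauss)"
    by (rule gauss_sf.product_nn_integral_insert_rev[OF J'(1,2)]) (use fm J'(3) in simp)
  also have "\<dots> = (\<integral>\<^sup>+a. \<integral>\<^sup>+y. f (y(k0 := \<sigma> * a)) \<partial>gauss L \<partial>std_gauss)"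
    unfolding upd by (intro nn_integral_cong insert(3)[OF J'(1) onb' fa])
  also have "\<dots> = (\<integral>\<^sup>+a. \<integral>\<^sup>+y. f (y(k0 := a)) \<partial>gauss L \<partial>std_gauss)"
    using \<sigma> nn_integral_std_gauss_uminus[OF g] by auto
  also have "\<dots> = (\<integral>\<^sup>+z. f z \<partial>gauss (insert k0 L))"
    by (rule gauss_sf.product_nn_integral_insert_rev[OF insert(1,2,6), symmetric])
  finally show ?case .
qed

section \<open>Chi-square tails\<close>

lemma measurable_gauss_sum_sq: "(\<lambda>z. \<Sum>k\<in>L. (z k)\<^sup>2) \<in> borel_measurable (gauss L)"
  by (intro borel_measurable_sum borel_measurable_power measurable_gauss_component)

text \<open>A Chernoff bound: with \<open>Z\<close> for the sum of squares, the indicator is at most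
  \<open>exp (s * (t - Z) / 2)\<close>. For \<open>t \<ge> d\<close> the right side is at least 1
  and nothing is to be shown.\<close>

lemma gauss_sum_sq_small:
  assumes L: "finite L" "card L = d" "0 < d" and t: "0 < t"
  shows "emeasure (gauss L) {z \<in> space (gauss L). (\<Sum>k\<in>L. (z k)\<^sup>2) < t} \<le> ennreal ((t * exp 1 / real d) powr (real d / 2))"
proof (cases "t < d")
  case False
  interpret prob_space "gauss L" by (rule prob_space_PiM) (rule prob_space_std_gauss)
  have "1 * 1 \<le> exp (1::real) * (t / real d)"
    using False L(3) by (intro mult_mono) (auto simp: field_simps)
  then have "1 \<le> t * exp 1 / real d" by (simp add: mult.commute)
  then have "1 \<le> (t * exp 1 / real d) powr (real d / 2)" by (intro ge_one_powr_ge_zero) auto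
  then have "1 \<le> ennreal ((t * exp 1 / real d) powr (real d / 2))" by simp
  then show ?thesis using emeasure_le_1 order_trans by blast
next
  case True
  \<comment> \<open>The minimizer of
    \<open>exp (s * t / 2) * (1 + s) powr (- d / 2)\<close>.\<close>
  define s where "s = real d / t - 1"
  have s: "0 < s" "1 + s = real d / t" using True t by (auto simp: s_def field_simps)
  have "emeasure (gauss L) {z \<in> space (gauss L). (\<Sum>k\<in>L. (z k)\<^sup>2) < t} =
      (\<integral>\<^sup>+z. indicator {z \<in> space (gauss L). (\<Sum>k\<in>L. (z k)\<^sup>2) < t} z \<partial>gauss L)"
    by (rule nn_integral_indicator[symmetric]) (use measurable_gauss_sum_sq[of L] in measurable)
  also have "\<dots> \<le> (\<integral>\<^sup>+z. ennreal (exp (s * t / 2)) * ennreal (exp (- s / 2 * (\<Sum>k\<in>L. (z k)\<^sup>2))) \<partial>gauss L)"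
  proof (rule nn_integral_mono)
    fix z
    have "1 \<le> exp (s * t / 2) * exp (- s / 2 * (\<Sum>k\<in>L. (z k)\<^sup>2))" if "(\<Sum>k\<in>L. (z k)\<^sup>2) < t"
    proof -
      have "s * (\<Sum>k\<in>L. (z k)\<^sup>2) \<le> s * t" using s that by (intro mult_left_mono) auto
      then show ?thesis by (simp add: exp_add[symmetric])
    qed
    then show "indicator {z \<in> space (gauss L). (\<Sum>k\<in>L. (z k)\<^sup>2) < t} z \<le>
        ennreal (exp (s * t / 2)) * ennreal (exp (- s / 2 * (\<Sum>k\<in>L. (z k)\<^sup>2)))"
      by (auto simp: indicator_def ennreal_mult[symmetric])
  qed
  also have "\<dots> = ennreal (exp (s * t / 2)) * ennreal ((1 / sqrt (1 + s)) ^ card L)"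
  proof -
    have "-1 < s" using s by simp
    have m: "(\<lambda>z. ennreal (exp (- s / 2 * (\<Sum>k\<in>L. (z k)\<^sup>2)))) \<in> borel_measurable (gauss L)"
      using measurable_gauss_sum_sq[of L] by measurable
    show ?thesis unfolding nn_integral_cmult[OF m] nn_integral_gauss_exp_sum_sq[OF L(1) \<open>-1 < s\<close>] ..
  qed
  also have "\<dots> = ennreal (exp (s * t / 2) * (1 / sqrt (1 + s)) ^ d)"
    unfolding L(2) by (rule ennreal_mult[symmetric]) (use s(1) in auto)
  also have "\<dots> \<le> ennreal ((t * exp 1 / real d) powr (real d / 2))"
  proof (rule ennreal_leI)
    have "s * t / 2 \<le> real d / 2" using t by (simp add: s_def left_diff_distrib)
    then have "exp (s * t / 2) \<le> exp 1 powr (real d / 2)" by (simp add: powr_def)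
    moreover have "(1 / sqrt (1 + s)) ^ d = (t / real d) powr (real d / 2)"
    proof -
      have "1 / sqrt (1 + s) = (t / real d) powr (1/2)"
        using t L(3) by (simp add: s(2) powr_half_sqrt real_sqrt_divide)
      then have "(1 / sqrt (1 + s)) ^ d = ((t / real d) powr (1/2)) powr real d"
        using t L(3) by (simp add: powr_realpow)
      then show ?thesis by (simp add: powr_powr)
    qed
    ultimately have "exp (s * t / 2) * (1 / sqrt (1 + s)) ^ d \<le> exp 1 powr (real d / 2) * (t / real d) powr (real d / 2)"
      by (simp add: mult_right_mono)
    also have "\<dots> = (t * exp 1 / real d) powr (real d / 2)"
      using t by (simp add: powr_mult[symmetric] mult.commute)
    finally show "exp (s * t / 2) * (1 / sqrt (1 + s)) ^ d \<le> (t * exp 1 / real d) powr (real d / 2)" .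
  qed
  finally show ?thesis .
qed

text \<open>The Chernoff bound with parameter 1/4: at the threshold the exponential amounts to
  \<open>exp 1\<close> per coordinate, against the factor \<open>sqrt 2\<close> per coordinate from
  the Laplace transform at \<open>s = - 1 / 2\<close>.\<close>

lemma gauss_sum_sq_large:
  assumes L: "finite L"
  shows "emeasure (gauss L) {z \<in> space (gauss L). 4 * real (card L) < (\<Sum>k\<in>L. (z k)\<^sup>2)} \<le> ennreal ((sqrt 2 / exp 1) ^ card L)"
proof -
  have "emeasure (gauss L) {z \<in> space (gauss L). 4 * real (card L) < (\<Sum>k\<in>L. (z k)\<^sup>2)} =
      (\<integral>\<^sup>+z. indicator {z \<in> space (gauss L). 4 * real (card L) < (\<Sum>k\<in>L. (z k)\<^sup>2)} z \<partial>gauss L)"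
    by (rule nn_integral_indicator[symmetric]) (use measurable_gauss_sum_sq[of L] in measurable)
  also have "\<dots> \<le> (\<integral>\<^sup>+z. ennreal (exp (- real (card L))) * ennreal (exp (- (- 1/2) / 2 * (\<Sum>k\<in>L. (z k)\<^sup>2))) \<partial>gauss L)"
  proof (rule nn_integral_mono)
    fix z
    have "1 \<le> exp (- real (card L)) * exp (- (- 1/2) / 2 * (\<Sum>k\<in>L. (z k)\<^sup>2))" if "4 * real (card L) < (\<Sum>k\<in>L. (z k)\<^sup>2)"
      using that by (simp add: exp_add[symmetric])
    then show "indicator {z \<in> space (gauss L). 4 * real (card L) < (\<Sum>k\<in>L. (z k)\<^sup>2)} z \<le>
        ennreal (exp (- real (card L))) * ennreal (exp (- (- 1/2) / 2 * (\<Sum>k\<in>L. (z k)\<^sup>2)))"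
      by (auto simp: indicator_def ennreal_mult[symmetric])
  qed
  also have "\<dots> = ennreal (exp (- real (card L))) * ennreal ((1 / sqrt (1 + (- 1/2))) ^ card L)"
  proof -
    have m: "(\<lambda>z. ennreal (exp (- (- 1/2) / 2 * (\<Sum>k\<in>L. (z k)\<^sup>2)))) \<in> borel_measurable (gauss L)"
      using measurable_gauss_sum_sq[of L] by measurable
    have h: "-1 < (- 1/2 :: real)" by simp
    show ?thesis unfolding nn_integral_cmult[OF m] nn_integral_gauss_exp_sum_sq[OF L h] ..
  qed
  also have "\<dots> = ennreal ((sqrt 2 / exp 1) ^ card L)"
  proof -
    have "exp (- real (card L)) = (1 / exp 1) ^ card L"
      using exp_of_nat_mult[of "card L" "1::real"] by (simp add: exp_minus power_one_over inverse_eq_divide)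
    moreover have "1 / sqrt (1 + (- 1/2)) = sqrt 2" by (simp add: real_sqrt_divide)
    ultimately have eq: "exp (- real (card L)) * (1 / sqrt (1 + (- 1/2))) ^ card L = (sqrt 2 / exp 1) ^ card L"
      by (simp only: power_mult_distrib[symmetric]) simp
    have nn: "0 \<le> (1 / sqrt (1 + (- 1/2 :: real))) ^ card L" by simp
    show ?thesis unfolding ennreal_mult[OF exp_ge_zero nn, symmetric] eq ..
  qed
  finally show ?thesis .
qed

section \<open>Right inverses of Gaussian matrices\<close>

text \<open>Rational coefficients make the set of all such \<open>g\<close> a countable union of measurable sets.\<close>

definition row_close :: "nat \<Rightarrow> nat \<Rightarrow> real \<Rightarrow> nat \<Rightarrow> (nat \<times> nat \<Rightarrow> real) \<Rightarrow> bool" where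
  "row_close l \<mu> t i g \<longleftrightarrow> (\<exists>c\<in>(\<Pi>\<^sub>E j\<in>{..<\<mu>}. \<rat>).
     (\<Sum>b<l. (g (i, b) - (\<Sum>j\<in>{..<\<mu>} - {i}. c j * g (j, b)))\<^sup>2) < t)"

text \<open>The squared distance is continuous in the coefficients, and real coefficients are limits
  of rational ones. This recovers a bound on the distance from the real span.\<close>

lemma not_row_closeD:
  assumes "\<not> row_close l \<mu> t i g"
  shows "t \<le> (\<Sum>b<l. (g (i, b) - (\<Sum>j\<in>{..<\<mu>} - {i}. c j * g (j, b)))\<^sup>2)"
proof (rule ccontr)
  define F where "F = (\<lambda>c. \<Sum>b<l. (g (i, b) - (\<Sum>j\<in>{..<\<mu>} - {i}. c j * g (j, b)))\<^sup>2)"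
  assume "\<not> ?thesis"
  then have lt: "F c < t" by (simp add: F_def)
  have "\<exists>r. (\<forall>n. r n \<in> \<rat>) \<and> r \<longlonglongrightarrow> x" for x :: real
  proof -
    have "\<exists>q\<in>\<rat>. x < q \<and> q < x + 1 / real (Suc n)" for n by (rule Rats_dense_in_real) simp
    then have "\<forall>n. \<exists>q. q \<in> \<rat> \<and> x < q \<and> q < x + 1 / real (Suc n)" by blast
    from choice[OF this] obtain r where r: "\<forall>n. r n \<in> \<rat> \<and> x < r n \<and> r n < x + 1 / real (Suc n)" by (elim exE)
    have "r \<longlonglongrightarrow> x"
    proof (rule tendsto_sandwich[of "\<lambda>_. x"])
      show "(\<lambda>n. x + 1 / real (Suc n)) \<longlonglongrightarrow> x"
        using tendsto_add[OF tendsto_const[of x] LIMSEQ_inverse_real_of_nat] by (simp add: inverse_eq_divide)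
    next
      show "\<forall>\<^sub>F n in sequentially. x \<le> r n" using r by (intro always_eventually allI less_imp_le) simp
      show "\<forall>\<^sub>F n in sequentially. r n \<le> x + 1 / real (Suc n)" using r by (intro always_eventually allI less_imp_le) simp
    qed simp
    then show ?thesis using r by (intro exI[of _ r]) simp
  qed
  then have "\<forall>x::real. \<exists>r. (\<forall>n. r n \<in> \<rat>) \<and> r \<longlonglongrightarrow> x" by (rule allI)
  from choice[OF this] obtain r where r_all: "\<forall>x::real. (\<forall>n. r x n \<in> \<rat>) \<and> r x \<longlonglongrightarrow> x" by (elim exE)
  have r: "r x n \<in> \<rat>" "r x \<longlonglongrightarrow> x" for x n using r_all by simp_all
  have "(\<lambda>n. F (\<lambda>j. r (c j) n)) \<longlonglongrightarrow> F c"
    unfolding F_def by (intro tendsto_sum tendsto_power tendsto_diff tendsto_mult tendsto_const r(2))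
  from eventually_happens'[OF sequentially_bot order_tendstoD(2)[OF this lt]]
  obtain n where n: "F (\<lambda>j. r (c j) n) < t" by (elim exE)
  define c' where "c' = (\<lambda>j\<in>{..<\<mu>}. r (c j) n)"
  have "(\<Sum>j\<in>{..<\<mu>} - {i}. c' j * g (j, b)) = (\<Sum>j\<in>{..<\<mu>} - {i}. r (c j) n * g (j, b))" for b
    by (intro sum.cong) (auto simp: c'_def)
  then have "F c' = F (\<lambda>j. r (c j) n)" unfolding F_def by (simp only:)
  with n have "F c' < t" by (simp only:)
  moreover have "c' \<in> (\<Pi>\<^sub>E j\<in>{..<\<mu>}. \<rat>)" unfolding c'_def using r(1) by (intro restrict_PiE_iff[THEN iffD2] ballI)
  ultimately have "row_close l \<mu> t i g" unfolding row_close_def F_def by (intro bexI[of _ c'])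
  then show False using assms by (rule notE[rotated])
qed

lemma row_close_sets:
  assumes i: "i < \<mu>"
  shows "{z \<in> space (gauss ({..<\<mu>} \<times> {..<l})). row_close l \<mu> t i z} \<in> sets (gauss ({..<\<mu>} \<times> {..<l}))"
proof -
  let ?M = "gauss ({..<\<mu>} \<times> {..<l})"
  have cnt: "countable (\<Pi>\<^sub>E j\<in>{..<\<mu>}. (\<rat>::real set))" by (intro countable_PiE) (auto simp: countable_rat)
  have "{z \<in> space ?M. row_close l \<mu> t i z} = (\<Union>c\<in>(\<Pi>\<^sub>E j\<in>{..<\<mu>}. \<rat>).
     {z \<in> space ?M. (\<Sum>b<l. (z (i, b) - (\<Sum>j\<in>{..<\<mu>} - {i}. c j * z (j, b)))\<^sup>2) < t})"
    by (auto simp: row_close_def)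
  also have "\<dots> \<in> sets ?M"
  proof (intro sets.countable_UN'' cnt)
    fix c :: "nat \<Rightarrow> real"
    have "(\<lambda>z. \<Sum>b<l. (z (i, b) - (\<Sum>j\<in>{..<\<mu>} - {i}. c j * z (j, b)))\<^sup>2) \<in> borel_measurable ?M"
      using i by (intro borel_measurable_sum borel_measurable_power borel_measurable_diff borel_measurable_times
        borel_measurable_const measurable_gauss_component) auto
    then show "{z \<in> space ?M. (\<Sum>b<l. (z (i, b) - (\<Sum>j\<in>{..<\<mu>} - {i}. c j * z (j, b)))\<^sup>2) < t} \<in> sets ?M"
      by measurable
  qed
  finally show ?thesis .
qed

text \<open>Conditionally on the other rows, the squared distance of a Gaussian row from their span
  dominates a chi-square variable with \<open>l - \<mu> + 1\<close> degrees of freedom.\<close>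

lemma emeasure_row_close:
  assumes i: "i < \<mu>" and d: "\<mu> + d \<le> l + 1" "0 < d" and t: "0 < t"
  shows "emeasure (gauss ({..<\<mu>} \<times> {..<l})) {z \<in> space (gauss ({..<\<mu>} \<times> {..<l})). row_close l \<mu> t i z}
    \<le> ennreal ((t * exp 1 / real d) powr (real d / 2))" (is "_ \<le> ?B")
proof -
  let ?A = "({..<\<mu>} - {i}) \<times> {..<l}" and ?R = "{i} \<times> {..<l}"
  have AR: "?A \<inter> ?R = {}" "finite ?A" "finite ?R" and un: "{..<\<mu>} \<times> {..<l} = ?A \<union> ?R" using i by auto
  let ?E = "{z \<in> space (gauss ({..<\<mu>} \<times> {..<l})). row_close l \<mu> t i z}"
  have Es: "?E \<in> sets (gauss ({..<\<mu>} \<times> {..<l}))" by (rule row_close_sets[OF i])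
  have m: "indicator ?E \<in> borel_measurable (gauss (?A \<union> ?R))"
    using Es unfolding un by simp
  have "emeasure (gauss ({..<\<mu>} \<times> {..<l})) ?E = (\<integral>\<^sup>+z. indicator ?E z \<partial>gauss (?A \<union> ?R))"
    using Es unfolding un by (rule nn_integral_indicator[symmetric])
  also have "\<dots> = (\<integral>\<^sup>+x. \<integral>\<^sup>+y. indicator ?E (merge ?A ?R (x, y)) \<partial>gauss ?R \<partial>gauss ?A)"
    by (rule gauss_sf.product_nn_integral_fold[OF AR m])
  also have "\<dots> \<le> (\<integral>\<^sup>+x. ?B \<partial>gauss ?A)"
  proof (rule nn_integral_mono)
    fix x :: "nat \<times> nat \<Rightarrow> real"
    define g where "g = (\<lambda>j b. x (j, b) :: real)"
    obtain k q where kq: "k \<le> card ({..<\<mu>} - {i})" "orthonormal_family l k q"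
      and ex: "\<And>j b. j \<in> {..<\<mu>} - {i} \<Longrightarrow> b < l \<Longrightarrow> g j b = (\<Sum>a<k. ip l (q a) (g j) * q a b)"
      using orthonormal_basis_of_span[of "{..<\<mu>} - {i}" l g] by auto
    have kd: "k + d \<le> l" using kq(1) d(1) i by simp
    \<comment> \<open>The span of the other rows has dimension \<open>k \<le> \<mu> - 1\<close>;
      completing its basis leaves at least \<open>d\<close> further orthonormal directions, in which
      combinations of the other rows have no component.\<close>
    obtain w where w: "orthonormal_family l l w" and wq: "\<forall>a<k. w a = q a"
      using orthonormal_family_extend[OF kq(2), of l] kd by auto
    have wg: "ip l (w (k + a)) (g j) = 0" if "a < d" "j \<in> {..<\<mu>} - {i}" for a j
    proof -
      have "ip l (w (k + a)) (g j) = ip l (w (k + a)) (\<lambda>b. \<Sum>a'<k. ip l (q a') (g j) * q a' b)"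
        by (rule ip_cong) (auto intro: ex[OF that(2)])
      also have "\<dots> = (\<Sum>a'<k. ip l (q a') (g j) * ip l (w (k + a)) (q a'))"
        by (simp only: ip_sum_right ip_scale_right)
      also have "\<dots> = 0"
      proof (intro sum.neutral ballI)
        fix a' assume a': "a' \<in> {..<k}"
        have "ip l (w (k + a)) (w a') = 0" using w a' that(1) kd by (auto simp: orthonormal_family_def)
        then show "ip l (q a') (g j) * ip l (w (k + a)) (q a') = 0" using wq a' by simp
      qed
      finally show ?thesis .
    qed
    have wd: "orthonormal_family l d (\<lambda>a. w (k + a))"
      using w kd by (auto simp: orthonormal_family_def)
    define v where "v = (\<lambda>a (jb :: nat \<times> nat). w (k + a) (snd jb))"
    have sumR: "(\<Sum>jb\<in>?R. h jb) = (\<Sum>b<l. h (i, b))" for h :: "nat \<times> nat \<Rightarrow> real"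
    proof -
      have "?R = Pair i ` {..<l}" by auto
      then show ?thesis by (simp add: sum.reindex inj_on_def)
    qed
    have v: "onb_index {..<d} ?R v"
      using wd by (simp add: onb_index_def sumR v_def orthonormal_family_def ip_def)
    let ?F = "indicator {y \<in> space (gauss {..<d}). (\<Sum>a\<in>{..<d}. (y a)\<^sup>2) < t} :: (nat \<Rightarrow> real) \<Rightarrow> ennreal"
    have "(\<integral>\<^sup>+y. indicator ?E (merge ?A ?R (x, y)) \<partial>gauss ?R) \<le> (\<integral>\<^sup>+y. ?F (\<lambda>a\<in>{..<d}. \<Sum>jb\<in>?R. v a jb * y jb) \<partial>gauss ?R)"
    proof (rule nn_integral_mono)
      fix y
      have "(\<lambda>a\<in>{..<d}. \<Sum>jb\<in>?R. v a jb * y jb) \<in> {y \<in> space (gauss {..<d}). (\<Sum>a\<in>{..<d}. (y a)\<^sup>2) < t}"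
        if z: "row_close l \<mu> t i (merge ?A ?R (x, y))"
      proof -
        obtain c where c: "(\<Sum>b<l. (merge ?A ?R (x, y) (i, b) - (\<Sum>j\<in>{..<\<mu>} - {i}. c j * merge ?A ?R (x, y) (j, b)))\<^sup>2) < t"
          using z unfolding row_close_def by blast
        define h where "h = (\<lambda>b. y (i, b) - (\<Sum>j\<in>{..<\<mu>} - {i}. c j * g j b))"
        have "(\<Sum>b<l. (merge ?A ?R (x, y) (i, b) - (\<Sum>j\<in>{..<\<mu>} - {i}. c j * merge ?A ?R (x, y) (j, b)))\<^sup>2) = ip l h h"
          unfolding ip_def h_def power2_eq_square[symmetric]
          by (intro sum.cong arg_cong[where f = "\<lambda>x. x\<^sup>2"] arg_cong2[where f = "(-)"] refl) (auto simp: merge_def g_def)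
        then have hh: "ip l h h < t" using c by simp
        have "(\<Sum>jb\<in>?R. v a jb * y jb) = ip l (w (k + a)) h" if "a < d" for a
        proof -
          have "ip l (w (k + a)) h = ip l (w (k + a)) (\<lambda>b. y (i, b)) - (\<Sum>j\<in>{..<\<mu>} - {i}. c j * ip l (w (k + a)) (g j))"
            unfolding h_def by (simp only: ip_diff_right ip_sum_right ip_scale_right)
          also have "\<dots> = ip l (w (k + a)) (\<lambda>b. y (i, b))" using wg[OF that] by simp
          finally show ?thesis by (simp add: sumR v_def ip_def)
        qed
        then have "(\<Sum>a<d. ((\<lambda>a\<in>{..<d}. \<Sum>jb\<in>?R. v a jb * y jb) a)\<^sup>2) = (\<Sum>a<d. (ip l (w (k + a)) h)\<^sup>2)"
          by (intro sum.cong) auto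
        also have "\<dots> \<le> ip l h h" by (rule bessel[OF wd])
        finally show ?thesis using hh by (auto simp: space_PiM)
      qed
      then show "indicator ?E (merge ?A ?R (x, y)) \<le> ?F (\<lambda>a\<in>{..<d}. \<Sum>jb\<in>?R. v a jb * y jb)"
        by (auto simp: indicator_def)
    qed
    \<comment> \<open>In the \<open>d\<close> new directions row \<open>i\<close> is a standard
      Gaussian vector.\<close>
    also have "\<dots> = (\<integral>\<^sup>+y. ?F y \<partial>gauss {..<d})"
      using measurable_gauss_sum_sq[of "{..<d}"]
      by (intro nn_integral_gauss_orthonormal[OF _ _ v]) measurable
    also have "\<dots> = emeasure (gauss {..<d}) {y \<in> space (gauss {..<d}). (\<Sum>a\<in>{..<d}. (y a)\<^sup>2) < t}"
      by (rule nn_integral_indicator) (use measurable_gauss_sum_sq[of "{..<d}"] in measurable)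
    also have "\<dots> \<le> ?B" by (rule gauss_sum_sq_small) (use d t in auto)
    finally show "(\<integral>\<^sup>+y. indicator ?E (merge ?A ?R (x, y)) \<partial>gauss ?R) \<le> ?B" .
  qed
  also have "\<dots> = ?B"
  proof -
    interpret prob_space "gauss ?A" by (rule prob_space_PiM) (rule prob_space_std_gauss)
    show ?thesis by (simp add: emeasure_space_1)
  qed
  finally show ?thesis .
qed

definition project_rows :: "nat \<Rightarrow> nat \<Rightarrow> nat \<Rightarrow> real mat \<Rightarrow> (nat \<times> nat \<Rightarrow> real) \<Rightarrow> nat \<times> nat \<Rightarrow> real" where
  "project_rows m \<mu> l U z = (\<lambda>(i, b)\<in>{..<\<mu>} \<times> {..<l}. \<Sum>a<m. U $$ (a, i) * z (a, b))"

text \<open>Outside this set both inputs of \<open>residual_bound\<close> are at hand: a right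
  inverse of \<open>U\<^sup>T G\<close> of controlled norm, and the bound
  \<open>2 sqrt (m l)\<close> on the norm of \<open>G\<close>.\<close>

definition bad_sketch :: "nat \<Rightarrow> nat \<Rightarrow> nat \<Rightarrow> real \<Rightarrow> real mat \<Rightarrow> (nat \<times> nat \<Rightarrow> real) set" where
  "bad_sketch m \<mu> l t U = {z \<in> space (gauss ({..<m} \<times> {..<l})).
     (\<exists>i<\<mu>. row_close l \<mu> t i (project_rows m \<mu> l U z)) \<or>
     4 * real (m * l) < (\<Sum>p\<in>{..<m} \<times> {..<l}. (z p)\<^sup>2)}"

text \<open>Passing from \<open>G\<close> to \<open>U\<^sup>T G\<close> treats all columns alike, so
  the entries of the product are orthonormal linear forms in the entries of \<open>G\<close>, and
  the product is again a standard Gaussian matrix. A union bound over its \<open>\<mu>\<close> rows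
  and the norm of \<open>G\<close> finishes.\<close>

lemma bad_sketch:
  assumes U: "orthonormal_mat m \<mu> U" and d: "\<mu> + d \<le> l + 1" "0 < d" and t: "0 < t"
  shows "bad_sketch m \<mu> l t U \<in> sets (gauss ({..<m} \<times> {..<l}))" (is "_ \<in> sets ?M")
    and "emeasure (gauss ({..<m} \<times> {..<l})) (bad_sketch m \<mu> l t U) \<le>
      ennreal (real \<mu> * (t * exp 1 / real d) powr (real d / 2) + (sqrt 2 / exp 1) ^ (m * l))"
proof -
  interpret orthonormal_mat m \<mu> U by fact
  let ?L = "{..<\<mu>} \<times> {..<l}" and ?J = "{..<m} \<times> {..<l}"
  define v where "v = (\<lambda>(ib :: nat \<times> nat) (ab :: nat \<times> nat). if snd ib = snd ab then U $$ (fst ab, fst ib) else 0)"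
  have sumJ: "(\<Sum>ab\<in>?J. v ib ab * h ab) = (\<Sum>a<m. U $$ (a, fst ib) * h (a, snd ib))"
    if "ib \<in> ?L" for ib and h :: "nat \<times> nat \<Rightarrow> real"
  proof -
    have "(\<Sum>ab\<in>?J. v ib ab * h ab) = (\<Sum>a<m. \<Sum>b<l. if b = snd ib then U $$ (a, fst ib) * h (a, b) else 0)"
      unfolding sum.cartesian_product by (intro sum.cong) (auto simp: v_def)
    also have "\<dots> = (\<Sum>a<m. U $$ (a, fst ib) * h (a, snd ib))"
      using that by (intro sum.cong refl) auto
    finally show ?thesis .
  qed
  have v: "onb_index ?L ?J v"
    unfolding onb_index_def
  proof (intro ballI)
    fix ib ib' assume ib: "ib \<in> ?L" "ib' \<in> ?L"
    have "(\<Sum>ab\<in>?J. v ib ab * v ib' ab) = (if snd ib = snd ib' then ip m (colf U (fst ib)) (colf U (fst ib')) else 0)"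
      unfolding sumJ[OF ib(1)] by (auto simp: v_def ip_def colf_def)
    also have "\<dots> = (if ib = ib' then 1 else 0)"
      using ib orthonormal_family_colf by (auto simp: orthonormal_family_def prod_eq_iff)
    finally show "(\<Sum>ab\<in>?J. v ib ab * v ib' ab) = (if ib = ib' then 1 else 0)" .
  qed
  have proj: "project_rows m \<mu> l U = (\<lambda>z. \<lambda>ib\<in>?L. \<Sum>ab\<in>?J. v ib ab * z ab)"
    by (rule ext) (auto simp: project_rows_def sumJ split_beta intro!: restrict_ext)
  have pm: "project_rows m \<mu> l U \<in> ?M \<rightarrow>\<^sub>M gauss ?L"
    unfolding proj by (rule measurable_gauss_linear) simp
  define E where "E = (\<lambda>i. {z \<in> space (gauss ?L). row_close l \<mu> t i z})"
  define E' where "E' = (\<lambda>i. project_rows m \<mu> l U -` E i \<inter> space ?M)"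
  define N where "N = {z \<in> space ?M. 4 * real (m * l) < (\<Sum>p\<in>?J. (z p)\<^sup>2)}"
  have Es: "E i \<in> sets (gauss ?L)" if "i < \<mu>" for i unfolding E_def by (rule row_close_sets[OF that])
  have E's: "E' i \<in> sets ?M" if "i < \<mu>" for i
    unfolding E'_def by (rule measurable_sets[OF pm Es[OF that]])
  have Ns: "N \<in> sets ?M" unfolding N_def using measurable_gauss_sum_sq[of ?J] by measurable
  have eq: "bad_sketch m \<mu> l t U = (\<Union>i<\<mu>. E' i) \<union> N"
    using measurable_space[OF pm] by (auto simp: bad_sketch_def E'_def E_def N_def)
  show "bad_sketch m \<mu> l t U \<in> sets ?M"
    unfolding eq using E's Ns by (intro sets.Un sets.finite_UN) auto
  have "emeasure ?M (E' i) \<le> ennreal ((t * exp 1 / real d) powr (real d / 2))" if i: "i < \<mu>" for i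
  proof -
    have "emeasure ?M (E' i) = (\<integral>\<^sup>+z. indicator (E' i) z \<partial>?M)"
      by (rule nn_integral_indicator[OF E's[OF i], symmetric])
    also have "\<dots> = (\<integral>\<^sup>+z. indicator (E i) (\<lambda>ib\<in>?L. \<Sum>ab\<in>?J. v ib ab * z ab) \<partial>?M)"
      by (intro nn_integral_cong) (auto simp: E'_def indicator_def proj)
    also have "\<dots> = (\<integral>\<^sup>+z. indicator (E i) z \<partial>gauss ?L)"
      by (rule nn_integral_gauss_orthonormal[OF _ _ v]) (use Es[OF i] in auto)
    also have "\<dots> = emeasure (gauss ?L) (E i)"
      by (rule nn_integral_indicator[OF Es[OF i]])
    also have "\<dots> \<le> ennreal ((t * exp 1 / real d) powr (real d / 2))"
      unfolding E_def by (rule emeasure_row_close[OF i d t])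
    finally show ?thesis .
  qed
  note E'_bound = this
  have "emeasure ?M (bad_sketch m \<mu> l t U) \<le> emeasure ?M (\<Union>i<\<mu>. E' i) + emeasure ?M N"
    unfolding eq using E's Ns by (intro emeasure_subadditive sets.finite_UN) auto
  also have "emeasure ?M (\<Union>i<\<mu>. E' i) \<le> (\<Sum>i<\<mu>. emeasure ?M (E' i))"
    using E's by (intro emeasure_subadditive_finite) auto
  also have "\<dots> \<le> (\<Sum>i<\<mu>. ennreal ((t * exp 1 / real d) powr (real d / 2)))"
    using E'_bound by (intro sum_mono) auto
  also have "\<dots> = ennreal (real \<mu> * (t * exp 1 / real d) powr (real d / 2))"
    by (simp add: ennreal_mult ennreal_of_nat_eq_real_of_nat)
  also have "emeasure ?M N \<le> ennreal ((sqrt 2 / exp 1) ^ (m * l))"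
    using gauss_sum_sq_large[of ?J] unfolding N_def by (simp add: card_cartesian_product)
  finally show "emeasure ?M (bad_sketch m \<mu> l t U) \<le>
      ennreal (real \<mu> * (t * exp 1 / real d) powr (real d / 2) + (sqrt 2 / exp 1) ^ (m * l))"
    by (simp add: ennreal_plus add_mono)
qed

lemma not_bad_sketchD:
  assumes U: "orthonormal_mat m \<mu> U" and G: "G \<in> carrier_mat m l" and t: "0 < t"
    and good: "(\<lambda>p\<in>{..<m} \<times> {..<l}. G $$ p) \<notin> bad_sketch m \<mu> l t U"
  shows "\<exists>P\<in>carrier_mat l \<mu>. transpose_mat U * (G * P) = 1\<^sub>m \<mu> \<and> (frob_norm P)\<^sup>2 \<le> real \<mu> / t"
    and "frob_norm G \<le> 2 * sqrt (real (m * l))"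
proof -
  let ?z = "\<lambda>p\<in>{..<m} \<times> {..<l}. G $$ p"
  have sp: "?z \<in> space (gauss ({..<m} \<times> {..<l}))" by (auto simp: space_PiM)
  have nc: "\<not> row_close l \<mu> t i (project_rows m \<mu> l U ?z)" if "i < \<mu>" for i
    using good sp that by (auto simp: bad_sketch_def)
  show "\<exists>P\<in>carrier_mat l \<mu>. transpose_mat U * (G * P) = 1\<^sub>m \<mu> \<and> (frob_norm P)\<^sup>2 \<le> real \<mu> / t"
  proof (rule ex_right_inverse[OF orthonormal_mat.Q[OF U] G t])
    fix i c assume i: "i < \<mu>"
    have "project_rows m \<mu> l U ?z (j, b) = (\<Sum>a<m. U $$ (a, j) * G $$ (a, b))" if "j < \<mu>" "b < l" for j b
      using that by (simp add: project_rows_def)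
    then have "(\<Sum>b<l. (project_rows m \<mu> l U ?z (i, b) - (\<Sum>j\<in>{..<\<mu>} - {i}. c j * project_rows m \<mu> l U ?z (j, b)))\<^sup>2) =
      (\<Sum>b<l. ((\<Sum>a<m. U $$ (a, i) * G $$ (a, b)) - (\<Sum>j\<in>{..<\<mu>} - {i}. c j * (\<Sum>a<m. U $$ (a, j) * G $$ (a, b))))\<^sup>2)"
      using i by (intro sum.cong arg_cong[where f = "\<lambda>x. x\<^sup>2"] arg_cong2[where f = "(-)"] refl) auto
    then show "t \<le> (\<Sum>b<l. ((\<Sum>a<m. U $$ (a, i) * G $$ (a, b)) - (\<Sum>j\<in>{..<\<mu>} - {i}. c j * (\<Sum>a<m. U $$ (a, j) * G $$ (a, b))))\<^sup>2)"
      using not_row_closeD[OF nc[OF i], of c] by simp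
  qed
  have "(frob_norm G)\<^sup>2 \<le> 4 * real (m * l)"
  proof -
    have "(frob_norm G)\<^sup>2 = (\<Sum>p\<in>{..<m} \<times> {..<l}. (?z p)\<^sup>2)"
      unfolding frob_norm_sq[OF G] sum.cartesian_product by (intro sum.cong) auto
    then show ?thesis using good sp by (auto simp: bad_sketch_def)
  qed
  also have "4 * real (m * l) = (2 * sqrt (real (m * l)))\<^sup>2" by (simp add: power_mult_distrib)
  finally show "frob_norm G \<le> 2 * sqrt (real (m * l))" by (rule power2_le_imp_le) simp
qed

section \<open>Compressed tensors\<close>

lemma onb_index_pythagoras:
  assumes "finite C" "finite X" and q: "onb_index C X q"
  shows "(\<Sum>x\<in>X. (f x - (\<Sum>c\<in>C. (\<Sum>y\<in>X. f y * q c y) * q c x))\<^sup>2) =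
    (\<Sum>x\<in>X. (f x)\<^sup>2) - (\<Sum>c\<in>C. (\<Sum>y\<in>X. f y * q c y)\<^sup>2)"
proof -
  define b where "b = (\<lambda>c. \<Sum>y\<in>X. f y * q c y)"
  have "(\<Sum>x\<in>X. (f x - (\<Sum>c\<in>C. b c * q c x))\<^sup>2) =
    (\<Sum>x\<in>X. (f x)\<^sup>2) - 2 * (\<Sum>x\<in>X. f x * (\<Sum>c\<in>C. b c * q c x)) + (\<Sum>x\<in>X. (\<Sum>c\<in>C. b c * q c x)\<^sup>2)"
    by (simp add: power2_diff sum.distrib sum_subtractf sum_distrib_left mult.assoc)
  also have "(\<Sum>x\<in>X. f x * (\<Sum>c\<in>C. b c * q c x)) = (\<Sum>c\<in>C. b c * (\<Sum>x\<in>X. f x * q c x))"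
    unfolding sum_distrib_left by (subst sum.swap) (simp add: mult_ac)
  also have "\<dots> = (\<Sum>c\<in>C. (b c)\<^sup>2)"
    unfolding power2_eq_square by (intro sum.cong refl) (simp add: b_def)
  also have "(\<Sum>x\<in>X. (\<Sum>c\<in>C. b c * q c x)\<^sup>2) = (\<Sum>x\<in>X. \<Sum>c\<in>C. \<Sum>c'\<in>C. b c * b c' * (q c x * q c' x))"
    by (simp add: power2_eq_square sum_product mult_ac)
  also have "\<dots> = (\<Sum>c\<in>C. \<Sum>c'\<in>C. b c * b c' * (\<Sum>x\<in>X. q c x * q c' x))"
    unfolding sum_distrib_left by (subst sum.swap, rule sum.cong[OF refl], rule sum.swap)
  also have "\<dots> = (\<Sum>c\<in>C. \<Sum>c'\<in>C. if c = c' then (b c)\<^sup>2 else 0)"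
    using q by (intro sum.cong refl) (auto simp: onb_index_def power2_eq_square)
  also have "\<dots> = (\<Sum>c\<in>C. (b c)\<^sup>2)"
    using assms(1) by (intro sum.cong refl) simp
  finally show ?thesis by (simp add: b_def)
qed

lemma onb_index_bessel:
  assumes "finite C" "finite X" "onb_index C X q"
  shows "(\<Sum>c\<in>C. (\<Sum>y\<in>X. f y * q c y)\<^sup>2) \<le> (\<Sum>x\<in>X. (f x)\<^sup>2)"
proof -
  have "0 \<le> (\<Sum>x\<in>X. (f x - (\<Sum>c\<in>C. (\<Sum>y\<in>X. f y * q c y) * q c x))\<^sup>2)" by (intro sum_nonneg) simp
  then show ?thesis unfolding onb_index_pythagoras[OF assms] by simp
qed

section \<open>Multi-indices and unfoldings\<close>

lemma sum_PiE_insert: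
  assumes "n \<notin> K"
  shows "(\<Sum>i\<in>(\<Pi>\<^sub>E k\<in>insert n K. D k). f i) = (\<Sum>a\<in>D n. \<Sum>y\<in>(\<Pi>\<^sub>E k\<in>K. D k). f (y(n := a)))"
  unfolding PiE_insert_eq sum.reindex[OF inj_combinator[OF assms]]
  by (simp add: sum.cartesian_product split_beta comp_def)

lemma sum_PiE_remove:
  assumes "n \<in> K"
  shows "(\<Sum>i\<in>(\<Pi>\<^sub>E k\<in>K. D k). f i) = (\<Sum>a\<in>D n. \<Sum>y\<in>(\<Pi>\<^sub>E k\<in>K - {n}. D k). f (y(n := a)))"
proof -
  have "insert n (K - {n}) = K" using assms by auto
  then show ?thesis using sum_PiE_insert[where n = n and K = "K - {n}" and D = D and f = f] by simp
qed

text \<open>A mixed radix expansion.\<close>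

lemma fiber_index_bij:
  assumes pos: "\<And>k. k \<in> {1..N} \<Longrightarrow> 0 < d k"
  shows "bij_betw (fiber_index N d n) {..<unfold_cols N d n} (\<Pi>\<^sub>E k\<in>{1..N} - {n}. {..<d k})"
proof -
  \<comment> \<open>Equal digits up to mode \<open>M\<close> give equal residues modulo the product
    of these dimensions; once all modes are included, the residues are the column numbers
    themselves.\<close>
  have mod_eq: "j mod (\<Prod>k\<in>{1..M} - {n}. d k) = j' mod (\<Prod>k\<in>{1..M} - {n}. d k)"
    if "\<And>k. k \<in> {1..M} - {n} \<Longrightarrow>
      (j div (\<Prod>m\<in>{1..<k} - {n}. d m)) mod d k = (j' div (\<Prod>m\<in>{1..<k} - {n}. d m)) mod d k" for M j j'
    using that
  proof (induction M)
    case 0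
    then show ?case by simp
  next
    case (Suc M)
    have IH: "j mod (\<Prod>k\<in>{1..M} - {n}. d k) = j' mod (\<Prod>k\<in>{1..M} - {n}. d k)"
      by (rule Suc(1)) (rule Suc(2), auto)
    show ?case
    proof (cases "Suc M = n")
      case True
      then have E: "{1..Suc M} - {n} = {1..M} - {n}" by auto
      show ?thesis unfolding E by (rule IH)
    next
      case False
      define P where "P = (\<Prod>k\<in>{1..M} - {n}. d k)"
      have "{1..Suc M} - {n} = insert (Suc M) ({1..M} - {n})" using False by auto
      then have eq: "(\<Prod>k\<in>{1..Suc M} - {n}. d k) = P * d (Suc M)" by (simp add: P_def mult.commute)
      have W: "{1..<Suc M} - {n} = {1..M} - {n}" by auto
      have "Suc M \<in> {1..Suc M} - {n}" using False by simp
      from Suc(2)[OF this] have D: "(j div P) mod d (Suc M) = (j' div P) mod d (Suc M)"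
        unfolding W P_def .
      show ?thesis unfolding eq mod_mult2_eq D IH[folded P_def] ..
    qed
  qed
  have inj: "inj_on (fiber_index N d n) {..<unfold_cols N d n}"
  proof (rule inj_onI)
    fix j j' assume j: "j \<in> {..<unfold_cols N d n}" "j' \<in> {..<unfold_cols N d n}"
      and eq: "fiber_index N d n j = fiber_index N d n j'"
    have "j mod (\<Prod>k\<in>{1..N} - {n}. d k) = j' mod (\<Prod>k\<in>{1..N} - {n}. d k)"
    proof (rule mod_eq)
      fix k assume "k \<in> {1..N} - {n}"
      then have "fiber_index N d n i k = (i div (\<Prod>m\<in>{1..<k} - {n}. d m)) mod d k" for i
        unfolding fiber_index_def by (rule restrict_apply')
      from this[of j] this[of j'] show "(j div (\<Prod>m\<in>{1..<k} - {n}. d m)) mod d k = (j' div (\<Prod>m\<in>{1..<k} - {n}. d m)) mod d k"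
        unfolding eq by (rule trans[OF sym])
    qed
    moreover have "j < (\<Prod>k\<in>{1..N} - {n}. d k)" "j' < (\<Prod>k\<in>{1..N} - {n}. d k)"
      using j unfolding unfold_cols_def lessThan_iff .
    ultimately show "j = j'" by (simp only: mod_less)
  qed
  have sub: "fiber_index N d n ` {..<unfold_cols N d n} \<subseteq> (\<Pi>\<^sub>E k\<in>{1..N} - {n}. {..<d k})"
  proof (rule image_subsetI, rule PiE_I)
    fix j k assume "k \<in> {1..N} - {n}"
    then show "fiber_index N d n j k \<in> {..<d k}"
      using pos[of k] unfolding fiber_index_def restrict_apply'[OF \<open>k \<in> {1..N} - {n}\<close>] by simp
  qed (simp only: fiber_index_def restrict_apply if_False)
  \<comment> \<open>Surjectivity by counting: source and target have the same size.\<close>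
  have "card (fiber_index N d n ` {..<unfold_cols N d n}) = card (\<Pi>\<^sub>E k\<in>{1..N} - {n}. {..<d k})"
    unfolding card_image[OF inj] by (subst card_PiE) (auto simp: unfold_cols_def)
  then have "fiber_index N d n ` {..<unfold_cols N d n} = (\<Pi>\<^sub>E k\<in>{1..N} - {n}. {..<d k})"
    by (rule card_subset_eq[OF finite_PiE[OF finite_Diff[OF finite_atLeastAtMost] finite_lessThan] sub])
  with inj show ?thesis unfolding bij_betw_def by (rule conjI)
qed

lemma sum_unfold_cols:
  assumes "\<And>k. k \<in> {1..N} \<Longrightarrow> 0 < d k"
  shows "(\<Sum>j<unfold_cols N d n. f (fiber_index N d n j)) = (\<Sum>y\<in>(\<Pi>\<^sub>E k\<in>{1..N} - {n}. {..<d k}). f y)"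
  by (rule sum.reindex_bij_betw[OF fiber_index_bij[OF assms]])

lemma sum_tensor_index:
  assumes n: "n \<in> {1..N}" and pos: "\<And>k. k \<in> {1..N} \<Longrightarrow> 0 < d k"
  shows "(\<Sum>i\<in>tensor_index N d. f i) = (\<Sum>a<d n. \<Sum>j<unfold_cols N d n. f ((fiber_index N d n j)(n := a)))"
  unfolding tensor_index_def sum_PiE_remove[OF n]
  by (intro sum.cong refl sum_unfold_cols[where f = "\<lambda>y. f (y(n := _))", symmetric] pos) auto

lemma unfolding_mat_carrier [simp]: "unfolding_mat N d n A \<in> carrier_mat (d n) (unfold_cols N d n)"
  by (simp add: unfolding_mat_def)

lemma frob_norm_unfolding:
  assumes n: "n \<in> {1..N}" and pos: "\<And>k. k \<in> {1..N} \<Longrightarrow> 0 < d k"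
  shows "(frob_norm (unfolding_mat N d n A))\<^sup>2 = (tensor_norm N d A)\<^sup>2"
proof -
  have "(frob_norm (unfolding_mat N d n A))\<^sup>2 = (\<Sum>a<d n. \<Sum>j<unfold_cols N d n. (A ((fiber_index N d n j)(n := a)))\<^sup>2)"
    unfolding frob_norm_sq[OF unfolding_mat_carrier]
    by (intro sum.cong refl) (simp add: unfolding_mat_def)
  also have "\<dots> = (\<Sum>i\<in>tensor_index N d. (A i)\<^sup>2)"
    by (rule sum_tensor_index[OF n, symmetric]) (rule pos)
  finally have "(frob_norm (unfolding_mat N d n A))\<^sup>2 = (\<Sum>i\<in>tensor_index N d. (A i)\<^sup>2)" .
  then show ?thesis by (simp add: tensor_norm_def sum_nonneg)
qed

section \<open>Mode products\<close>

definition override :: "nat \<Rightarrow> (nat \<Rightarrow> nat) \<Rightarrow> (nat \<Rightarrow> nat) \<Rightarrow> nat \<Rightarrow> nat" where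
  "override n j i = (\<lambda>k. if k \<in> {1..n} then j k else i k)"

text \<open>The recursion flattened into one sum over multi-indices. In this form an entry is
  visibly a polynomial in the entries of the factors, and the products of column entries that
  describe the approximation appear.\<close>

lemma mode_prods_eq:
  "mode_prods A B n i = (\<Sum>j\<in>(\<Pi>\<^sub>E k\<in>{1..n}. {..<dim_col (B k)}). A (override n j i) * (\<Prod>k\<in>{1..n}. B k $$ (i k, j k)))"
proof (induction n arbitrary: i)
  case 0
  then show ?case by (simp add: override_def)
next
  case (Suc n)
  have ins: "{1..Suc n} = insert (Suc n) {1..n}" by auto
  have notin: "Suc n \<notin> {1..n}" by simp
  have "mode_prods A B (Suc n) i = (\<Sum>a<dim_col (B (Suc n)). mode_prods A B n (i(Suc n := a)) * B (Suc n) $$ (i (Suc n), a))"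
    by (simp add: mode_prod_def)
  also have "\<dots> = (\<Sum>a<dim_col (B (Suc n)). \<Sum>j\<in>(\<Pi>\<^sub>E k\<in>{1..n}. {..<dim_col (B k)}).
     A (override (Suc n) (j(Suc n := a)) i) * (\<Prod>k\<in>{1..Suc n}. B k $$ (i k, (j(Suc n := a)) k)))"
  proof (intro sum.cong refl)
    fix a
    have "A (override n j (i(Suc n := a))) * (\<Prod>k\<in>{1..n}. B k $$ ((i(Suc n := a)) k, j k)) * B (Suc n) $$ (i (Suc n), a) =
      A (override (Suc n) (j(Suc n := a)) i) * (\<Prod>k\<in>{1..Suc n}. B k $$ (i k, (j(Suc n := a)) k))" for j
    proof -
      have "override n j (i(Suc n := a)) = override (Suc n) (j(Suc n := a)) i"
        by (auto simp: override_def fun_eq_iff)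
      moreover have "(\<Prod>k\<in>{1..n}. B k $$ ((i(Suc n := a)) k, j k)) = (\<Prod>k\<in>{1..n}. B k $$ (i k, (j(Suc n := a)) k))"
        by (intro prod.cong) auto
      ultimately show ?thesis unfolding ins prod.insert[OF finite_atLeastAtMost notin] by (simp add: mult_ac)
    qed
    then show "mode_prods A B n (i(Suc n := a)) * B (Suc n) $$ (i (Suc n), a) = (\<Sum>j\<in>(\<Pi>\<^sub>E k\<in>{1..n}. {..<dim_col (B k)}).
     A (override (Suc n) (j(Suc n := a)) i) * (\<Prod>k\<in>{1..Suc n}. B k $$ (i k, (j(Suc n := a)) k)))"
      unfolding Suc.IH sum_distrib_right by (intro sum.cong refl)
  qed
  also have "\<dots> = (\<Sum>j\<in>(\<Pi>\<^sub>E k\<in>{1..Suc n}. {..<dim_col (B k)}). A (override (Suc n) j i) * (\<Prod>k\<in>{1..Suc n}. B k $$ (i k, j k)))"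
    unfolding ins sum_PiE_insert[OF notin] ..
  finally show ?case .
qed

text \<open>Products in modes other than \<open>n\<close> leave index \<open>n\<close> alone, so a
  linear form in mode \<open>n\<close> may be applied first. This moves a row of a left factor in
  front of the compression.\<close>

lemma mode_prods_contract:
  "n \<notin> {1..n'} \<Longrightarrow>
    mode_prods (\<lambda>x. \<Sum>i\<in>S. z i * A (x(n := i))) B n' x = (\<Sum>i\<in>S. z i * mode_prods A B n' (x(n := i)))"
proof (induction n' arbitrary: x)
  case 0
  then show ?case by simp
next
  case (Suc n')
  then have n: "n \<notin> {1..n'}" "n \<noteq> Suc n'" by auto
  have "mode_prods (\<lambda>x. \<Sum>i\<in>S. z i * A (x(n := i))) B (Suc n') x =
    (\<Sum>k<dim_col (B (Suc n')). \<Sum>i\<in>S. z i * mode_prods A B n' (x(Suc n' := k, n := i)) * B (Suc n') $$ (x (Suc n'), k))"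
    by (simp only: mode_prods.simps mode_prod_def Suc.IH[OF n(1)] sum_distrib_right)
  also have "\<dots> = (\<Sum>i\<in>S. \<Sum>k<dim_col (B (Suc n')). z i * mode_prods A B n' (x(n := i, Suc n' := k)) * B (Suc n') $$ (x (Suc n'), k))"
    using n(2) by (subst sum.swap) (simp only: fun_upd_twist[OF n(2)])
  also have "\<dots> = (\<Sum>i\<in>S. z i * mode_prods A B (Suc n') (x(n := i)))"
    using n(2) by (simp only: mode_prods.simps mode_prod_def sum_distrib_left mult.assoc fun_upd_other not_False_eq_True)
  finally show ?case .
qed

section \<open>Error of a compressed tensor\<close>

locale compressed_tensor =
  fixes N :: nat and I \<mu> :: "nat \<Rightarrow> nat" and A :: tensor and Q :: "nat \<Rightarrow> real mat"
  assumes pos: "\<And>k. k \<in> {1..N} \<Longrightarrow> 0 < I k \<and> 0 < \<mu> k"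
    and orth: "\<And>k. k \<in> {1..N} \<Longrightarrow> orthonormal_mat (I k) (\<mu> k) (Q k)"
begin

lemma carrier: "k \<in> {1..N} \<Longrightarrow> Q k \<in> carrier_mat (I k) (\<mu> k)"
  using orthonormal_mat.Q[OF orth] .

lemma step_dims_pos: "k \<in> {1..N} \<Longrightarrow> 0 < step_dims I \<mu> n k"
  using pos by (simp add: step_dims_def)

abbreviation "core n \<equiv> mode_prods A (\<lambda>k. transpose_mat (Q k)) n"

lemma onb_index_Q:
  assumes "k \<in> {1..N}"
  shows "onb_index {..<\<mu> k} {..<I k} (\<lambda>c a. Q k $$ (a, c))"
  using orthonormal_mat.orthonormal_family_colf[OF orth[OF assms]]
  by (auto simp: onb_index_def orthonormal_family_def ip_def colf_def)

text \<open>Mode by mode, multiplication by \<open>Q\<^sup>T\<close> does not increase the norm, by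
  Bessel along the fibers of that mode. Mode \<open>n\<close> is missing from the index set because
  \<open>F\<close> will already have summed it away; \<open>step_dims\<close> at
  \<open>Suc n'\<close> describes the state with \<open>n'\<close> modes compressed.\<close>

lemma mode_prod_norm_le:
  assumes n: "n \<in> {1..N}" and n': "n' < n"
  shows "(\<Sum>y\<in>(\<Pi>\<^sub>E k\<in>{1..N} - {n}. {..<step_dims I \<mu> (Suc n') k}). (mode_prods F (\<lambda>k. transpose_mat (Q k)) n' y)\<^sup>2)
    \<le> (\<Sum>y\<in>(\<Pi>\<^sub>E k\<in>{1..N} - {n}. {..<I k}). (F y)\<^sup>2)"
  using n'
proof (induction n')
  case 0
  have "(\<Pi>\<^sub>E k\<in>{1..N} - {n}. {..<step_dims I \<mu> (Suc 0) k}) = (\<Pi>\<^sub>E k\<in>{1..N} - {n}. {..<I k})"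
    by (intro PiE_cong) (auto simp: step_dims_def)
  then show ?case by simp
next
  case (Suc n')
  let ?X = "mode_prods F (\<lambda>k. transpose_mat (Q k)) n'"
  let ?k = "Suc n'"
  have k: "?k \<in> {1..N}" "?k \<in> {1..N} - {n}" using Suc n by auto
  let ?K = "{1..N} - {n} - {?k}"
  have eqK: "(\<Pi>\<^sub>E k\<in>?K. {..<step_dims I \<mu> (Suc ?k) k}) = (\<Pi>\<^sub>E k\<in>?K. {..<step_dims I \<mu> ?k k})"
    by (intro PiE_cong) (auto simp: step_dims_def)
  have dims: "step_dims I \<mu> (Suc ?k) ?k = \<mu> ?k" "step_dims I \<mu> ?k ?k = I ?k"
    by (auto simp: step_dims_def)
  have "(\<Sum>y\<in>(\<Pi>\<^sub>E k\<in>{1..N} - {n}. {..<step_dims I \<mu> (Suc ?k) k}). (mode_prods F (\<lambda>k. transpose_mat (Q k)) ?k y)\<^sup>2)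
    = (\<Sum>c<\<mu> ?k. \<Sum>y\<in>(\<Pi>\<^sub>E k\<in>?K. {..<step_dims I \<mu> ?k k}). (mode_prod ?X ?k (transpose_mat (Q ?k)) (y(?k := c)))\<^sup>2)"
    unfolding sum_PiE_remove[OF k(2)] dims eqK by simp
  also have "\<dots> = (\<Sum>c<\<mu> ?k. \<Sum>y\<in>(\<Pi>\<^sub>E k\<in>?K. {..<step_dims I \<mu> ?k k}). (\<Sum>a<I ?k. ?X (y(?k := a)) * Q ?k $$ (a, c))\<^sup>2)"
    using carrier_matD[OF carrier[OF k(1)]] by (intro sum.cong refl) (simp add: mode_prod_def)
  also have "\<dots> = (\<Sum>y\<in>(\<Pi>\<^sub>E k\<in>?K. {..<step_dims I \<mu> ?k k}). \<Sum>c<\<mu> ?k. (\<Sum>a<I ?k. ?X (y(?k := a)) * Q ?k $$ (a, c))\<^sup>2)"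
    by (rule sum.swap)
  also have "\<dots> \<le> (\<Sum>y\<in>(\<Pi>\<^sub>E k\<in>?K. {..<step_dims I \<mu> ?k k}). \<Sum>a<I ?k. (?X (y(?k := a)))\<^sup>2)"
    by (intro sum_mono onb_index_bessel onb_index_Q k(1)) auto
  also have "\<dots> = (\<Sum>a<I ?k. \<Sum>y\<in>(\<Pi>\<^sub>E k\<in>?K. {..<step_dims I \<mu> ?k k}). (?X (y(?k := a)))\<^sup>2)"
    by (rule sum.swap)
  also have "\<dots> = (\<Sum>y\<in>(\<Pi>\<^sub>E k\<in>{1..N} - {n}. {..<step_dims I \<mu> ?k k}). (?X y)\<^sup>2)"
    unfolding sum_PiE_remove[OF k(2)] dims ..
  also have "\<dots> \<le> (\<Sum>y\<in>(\<Pi>\<^sub>E k\<in>{1..N} - {n}. {..<I k}). (F y)\<^sup>2)"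
    using Suc by simp
  finally show ?case .
qed

lemma step_unfolding_carrier: "step_unfolding N I \<mu> A Q n \<in> carrier_mat (I n) (step_cols N I \<mu> n)"
  by (simp add: step_unfolding_def step_cols_def unfolding_mat_def step_dims_def)

text \<open>Each row of \<open>Z B\<close> is a compression of the corresponding row of
  \<open>Z A\<^sub>(\<^sub>n\<^sub>)\<close>, both read as tensors in the remaining modes. The two
  sides enumerate columns differently, which the norm does not see.\<close>

lemma frob_norm_mult_step_unfolding_le:
  assumes n: "n \<in> {1..N}" and Z: "Z \<in> carrier_mat r (I n)"
  shows "frob_norm (Z * step_unfolding N I \<mu> A Q n) \<le> frob_norm (Z * unfolding_mat N I n A)"
proof (rule power2_le_imp_le)
  let ?d = "step_dims I \<mu> n"
  have posI: "\<And>k. k \<in> {1..N} \<Longrightarrow> 0 < I k" using pos by blast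
  have dn: "?d n = I n" by (simp add: step_dims_def)
  have UM: "unfolding_mat N I n A \<in> carrier_mat (I n) (unfold_cols N I n)" by simp
  have sc: "step_cols N I \<mu> n = unfold_cols N ?d n" by (simp add: step_cols_def)
  define F where "F = (\<lambda>a x. \<Sum>i<I n. Z $$ (a, i) * A (x(n := i)))"
  have "(frob_norm (Z * step_unfolding N I \<mu> A Q n))\<^sup>2 =
    (\<Sum>a<r. \<Sum>j<unfold_cols N ?d n. (mode_prods (F a) (\<lambda>k. transpose_mat (Q k)) (n - 1) (fiber_index N ?d n j))\<^sup>2)"
    unfolding frob_norm_sq[OF mult_carrier_mat[OF Z step_unfolding_carrier]] sc
  proof (intro sum.cong refl)
    fix a j assume aj: "a \<in> {..<r}" "j \<in> {..<unfold_cols N ?d n}"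
    have "(Z * step_unfolding N I \<mu> A Q n) $$ (a, j) = (\<Sum>i<I n. Z $$ (a, i) * step_unfolding N I \<mu> A Q n $$ (i, j))"
      using aj by (intro mult_entry[OF Z step_unfolding_carrier]) (auto simp: sc)
    also have "\<dots> = (\<Sum>i<I n. Z $$ (a, i) * core (n - 1) ((fiber_index N ?d n j)(n := i)))"
      using aj by (intro sum.cong refl) (simp add: step_unfolding_def unfolding_mat_def dn)
    also have "\<dots> = mode_prods (F a) (\<lambda>k. transpose_mat (Q k)) (n - 1) (fiber_index N ?d n j)"
      unfolding F_def by (rule mode_prods_contract[symmetric]) (use n in auto)
    finally show "((Z * step_unfolding N I \<mu> A Q n) $$ (a, j))\<^sup>2 =
      (mode_prods (F a) (\<lambda>k. transpose_mat (Q k)) (n - 1) (fiber_index N ?d n j))\<^sup>2" by (simp only:)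
  qed
  also have "\<dots> = (\<Sum>a<r. \<Sum>y\<in>(\<Pi>\<^sub>E k\<in>{1..N} - {n}. {..<?d k}). (mode_prods (F a) (\<lambda>k. transpose_mat (Q k)) (n - 1) y)\<^sup>2)"
    by (intro sum.cong refl sum_unfold_cols[where f = "\<lambda>y. (mode_prods _ _ _ y)\<^sup>2"] step_dims_pos)
  also have "\<dots> \<le> (\<Sum>a<r. \<Sum>y\<in>(\<Pi>\<^sub>E k\<in>{1..N} - {n}. {..<I k}). (F a y)\<^sup>2)"
    using mode_prod_norm_le[OF n, of "n - 1"] n by (intro sum_mono) auto
  also have "\<dots> = (\<Sum>a<r. \<Sum>j<unfold_cols N I n. (F a (fiber_index N I n j))\<^sup>2)"
    by (intro sum.cong refl sum_unfold_cols[where f = "\<lambda>y. (F _ y)\<^sup>2", symmetric] posI)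
  also have "\<dots> = (frob_norm (Z * unfolding_mat N I n A))\<^sup>2"
    unfolding frob_norm_sq[OF mult_carrier_mat[OF Z UM]]
  proof (intro sum.cong refl)
    fix a j assume aj: "a \<in> {..<r}" "j \<in> {..<unfold_cols N I n}"
    have "(Z * unfolding_mat N I n A) $$ (a, j) = (\<Sum>i<I n. Z $$ (a, i) * unfolding_mat N I n A $$ (i, j))"
      using aj by (intro mult_entry[OF Z UM]) auto
    also have "\<dots> = F a (fiber_index N I n j)"
      using aj unfolding F_def by (intro sum.cong refl) (simp add: unfolding_mat_def)
    finally show "(F a (fiber_index N I n j))\<^sup>2 = ((Z * unfolding_mat N I n A) $$ (a, j))\<^sup>2" by (simp only:)
  qed
  finally show "(frob_norm (Z * step_unfolding N I \<mu> A Q n))\<^sup>2 \<le> (frob_norm (Z * unfolding_mat N I n A))\<^sup>2" .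
qed (rule frob_norm_nonneg)

text \<open>Squared norm of the tensor entering step \<open>n\<close>: consecutive differences are
  the losses of the single steps, and \<open>energy (Suc N)\<close> belongs to the final
  core.\<close>

definition energy :: "nat \<Rightarrow> real" where
  "energy n = (tensor_norm N (step_dims I \<mu> n) (core (n - 1)))\<^sup>2"

lemma frob_norm_res_step:
  assumes n: "n \<in> {1..N}"
  shows "(frob_norm (res (Q n) (step_unfolding N I \<mu> A Q n)))\<^sup>2 = energy n - energy (Suc n)"
proof -
  interpret orthonormal_mat "I n" "\<mu> n" "Q n" by (rule orth[OF n])
  let ?d = "step_dims I \<mu> n" and ?d' = "step_dims I \<mu> (Suc n)"
  have dn: "?d n = I n" "?d' n = \<mu> n" by (simp_all add: step_dims_def)
  \<comment> \<open>The dimension of mode \<open>n\<close> itself changes between the two tensors,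
    but neither the enumeration of its fibers nor their number involves it.\<close>
  have fib: "fiber_index N ?d' n = fiber_index N ?d n"
  proof -
    have "(\<Prod>m\<in>{1..<k} - {n}. ?d' m) = (\<Prod>m\<in>{1..<k} - {n}. ?d m)" for k
      by (intro prod.cong) (auto simp: step_dims_def)
    then show ?thesis
      by (auto simp: fiber_index_def fun_eq_iff step_dims_def)
  qed
  have cols: "unfold_cols N ?d' n = unfold_cols N ?d n"
    unfolding unfold_cols_def by (intro prod.cong) (auto simp: step_dims_def)
  have B: "step_unfolding N I \<mu> A Q n \<in> carrier_mat (I n) (unfold_cols N ?d n)"
    using step_unfolding_carrier[of n] by (simp add: step_cols_def)
  have e1: "(frob_norm (step_unfolding N I \<mu> A Q n))\<^sup>2 = energy n"
    unfolding step_unfolding_def energy_def by (rule frob_norm_unfolding[OF n step_dims_pos])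
  have "(frob_norm (transpose_mat (Q n) * step_unfolding N I \<mu> A Q n))\<^sup>2 =
    (\<Sum>c<\<mu> n. \<Sum>j<unfold_cols N ?d n. (\<Sum>a<I n. Q n $$ (a, c) * step_unfolding N I \<mu> A Q n $$ (a, j))\<^sup>2)"
    by (rule frob_norm_QtX_sq[OF B])
  also have "\<dots> = (\<Sum>c<\<mu> n. \<Sum>j<unfold_cols N ?d n. (core n ((fiber_index N ?d n j)(n := c)))\<^sup>2)"
  proof (intro sum.cong refl)
    fix c j assume cj: "c \<in> {..<\<mu> n}" "j \<in> {..<unfold_cols N ?d n}"
    have entry: "step_unfolding N I \<mu> A Q n $$ (a, j) = core (n - 1) ((fiber_index N ?d n j)(n := a))" if "a < I n" for a
      using that cj by (simp add: step_unfolding_def unfolding_mat_def dn)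
    obtain n' where n': "n = Suc n'" using n by (cases n) auto
    have "core n ((fiber_index N ?d n j)(n := c)) =
       (\<Sum>a<I n. core n' ((fiber_index N ?d n j)(n := c, n := a)) * transpose_mat (Q n) $$ (c, a))"
      unfolding n' using carrier_matD[OF Q] by (simp add: mode_prod_def n')
    also have "\<dots> = (\<Sum>a<I n. Q n $$ (a, c) * step_unfolding N I \<mu> A Q n $$ (a, j))"
      using cj carrier_matD[OF Q] by (intro sum.cong refl) (simp add: entry, simp add: n')
    finally show "(\<Sum>a<I n. Q n $$ (a, c) * step_unfolding N I \<mu> A Q n $$ (a, j))\<^sup>2 =
      (core n ((fiber_index N ?d n j)(n := c)))\<^sup>2" by (simp only:)
  qed
  also have "\<dots> = energy (Suc n)"
  proof -
    have "(\<Sum>i\<in>tensor_index N ?d'. (core n i)\<^sup>2) = (\<Sum>a<?d' n. \<Sum>j<unfold_cols N ?d' n. (core n ((fiber_index N ?d' n j)(n := a)))\<^sup>2)"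
      by (rule sum_tensor_index[OF n]) (rule step_dims_pos)
    then show ?thesis by (simp add: energy_def tensor_norm_def sum_nonneg dn fib cols)
  qed
  finally show ?thesis unfolding frob_norm_res_sq[OF B] e1 by simp
qed

lemma tensor_index_fin: "finite (tensor_index N d)"
  unfolding tensor_index_def by (intro finite_PiE) auto

text \<open>The approximation is the orthogonal projection of the tensor on the span of the rank-one
  tensors built from columns of the \<open>Q k\<close>, and the core holds the coefficients;
  Pythagoras then gives the error.\<close>

lemma approx_error:
  "(tensor_norm N I (\<lambda>i. A i - hosvd_approx N A Q i))\<^sup>2 = (tensor_norm N I A)\<^sup>2 - energy (Suc N)"
proof -
  define q where "q = (\<lambda>c i. \<Prod>k\<in>{1..N}. Q k $$ (i k, c k))"
  let ?X = "tensor_index N I" and ?C = "tensor_index N \<mu>"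
  have q: "onb_index ?C ?X q"
    unfolding onb_index_def
  proof (intro ballI)
    fix c c' assume c: "c \<in> ?C" "c' \<in> ?C"
    have "(\<Sum>i\<in>?X. q c i * q c' i) = (\<Sum>i\<in>?X. \<Prod>k\<in>{1..N}. Q k $$ (i k, c k) * Q k $$ (i k, c' k))"
      by (simp add: q_def prod.distrib)
    also have "\<dots> = (\<Prod>k\<in>{1..N}. \<Sum>a<I k. Q k $$ (a, c k) * Q k $$ (a, c' k))"
      unfolding tensor_index_def by (rule prod_sum_PiE[symmetric]) auto
    also have "\<dots> = (\<Prod>k\<in>{1..N}. if c k = c' k then 1 else 0)"
    proof (rule prod.cong[OF refl])
      fix k assume k: "k \<in> {1..N}"
      then have "c k < \<mu> k" "c' k < \<mu> k" using c by (auto simp: tensor_index_def PiE_iff)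
      then show "(\<Sum>a<I k. Q k $$ (a, c k) * Q k $$ (a, c' k)) = (if c k = c' k then 1 else 0)"
        using onb_index_Q[OF k] by (auto simp: onb_index_def)
    qed
    also have "\<dots> = (if c = c' then 1 else 0)"
    proof (cases "c = c'")
      case False
      have "\<exists>k\<in>{1..N}. c k \<noteq> c' k"
      proof (rule ccontr)
        assume "\<not> ?thesis"
        then have "c = c'" using c unfolding tensor_index_def by (intro PiE_ext) auto
        then show False using False by blast
      qed
      then show ?thesis using False by (auto intro!: prod_zero)
    qed simp
    finally show "(\<Sum>i\<in>?X. q c i * q c' i) = (if c = c' then 1 else 0)" .
  qed
  have dimc: "(\<Pi>\<^sub>E k\<in>{1..N}. {..<dim_col (transpose_mat (Q k))}) = ?X"
    "(\<Pi>\<^sub>E k\<in>{1..N}. {..<dim_col (Q k * transpose_mat (Q k))}) = ?X"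
  proof -
    have "dim_row (Q k) = I k" if "k \<in> {1..N}" for k using carrier_matD(1)[OF carrier[OF that]] .
    then show "(\<Pi>\<^sub>E k\<in>{1..N}. {..<dim_col (transpose_mat (Q k))}) = ?X"
      "(\<Pi>\<^sub>E k\<in>{1..N}. {..<dim_col (Q k * transpose_mat (Q k))}) = ?X"
      unfolding tensor_index_def by (auto intro!: PiE_cong)
  qed
  have ov: "override N j i = j" if "i \<in> tensor_index N d" "j \<in> ?X" for i j d
    using that by (auto simp: override_def tensor_index_def PiE_iff extensional_def fun_eq_iff)
  have core: "core N c = (\<Sum>j\<in>?X. A j * q c j)" if c: "c \<in> ?C" for c
    unfolding mode_prods_eq dimc q_def
  proof (intro sum.cong refl)
    fix j assume j: "j \<in> ?X"
    have "(\<Prod>k\<in>{1..N}. transpose_mat (Q k) $$ (c k, j k)) = (\<Prod>k\<in>{1..N}. Q k $$ (j k, c k))"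
    proof (rule prod.cong[OF refl])
      fix k assume k: "k \<in> {1..N}"
      then have "c k < \<mu> k" "j k < I k" using c j by (auto simp: tensor_index_def PiE_iff)
      then show "transpose_mat (Q k) $$ (c k, j k) = Q k $$ (j k, c k)"
        using carrier_matD[OF carrier[OF k]] by simp
    qed
    then show "A (override N j c) * (\<Prod>k\<in>{1..N}. transpose_mat (Q k) $$ (c k, j k)) = A j * (\<Prod>k\<in>{1..N}. Q k $$ (j k, c k))"
      using ov[OF c j] by simp
  qed
  have approx: "hosvd_approx N A Q i = (\<Sum>c\<in>?C. (\<Sum>j\<in>?X. A j * q c j) * q c i)" if i: "i \<in> ?X" for i
  proof -
    have "hosvd_approx N A Q i = (\<Sum>j\<in>?X. A j * (\<Sum>c\<in>?C. q c i * q c j))"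
      unfolding hosvd_approx_def mode_prods_eq dimc
    proof (intro sum.cong refl)
      fix j assume j: "j \<in> ?X"
      have "(\<Prod>k\<in>{1..N}. (Q k * transpose_mat (Q k)) $$ (i k, j k)) = (\<Prod>k\<in>{1..N}. \<Sum>c<\<mu> k. Q k $$ (i k, c) * Q k $$ (j k, c))"
      proof (rule prod.cong[OF refl])
        fix k assume k: "k \<in> {1..N}"
        then have ij: "i k < I k" "j k < I k" using i j by (auto simp: tensor_index_def PiE_iff)
        have "(Q k * transpose_mat (Q k)) $$ (i k, j k) = (\<Sum>c<\<mu> k. Q k $$ (i k, c) * transpose_mat (Q k) $$ (c, j k))"
          by (rule mult_entry[OF carrier[OF k] transpose_carrier_mat[THEN iffD2, OF carrier[OF k]] ij])
        also have "\<dots> = (\<Sum>c<\<mu> k. Q k $$ (i k, c) * Q k $$ (j k, c))"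
          using ij carrier_matD[OF carrier[OF k]] by (intro sum.cong refl) simp
        finally show "(Q k * transpose_mat (Q k)) $$ (i k, j k) = (\<Sum>c<\<mu> k. Q k $$ (i k, c) * Q k $$ (j k, c))" .
      qed
      also have "\<dots> = (\<Sum>c\<in>?C. \<Prod>k\<in>{1..N}. Q k $$ (i k, c k) * Q k $$ (j k, c k))"
        unfolding tensor_index_def by (rule prod_sum_PiE) auto
      also have "\<dots> = (\<Sum>c\<in>?C. q c i * q c j)" by (simp add: q_def prod.distrib)
      finally show "A (override N j i) * (\<Prod>k\<in>{1..N}. (Q k * transpose_mat (Q k)) $$ (i k, j k)) = A j * (\<Sum>c\<in>?C. q c i * q c j)"
        using ov[OF i j] by simp
    qed
    also have "\<dots> = (\<Sum>c\<in>?C. (\<Sum>j\<in>?X. A j * q c j) * q c i)"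
      unfolding sum_distrib_left sum_distrib_right by (subst sum.swap) (simp add: mult_ac)
    finally show ?thesis .
  qed
  have dimsN: "tensor_index N (step_dims I \<mu> (Suc N)) = ?C"
    unfolding tensor_index_def by (intro PiE_cong) (auto simp: step_dims_def)
  have "(tensor_norm N I (\<lambda>i. A i - hosvd_approx N A Q i))\<^sup>2 = (\<Sum>i\<in>?X. (A i - hosvd_approx N A Q i)\<^sup>2)"
    by (simp add: tensor_norm_def sum_nonneg)
  also have "\<dots> = (\<Sum>i\<in>?X. (A i - (\<Sum>c\<in>?C. (\<Sum>j\<in>?X. A j * q c j) * q c i))\<^sup>2)"
    by (intro sum.cong refl) (simp add: approx)
  also have "\<dots> = (\<Sum>i\<in>?X. (A i)\<^sup>2) - (\<Sum>c\<in>?C. (\<Sum>j\<in>?X. A j * q c j)\<^sup>2)"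
    by (rule onb_index_pythagoras[OF tensor_index_fin tensor_index_fin q])
  also have "(\<Sum>c\<in>?C. (\<Sum>j\<in>?X. A j * q c j)\<^sup>2) = energy (Suc N)"
    unfolding energy_def tensor_norm_def dimsN by (simp add: sum_nonneg core)
  also have "(\<Sum>i\<in>?X. (A i)\<^sup>2) = (tensor_norm N I A)\<^sup>2" by (simp add: tensor_norm_def sum_nonneg)
  finally show ?thesis .
qed

theorem error_eq_sum:
  "(tensor_norm N I (\<lambda>i. A i - hosvd_approx N A Q i))\<^sup>2 =
    (\<Sum>n = 1..N. (frob_norm (res (Q n) (step_unfolding N I \<mu> A Q n)))\<^sup>2)"
proof -
  have "tensor_index N (step_dims I \<mu> 1) = tensor_index N I"
    unfolding tensor_index_def by (intro PiE_cong) (auto simp: step_dims_def)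
  then have "energy 1 = (tensor_norm N I A)\<^sup>2" by (simp add: energy_def tensor_norm_def)
  moreover have "(\<Sum>n = 1..N. (frob_norm (res (Q n) (step_unfolding N I \<mu> A Q n)))\<^sup>2) = (\<Sum>n = 1..N. energy n - energy (Suc n))"
    by (intro sum.cong refl frob_norm_res_step)
  moreover have "(\<Sum>n = 1..N. energy n - energy (Suc n)) = energy 1 - energy (Suc N)"
    using sum_Suc_diff[of 1 N "\<lambda>n. - energy n"] by simp
  ultimately show ?thesis unfolding approx_error by simp
qed

lemma error_le: "(tensor_norm N I (\<lambda>i. A i - hosvd_approx N A Q i))\<^sup>2 \<le> (tensor_norm N I A)\<^sup>2"
  unfolding approx_error by (simp add: energy_def)

end

section \<open>Range finding with a Gaussian sketch\<close>

text \<open>Applied with \<open>FF\<close> the measurable functions of a \<open>\<sigma>\<close>-algebra, and with the continuous functions.\<close>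

locale function_algebra =
  fixes S :: "'a set" and FF :: "('a \<Rightarrow> real) set"
  assumes const: "(\<lambda>_. c) \<in> FF"
    and add: "f \<in> FF \<Longrightarrow> g \<in> FF \<Longrightarrow> (\<lambda>x. f x + g x) \<in> FF"
    and mult: "f \<in> FF \<Longrightarrow> g \<in> FF \<Longrightarrow> (\<lambda>x. f x * g x) \<in> FF"
    and cong: "f \<in> FF \<Longrightarrow> (\<And>x. x \<in> S \<Longrightarrow> g x = f x) \<Longrightarrow> g \<in> FF"
begin

lemma sum: "finite J \<Longrightarrow> (\<And>j. j \<in> J \<Longrightarrow> f j \<in> FF) \<Longrightarrow> (\<lambda>x. \<Sum>j\<in>J. f j x) \<in> FF"
  by (induction J rule: finite_induct) (auto intro: const add)

lemma prod: "finite J \<Longrightarrow> (\<And>j. j \<in> J \<Longrightarrow> f j \<in> FF) \<Longrightarrow> (\<lambda>x. \<Prod>j\<in>J. f j x) \<in> FF"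
  by (induction J rule: finite_induct) (auto intro: const mult)

lemma diff:
  assumes "f \<in> FF" "g \<in> FF"
  shows "(\<lambda>x. f x - g x) \<in> FF"
  using add[OF assms(1) mult[OF const[of "-1"] assms(2)]] by simp

definition mat_valued :: "nat \<Rightarrow> nat \<Rightarrow> ('a \<Rightarrow> real mat) \<Rightarrow> bool" where
  "mat_valued m k X \<longleftrightarrow>
     (\<forall>x\<in>S. X x \<in> carrier_mat m k) \<and> (\<forall>i<m. \<forall>j<k. (\<lambda>x. X x $$ (i, j)) \<in> FF)"

lemma mat_valuedI:
  "(\<And>x. x \<in> S \<Longrightarrow> X x \<in> carrier_mat m k) \<Longrightarrow>
   (\<And>i j. i < m \<Longrightarrow> j < k \<Longrightarrow> (\<lambda>x. X x $$ (i, j)) \<in> FF) \<Longrightarrow> mat_valued m k X"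
  by (simp add: mat_valued_def)

lemma mat_valuedD:
  assumes "mat_valued m k X"
  shows "x \<in> S \<Longrightarrow> X x \<in> carrier_mat m k"
    and "i < m \<Longrightarrow> j < k \<Longrightarrow> (\<lambda>x. X x $$ (i, j)) \<in> FF"
  using assms by (simp_all add: mat_valued_def)

lemma mat_valued_const: "A \<in> carrier_mat m k \<Longrightarrow> mat_valued m k (\<lambda>_. A)"
  by (simp add: mat_valued_def const)

lemma mat_valued_mult:
  assumes X: "mat_valued m n X" and Y: "mat_valued n k Y"
  shows "mat_valued m k (\<lambda>x. X x * Y x)"
proof (rule mat_valuedI)
  fix x assume "x \<in> S"
  then show "X x * Y x \<in> carrier_mat m k"
    using mult_carrier_mat mat_valuedD(1)[OF X] mat_valuedD(1)[OF Y] by blast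
next
  fix i j assume ij: "i < m" "j < k"
  show "(\<lambda>x. (X x * Y x) $$ (i, j)) \<in> FF"
  proof (rule cong)
    show "(\<lambda>x. \<Sum>a<n. X x $$ (i, a) * Y x $$ (a, j)) \<in> FF"
      using ij by (intro sum mult mat_valuedD(2)[OF X] mat_valuedD(2)[OF Y]) auto
    show "(X x * Y x) $$ (i, j) = (\<Sum>a<n. X x $$ (i, a) * Y x $$ (a, j))" if "x \<in> S" for x
      by (rule mult_entry[OF mat_valuedD(1)[OF X that] mat_valuedD(1)[OF Y that] ij])
  qed
qed

lemma mat_valued_transpose:
  assumes X: "mat_valued m n X"
  shows "mat_valued n m (\<lambda>x. transpose_mat (X x))"
proof (rule mat_valuedI)
  fix i j assume ij: "i < n" "j < m"
  show "(\<lambda>x. transpose_mat (X x) $$ (i, j)) \<in> FF"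
  proof (rule cong)
    show "(\<lambda>x. X x $$ (j, i)) \<in> FF" by (rule mat_valuedD(2)[OF X ij(2,1)])
    show "transpose_mat (X x) $$ (i, j) = X x $$ (j, i)" if "x \<in> S" for x
      using carrier_matD[OF mat_valuedD(1)[OF X that]] ij by simp
  qed
qed (use mat_valuedD(1)[OF X] in simp)

lemma mat_valued_minus:
  assumes X: "mat_valued m n X" and Y: "mat_valued m n Y"
  shows "mat_valued m n (\<lambda>x. X x - Y x)"
proof (rule mat_valuedI)
  fix i j assume ij: "i < m" "j < n"
  show "(\<lambda>x. (X x - Y x) $$ (i, j)) \<in> FF"
  proof (rule cong)
    show "(\<lambda>x. X x $$ (i, j) - Y x $$ (i, j)) \<in> FF"
      by (intro diff mat_valuedD(2)[OF X ij] mat_valuedD(2)[OF Y ij])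
    show "(X x - Y x) $$ (i, j) = X x $$ (i, j) - Y x $$ (i, j)" if "x \<in> S" for x
      using carrier_matD[OF mat_valuedD(1)[OF Y that]] ij by simp
  qed
qed (rule minus_carrier_mat, rule mat_valuedD(1)[OF Y])

lemma mat_valued_res:
  assumes U: "mat_valued m k U" and X: "mat_valued m n X"
  shows "mat_valued m n (\<lambda>x. res (U x) (X x))"
  unfolding res_def
  by (rule mat_valued_minus[OF X mat_valued_mult[OF U mat_valued_mult[OF mat_valued_transpose[OF U] X]]])

lemma frob_norm_sq_mem:
  assumes X: "mat_valued m n X"
  shows "(\<lambda>x. (frob_norm (X x))\<^sup>2) \<in> FF"
proof (rule cong)
  show "(\<lambda>x. \<Sum>i<m. \<Sum>j<n. X x $$ (i, j) * X x $$ (i, j)) \<in> FF"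
    by (intro sum mult mat_valuedD(2)[OF X]) auto
  show "(frob_norm (X x))\<^sup>2 = (\<Sum>i<m. \<Sum>j<n. X x $$ (i, j) * X x $$ (i, j))" if "x \<in> S" for x
    using frob_norm_sq[OF mat_valuedD(1)[OF X that]] by (simp add: power2_eq_square)
qed

end

lemma function_algebra_measurable: "function_algebra (space M) (borel_measurable M)"
proof
  fix f g :: "'a \<Rightarrow> real"
  show "f \<in> borel_measurable M \<Longrightarrow> (\<And>x. x \<in> space M \<Longrightarrow> g x = f x) \<Longrightarrow> g \<in> borel_measurable M"
    by (subst measurable_cong[where g = f]) auto
qed (auto intro: borel_measurable_add borel_measurable_times)

lemma function_algebra_continuous: "function_algebra UNIV {f. continuous_on UNIV f}"
  by standard (auto intro: continuous_intros cong: continuous_on_cong)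

interpretation meas: function_algebra "space M" "borel_measurable M :: ('a \<Rightarrow> real) set" for M :: "'a measure"
  by (rule function_algebra_measurable)

interpretation cont: function_algebra UNIV "{f :: 'a::topological_space \<Rightarrow> real. continuous_on UNIV f}"
  by (rule function_algebra_continuous)

lemma meas_mat_valued_subalgebra:
  assumes X: "meas.mat_valued F m k X" and F: "subalgebra M F"
  shows "meas.mat_valued M m k X"
proof (rule meas.mat_valuedI)
  show "X x \<in> carrier_mat m k" if "x \<in> space M" for x
    using meas.mat_valuedD(1)[OF X] F that by (simp add: subalgebra_def)
qed (rule measurable_from_subalg[OF F meas.mat_valuedD(2)[OF X]])

text \<open>A Lindeloef argument replaces the measurable selection of a top eigenspace.\<close>

lemma countable_eigenspace_cover:
  assumes \<mu>: "\<mu> \<le> m" and V: "orthonormal_mat m k V" "k \<le> \<mu>" and e: "0 < \<epsilon>"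
  shows "\<exists>U :: nat \<Rightarrow> real mat. (\<forall>i. orthonormal_mat m \<mu> (U i)) \<and>
    (\<forall>X\<in>carrier_mat m n. \<exists>i. (frob_norm (res (U i) X * (transpose_mat X * U i)))\<^sup>2 < \<epsilon> \<and>
       (frob_norm (res (U i) X))\<^sup>2 < (frob_norm (res V X))\<^sup>2 + \<epsilon>)"
proof -
  \<comment> \<open>Matrices are parametrized by real functions on index pairs: that space is second
    countable and entries are continuous on it, as the covering argument requires.\<close>
  define mk where "mk c = mat m n c" for c :: "nat \<times> nat \<Rightarrow> real"
  define good where "good U X \<longleftrightarrow> (frob_norm (res U X * (transpose_mat X * U)))\<^sup>2 < \<epsilon> \<and>
       (frob_norm (res U X))\<^sup>2 < (frob_norm (res V X))\<^sup>2 + \<epsilon>" for U X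
  define Os where "Os U = {c. good U (mk c)}" for U
  have VC: "V \<in> carrier_mat m k" by (rule orthonormal_mat.Q[OF V(1)])
  have mk: "cont.mat_valued m n mk"
    by (rule cont.mat_valuedI) (auto simp: mk_def)
  \<comment> \<open>Exact eigenspaces would give closed conditions; the slack
    \<open>\<epsilon>\<close> in two strict inequalities makes them open.\<close>
  have opn: "open (Os U)" if U: "orthonormal_mat m \<mu> U" for U
  proof -
    have UC: "U \<in> carrier_mat m \<mu>" by (rule orthonormal_mat.Q[OF U])
    have 1: "continuous_on UNIV (\<lambda>c. (frob_norm (res U (mk c) * (transpose_mat (mk c) * U)))\<^sup>2)"
      using cont.frob_norm_sq_mem[OF cont.mat_valued_mult[OF
          cont.mat_valued_res[OF cont.mat_valued_const[OF UC] mk]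
          cont.mat_valued_mult[OF cont.mat_valued_transpose[OF mk] cont.mat_valued_const[OF UC]]]] by simp
    have 2: "continuous_on UNIV (\<lambda>c. (frob_norm (res U (mk c)))\<^sup>2)"
      using cont.frob_norm_sq_mem[OF cont.mat_valued_res[OF cont.mat_valued_const[OF UC] mk]] by simp
    have 3: "continuous_on UNIV (\<lambda>c. (frob_norm (res V (mk c)))\<^sup>2)"
      using cont.frob_norm_sq_mem[OF cont.mat_valued_res[OF cont.mat_valued_const[OF VC] mk]] by simp
    show ?thesis unfolding Os_def good_def
      by (intro open_Collect_conj open_Collect_less 1 2 continuous_on_add 3 continuous_on_const)
  qed
  have ex: "\<exists>U. orthonormal_mat m \<mu> U \<and> good U X" if X: "X \<in> carrier_mat m n" for X
  proof -
    from ex_top_eigenspace[OF X \<mu>] obtain U where U: "orthonormal_mat m \<mu> U"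
      and z: "res U X * (transpose_mat X * U) = 0\<^sub>m m \<mu>"
      and le: "\<forall>k V. orthonormal_mat m k V \<longrightarrow> k \<le> \<mu> \<longrightarrow> frob_norm (res U X) \<le> frob_norm (res V X)"
      by auto
    have "frob_norm (res U X) \<le> frob_norm (res V X)" using le V by blast
    then have "(frob_norm (res U X))\<^sup>2 \<le> (frob_norm (res V X))\<^sup>2" by (intro power_mono) auto
    then have "good U X" using e unfolding good_def z by (simp add: frob_norm_def)
    then show ?thesis using U by blast
  qed
  let ?F = "Os ` {U. orthonormal_mat m \<mu> U}"
  have "\<And>S. S \<in> ?F \<Longrightarrow> open S" using opn by auto
  from Lindelof[OF this] obtain \<F>' where F': "\<F>' \<subseteq> ?F" "countable \<F>'" "\<Union>\<F>' = \<Union>?F" by metis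
  from countable_subset_image[THEN iffD1, OF conjI[OF F'(2,1)]]
  obtain CU where CU: "countable CU" "CU \<subseteq> {U. orthonormal_mat m \<mu> U}" "\<F>' = Os ` CU" by auto
  have cov: "\<exists>U\<in>CU. good U X" if X: "X \<in> carrier_mat m n" for X
  proof -
    have mkX: "mk (\<lambda>p. X $$ p) = X" using X by (auto simp: mk_def)
    from ex[OF X] obtain U where "orthonormal_mat m \<mu> U" "good U X" by blast
    then have "(\<lambda>p. X $$ p) \<in> \<Union>?F" using mkX by (auto simp: Os_def)
    then have "(\<lambda>p. X $$ p) \<in> \<Union>(Os ` CU)" using F'(3) CU(3) by simp
    then show ?thesis using mkX by (auto simp: Os_def)
  qed
  have ne: "CU \<noteq> {}" using cov[of "0\<^sub>m m n"] by auto
  show ?thesis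
  proof (intro exI[of _ "from_nat_into CU"] conjI allI ballI)
    fix i show "orthonormal_mat m \<mu> (from_nat_into CU i)" using from_nat_into[OF ne] CU(2) by auto
  next
    fix X :: "real mat" assume "X \<in> carrier_mat m n"
    from cov[OF this] obtain U where U: "U \<in> CU" "good U X" by blast
    from from_nat_into_surj[OF CU(1) U(1)] obtain i where "from_nat_into CU i = U" by blast
    with U(2) have "good (from_nat_into CU i) X" by simp
    then show "\<exists>i. (frob_norm (res (from_nat_into CU i) X * (transpose_mat X * from_nat_into CU i)))\<^sup>2 < \<epsilon> \<and>
       (frob_norm (res (from_nat_into CU i) X))\<^sup>2 < (frob_norm (res V X))\<^sup>2 + \<epsilon>"
      unfolding good_def by blast
  qed
qed

text \<open>Both residuals are compared through the tail of singular values: that of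
  \<open>Q\<close> is at most the tolerated sketch error, which is at most that of
  \<open>U\<close>.\<close>

lemma admissible_basis:
  assumes Y: "Y \<in> carrier_mat m (\<mu> + K)" and rb: "range_basis \<mu> K Y Q" and U: "orthonormal_mat m \<mu> U"
  shows "orthonormal_mat m \<mu> Q" and "frob_norm (res Q Y) \<le> frob_norm (res U Y)"
proof -
  from rb carrier_matD[OF Y] have QC: "Q \<in> carrier_mat m \<mu>" and "orthonormal Q"
    by (auto simp: range_basis_def)
  then show QO: "orthonormal_mat m \<mu> Q" by (intro orthonormal_matI)
  from rb obtain R where R: "R \<in> carrier_mat \<mu> (\<mu> + K)"
    and le: "frob_norm (Q * R - Y) \<le> sqrt (\<Sum>k = \<mu> + 1..\<mu> + K. (sigma k Y)\<^sup>2)"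
    by (auto simp: range_basis_def)
  note orthonormal_mat.frob_norm_res_le_dist[OF QO Y R]
  also note le
  also have "sqrt (\<Sum>k = \<mu> + 1..\<mu> + K. (sigma k Y)\<^sup>2) \<le> sqrt ((frob_norm (res U Y))\<^sup>2)"
    by (intro real_sqrt_le_mono sum_sigma_tail_le[OF Y U])
  also have "\<dots> = frob_norm (res U Y)" by simp
  finally show "frob_norm (res Q Y) \<le> frob_norm (res U Y)" .
qed

lemma (in prob_space) distr_gaussian_mat:
  assumes G: "standard_gaussian_mat M m l G" and pos: "0 < m" "0 < l"
  shows "(\<lambda>\<omega>. \<lambda>e\<in>{..<m} \<times> {..<l}. G \<omega> $$ e) \<in> M \<rightarrow>\<^sub>M (\<Pi>\<^sub>M e\<in>{..<m} \<times> {..<l}. borel)"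
    and "distr M (\<Pi>\<^sub>M e\<in>{..<m} \<times> {..<l}. borel) (\<lambda>\<omega>. \<lambda>e\<in>{..<m} \<times> {..<l}. G \<omega> $$ e) =
      gauss ({..<m} \<times> {..<l})"
proof -
  let ?E = "{..<m} \<times> {..<l}"
  have rv: "random_variable borel (\<lambda>\<omega>. G \<omega> $$ e)" if "e \<in> ?E" for e
  proof -
    have "distributed M lborel (\<lambda>\<omega>. G \<omega> $$ e) std_normal_density"
      using G that unfolding standard_gaussian_mat_def by blast
    from distributed_measurable[OF this] show ?thesis by simp
  qed
  then show "(\<lambda>\<omega>. \<lambda>e\<in>?E. G \<omega> $$ e) \<in> M \<rightarrow>\<^sub>M (\<Pi>\<^sub>M e\<in>?E. borel)" by (intro measurable_restrict)
  have ne: "?E \<noteq> {}" using pos by auto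
  have iv: "indep_vars (\<lambda>_. borel) (\<lambda>e \<omega>. G \<omega> $$ e) ?E" using G unfolding standard_gaussian_mat_def by blast
  have "distr M (\<Pi>\<^sub>M e\<in>?E. borel) (\<lambda>\<omega>. \<lambda>e\<in>?E. G \<omega> $$ e) = (\<Pi>\<^sub>M e\<in>?E. distr M borel (\<lambda>\<omega>. G \<omega> $$ e))"
    by (rule indep_vars_iff_distr_eq_PiM'[OF ne rv, THEN iffD1, OF _ iv])
  also have "\<dots> = gauss ?E"
  proof (rule PiM_cong[OF refl])
    fix e assume "e \<in> ?E"
    then have "distributed M lborel (\<lambda>\<omega>. G \<omega> $$ e) std_normal_density"
      using G unfolding standard_gaussian_mat_def by blast
    from distributed_distr_eq_density[OF this]
    have "distr M lborel (\<lambda>\<omega>. G \<omega> $$ e) = std_gauss" unfolding std_gauss_def .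
    moreover have "distr M borel (\<lambda>\<omega>. G \<omega> $$ e) = distr M lborel (\<lambda>\<omega>. G \<omega> $$ e)"
      by (rule distr_cong) auto
    ultimately show "distr M borel (\<lambda>\<omega>. G \<omega> $$ e) = std_gauss" by simp
  qed
  finally show "distr M (\<Pi>\<^sub>M e\<in>?E. borel) (\<lambda>\<omega>. \<lambda>e\<in>?E. G \<omega> $$ e) = gauss ?E" .
qed

text \<open>The free parameter \<open>c\<close> trades the size of the right inverse, whose squared norm is at most
  \<open>c \<mu>\<^sup>2\<close>, against the probability that none of that size exists.\<close>

definition sketch_failure :: "nat \<Rightarrow> nat \<Rightarrow> nat \<Rightarrow> real \<Rightarrow> real" where
  "sketch_failure d m l c = (exp 1 / (c * real d)) powr (real d / 2) + (sqrt 2 / exp 1) ^ (m * l)"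

text \<open>The factor \<open>1 + 2 g x\<close> of \<open>residual_bound\<close> with
  \<open>g = 2 sqrt (m l)\<close> and \<open>x = \<mu> sqrt c\<close>.\<close>

definition sketch_factor :: "nat \<Rightarrow> nat \<Rightarrow> nat \<Rightarrow> real \<Rightarrow> real" where
  "sketch_factor m l \<mu> c = 1 + 4 * real \<mu> * sqrt (real (m * l) * c)"

text \<open>The distance threshold \<open>1 / (c \<mu>)\<close> puts \<open>\<mu>\<close> to the
  power \<open>- d / 2\<close> into the probability for each row. As \<open>d \<ge> 2\<close>, this
  outweighs the factor \<open>\<mu>\<close> of the union bound.\<close>

lemma emeasure_bad_sketch_le:
  assumes U: "orthonormal_mat m \<mu> U" and d: "\<mu> + d \<le> l + 1" "2 \<le> d" and c: "0 < c" and \<mu>: "0 < \<mu>"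
  shows "emeasure (gauss ({..<m} \<times> {..<l})) (bad_sketch m \<mu> l (1 / (c * real \<mu>)) U) \<le> ennreal (sketch_failure d m l c)"
proof -
  have d0: "0 < d" using d(2) by simp
  have t: "0 < 1 / (c * real \<mu>)" using c \<mu> by simp
  note bad_sketch(2)[OF U d(1) d0 t]
  also have "real \<mu> * (1 / (c * real \<mu>) * exp 1 / real d) powr (real d / 2) \<le> (exp 1 / (c * real d)) powr (real d / 2)"
  proof -
    have e: "1 / (c * real \<mu>) * exp 1 / real d = (exp 1 / (c * real d)) / real \<mu>" using c by (simp add: field_simps)
    have "real \<mu> powr 1 \<le> real \<mu> powr (real d / 2)" using \<mu> d(2) by (intro powr_mono) auto
    then have "real \<mu> / real \<mu> powr (real d / 2) \<le> 1" using \<mu> by (simp add: divide_le_eq)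
    then have "(exp 1 / (c * real d)) powr (real d / 2) * (real \<mu> / real \<mu> powr (real d / 2)) \<le>
      (exp 1 / (c * real d)) powr (real d / 2) * 1" by (intro mult_left_mono) auto
    moreover have "real \<mu> * ((exp 1 / (c * real d)) / real \<mu>) powr (real d / 2) =
      (exp 1 / (c * real d)) powr (real d / 2) * (real \<mu> / real \<mu> powr (real d / 2))"
      using c by (subst powr_divide) auto
    ultimately show ?thesis unfolding e by simp
  qed
  finally show ?thesis unfolding sketch_failure_def by (auto simp: ennreal_leI)
qed

text \<open>On each piece of a countable partition that is determined before \<open>G\<close> is drawn, \<open>U\<close> is constant and
  hence independent of \<open>G\<close>.\<close>

lemma (in prob_space) sketch_tail_eps:
  assumes F: "subalgebra M F"
    and C: "meas.mat_valued F m n C"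
    and G: "standard_gaussian_mat M m (\<mu> + K) G"
    and fresh: "indep_set (sets F)
         (sets (vimage_algebra (space M) (\<lambda>\<omega>. \<lambda>e\<in>{..<m} \<times> {..<\<mu> + K}. G \<omega> $$ e)
           (\<Pi>\<^sub>M e\<in>{..<m} \<times> {..<\<mu> + K}. borel)))"
    and Q: "meas.mat_valued M m \<mu> Q"
    and basis: "\<And>\<omega>. \<omega> \<in> space M \<Longrightarrow> range_basis \<mu> K (C \<omega> * (transpose_mat (C \<omega>) * G \<omega>)) (Q \<omega>)"
    and V: "orthonormal_mat m k V" "k \<le> \<mu>" and \<mu>: "0 < \<mu>" "\<mu> \<le> m" and K: "0 < K"
    and c: "0 < c" and e: "0 < \<epsilon>"
  shows "prob {\<omega> \<in> space M. sketch_factor m (\<mu> + K) \<mu> c * ((frob_norm (res V (C \<omega>)))\<^sup>2 + \<epsilon>\<^sup>2) +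
       \<epsilon> * (sqrt (real \<mu>) + 2 * real \<mu> * sqrt (real (m * (\<mu> + K)) * c) * (1 + sqrt (real \<mu>)))
       < (frob_norm (res (Q \<omega>) (C \<omega>)))\<^sup>2} \<le> sketch_failure (K + 1) m (\<mu> + K) c"
    (is "prob ?S \<le> ?b")
proof -
  define l where "l = \<mu> + K"
  define t where "t = 1 / (c * real \<mu>)"
  define gx where "gx = 2 * real \<mu> * sqrt (real (m * l) * c)"
  let ?E = "{..<m} \<times> {..<l}"
  let ?g = "\<lambda>\<omega>. \<lambda>e\<in>?E. G \<omega> $$ e"
  have VC: "V \<in> carrier_mat m k" by (rule orthonormal_mat.Q[OF V(1)])
  have l: "0 < l" using \<mu> by (simp add: l_def)
  have t: "0 < t" using c \<mu> by (simp add: t_def)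
  have m: "0 < m" using \<mu> by simp
  have spF: "space F = space M" using F by (simp add: subalgebra_def)
  have e2: "0 < \<epsilon>\<^sup>2" using e by simp
  from countable_eigenspace_cover[OF \<mu>(2) V e2, of n]
  obtain U :: "nat \<Rightarrow> real mat" where U': "\<forall>i. orthonormal_mat m \<mu> (U i)"
    and cov': "\<forall>X\<in>carrier_mat m n. \<exists>i. (frob_norm (res (U i) X * (transpose_mat X * U i)))\<^sup>2 < \<epsilon>\<^sup>2 \<and>
       (frob_norm (res (U i) X))\<^sup>2 < (frob_norm (res V X))\<^sup>2 + \<epsilon>\<^sup>2"
    by (elim exE conjE)
  note U = U'[rule_format] and cov = cov'[rule_format]
  define good where "good i \<omega> \<longleftrightarrow> (frob_norm (res (U i) (C \<omega>) * (transpose_mat (C \<omega>) * U i)))\<^sup>2 < \<epsilon>\<^sup>2 \<and>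
       (frob_norm (res (U i) (C \<omega>)))\<^sup>2 < (frob_norm (res V (C \<omega>)))\<^sup>2 + \<epsilon>\<^sup>2" for i \<omega>
  \<comment> \<open>Sorted by the first candidate that fits: a countable partition measurable with
    respect to the information before \<open>G\<close>.\<close>
  define A where "A i = {\<omega> \<in> space F. good i \<omega> \<and> (\<forall>j<i. \<not> good j \<omega>)}" for i
  have good_sets: "{\<omega> \<in> space F. good i \<omega>} \<in> sets F" for i
  proof -
    note UC = orthonormal_mat.Q[OF U[of i]]
    have [measurable]: "(\<lambda>\<omega>. (frob_norm (res (U i) (C \<omega>) * (transpose_mat (C \<omega>) * U i)))\<^sup>2) \<in> borel_measurable F"
      by (rule meas.frob_norm_sq_mem[OF meas.mat_valued_mult[OF
          meas.mat_valued_res[OF meas.mat_valued_const[OF UC] C]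
          meas.mat_valued_mult[OF meas.mat_valued_transpose[OF C] meas.mat_valued_const[OF UC]]]])
    have [measurable]: "(\<lambda>\<omega>. (frob_norm (res (U i) (C \<omega>)))\<^sup>2) \<in> borel_measurable F"
      by (rule meas.frob_norm_sq_mem[OF meas.mat_valued_res[OF meas.mat_valued_const[OF UC] C]])
    have [measurable]: "(\<lambda>\<omega>. (frob_norm (res V (C \<omega>)))\<^sup>2) \<in> borel_measurable F"
      by (rule meas.frob_norm_sq_mem[OF meas.mat_valued_res[OF meas.mat_valued_const[OF VC] C]])
    show ?thesis unfolding good_def by measurable
  qed
  have A_sets: "A i \<in> sets F" for i
  proof -
    have "A i = {\<omega> \<in> space F. good i \<omega>} - (\<Union>j<i. {\<omega> \<in> space F. good j \<omega>})"
      by (auto simp: A_def)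
    also have "\<dots> \<in> sets F" by (intro sets.Diff sets.finite_UN good_sets) auto
    finally show ?thesis .
  qed
  have A_M: "A i \<in> events" for i using A_sets F by (auto simp: subalgebra_def)
  have A_disj: "disjoint_family A"
    unfolding disjoint_family_on_def
  proof (intro ballI impI)
    fix i j :: nat assume "i \<noteq> j"
    then have "i < j \<or> j < i" by linarith
    then show "A i \<inter> A j = {}" unfolding A_def by blast
  qed
  have A_cov: "\<exists>i. \<omega> \<in> A i" if w: "\<omega> \<in> space M" for \<omega>
  proof -
    from cov[OF meas.mat_valuedD(1)[OF C]] w have "\<exists>i. good i \<omega>" by (simp add: good_def spF)
    then have "\<exists>i. good i \<omega> \<and> (\<forall>j<i. \<not> good j \<omega>)" by (rule exists_least_iff[THEN iffD1])
    then show ?thesis using w by (auto simp: A_def spF)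
  qed
  define Bd where "Bd i = ?g -` bad_sketch m \<mu> l t (U i) \<inter> space M" for i
  have gm: "?g \<in> M \<rightarrow>\<^sub>M (\<Pi>\<^sub>M e\<in>?E. borel)" and gd: "distr M (\<Pi>\<^sub>M e\<in>?E. borel) ?g = gauss ?E"
    using distr_gaussian_mat[OF G m] l unfolding l_def by auto
  have sg: "sets (\<Pi>\<^sub>M e\<in>?E. (borel :: real measure)) = sets (gauss ?E)"
    by (intro sets_PiM_cong) (auto simp: std_gauss_def)
  have d: "\<mu> + (K + 1) \<le> l + 1" "0 < K + 1" "2 \<le> K + 1" using K by (auto simp: l_def)
  have bs: "bad_sketch m \<mu> l t (U i) \<in> sets (\<Pi>\<^sub>M e\<in>?E. borel)" for i
    unfolding sg by (rule bad_sketch(1)[OF U d(1,2) t])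
  have Bd_M: "Bd i \<in> events" for i unfolding Bd_def by (rule measurable_sets[OF gm bs])
  have b0: "0 \<le> ?b" by (simp add: sketch_failure_def)
  have Bd_le: "prob (Bd i) \<le> ?b" for i
  proof -
    have "emeasure M (Bd i) = emeasure (gauss ?E) (bad_sketch m \<mu> l t (U i))"
      unfolding Bd_def gd[symmetric] by (rule emeasure_distr[OF gm bs, symmetric])
    also have "\<dots> \<le> ennreal ?b"
      unfolding t_def l_def[symmetric] by (rule emeasure_bad_sketch_le[OF U d(1,3) c \<mu>(1)])
    finally show ?thesis unfolding emeasure_eq_measure by (simp only: ennreal_le_iff b0)
  qed
  have ind: "prob (A i \<inter> Bd i) = prob (A i) * prob (Bd i)" for i
  proof (rule indep_setD[OF fresh A_sets])
    show "Bd i \<in> sets (vimage_algebra (space M) (\<lambda>\<omega>. \<lambda>e\<in>{..<m} \<times> {..<\<mu> + K}. G \<omega> $$ e) (\<Pi>\<^sub>M e\<in>{..<m} \<times> {..<\<mu> + K}. borel))"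
      unfolding Bd_def l_def[symmetric] by (rule in_vimage_algebra[OF bs])
  qed
  \<comment> \<open>On the piece \<open>A i\<close>, outside the bad set of the fixed
    \<open>U i\<close>, the deterministic bound holds. So the failure event is covered by
    intersections of independent events.\<close>
  have sub: "?S \<subseteq> (\<Union>i. A i \<inter> Bd i)"
  proof
    fix \<omega> assume w: "\<omega> \<in> ?S"
    then have wM: "\<omega> \<in> space M" by simp
    from A_cov[OF wM] obtain i where i: "\<omega> \<in> A i" ..
    have "\<omega> \<in> Bd i"
    proof (rule ccontr)
      assume "\<omega> \<notin> Bd i"
      then have nb: "?g \<omega> \<notin> bad_sketch m \<mu> l t (U i)" using wM by (simp add: Bd_def)
      have GC: "G \<omega> \<in> carrier_mat m l" using G wM by (auto simp: standard_gaussian_mat_def l_def)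
      have CC: "C \<omega> \<in> carrier_mat m n" using meas.mat_valuedD(1)[OF C] wM by (simp add: spF)
      from not_bad_sketchD(1)[OF U GC t nb] obtain P where P: "P \<in> carrier_mat l \<mu>"
        "transpose_mat (U i) * (G \<omega> * P) = 1\<^sub>m \<mu>" "(frob_norm P)\<^sup>2 \<le> real \<mu> / t" by blast
      have "frob_norm P \<le> sqrt (real \<mu> / t)" using P(3) by (rule real_le_rsqrt)
      also have "real \<mu> / t = (real \<mu>)\<^sup>2 * c" by (simp add: t_def power2_eq_square)
      also have "sqrt \<dots> = real \<mu> * sqrt c" by (simp add: real_sqrt_mult)
      finally have x: "frob_norm P \<le> real \<mu> * sqrt c" .
      have Y: "C \<omega> * (transpose_mat (C \<omega>) * G \<omega>) \<in> carrier_mat m (\<mu> + K)"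
        using CC GC unfolding l_def[symmetric] by (intro mult_carrier_mat[OF CC mult_carrier_mat[of _ n m]]) auto
      note adm = admissible_basis[OF Y basis[OF wM] U[of i]]
      have gi: "good i \<omega>" using i by (simp add: A_def)
      have lt: "(frob_norm (res (U i) (C \<omega>) * (transpose_mat (C \<omega>) * U i)))\<^sup>2 < \<epsilon>\<^sup>2"
        using gi by (simp add: good_def)
      have eps: "frob_norm (res (U i) (C \<omega>) * (transpose_mat (C \<omega>) * U i)) \<le> \<epsilon>"
        by (rule power2_le_imp_le[OF less_imp_le[OF lt] less_imp_le[OF e]])
      have gxe: "2 * sqrt (real (m * l)) * (real \<mu> * sqrt c) = gx" by (simp add: gx_def real_sqrt_mult)
      have gx0: "0 \<le> gx" using c by (simp add: gx_def)
      from residual_bound[OF adm(1) U CC GC P(1,2) adm(2) eps x not_bad_sketchD(2)[OF U GC t nb]]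
      have "(frob_norm (res (Q \<omega>) (C \<omega>)))\<^sup>2 \<le> (frob_norm (res (U i) (C \<omega>)))\<^sup>2 * (1 + 2 * gx) +
        \<epsilon> * (sqrt (real \<mu>) + gx + sqrt (real \<mu>) * gx)" unfolding gxe .
      also have "(frob_norm (res (U i) (C \<omega>)))\<^sup>2 * (1 + 2 * gx) \<le> ((frob_norm (res V (C \<omega>)))\<^sup>2 + \<epsilon>\<^sup>2) * (1 + 2 * gx)"
        using gi gx0 unfolding good_def by (intro mult_right_mono) auto
      also have "1 + 2 * gx = sketch_factor m (\<mu> + K) \<mu> c" by (simp add: sketch_factor_def gx_def l_def)
      also have "sqrt (real \<mu>) + gx + sqrt (real \<mu>) * gx =
        sqrt (real \<mu>) + 2 * real \<mu> * sqrt (real (m * (\<mu> + K)) * c) * (1 + sqrt (real \<mu>))"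
        by (simp add: gx_def l_def algebra_simps)
      finally show False using w by (simp add: mult.commute)
    qed
    then show "\<omega> \<in> (\<Union>i. A i \<inter> Bd i)" using i by blast
  qed
  have AB: "(\<lambda>i. prob (A i \<inter> Bd i)) sums prob (\<Union>i. A i \<inter> Bd i)"
  proof (rule finite_measure_UNION)
    show "range (\<lambda>i. A i \<inter> Bd i) \<subseteq> events" by (intro image_subsetI sets.Int A_M Bd_M)
    show "disjoint_family (\<lambda>i. A i \<inter> Bd i)"
      by (rule disjoint_family_subset[OF A_disj]) (rule Int_lower1)
  qed
  have Asum: "(\<lambda>i. prob (A i)) sums prob (\<Union>i. A i)"
    by (rule finite_measure_UNION[OF image_subsetI[OF A_M] A_disj])
  have "prob ?S \<le> prob (\<Union>i. A i \<inter> Bd i)"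
    by (rule finite_measure_mono[OF sub]) (intro sets.countable_UN image_subsetI sets.Int A_M Bd_M)
  also have "\<dots> \<le> prob (\<Union>i. A i) * ?b"
  proof (rule sums_le[OF _ AB sums_mult2[OF Asum]])
    show "prob (A i \<inter> Bd i) \<le> prob (A i) * ?b" for i
      unfolding ind by (intro mult_left_mono Bd_le) auto
  qed
  also have "\<dots> \<le> 1 * ?b" by (intro mult_right_mono b0) simp
  finally show ?thesis by simp
qed

text \<open>With slack \<open>1 / (i + 1)\<close> the failure events increase to the one without
  slack, because the inequality defining the latter is strict; the probability bound does not
  involve the slack and passes to the limit.\<close>

lemma (in prob_space) sketch_tail:
  assumes F: "subalgebra M F"
    and C: "meas.mat_valued F m n C"
    and G: "standard_gaussian_mat M m (\<mu> + K) G"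
    and fresh: "indep_set (sets F)
         (sets (vimage_algebra (space M) (\<lambda>\<omega>. \<lambda>e\<in>{..<m} \<times> {..<\<mu> + K}. G \<omega> $$ e)
           (\<Pi>\<^sub>M e\<in>{..<m} \<times> {..<\<mu> + K}. borel)))"
    and Q: "meas.mat_valued M m \<mu> Q"
    and basis: "\<And>\<omega>. \<omega> \<in> space M \<Longrightarrow> range_basis \<mu> K (C \<omega> * (transpose_mat (C \<omega>) * G \<omega>)) (Q \<omega>)"
    and V: "orthonormal_mat m k V" "k \<le> \<mu>" and \<mu>: "0 < \<mu>" "\<mu> \<le> m" and K: "0 < K"
    and c: "0 < c"
  shows "{\<omega> \<in> space M. sketch_factor m (\<mu> + K) \<mu> c * (frob_norm (res V (C \<omega>)))\<^sup>2 < (frob_norm (res (Q \<omega>) (C \<omega>)))\<^sup>2} \<in> events"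
      (is "?S \<in> events")
    and "prob {\<omega> \<in> space M. sketch_factor m (\<mu> + K) \<mu> c * (frob_norm (res V (C \<omega>)))\<^sup>2 < (frob_norm (res (Q \<omega>) (C \<omega>)))\<^sup>2}
      \<le> sketch_failure (K + 1) m (\<mu> + K) c"
proof -
  define x where "x \<omega> = (frob_norm (res (Q \<omega>) (C \<omega>)))\<^sup>2" for \<omega>
  define y where "y \<omega> = (frob_norm (res V (C \<omega>)))\<^sup>2" for \<omega>
  define h where "h = sketch_factor m (\<mu> + K) \<mu> c"
  define a where "a = sqrt (real \<mu>) + 2 * real \<mu> * sqrt (real (m * (\<mu> + K)) * c) * (1 + sqrt (real \<mu>))"
  define e where "e i = 1 / real (Suc i)" for i
  have VC: "V \<in> carrier_mat m k" by (rule orthonormal_mat.Q[OF V(1)])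
  have CM: "meas.mat_valued M m n C" by (rule meas_mat_valued_subalgebra[OF C F])
  have [measurable]: "x \<in> borel_measurable M"
    unfolding x_def by (rule meas.frob_norm_sq_mem[OF meas.mat_valued_res[OF Q CM]])
  have [measurable]: "y \<in> borel_measurable M"
    unfolding y_def by (rule meas.frob_norm_sq_mem[OF meas.mat_valued_res[OF meas.mat_valued_const[OF VC] CM]])
  have S: "?S = {\<omega> \<in> space M. h * y \<omega> < x \<omega>}" by (simp add: h_def x_def y_def)
  show "?S \<in> events" unfolding S by measurable
  define B where "B i = {\<omega> \<in> space M. h * (y \<omega> + (e i)\<^sup>2) + e i * a < x \<omega>}" for i
  have B_M: "B i \<in> events" for i unfolding B_def by measurable
  have h0: "0 \<le> h" and a0: "0 \<le> a" using c by (auto simp: h_def sketch_factor_def a_def)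
  have e0: "0 \<le> e i" for i by (simp add: e_def)
  have e_dec: "e j \<le> e i" if "i \<le> j" for i j using that by (simp add: e_def frac_le)
  have inc: "incseq B"
  proof (rule incseq_SucI, rule subsetI)
    fix i \<omega> assume "\<omega> \<in> B i"
    moreover have "h * (y \<omega> + (e (Suc i))\<^sup>2) + e (Suc i) * a \<le> h * (y \<omega> + (e i)\<^sup>2) + e i * a"
      by (intro add_mono mult_left_mono mult_right_mono power_mono e_dec h0 a0 e0) auto
    ultimately show "\<omega> \<in> B (Suc i)" by (auto simp: B_def)
  qed
  have lim0: "(\<lambda>i. h * (y \<omega> + (e i)\<^sup>2) + e i * a) \<longlonglongrightarrow> h * (y \<omega> + 0\<^sup>2) + 0 * a" for \<omega>
    unfolding e_def by (intro tendsto_intros) (rule LIMSEQ_inverse_real_of_nat[unfolded inverse_eq_divide])+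
  have un: "(\<Union>i. B i) = ?S"
  proof (intro equalityI subsetI)
    fix \<omega> assume "\<omega> \<in> (\<Union>i. B i)"
    then obtain i where i: "\<omega> \<in> space M" "h * (y \<omega> + (e i)\<^sup>2) + e i * a < x \<omega>" by (auto simp: B_def)
    have "h * y \<omega> \<le> h * (y \<omega> + (e i)\<^sup>2) + e i * a"
      using h0 a0 e0[of i] by (simp add: distrib_left)
    then show "\<omega> \<in> ?S" unfolding S using i by simp
  next
    fix \<omega> assume w: "\<omega> \<in> ?S"
    then have "h * (y \<omega> + 0\<^sup>2) + 0 * a < x \<omega>" unfolding S by simp
    from order_tendstoD(2)[OF lim0 this] obtain i where "h * (y \<omega> + (e i)\<^sup>2) + e i * a < x \<omega>"
      by (auto simp: eventually_sequentially)
    then show "\<omega> \<in> (\<Union>i. B i)" using w by (auto simp: B_def)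
  qed
  have "(\<lambda>i. prob (B i)) \<longlonglongrightarrow> prob (\<Union>i. B i)"
    by (rule finite_Lim_measure_incseq) (use B_M inc in auto)
  moreover have "prob (B i) \<le> sketch_failure (K + 1) m (\<mu> + K) c" for i
    unfolding B_def x_def y_def h_def a_def
    by (rule sketch_tail_eps[OF F C G fresh Q basis V \<mu> K c]) (auto simp: e_def)
  ultimately show "prob ?S \<le> sketch_failure (K + 1) m (\<mu> + K) c"
    unfolding un by (intro LIMSEQ_le_const2) auto
qed

section \<open>Column sampling\<close>

definition avg :: "nat \<Rightarrow> (nat \<Rightarrow> real) \<Rightarrow> (nat \<Rightarrow> nat) \<Rightarrow> real" where
  "avg L x v = (\<Sum>a<L. x (v a)) / real L"

locale weighted_draws =
  fixes n L :: nat and p :: "nat \<Rightarrow> real"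
  assumes p: "prob_vector n p" and L: "0 < L"
begin

text \<open>Expectation over \<open>L\<close> independent draws as a finite sum. Its weights are the
  products that occur as conditional probabilities in the assumption \<open>draws\<close>.\<close>

definition expect :: "((nat \<Rightarrow> nat) \<Rightarrow> real) \<Rightarrow> real" where
  "expect f = (\<Sum>v\<in>{..<L} \<rightarrow>\<^sub>E {..<n}. (\<Prod>a<L. p (v a)) * f v)"

lemma p_nonneg: "i < n \<Longrightarrow> 0 \<le> p i" and p_sum: "(\<Sum>i<n. p i) = 1"
  using p by (auto simp: prob_vector_def)

lemma expect_cong: "(\<And>v. v \<in> {..<L} \<rightarrow>\<^sub>E {..<n} \<Longrightarrow> f v = g v) \<Longrightarrow> expect f = expect g"
  unfolding expect_def by (intro sum.cong) auto

lemma expect_sum: "expect (\<lambda>v. \<Sum>i\<in>J. f i v) = (\<Sum>i\<in>J. expect (f i))"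
  unfolding expect_def sum_distrib_left by (rule sum.swap)

lemma expect_cmult: "expect (\<lambda>v. c * f v) = c * expect f"
  unfolding expect_def sum_distrib_left by (intro sum.cong) auto

lemma expect_prod:
  "expect (\<lambda>v. \<Prod>a<L. f a (v a)) = (\<Prod>a<L. \<Sum>i<n. p i * f a i)"
  unfolding expect_def prod.distrib[symmetric]
  by (subst prod_sum_PiE[symmetric]) auto

lemma expect_one_coord:
  assumes "a < L"
  shows "expect (\<lambda>v. g (v a)) = (\<Sum>i<n. p i * g i)"
proof -
  have "expect (\<lambda>v. g (v a)) = expect (\<lambda>v. \<Prod>b<L. if b = a then g (v b) else 1)"
    using assms by (intro expect_cong) simp
  also have "\<dots> = (\<Prod>b<L. \<Sum>i<n. p i * (if b = a then g i else 1))"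
    using expect_prod[of "\<lambda>b i. if b = a then g i else 1"] by simp
  also have "\<dots> = (\<Prod>b<L. if b = a then \<Sum>i<n. p i * g i else 1)"
    using p_sum by (intro prod.cong) auto
  finally show ?thesis using assms by simp
qed

lemma expect_two_coord:
  assumes "a < L" "b < L" "a \<noteq> b"
  shows "expect (\<lambda>v. g (v a) * g (v b)) = (\<Sum>i<n. p i * g i)\<^sup>2"
proof -
  have two: "(\<Prod>c<L. if c = a then x else if c = b then y else 1) = x * y" for x y :: real
  proof -
    have "(\<Prod>c<L. if c = a then x else if c = b then y else 1) =
      (\<Prod>c<L. (if c = a then x else 1) * (if c = b then y else 1))"
      using assms(3) by (intro prod.cong) auto
    then show ?thesis unfolding prod.distrib using assms(1,2) by simp
  qed
  have "expect (\<lambda>v. g (v a) * g (v b)) = expect (\<lambda>v. \<Prod>c<L. if c = a then g (v c) else if c = b then g (v c) else 1)"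
  proof (rule expect_cong)
    fix v
    have "(\<Prod>c<L. if c = a then g (v c) else if c = b then g (v c) else 1) =
      (\<Prod>c<L. if c = a then g (v a) else if c = b then g (v b) else 1)"
      by (intro prod.cong) auto
    then show "g (v a) * g (v b) = (\<Prod>c<L. if c = a then g (v c) else if c = b then g (v c) else 1)"
      by (simp only: two)
  qed
  also have "\<dots> = (\<Prod>c<L. \<Sum>i<n. p i * (if c = a then g i else if c = b then g i else 1))"
    using expect_prod[of "\<lambda>c i. if c = a then g i else if c = b then g i else 1"] by simp
  also have "\<dots> = (\<Prod>c<L. if c = a then \<Sum>i<n. p i * g i else if c = b then \<Sum>i<n. p i * g i else 1)"
    using p_sum by (intro prod.cong) auto
  finally show ?thesis by (simp only: two power2_eq_square)
qed

lemma expect_avg: "expect (avg L x) = (\<Sum>i<n. p i * x i)"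
proof -
  have "expect (avg L x) = expect (\<lambda>v. (1 / real L) * (\<Sum>a<L. x (v a)))"
    by (intro arg_cong[where f = expect]) (simp add: avg_def fun_eq_iff)
  also have "\<dots> = (1 / real L) * (\<Sum>a<L. \<Sum>i<n. p i * x i)"
    unfolding expect_cmult expect_sum by (intro arg_cong2[where f = "(*)"] refl sum.cong expect_one_coord) auto
  finally show ?thesis using L by simp
qed

text \<open>In the squared centered average the mixed terms vanish by independence, leaving the
  variance of one draw divided by \<open>L\<close>; the variance is at most the second
  moment.\<close>

lemma expect_avg_variance:
  "expect (\<lambda>v. (avg L x v - (\<Sum>i<n. p i * x i))\<^sup>2) \<le> (\<Sum>i<n. p i * (x i)\<^sup>2) / real L"
proof -
  define e where "e = (\<Sum>i<n. p i * x i)"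
  define g where "g i = x i - e" for i
  have g0: "(\<Sum>i<n. p i * g i) = 0"
    using p_sum by (simp add: g_def right_diff_distrib sum_subtractf sum_distrib_right[symmetric] e_def)
  have "(avg L x v - e)\<^sup>2 = (1 / (real L)\<^sup>2) * (\<Sum>a<L. \<Sum>b<L. g (v a) * g (v b))" for v
  proof -
    have "avg L x v - e = (1 / real L) * (\<Sum>a<L. g (v a))"
      using L by (simp add: avg_def g_def sum_subtractf field_simps)
    then show ?thesis by (simp add: power2_eq_square sum_product)
  qed
  then have "expect (\<lambda>v. (avg L x v - e)\<^sup>2) = (1 / (real L)\<^sup>2) * (\<Sum>a<L. \<Sum>b<L. expect (\<lambda>v. g (v a) * g (v b)))"
    by (simp only: expect_cmult expect_sum)
  also have "(\<Sum>a<L. \<Sum>b<L. expect (\<lambda>v. g (v a) * g (v b))) = (\<Sum>a<L. \<Sum>b<L. if a = b then \<Sum>i<n. p i * (g i)\<^sup>2 else 0)"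
  proof (intro sum.cong refl)
    fix a b assume "a \<in> {..<L}" "b \<in> {..<L}"
    then show "expect (\<lambda>v. g (v a) * g (v b)) = (if a = b then \<Sum>i<n. p i * (g i)\<^sup>2 else 0)"
      using expect_one_coord[of a "\<lambda>i. (g i)\<^sup>2"] expect_two_coord[of a b g] g0
      by (auto simp: power2_eq_square)
  qed
  also have "\<dots> = real L * (\<Sum>i<n. p i * (g i)\<^sup>2)" by simp
  also have "(\<Sum>i<n. p i * (g i)\<^sup>2) = (\<Sum>i<n. p i * (x i)\<^sup>2) - e\<^sup>2"
  proof -
    have "(\<Sum>i<n. p i * (g i)\<^sup>2) = (\<Sum>i<n. p i * (x i)\<^sup>2) - 2 * e * (\<Sum>i<n. p i * x i) + e\<^sup>2 * (\<Sum>i<n. p i)"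
      unfolding g_def sum_distrib_left sum.distrib[symmetric] sum_subtractf[symmetric]
      by (intro sum.cong refl) (simp add: power2_eq_square algebra_simps)
    then show ?thesis using p_sum by (simp add: e_def[symmetric] power2_eq_square)
  qed
  also have "(1 / (real L)\<^sup>2) * (real L * ((\<Sum>i<n. p i * (x i)\<^sup>2) - e\<^sup>2)) = ((\<Sum>i<n. p i * (x i)\<^sup>2) - e\<^sup>2) / real L"
    using L by (simp add: power2_eq_square)
  also have "\<dots> \<le> (\<Sum>i<n. p i * (x i)\<^sup>2) / real L" by (intro divide_right_mono) auto
  finally show ?thesis by (simp add: e_def)
qed

end

section \<open>Sampled columns under near optimality\<close>

lemma sampled_mult_entry:
  assumes X: "X \<in> carrier_mat m n" and v: "v \<in> {..<L} \<rightarrow> {..<n}" and a: "a < m" and j: "j < L"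
  shows "(X * sampling_mat n L p v) $$ (a, j) = X $$ (a, v j) / sqrt (real L * p (v j))"
proof -
  have S: "sampling_mat n L p v \<in> carrier_mat n L" by (simp add: sampling_mat_def)
  have vj: "v j < n" using v j by auto
  have "(X * sampling_mat n L p v) $$ (a, j) = (\<Sum>i<n. if i = v j then X $$ (a, v j) / sqrt (real L * p (v j)) else 0)"
    unfolding mult_entry[OF X S a j] using j by (intro sum.cong refl) (auto simp: sampling_mat_def)
  then show ?thesis using vj by simp
qed

lemma gram_entry:
  "A \<in> carrier_mat m n \<Longrightarrow> X \<in> carrier_mat k n \<Longrightarrow> i < m \<Longrightarrow> j < k \<Longrightarrow>
    (A * transpose_mat X) $$ (i, j) = (\<Sum>l<n. A $$ (i, l) * X $$ (j, l))"
  by (auto simp: scalar_prod_def lessThan_atLeast0)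

lemma sampled_gram_entry:
  assumes X: "X \<in> carrier_mat m n" and v: "v \<in> {..<L} \<rightarrow> {..<n}" and ab: "a < m" "b < m" and p: "\<And>i. i < n \<Longrightarrow> 0 \<le> p i"
  shows "(\<Sum>j<L. (X * sampling_mat n L p v) $$ (a, j) * (X * sampling_mat n L p v) $$ (b, j)) =
    avg L (\<lambda>i. X $$ (a, i) * X $$ (b, i) / p i) v"
  unfolding avg_def sum_divide_distrib
proof (intro sum.cong refl)
  fix j assume j: "j \<in> {..<L}"
  then have "0 \<le> p (v j)" using v by (intro p) auto
  then have "sqrt (real L * p (v j)) * sqrt (real L * p (v j)) = real L * p (v j)" by simp
  then show "(X * sampling_mat n L p v) $$ (a, j) * (X * sampling_mat n L p v) $$ (b, j) =
    X $$ (a, v j) * X $$ (b, v j) / p (v j) / real L"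
    using j by (simp add: sampled_mult_entry[OF X v] ab)
qed

locale nearly_optimal_draws = weighted_draws +
  fixes m :: nat and B :: "real mat" and \<beta>\<^sub>0 :: real
  assumes B: "B \<in> carrier_mat m n" and \<beta>\<^sub>0: "0 < \<beta>\<^sub>0" and opt: "nearly_optimal \<beta>\<^sub>0 B p"
begin

abbreviation colsq :: "real mat \<Rightarrow> nat \<Rightarrow> real" where
  "colsq X i \<equiv> (\<Sum>a<m. (X $$ (a, i))\<^sup>2)"

lemma colsq_le: "i < n \<Longrightarrow> \<beta>\<^sub>0 * colsq B i \<le> p i * (frob_norm B)\<^sup>2"
proof -
  assume i: "i < n"
  show ?thesis
  \<comment> \<open>Near optimality divides by the squared norm and carries no information about a
    zero matrix; there all columns vanish.\<close>
  proof (cases "frob_norm B = 0")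
    case True
    then have "(\<Sum>a<m. \<Sum>j<n. (B $$ (a, j))\<^sup>2) = 0" using frob_norm_sq[OF B] by simp
    then have "(\<Sum>j<n. (B $$ (a, j))\<^sup>2) = 0" if "a < m" for a
      using that by (subst (asm) sum_nonneg_eq_0_iff) (auto intro: sum_nonneg)
    then have "(B $$ (a, i))\<^sup>2 = 0" if "a < m" for a
      using that i sum_nonneg_eq_0_iff[of "{..<n}" "\<lambda>j. (B $$ (a, j))\<^sup>2"] by auto
    then show ?thesis using True by simp
  next
    case False
    then have "0 < (frob_norm B)\<^sup>2" by simp
    then show ?thesis using opt i carrier_matD[OF B] by (simp add: nearly_optimal_def pos_divide_le_eq)
  qed
qed

text \<open>A column that is never drawn must vanish. Hence the convention \<open>x / 0 = 0\<close>
  in the importance weights does not bias the averages.\<close>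

lemma zero_col: "i < n \<Longrightarrow> p i = 0 \<Longrightarrow> colsq B i = 0"
  using colsq_le[of i] \<beta>\<^sub>0 by (simp add: mult_le_0_iff antisym sum_nonneg)

lemma colsq_div_le: "i < n \<Longrightarrow> colsq B i / p i \<le> (frob_norm B)\<^sup>2 / \<beta>\<^sub>0"
  using colsq_le[of i] \<beta>\<^sub>0 p_nonneg[of i]
  by (cases "p i = 0") (auto simp: field_simps)

lemma sum_colsq: "X \<in> carrier_mat m n \<Longrightarrow> (\<Sum>i<n. colsq X i) = (frob_norm X)\<^sup>2"
  unfolding frob_norm_sq by (rule sum.swap)

text \<open>Each entry of \<open>C C\<^sup>T\<close> is an average of unbiased weighted products of
  entries of \<open>B\<close>. The second moments of all entries add up to the sum of
  \<open>p (\<parallel>b\<parallel>\<^sup>2 / p)\<^sup>2\<close> over the columns \<open>b\<close>,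
  and near optimality bounds one factor \<open>\<parallel>b\<parallel>\<^sup>2 / p\<close> by
  \<open>\<parallel>B\<parallel>\<^sup>2 / \<beta>\<^sub>0\<close>.\<close>

lemma expect_gram_error:
  "expect (\<lambda>v. (frob_norm ((B * sampling_mat n L p v) * transpose_mat (B * sampling_mat n L p v) - B * transpose_mat B))\<^sup>2)
     \<le> (frob_norm B)^4 / (\<beta>\<^sub>0 * real L)"
proof -
  define x where "x a b i = B $$ (a, i) * B $$ (b, i) / p i" for a b i
  have mean: "(\<Sum>i<n. p i * x a b i) = (\<Sum>i<n. B $$ (a, i) * B $$ (b, i))" if "a < m" for a b
  proof (intro sum.cong refl)
    fix i assume i: "i \<in> {..<n}"
    show "p i * x a b i = B $$ (a, i) * B $$ (b, i)"
    proof (cases "p i = 0")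
      case True
      then have "colsq B i = 0" using zero_col i by simp
      then have "B $$ (a, i) = 0" using that by (subst (asm) sum_nonneg_eq_0_iff) auto
      then show ?thesis by (simp add: x_def)
    qed (simp add: x_def)
  qed
  have "expect (\<lambda>v. (frob_norm ((B * sampling_mat n L p v) * transpose_mat (B * sampling_mat n L p v) - B * transpose_mat B))\<^sup>2)
    = expect (\<lambda>v. \<Sum>a<m. \<Sum>b<m. (avg L (x a b) v - (\<Sum>i<n. p i * x a b i))\<^sup>2)"
  proof (rule expect_cong)
    fix v assume "v \<in> {..<L} \<rightarrow>\<^sub>E {..<n}"
    then have v: "v \<in> {..<L} \<rightarrow> {..<n}" by (simp add: PiE_def)
    let ?C = "B * sampling_mat n L p v"
    have C: "?C \<in> carrier_mat m L" by (rule mult_carrier_mat[OF B]) (simp add: sampling_mat_def)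
    have CC: "?C * transpose_mat ?C \<in> carrier_mat m m" "B * transpose_mat B \<in> carrier_mat m m"
      using B C by auto
    show "(frob_norm (?C * transpose_mat ?C - B * transpose_mat B))\<^sup>2 = (\<Sum>a<m. \<Sum>b<m. (avg L (x a b) v - (\<Sum>i<n. p i * x a b i))\<^sup>2)"
      unfolding frob_norm_sq[OF minus_carrier_mat[OF CC(2)]]
    proof (intro sum.cong refl)
      fix a b assume ab: "a \<in> {..<m}" "b \<in> {..<m}"
      have "(?C * transpose_mat ?C) $$ (a, b) = avg L (x a b) v"
        using sampled_gram_entry[OF B v _ _ p_nonneg, of a b] ab
        unfolding x_def by (simp add: gram_entry[OF C C])
      moreover have "(B * transpose_mat B) $$ (a, b) = (\<Sum>i<n. p i * x a b i)"
        using ab mean by (simp add: gram_entry[OF B B])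
      ultimately show "((?C * transpose_mat ?C - B * transpose_mat B) $$ (a, b))\<^sup>2 = (avg L (x a b) v - (\<Sum>i<n. p i * x a b i))\<^sup>2"
        using ab carrier_matD[OF CC(2)] by simp
    qed
  qed
  also have "\<dots> = (\<Sum>a<m. \<Sum>b<m. expect (\<lambda>v. (avg L (x a b) v - (\<Sum>i<n. p i * x a b i))\<^sup>2))"
    by (simp only: expect_sum)
  also have "\<dots> \<le> (\<Sum>a<m. \<Sum>b<m. (\<Sum>i<n. p i * (x a b i)\<^sup>2) / real L)"
    by (intro sum_mono expect_avg_variance)
  also have "\<dots> = (\<Sum>i<n. p i * (colsq B i / p i)\<^sup>2) / real L"
  proof -
    have "(\<Sum>a<m. \<Sum>b<m. \<Sum>i<n. p i * (x a b i)\<^sup>2) = (\<Sum>i<n. \<Sum>a<m. \<Sum>b<m. p i * (x a b i)\<^sup>2)"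
      by (subst sum.swap[of _ "{..<n}"]) (intro sum.cong refl sum.swap)
    also have "\<dots> = (\<Sum>i<n. p i * (colsq B i / p i)\<^sup>2)"
    proof (intro sum.cong refl)
      fix i
      have "(\<Sum>a<m. \<Sum>b<m. p i * (x a b i)\<^sup>2) = (\<Sum>a<m. \<Sum>b<m. (p i / (p i)\<^sup>2) * ((B $$ (a, i))\<^sup>2 * (B $$ (b, i))\<^sup>2))"
        by (simp add: x_def power_mult_distrib power_divide)
      also have "\<dots> = (p i / (p i)\<^sup>2) * (colsq B i * colsq B i)"
        by (simp only: sum_distrib_left[symmetric] sum_product)
      finally show "(\<Sum>a<m. \<Sum>b<m. p i * (x a b i)\<^sup>2) = p i * (colsq B i / p i)\<^sup>2"
        by (simp add: power2_eq_square)
    qed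
    finally show ?thesis by (simp add: sum_divide_distrib[symmetric])
  qed
  also have "\<dots> \<le> (\<Sum>i<n. colsq B i * ((frob_norm B)\<^sup>2 / \<beta>\<^sub>0)) / real L"
  proof (intro divide_right_mono sum_mono)
    fix i assume i: "i \<in> {..<n}"
    have "p i * (colsq B i / p i)\<^sup>2 = colsq B i * (colsq B i / p i)" by (simp add: power2_eq_square)
    also have "\<dots> \<le> colsq B i * ((frob_norm B)\<^sup>2 / \<beta>\<^sub>0)"
      using i by (intro mult_left_mono colsq_div_le) (auto intro: sum_nonneg)
    finally show "p i * (colsq B i / p i)\<^sup>2 \<le> colsq B i * ((frob_norm B)\<^sup>2 / \<beta>\<^sub>0)" .
  qed simp
  also have "\<dots> = (frob_norm B)^4 / (\<beta>\<^sub>0 * real L)"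
    unfolding sum_distrib_right[symmetric] sum_colsq[OF B] by (simp add: power2_eq_square power4_eq_xxxx)
  finally show ?thesis .
qed

lemma sampled_norm:
  assumes X: "X \<in> carrier_mat m n" and v: "v \<in> {..<L} \<rightarrow>\<^sub>E {..<n}"
  shows "(frob_norm (X * sampling_mat n L p v))\<^sup>2 = avg L (\<lambda>i. colsq X i / p i) v"
proof -
  have v': "v \<in> {..<L} \<rightarrow> {..<n}" using v by (simp add: PiE_def)
  have C: "X * sampling_mat n L p v \<in> carrier_mat m L" by (rule mult_carrier_mat[OF X]) (simp add: sampling_mat_def)
  have "(frob_norm (X * sampling_mat n L p v))\<^sup>2 = (\<Sum>a<m. avg L (\<lambda>i. X $$ (a, i) * X $$ (a, i) / p i) v)"
    unfolding frob_norm_sq[OF C]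
    by (intro sum.cong refl, subst sampled_gram_entry[OF X v', symmetric]) (auto simp: power2_eq_square p_nonneg)
  also have "\<dots> = avg L (\<lambda>i. colsq X i / p i) v"
    unfolding avg_def sum_divide_distrib power2_eq_square by (subst sum.swap) simp
  finally show ?thesis .
qed

text \<open>The distribution is adapted to \<open>B\<close>, not to \<open>X\<close>; columnwise
  domination lets the bound on \<open>\<parallel>b\<parallel>\<^sup>2 / p\<close> serve
  \<open>X\<close> as well. The intended \<open>X\<close> is the projected matrix
  \<open>res V B\<close>.\<close>

lemma expect_sampled_norm:
  assumes X: "X \<in> carrier_mat m n" and le: "\<And>i. i < n \<Longrightarrow> colsq X i \<le> colsq B i"
  shows "expect (\<lambda>v. (frob_norm (X * sampling_mat n L p v))\<^sup>2) = (frob_norm X)\<^sup>2"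
    and "expect (\<lambda>v. ((frob_norm (X * sampling_mat n L p v))\<^sup>2 - (frob_norm X)\<^sup>2)\<^sup>2)
      \<le> (frob_norm B)\<^sup>2 * (frob_norm X)\<^sup>2 / (\<beta>\<^sub>0 * real L)"
proof -
  define x where "x i = colsq X i / p i" for i
  have px: "p i * x i = colsq X i" if i: "i < n" for i
  proof (cases "p i = 0")
    case True
    then have "colsq X i \<le> 0" using le[OF i] zero_col[OF i] by simp
    moreover have "0 \<le> colsq X i" by (intro sum_nonneg) simp
    ultimately have "colsq X i = 0" by (rule antisym)
    then show ?thesis by (simp add: True)
  qed (simp add: x_def)
  have mean: "(\<Sum>i<n. p i * x i) = (frob_norm X)\<^sup>2"
    unfolding sum_colsq[OF X, symmetric] by (intro sum.cong refl px) simp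
  have "expect (\<lambda>v. (frob_norm (X * sampling_mat n L p v))\<^sup>2) = expect (avg L x)"
    unfolding x_def by (rule expect_cong) (rule sampled_norm[OF X])
  then show "expect (\<lambda>v. (frob_norm (X * sampling_mat n L p v))\<^sup>2) = (frob_norm X)\<^sup>2"
    by (simp only: expect_avg mean)
  have "expect (\<lambda>v. ((frob_norm (X * sampling_mat n L p v))\<^sup>2 - (frob_norm X)\<^sup>2)\<^sup>2) =
    expect (\<lambda>v. (avg L x v - (\<Sum>i<n. p i * x i))\<^sup>2)"
    unfolding mean
  proof (rule expect_cong)
    fix v assume "v \<in> {..<L} \<rightarrow>\<^sub>E {..<n}"
    from sampled_norm[OF X this] show "((frob_norm (X * sampling_mat n L p v))\<^sup>2 - (frob_norm X)\<^sup>2)\<^sup>2 = (avg L x v - (frob_norm X)\<^sup>2)\<^sup>2"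
      unfolding x_def[abs_def] by (simp only:)
  qed
  also have "\<dots> \<le> (\<Sum>i<n. p i * (x i)\<^sup>2) / real L" by (rule expect_avg_variance)
  also have "\<dots> \<le> (\<Sum>i<n. colsq X i * ((frob_norm B)\<^sup>2 / \<beta>\<^sub>0)) / real L"
  proof (intro divide_right_mono sum_mono)
    fix i assume "i \<in> {..<n}"
    then have i: "i < n" by simp
    have "x i \<le> colsq B i / p i" unfolding x_def by (intro divide_right_mono le p_nonneg i)
    also have "\<dots> \<le> (frob_norm B)\<^sup>2 / \<beta>\<^sub>0" by (rule colsq_div_le[OF i])
    finally have "colsq X i * x i \<le> colsq X i * ((frob_norm B)\<^sup>2 / \<beta>\<^sub>0)" by (intro mult_left_mono) (auto intro: sum_nonneg)
    then show "p i * (x i)\<^sup>2 \<le> colsq X i * ((frob_norm B)\<^sup>2 / \<beta>\<^sub>0)"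
      using px[OF i] by (simp add: power2_eq_square mult.assoc[symmetric])
  qed simp
  also have "\<dots> = (frob_norm B)\<^sup>2 * (frob_norm X)\<^sup>2 / (\<beta>\<^sub>0 * real L)"
    unfolding sum_distrib_right[symmetric] sum_colsq[OF X] by simp
  finally show "expect (\<lambda>v. ((frob_norm (X * sampling_mat n L p v))\<^sup>2 - (frob_norm X)\<^sup>2)\<^sup>2)
      \<le> (frob_norm B)\<^sup>2 * (frob_norm X)\<^sup>2 / (\<beta>\<^sub>0 * real L)" .
qed

text \<open>Multiplication by a coordinate vector isolates a column, on which the projection cannot
  increase the norm.\<close>

lemma colsq_res_le:
  assumes V: "orthonormal_mat m k V" and i: "i < n"
  shows "colsq (res V B) i \<le> colsq B i"
proof -
  interpret V: orthonormal_mat m k V by (rule V)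
  define e where "e = mat n 1 (\<lambda>(j, _). if j = i then 1 else 0 :: real)"
  have e: "e \<in> carrier_mat n 1" by (simp add: e_def)
  have col: "(frob_norm (X * e))\<^sup>2 = colsq X i" if X: "X \<in> carrier_mat m n" for X
  proof -
    have "(X * e) $$ (a, 0) = X $$ (a, i)" if a: "a < m" for a
    proof -
      have "(X * e) $$ (a, 0) = (\<Sum>j<n. if j = i then X $$ (a, i) else 0)"
        unfolding mult_entry[OF X e a, of 0, simplified] by (intro sum.cong refl) (auto simp: e_def)
      then show ?thesis using i by simp
    qed
    then show ?thesis unfolding frob_norm_sq[OF mult_carrier_mat[OF X e]] by simp
  qed
  have "colsq (res V B) i = (frob_norm (res V (B * e)))\<^sup>2"
    unfolding V.res_mult[OF B e] by (rule col[symmetric, OF V.res_carrier[OF B]])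
  also have "\<dots> \<le> (frob_norm (B * e))\<^sup>2"
    by (rule power_mono[OF V.frob_norm_res_le[OF mult_carrier_mat[OF B e]] frob_norm_nonneg])
  also have "\<dots> = colsq B i" by (rule col[OF B])
  finally show ?thesis .
qed

end

section \<open>From conditional draws to tail probabilities\<close>

text \<open>Against an integrand known from the history, an indicator may be replaced by its
  conditional probability. As \<open>f\<close> need not be integrable, the nonnegative version of
  conditional expectation is used, identified with \<open>w\<close> through integrals over history
  events.\<close>

lemma (in prob_space) nn_integral_conditional_weight:
  assumes F: "subalgebra M F" and E: "E \<in> events"
    and w: "w \<in> borel_measurable F" and w0: "\<And>\<omega>. \<omega> \<in> space M \<Longrightarrow> 0 \<le> w \<omega>"
    and cond: "AE \<omega> in M. real_cond_exp M F (indicator E) \<omega> = w \<omega>"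
    and f: "f \<in> borel_measurable F"
  shows "(\<integral>\<^sup>+\<omega>. f \<omega> * indicator E \<omega> \<partial>M) = (\<integral>\<^sup>+\<omega>. f \<omega> * ennreal (w \<omega>) \<partial>M)"
proof -
  interpret finite_measure_subalgebra M F by unfold_locales (rule F)
  have wM: "w \<in> borel_measurable M" by (rule measurable_from_subalg[OF F w])
  have fM: "f \<in> borel_measurable M" by (rule measurable_from_subalg[OF F f])
  have int: "integrable M (indicator E :: _ \<Rightarrow> real)"
    using E by (intro integrable_real_indicator) (auto simp: emeasure_eq_measure)
  have "AE \<omega> in M. ennreal (w \<omega>) = nn_cond_exp M F (indicator E) \<omega>"
  proof (rule nn_cond_exp_charact)
    fix X assume X: "X \<in> sets F"
    then have XM: "X \<in> events" using F by (auto simp: subalgebra_def)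
    have eq: "(\<integral>\<omega>\<in>X. w \<omega> \<partial>M) = measure M (E \<inter> X)"
    proof -
      have "(\<integral>\<omega>\<in>X. w \<omega> \<partial>M) = (\<integral>\<omega>\<in>X. real_cond_exp M F (indicator E) \<omega> \<partial>M)"
        unfolding set_lebesgue_integral_def using cond wM XM
        by (intro integral_cong_AE) auto
      also have "\<dots> = (\<integral>\<omega>\<in>X. indicator E \<omega> \<partial>M)"
        by (rule real_cond_exp_intA[OF int X, symmetric])
      also have "\<dots> = (\<integral>\<omega>. indicator (E \<inter> X) \<omega> \<partial>M)"
        unfolding set_lebesgue_integral_def by (intro Bochner_Integration.integral_cong) (auto simp: indicator_def)
      also have "\<dots> = measure M (E \<inter> X)" using E XM by simp
      finally show ?thesis .
    qed
    have wint: "integrable M w"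
    proof (rule integrable_cong_AE_imp[OF real_cond_exp_int(1)[OF int] wM])
      show "AE x in M. real_cond_exp M F (indicator E) x = w x" by (rule cond)
    qed
    have "(\<integral>\<^sup>+\<omega>\<in>X. indicator E \<omega> \<partial>M) = (\<integral>\<^sup>+\<omega>. indicator (E \<inter> X) \<omega> \<partial>M)"
      by (intro nn_integral_cong) (auto simp: indicator_def)
    also have "\<dots> = ennreal (measure M (E \<inter> X))" using E XM by (simp add: emeasure_eq_measure)
    also have "\<dots> = ennreal (\<integral>\<omega>. indicator X \<omega> * w \<omega> \<partial>M)" using eq by (simp add: set_lebesgue_integral_def)
    also have "\<dots> = (\<integral>\<^sup>+\<omega>. ennreal (indicator X \<omega> * w \<omega>) \<partial>M)"
      using integrable_mult_indicator[OF XM wint] w0 by (intro nn_integral_eq_integral[symmetric]) auto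
    also have "\<dots> = (\<integral>\<^sup>+\<omega>\<in>X. ennreal (w \<omega>) \<partial>M)"
      by (intro nn_integral_cong) (auto simp: indicator_def)
    finally show "(\<integral>\<^sup>+\<omega>\<in>X. indicator E \<omega> \<partial>M) = (\<integral>\<^sup>+\<omega>\<in>X. ennreal (w \<omega>) \<partial>M)" .
  qed (use E w in auto)
  then have "(\<integral>\<^sup>+\<omega>. f \<omega> * ennreal (w \<omega>) \<partial>M) = (\<integral>\<^sup>+\<omega>. f \<omega> * nn_cond_exp M F (indicator E) \<omega> \<partial>M)"
    by (intro nn_integral_cong_AE) auto
  also have "\<dots> = (\<integral>\<^sup>+\<omega>. f \<omega> * indicator E \<omega> \<partial>M)"
    by (rule nn_cond_exp_intg) (use f E in auto)
  finally show ?thesis by simp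
qed

text \<open>\<open>X\<close> takes finitely many values, and for each fixed value \<open>v\<close>
  the function \<open>f v\<close> is known from the history although \<open>f (X \<omega>)\<close>
  is not. Markov's inequality is applied to the sum over \<open>v\<close>, in which the conditional
  weights \<open>w v\<close> replace the indicators.\<close>

lemma (in prob_space) markov_draws:
  fixes X :: "'a \<Rightarrow> 'v" and f w :: "'v \<Rightarrow> 'a \<Rightarrow> real"
  assumes F: "subalgebra M F" and V: "finite V" and XV: "\<And>\<omega>. \<omega> \<in> space M \<Longrightarrow> X \<omega> \<in> V"
    and E: "\<And>v. v \<in> V \<Longrightarrow> {\<omega> \<in> space M. X \<omega> = v} \<in> events"
    and w: "\<And>v. v \<in> V \<Longrightarrow> w v \<in> borel_measurable F"
    and w0: "\<And>v \<omega>. v \<in> V \<Longrightarrow> \<omega> \<in> space M \<Longrightarrow> 0 \<le> w v \<omega>"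
    and cond: "\<And>v. v \<in> V \<Longrightarrow> AE \<omega> in M. real_cond_exp M F (indicator {\<omega> \<in> space M. X \<omega> = v}) \<omega> = w v \<omega>"
    and f: "\<And>v. v \<in> V \<Longrightarrow> f v \<in> borel_measurable F"
    and f0: "\<And>v \<omega>. v \<in> V \<Longrightarrow> \<omega> \<in> space M \<Longrightarrow> 0 \<le> f v \<omega>"
    and le: "\<And>\<omega>. \<omega> \<in> space M \<Longrightarrow> (\<Sum>v\<in>V. w v \<omega> * f v \<omega>) \<le> b" and a: "0 < a"
  shows "{\<omega> \<in> space M. a \<le> f (X \<omega>) \<omega>} \<in> events"
    and "prob {\<omega> \<in> space M. a \<le> f (X \<omega>) \<omega>} \<le> b / a"
proof -
  let ?E = "\<lambda>v. {\<omega> \<in> space M. X \<omega> = v}"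
  have fM: "v \<in> V \<Longrightarrow> f v \<in> borel_measurable M" for v by (rule measurable_from_subalg[OF F f])
  have wM: "v \<in> V \<Longrightarrow> w v \<in> borel_measurable M" for v by (rule measurable_from_subalg[OF F w])
  have "{\<omega> \<in> space M. a \<le> f (X \<omega>) \<omega>} = (\<Union>v\<in>V. ?E v \<inter> {\<omega> \<in> space M. a \<le> f v \<omega>})" using XV by auto
  also have "\<dots> \<in> events"
  proof (intro sets.finite_UN V sets.Int E)
    fix v assume "v \<in> V"
    note [measurable] = fM[OF this]
    show "{\<omega> \<in> space M. a \<le> f v \<omega>} \<in> events" by measurable
  qed
  finally show ev: "{\<omega> \<in> space M. a \<le> f (X \<omega>) \<omega>} \<in> events" .
  have "ennreal a * emeasure M {\<omega> \<in> space M. a \<le> f (X \<omega>) \<omega>} =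
      (\<integral>\<^sup>+\<omega>. ennreal a * indicator {\<omega> \<in> space M. a \<le> f (X \<omega>) \<omega>} \<omega> \<partial>M)"
    using ev by (simp add: nn_integral_cmult_indicator)
  also have "\<dots> \<le> (\<integral>\<^sup>+\<omega>. (\<Sum>v\<in>V. ennreal (f v \<omega>) * indicator (?E v) \<omega>) \<partial>M)"
  proof (rule nn_integral_mono)
    fix \<omega> assume \<omega>: "\<omega> \<in> space M"
    have "ennreal a * indicator {\<omega> \<in> space M. a \<le> f (X \<omega>) \<omega>} \<omega> \<le> ennreal (f (X \<omega>) \<omega>) * indicator (?E (X \<omega>)) \<omega>"
      using \<omega> by (auto simp: indicator_def ennreal_leI)
    also have "\<dots> \<le> (\<Sum>v\<in>V. ennreal (f v \<omega>) * indicator (?E v) \<omega>)"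
      by (rule member_le_sum[OF XV[OF \<omega>]]) (auto intro: V)
    finally show "ennreal a * indicator {\<omega> \<in> space M. a \<le> f (X \<omega>) \<omega>} \<omega> \<le> (\<Sum>v\<in>V. ennreal (f v \<omega>) * indicator (?E v) \<omega>)" .
  qed
  also have "\<dots> = (\<Sum>v\<in>V. \<integral>\<^sup>+\<omega>. ennreal (f v \<omega>) * indicator (?E v) \<omega> \<partial>M)"
    using fM E by (intro nn_integral_sum) auto
  also have "\<dots> = (\<Sum>v\<in>V. \<integral>\<^sup>+\<omega>. ennreal (f v \<omega>) * ennreal (w v \<omega>) \<partial>M)"
    using f by (intro sum.cong refl nn_integral_conditional_weight[OF F E w w0 cond]) auto
  also have "\<dots> = (\<integral>\<^sup>+\<omega>. (\<Sum>v\<in>V. ennreal (f v \<omega>) * ennreal (w v \<omega>)) \<partial>M)"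
    using fM wM by (intro nn_integral_sum[symmetric]) auto
  also have "\<dots> \<le> (\<integral>\<^sup>+\<omega>. ennreal b \<partial>M)"
  proof (rule nn_integral_mono)
    fix \<omega> assume \<omega>: "\<omega> \<in> space M"
    have "(\<Sum>v\<in>V. ennreal (f v \<omega>) * ennreal (w v \<omega>)) = (\<Sum>v\<in>V. ennreal (w v \<omega> * f v \<omega>))"
      using w0 f0 \<omega> by (intro sum.cong refl) (simp add: ennreal_mult mult.commute)
    also have "\<dots> = ennreal (\<Sum>v\<in>V. w v \<omega> * f v \<omega>)"
      using w0 f0 \<omega> by (intro sum_ennreal) auto
    also have "\<dots> \<le> ennreal b" by (intro ennreal_leI le \<omega>)
    finally show "(\<Sum>v\<in>V. ennreal (f v \<omega>) * ennreal (w v \<omega>)) \<le> ennreal b" .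
  qed
  also have "\<dots> = ennreal b" by (simp add: emeasure_space_1)
  finally have "ennreal (a * prob {\<omega> \<in> space M. a \<le> f (X \<omega>) \<omega>}) \<le> ennreal b"
    using a by (simp add: emeasure_eq_measure ennreal_mult')
  moreover have "0 \<le> b"
  proof -
    obtain \<omega> where "\<omega> \<in> space M" using not_empty by auto
    have "0 \<le> (\<Sum>v\<in>V. w v \<omega> * f v \<omega>)"
      by (intro sum_nonneg mult_nonneg_nonneg w0 f0 \<open>\<omega> \<in> space M\<close>)
    also have "\<dots> \<le> b" by (rule le) fact
    finally show ?thesis .
  qed
  ultimately show "prob {\<omega> \<in> space M. a \<le> f (X \<omega>) \<omega>} \<le> b / a"
    using a by (simp add: pos_le_divide_eq mult.commute)
qed

section \<open>Numerical estimates\<close>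

text \<open>Quadratic bounds at 1/8, raised to the eighth power.\<close>

lemma exp_1_bounds: "27 / 10 \<le> exp (1::real)" "exp (1::real) \<le> 288 / 100"
proof -
  have e: "exp (1::real) = exp (1 / 8) ^ 8"
    by (simp add: exp_of_nat_mult[symmetric])
  have "(1 + 1 / 8 + (1 / 8)\<^sup>2 / 2) ^ 8 \<le> exp (1 / 8 :: real) ^ 8"
    by (intro power_mono exp_lower_Taylor_quadratic) auto
  then show "27 / 10 \<le> exp (1::real)" unfolding e by (rule order_trans[rotated]) (simp add: eval_nat_numeral)
  have "exp (1 / 8 :: real) ^ 8 \<le> (1 + 1 / 8 + (1 / 8)\<^sup>2) ^ 8"
    by (intro power_mono exp_bound) auto
  then show "exp (1::real) \<le> 288 / 100" unfolding e by (rule order_trans) (simp add: eval_nat_numeral)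
qed

text \<open>\<open>21 / 40\<close> is one sixth of 3.15, and by a Taylor estimate its sine already
  exceeds 1/2, the sine of \<open>pi / 6\<close>.\<close>

lemma pi_le_315: "pi \<le> 315 / 100"
proof (rule ccontr)
  assume "\<not> ?thesis"
  then have lt: "21 / 40 < pi / 6" by simp
  have "sin (21 / 40 :: real) \<le> sin (pi / 6)"
    using lt by (intro sin_monotone_2pi_le) auto
  then have s: "sin (21 / 40 :: real) \<le> 1 / 2" by (simp add: sin_30)
  define x :: real where "x = 21 / 40"
  have "{..<5::nat} = {0, 1, 2, 3, 4}" by auto
  then have sum: "(\<Sum>m<5. sin_coeff m * x ^ m) = x - x ^ 3 / 6"
    by (simp add: sin_coeff_def fact_numeral)
  have "\<bar>sin x - (\<Sum>m<5. sin_coeff m * x ^ m)\<bar> \<le> inverse (fact 5) * \<bar>x\<bar> ^ 5"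
    by (rule Maclaurin_sin_bound)
  then have "x - x ^ 3 / 6 - inverse (fact 5) * \<bar>x\<bar> ^ 5 \<le> sin x" unfolding sum by linarith
  moreover have "1 / 2 < x - x ^ 3 / 6 - inverse (fact 5) * \<bar>x\<bar> ^ 5"
    unfolding x_def by (simp add: fact_numeral eval_nat_numeral)
  ultimately show False using s unfolding x_def by linarith
qed

lemma sqrt2_bounds: "14 / 10 \<le> sqrt (2::real)" "sqrt (2::real) \<le> 1415 / 1000"
proof -
  show "14 / 10 \<le> sqrt (2::real)" by (rule real_le_rsqrt) (simp add: power2_eq_square)
  have "(2::real) \<le> (1415 / 1000)\<^sup>2" by (simp add: power2_eq_square)
  then show "sqrt (2::real) \<le> 1415 / 1000" by (rule real_le_lsqrt[rotated]) simp
qed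

lemma sqrt2_div_exp_le: "sqrt 2 / exp 1 \<le> (21 / 40 :: real)"
proof -
  have "sqrt 2 / exp 1 \<le> (1415 / 1000) / (27 / 10 :: real)"
    by (intro frac_le sqrt2_bounds exp_1_bounds) auto
  then show ?thesis by simp
qed

text \<open>The constant \<open>361 / 400\<close> is the square of 19/20, the share that the row
  term receives in \<open>sketch_failure_le_stirling\<close>.\<close>

lemma pi_mult_le_exp:
  assumes "2 \<le> d"
  shows "pi * real d \<le> (361 / 400) * exp 1 ^ d"
proof -
  have "(63 / 20) * real d \<le> (361 / 400) * (27 / 10) ^ d" using assms
  proof (induction d rule: nat_induct_at_least)
    case base
    then show ?case by (simp add: power2_eq_square)
  next
    case (Suc n)
    then have "(63 / 20) * real (Suc n) \<le> (27 / 10) * ((63 / 20) * real n)" by simp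
    also have "\<dots> \<le> (27 / 10) * ((361 / 400) * (27 / 10) ^ n)" using Suc by (intro mult_left_mono) auto
    finally show ?case by simp
  qed
  moreover have "pi * real d \<le> (63 / 20) * real d" using pi_le_315 by (intro mult_right_mono) auto
  moreover have "(27 / 10 :: real) ^ d \<le> exp 1 ^ d" by (intro power_mono exp_1_bounds) auto
  ultimately show ?thesis by linarith
qed

text \<open>Bernoulli's inequality for the reciprocal \<open>(1 + 1 / d) ^ d\<close>.\<close>

lemma half_power_bound:
  assumes "0 < d"
  shows "(real d / real (d + 1)) ^ d \<le> 1 / 2"
proof -
  have "1 + real d * (1 / real d) \<le> (1 + 1 / real d) ^ d"
    by (rule Bernoulli_inequality) (use assms in \<open>simp add: order_trans[of _ 0]\<close>)
  then have "2 \<le> (1 + 1 / real d) ^ d" using assms by simp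
  also have "1 + 1 / real d = 1 / (real d / real (d + 1))" using assms by (simp add: field_simps)
  finally have "2 \<le> 1 / (real d / real (d + 1)) ^ d" by (simp only: power_divide power_one)
  moreover have "0 < (real d / real (d + 1)) ^ d" using assms by simp
  ultimately show ?thesis by (simp add: field_simps)
qed

text \<open>With \<open>c = d + 1\<close> the first summand of \<open>sketch_failure\<close> takes
  at most 19/20 of the right side and the term for the norm of \<open>G\<close> at most 1/20. For
  the former, squares are compared by \<open>half_power_bound\<close> and
  \<open>pi_mult_le_exp\<close>.\<close>

lemma sketch_failure_le_stirling:
  assumes d: "2 \<le> d" and l: "d \<le> l" "l < m"
  shows "sketch_failure d m l (real (d + 1)) \<le> 1 / sqrt (2 * pi * real d) * (exp 1 / real d) ^ d"
proof -
  define E where "E = 1 / sqrt (2 * pi * real d) * (exp 1 / real d) ^ d"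
  have d0: "0 < real d" using d by simp
  have E0: "0 < E" using d0 by (simp add: E_def)
  have "(exp 1 / (real (d + 1) * real d)) powr (real d / 2) \<le> (19 / 20) * E"
  proof (rule power2_le_imp_le)
    have "((exp 1 / (real (d + 1) * real d)) powr (real d / 2))\<^sup>2 = (exp 1 / (real (d + 1) * real d)) powr real d"
      by (simp add: power2_eq_square powr_add[symmetric])
    also have "\<dots> = (exp 1 / (real (d + 1) * real d)) ^ d"
      using d0 by (intro powr_realpow) simp
    also have "\<dots> = (real d / real (d + 1)) ^ d * (exp 1 ^ d / (real d ^ d)\<^sup>2)"
      using d0 by (simp add: power_divide power_mult_distrib power2_eq_square)
    also have "\<dots> \<le> (1 / 2) * (exp 1 ^ d / (real d ^ d)\<^sup>2)"
      using d by (intro mult_right_mono half_power_bound) auto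
    also have "\<dots> \<le> ((19 / 20) * E)\<^sup>2"
    proof -
      have "((19 / 20) * E)\<^sup>2 = ((361 / 400) * exp 1 ^ d) * exp 1 ^ d / (2 * pi * real d * (real d ^ d)\<^sup>2)"
      proof -
        have s2: "(sqrt (2 * pi * real d))\<^sup>2 = 2 * pi * real d" using d0 by simp
        show ?thesis unfolding E_def power_mult_distrib power_divide s2 by (simp add: power2_eq_square)
      qed
      moreover have "\<dots> \<ge> (pi * real d) * exp 1 ^ d / (2 * pi * real d * (real d ^ d)\<^sup>2)"
        using d0 by (intro divide_right_mono mult_right_mono pi_mult_le_exp d) auto
      moreover have "(pi * real d) * exp 1 ^ d / (2 * pi * real d * (real d ^ d)\<^sup>2) = (1 / 2) * (exp 1 ^ d / (real d ^ d)\<^sup>2)"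
        using d0 by (simp add: field_simps)
      ultimately show ?thesis by simp
    qed
    finally show "((exp 1 / (real (d + 1) * real d)) powr (real d / 2))\<^sup>2 \<le> ((19 / 20) * E)\<^sup>2" .
  qed (use E0 in simp)
  moreover have "(sqrt 2 / exp 1) ^ (m * l) \<le> (1 / 20) * E"
  proof -
    \<comment> \<open>The decimal constants below come from the case \<open>d = 2\<close>, rounded
      up; the quantities they bound decrease from there on.\<close>
    have step: "(21 / 40) ^ (d + 1) * real d \<le> (2895 / 10000 :: real)" using d
    proof (induction d rule: nat_induct_at_least)
      case base
      then show ?case by (simp add: eval_nat_numeral)
    next
      case (Suc n)
      have "(21 / 40 :: real) ^ (Suc n + 1) * real (Suc n) = (21 / 40) ^ (n + 1) * ((21 / 40) * real (Suc n))" by simp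
      also have "\<dots> \<le> (21 / 40) ^ (n + 1) * real n" using Suc by (intro mult_left_mono) auto
      finally show ?case using Suc by linarith
    qed
    have dec: "(1073 / 10000) ^ d * real d \<le> (2304 / 100000 :: real)" using d
    proof (induction d rule: nat_induct_at_least)
      case base
      then show ?case by (simp add: power2_eq_square)
    next
      case (Suc n)
      have "(1073 / 10000 :: real) ^ Suc n * real (Suc n) = (1073 / 10000) ^ n * ((1073 / 10000) * real (Suc n))" by simp
      also have "\<dots> \<le> (1073 / 10000) ^ n * real n" using Suc by (intro mult_left_mono) auto
      finally show ?case using Suc by linarith
    qed
    have sq: "sqrt (2 * pi * real d) \<le> (1775 / 1000) * real d"
    proof (rule real_le_lsqrt)
      have "2 * pi * real d \<le> 2 * (315 / 100) * real d"
        using pi_le_315 by (intro mult_right_mono mult_left_mono) auto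
      also have "\<dots> \<le> (1775 / 1000)\<^sup>2 * (2 * real d)" by (simp add: power2_eq_square)
      also have "\<dots> \<le> (1775 / 1000)\<^sup>2 * (real d * real d)" using d by (intro mult_left_mono mult_right_mono) auto
      finally show "2 * pi * real d \<le> ((1775 / 1000) * real d)\<^sup>2" by (simp add: power_mult_distrib power2_eq_square mult_ac)
    qed simp
    have q: "0 \<le> sqrt 2 / exp (1::real)" by simp
    have q1: "sqrt 2 / exp (1::real) \<le> 1" by (rule order_trans[OF sqrt2_div_exp_le]) simp
    have "(d + 1) * d \<le> m * l" using l by (intro mult_le_mono) auto
    then have "(sqrt 2 / exp (1::real)) ^ (m * l) \<le> (sqrt 2 / exp 1) ^ ((d + 1) * d)"
      by (rule power_decreasing[OF _ q q1])
    also have "\<dots> = ((sqrt 2 / exp 1) ^ (d + 1)) ^ d" by (rule power_mult)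
    also have "\<dots> \<le> ((21 / 40) ^ (d + 1)) ^ d"
      by (intro power_mono sqrt2_div_exp_le q zero_le_power)
    also have "\<dots> = ((21 / 40) ^ (d + 1) * real d / exp 1) ^ d * (exp 1 / real d) ^ d"
      using d0 by (simp add: power_mult_distrib[symmetric])
    also have "\<dots> \<le> (1073 / 10000) ^ d * (exp 1 / real d) ^ d"
    proof (intro mult_right_mono power_mono)
      have "(21 / 40) ^ (d + 1) * real d / exp 1 \<le> (2895 / 10000) / (27 / 10 :: real)"
        by (intro frac_le step exp_1_bounds) auto
      then show "(21 / 40) ^ (d + 1) * real d / exp 1 \<le> (1073 / 10000 :: real)" by simp
    qed (use d0 in auto)
    also have "\<dots> = (1073 / 10000) ^ d * sqrt (2 * pi * real d) * E"
      using d0 by (simp add: E_def)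
    also have "\<dots> \<le> (1073 / 10000) ^ d * ((1775 / 1000) * real d) * E"
      using E0 by (intro mult_right_mono mult_left_mono sq) auto
    also have "\<dots> \<le> (1 / 20) * E"
    proof (rule mult_right_mono)
      have "(1073 / 10000) ^ d * ((1775 / 1000) * real d) = (1775 / 1000) * ((1073 / 10000) ^ d * real d)" by (simp only: mult_ac)
      also have "\<dots> \<le> (1775 / 1000) * (2304 / 100000)" by (rule mult_left_mono[OF dec]) simp
      also have "\<dots> \<le> 1 / 20" by simp
      finally show "(1073 / 10000) ^ d * ((1775 / 1000) * real d) \<le> 1 / 20" .
    qed (use E0 in simp)
    finally show ?thesis .
  qed
  ultimately show ?thesis unfolding sketch_failure_def E_def[symmetric] by linarith
qed

text \<open>For \<open>c = 4\<close> and \<open>d \<ge> 8\<close> both summands of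
  \<open>sketch_failure\<close> are at most \<open>(3 / 10) ^ d\<close>. The hypothesis on
  \<open>s\<close> gives \<open>s \<le> d / 8\<close>, so \<open>exp (- s)\<close> decays far more
  slowly and leaves room for a factor 8.\<close>

lemma sketch_failure_4_le:
  assumes d: "8 \<le> d" and l: "d \<le> l" "l < m" and s: "8 * s < 2 + (3 / 5) * real (d + 1)"
  shows "sketch_failure d m l 4 \<le> exp (- s) / 4"
proof -
  have "(exp 1 / (4 * real d)) powr (real d / 2) \<le> (3 / 10) ^ d"
  proof -
    have "exp 1 / (4 * real d) \<le> (288 / 100) / (4 * 8)"
      using d by (intro frac_le exp_1_bounds) auto
    then have "(exp 1 / (4 * real d)) powr (real d / 2) \<le> ((3 / 10)\<^sup>2) powr (real d / 2)"
      using d by (intro powr_mono2) (auto simp: power2_eq_square)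
    also have "\<dots> = ((3 / 10) powr 2) powr (real d / 2)" by simp
    also have "\<dots> = (3 / 10) powr real d" unfolding powr_powr by simp
    also have "\<dots> = (3 / 10) ^ d" by (rule powr_realpow) simp
    finally show ?thesis .
  qed
  moreover have "(sqrt 2 / exp (1::real)) ^ (m * l) \<le> (3 / 10) ^ d"
  proof -
    have q: "0 \<le> sqrt 2 / exp (1::real)" by simp
    have q1: "sqrt 2 / exp (1::real) \<le> 1" by (rule order_trans[OF sqrt2_div_exp_le]) simp
    have "2 * d \<le> m * l" using l d by (intro mult_le_mono) auto
    then have "(sqrt 2 / exp (1::real)) ^ (m * l) \<le> (sqrt 2 / exp 1) ^ (2 * d)"
      by (rule power_decreasing[OF _ q q1])
    also have "\<dots> = ((sqrt 2 / exp 1)\<^sup>2) ^ d" by (rule power_mult)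
    also have "\<dots> \<le> ((21 / 40)\<^sup>2) ^ d" by (intro power_mono sqrt2_div_exp_le q zero_le_power)
    also have "\<dots> \<le> (3 / 10) ^ d" by (intro power_mono) (auto simp: power2_eq_square)
    finally show ?thesis .
  qed
  moreover have "8 * (3 / 10) ^ d \<le> exp (- s)"
  proof -
    have "8 * (3 / 10 :: real) ^ d * exp (1 / 8) ^ d \<le> 8 * (3 / 10) ^ d * (1 + 1 / 8 + (1 / 8)\<^sup>2) ^ d"
      by (intro mult_left_mono power_mono exp_bound) auto
    also have "\<dots> = 8 * (3 / 10 * (1 + 1 / 8 + (1 / 8)\<^sup>2)) ^ d" by (simp only: power_mult_distrib mult.assoc)
    also have "\<dots> \<le> 8 * (2 / 5) ^ d" by (intro mult_left_mono power_mono) (auto simp: power2_eq_square)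
    also have "\<dots> \<le> 8 * (2 / 5) ^ 8" using d by (intro mult_left_mono power_decreasing) auto
    also have "\<dots> \<le> 1" by (simp add: eval_nat_numeral)
    finally have "8 * (3 / 10 :: real) ^ d * exp (1 / 8) ^ d \<le> 1" .
    moreover have "exp s \<le> exp (1 / 8 :: real) ^ d"
    proof -
      have "8 \<le> real d" using d by simp
      then have "s \<le> real d * (1 / 8)" using s by (simp add: distrib_left)
      then show ?thesis unfolding exp_of_nat_mult[symmetric] by simp
    qed
    then have "8 * (3 / 10 :: real) ^ d * exp s \<le> 8 * (3 / 10) ^ d * exp (1 / 8) ^ d" by (intro mult_left_mono) auto
    ultimately have "8 * (3 / 10 :: real) ^ d * exp s \<le> 1" by linarith
    then have "8 * (3 / 10 :: real) ^ d \<le> 1 / exp s" by (simp only: pos_le_divide_eq[OF exp_gt_zero])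
    then show ?thesis by (simp only: exp_minus inverse_eq_divide)
  qed
  ultimately show ?thesis unfolding sketch_failure_def by linarith
qed

text \<open>All from \<open>\<eta>\<^sup>2 \<ge> 1 + (8 / \<delta>) ln (1 / \<delta>)\<close>. The
  first bound is the strong one for small \<open>\<delta>\<close>; the second, by
  \<open>ln \<delta> \<le> \<delta> - 1\<close>, is free of logarithms and serves large
  \<open>\<delta>\<close>.\<close>

lemma confidence_factor_bounds:
  fixes \<delta> :: real
  assumes \<delta>: "0 < \<delta>" "\<delta> < 1" and \<eta>: "\<eta> = 1 + sqrt (8 / \<delta> * ln (1 / \<delta>))"
  shows "8 * ln (1 / \<delta>) \<le> \<eta>\<^sup>2 * \<delta>" and "8 / \<delta> - 7 \<le> \<eta>\<^sup>2" and "1 \<le> \<eta>"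
proof -
  have ln0: "0 \<le> ln (1 / \<delta>)" using \<delta> by simp
  have x0: "0 \<le> 8 / \<delta> * ln (1 / \<delta>)" using \<delta> ln0 by (intro mult_nonneg_nonneg) auto
  show "1 \<le> \<eta>" unfolding \<eta> using x0 by simp
  have ge: "1 + 8 / \<delta> * ln (1 / \<delta>) \<le> \<eta>\<^sup>2"
    unfolding \<eta> using x0 by (simp add: power2_sum)
  have "8 / \<delta> * ln (1 / \<delta>) \<le> \<eta>\<^sup>2" using ge by simp
  then have "8 / \<delta> * ln (1 / \<delta>) * \<delta> \<le> \<eta>\<^sup>2 * \<delta>" using \<delta> by (intro mult_right_mono) auto
  then show "8 * ln (1 / \<delta>) \<le> \<eta>\<^sup>2 * \<delta>" using \<delta> by simp
  have "ln \<delta> \<le> \<delta> - 1" using \<delta>(1) by (rule ln_le_minus_one)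
  then have "1 - \<delta> \<le> ln (1 / \<delta>)" using \<delta> by (simp add: ln_div)
  then have "8 / \<delta> * (1 - \<delta>) \<le> 8 / \<delta> * ln (1 / \<delta>)" using \<delta> by (intro mult_left_mono) auto
  moreover have "8 / \<delta> * (1 - \<delta>) = 8 / \<delta> - 8" using \<delta> by (simp add: field_simps)
  ultimately show "8 / \<delta> - 7 \<le> \<eta>\<^sup>2" using ge by linarith
qed

text \<open>A lower estimate of the coefficient \<open>2 (1 + \<lambda>) I\<close> in the claim,
  from \<open>\<lambda> \<ge> sqrt (2 l) (sqrt l + sqrt m)\<close> with \<open>l = \<mu> + K\<close>
  and \<open>m = I\<close>, multiplied by the \<open>2 sqrt \<mu>\<close> that arises when rank
  times \<open>Delta1\<close> is replaced by the tail sum of squares.\<close>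

definition budget_factor :: "nat \<Rightarrow> nat \<Rightarrow> nat \<Rightarrow> real" where
  "budget_factor m l \<mu> = 4 * (1 + sqrt (2 * real l) * (sqrt (real l) + sqrt (real m))) * real m * sqrt (real \<mu>)"

lemma budget_factor_ge:
  assumes "l < m"
  shows "4 * sqrt (real \<mu>) * real m * (1 + 14 / 5 * real l) \<le> budget_factor m l \<mu>"
    and "56 / 5 * sqrt (real \<mu>) * real m * real l \<le> budget_factor m l \<mu>"
proof -
  have "sqrt (2 * real l) * (sqrt (real l) + sqrt (real m)) \<ge> sqrt (2 * real l) * (2 * sqrt (real l))"
    using assms by (intro mult_left_mono) auto
  moreover have "sqrt (2 * real l) * (2 * sqrt (real l)) = 2 * sqrt 2 * real l"
    by (simp add: real_sqrt_mult)
  moreover have "2 * (14 / 10) * real l \<le> 2 * sqrt 2 * real l"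
    using sqrt2_bounds by (intro mult_right_mono mult_left_mono) auto
  ultimately have "1 + 14 / 5 * real l \<le> 1 + sqrt (2 * real l) * (sqrt (real l) + sqrt (real m))" by linarith
  then have "4 * sqrt (real \<mu>) * real m * (1 + 14 / 5 * real l) \<le>
    4 * sqrt (real \<mu>) * real m * (1 + sqrt (2 * real l) * (sqrt (real l) + sqrt (real m)))"
    by (intro mult_left_mono) auto
  also have "\<dots> = budget_factor m l \<mu>" by (simp add: budget_factor_def mult_ac)
  finally show 1: "4 * sqrt (real \<mu>) * real m * (1 + 14 / 5 * real l) \<le> budget_factor m l \<mu>" .
  have "56 / 5 * sqrt (real \<mu>) * real m * real l \<le> 4 * sqrt (real \<mu>) * real m * (1 + 14 / 5 * real l)"
    by (simp add: algebra_simps)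
  with 1 show "56 / 5 * sqrt (real \<mu>) * real m * real l \<le> budget_factor m l \<mu>" by linarith
qed

text \<open>The arithmetic-geometric inequality gives
  \<open>2 sqrt (\<mu> c) \<le> \<mu> + c \<le> l + 2\<close>, so the sketch factor is of the order
  \<open>sqrt \<mu> m l\<close> like the budget. The factor 3 keeps the Markov probability at 1/3
  and leaves Chebyshev two thirds of the budget.\<close>

lemma sketch_factor_le:
  assumes \<mu>: "0 < \<mu>" and K: "0 < K" and m: "\<mu> + K < m" and c: "0 < c" "c \<le> real (K + 2)"
  shows "3 * sketch_factor m (\<mu> + K) \<mu> c \<le> budget_factor m (\<mu> + K) \<mu>"
proof -
  define l where "l = \<mu> + K"
  define z where "z = sqrt (real \<mu>)"
  have z: "1 \<le> z" "z\<^sup>2 = real \<mu>" using \<mu> by (auto simp: z_def)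
  have l2: "2 \<le> real l" "real l \<le> real m" "3 \<le> real m" using \<mu> K m by (auto simp: l_def)
  have ml: "sqrt (real (m * l)) \<le> real m"
  proof (rule real_le_lsqrt)
    have "real m * real l \<le> real m * real m" using l2 by (intro mult_left_mono) auto
    then show "real (m * l) \<le> (real m)\<^sup>2" by (simp add: power2_eq_square)
  qed simp
  have zc: "2 * (z * sqrt c) \<le> real l + 2"
  proof -
    have "0 \<le> (z - sqrt c)\<^sup>2" by simp
    then have "2 * (z * sqrt c) \<le> real \<mu> + c" using c z(2) by (simp add: power2_diff)
    then show ?thesis using c(2) by (simp add: l_def)
  qed
  have "sketch_factor m l \<mu> c = 1 + 2 * z * sqrt (real (m * l)) * (2 * (z * sqrt c))"
    using z(2) by (simp add: sketch_factor_def real_sqrt_mult power2_eq_square)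
  also have "\<dots> \<le> 1 + 2 * z * real m * (real l + 2)"
    using z(1) c ml by (intro add_left_mono mult_mono zc mult_left_mono) (auto intro: mult_nonneg_nonneg)
  finally have 1: "3 * sketch_factor m l \<mu> c \<le> 3 + z * real m * (6 * real l + 12)" by (simp add: algebra_simps)
  have "1 * 3 \<le> z * real m" using z(1) l2 by (intro mult_mono) auto
  then have zm: "3 \<le> z * real m" by simp
  have "3 \<le> z * real m * 1" using zm by simp
  also have "\<dots> \<le> z * real m * (26 / 5 * real l - 8)" using zm l2 by (intro mult_left_mono) auto
  finally have "3 + z * real m * (6 * real l + 12) \<le> z * real m * (26 / 5 * real l - 8) + z * real m * (6 * real l + 12)" by simp
  also have "\<dots> = 4 * z * real m * (1 + 14 / 5 * real l)" by (simp add: algebra_simps)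
  also have "\<dots> \<le> budget_factor m l \<mu>"
    unfolding z_def by (rule budget_factor_ge(1)) (use m in \<open>simp add: l_def\<close>)
  finally show ?thesis using 1 unfolding l_def by linarith
qed

text \<open>This quantity multiplies \<open>1 / \<eta>\<^sup>2\<close> in the Chebyshev estimate. In
  it \<open>h\<^sup>2\<close> is about \<open>16 \<mu>\<^sup>2 m l c\<close> and
  \<open>a - h\<close> at least a multiple of \<open>sqrt \<mu> m l\<close>; the remaining power 3/2
  of \<open>\<mu>\<close> is cancelled by \<open>r\<^sup>2\<close>, as
  \<open>r \<ge> \<mu> + 1\<close>.\<close>

lemma chebyshev_constant_le:
  assumes \<mu>: "0 < \<mu>" and K: "0 < K" and m: "\<mu> + K < m" and c: "3 \<le> c" "c \<le> real (K + 2)" and r: "\<mu> < r"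
    and h: "h = sketch_factor m (\<mu> + K) \<mu> c" and a: "a = budget_factor m (\<mu> + K) \<mu>"
  shows "h\<^sup>2 / (2 * (a - h) * (real r)\<^sup>2) \<le> (3 / 5) * c"
proof -
  define l where "l = \<mu> + K"
  define z where "z = sqrt (real \<mu>)"
  have z: "1 \<le> z" "z\<^sup>2 = real \<mu>" using \<mu> by (auto simp: z_def)
  have l2: "2 \<le> real l" "real l \<le> real m" "3 \<le> real m" using \<mu> K m by (auto simp: l_def)
  define g where "g = 4 * real \<mu> * sqrt (real (m * l) * c)"
  have hg: "h = 1 + g" by (simp add: h sketch_factor_def g_def l_def)
  have g2: "g\<^sup>2 = 16 * (real \<mu>)\<^sup>2 * (real m * real l * c)"
  proof -
    have "(sqrt (real (m * l) * c))\<^sup>2 = real m * real l * c" using c by simp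
    then show ?thesis unfolding g_def power_mult_distrib by simp
  qed
  have "16 \<le> g"
  proof -
    have "3 * 2 * 3 \<le> real m * real l * c" using l2 c by (intro mult_mono) auto
    then have "4 \<le> sqrt (real (m * l) * c)" by (intro real_le_rsqrt) simp
    then have "4 * 1 * 4 \<le> 4 * real \<mu> * sqrt (real (m * l) * c)" using \<mu> by (intro mult_mono) auto
    then show ?thesis by (simp add: g_def)
  qed
  \<comment> \<open>The summand 1 of \<open>h\<close> is at most \<open>g / 16\<close>.\<close>
  then have "h \<le> (17 / 16) * g" and h0: "0 < h" by (auto simp: hg)
  then have "h\<^sup>2 \<le> ((17 / 16) * g)\<^sup>2" by (intro power_mono) auto
  also have "\<dots> = (289 / 16) * ((real \<mu>)\<^sup>2 * (real m * real l * c))" unfolding power_mult_distrib g2 by (simp add: power2_eq_square)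
  finally have h2: "h\<^sup>2 \<le> (289 / 16) * ((real \<mu>)\<^sup>2 * (real m * real l * c))" .
  have ha: "3 * h \<le> a" unfolding h a by (rule sketch_factor_le[OF \<mu> K m _ c(2)]) (use c in simp)
  have "56 / 5 * z * real m * real l \<le> a" unfolding a l_def[symmetric] z_def
    by (rule budget_factor_ge(2)) (use m in \<open>simp add: l_def\<close>)
  then have ah: "112 / 15 * (z * real m * real l) \<le> a - h" using ha by simp
  \<comment> \<open>Expand \<open>z\<^sup>2 (z - 7/5)\<^sup>2 \<ge> 0\<close>; rounding
    \<open>49/25\<close> up to 2 completes the square
    \<open>(z\<^sup>2 + 1)\<^sup>2\<close>.\<close>
  have zr: "2 * z ^ 3 * (14 / 10) \<le> (real r)\<^sup>2"
  proof -
    have "0 \<le> z\<^sup>2 * (z - 14 / 10)\<^sup>2" by simp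
    also have "\<dots> = z ^ 4 - 2 * z ^ 3 * (14 / 10) + (196 / 100) * z\<^sup>2"
      by (simp add: power2_eq_square eval_nat_numeral algebra_simps)
    finally have "2 * z ^ 3 * (14 / 10) \<le> z ^ 4 + 2 * z\<^sup>2 + 1" using zero_le_power2[of z] by linarith
    also have "\<dots> = (z\<^sup>2 + 1)\<^sup>2" by (simp add: power2_eq_square eval_nat_numeral algebra_simps)
    also have "\<dots> \<le> (real r)\<^sup>2" using r by (intro power_mono) (auto simp: z(2))
    finally show ?thesis .
  qed
  have pos: "0 < z * real m * real l" using z l2 by (intro mult_pos_pos) auto
  have den: "0 < 2 * (a - h) * (real r)\<^sup>2" using ah pos r by (intro mult_pos_pos) auto
  have "(289 / 16) * ((real \<mu>)\<^sup>2 * (real m * real l * c)) = (289 / 16) * c * (z * real m * real l) * z ^ 3"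
    using z(2)[symmetric] by (simp add: eval_nat_numeral mult_ac)
  also have "\<dots> \<le> (3 / 5) * c * (2 * (112 / 15 * (z * real m * real l)) * (2 * z ^ 3 * (14 / 10)))"
    using c pos z by simp
  also have "\<dots> \<le> (3 / 5) * c * (2 * (a - h) * (real r)\<^sup>2)"
    using c ah zr pos z by (intro mult_left_mono mult_mono) auto
  finally have "h\<^sup>2 \<le> (3 / 5) * c * (2 * (a - h) * (real r)\<^sup>2)" using h2 by linarith
  then show ?thesis using den by (simp add: pos_divide_le_eq)
qed

section \<open>The failure probability of one step\<close>

lemma sqrt_mult_less:
  assumes "0 < r" "0 \<le> u" "D\<^sup>2 < u\<^sup>2 / r"
  shows "sqrt r * D < u"
proof (rule power2_less_imp_less[OF _ assms(2)])
  have "(sqrt r * D)\<^sup>2 = r * D\<^sup>2" using assms(1) by (simp add: power_mult_distrib)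
  also have "\<dots> < u\<^sup>2" using assms(1,3) by (simp add: pos_less_divide_eq mult.commute)
  finally show "(sqrt r * D)\<^sup>2 < u\<^sup>2" .
qed

lemma (in prob_space) prob_Un3_le:
  assumes "S \<subseteq> A \<union> B \<union> C" "A \<in> events" "B \<in> events" "C \<in> events"
    and "prob A \<le> a" "prob B \<le> b" "prob C \<le> c"
  shows "prob S \<le> a + b + c"
proof -
  have "prob S \<le> prob (A \<union> B \<union> C)" using assms by (intro finite_measure_mono) auto
  also have "\<dots> \<le> prob (A \<union> B) + prob C" using assms by (intro measure_Un_le) auto
  also have "\<dots> \<le> prob A + prob B + prob C" using assms by (intro add_right_mono measure_Un_le) auto
  finally show ?thesis using assms by linarith
qed

text \<open>In the notation of the introduction, \<open>x = \<parallel>E C\<parallel>\<^sup>2\<close>, \<open>y = \<parallel>(1 - V V\<^sup>T) C\<parallel>\<^sup>2\<close>, \<open>e = \<parallel>E B\<parallel>\<^sup>2\<close>,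
  \<open>D = \<parallel>C C\<^sup>T - B B\<^sup>T\<parallel>\<close> and \<open>t = \<parallel>(1 - V V\<^sup>T) B\<parallel>\<^sup>2\<close>, the conditional mean of \<open>y\<close>; moreover \<open>\<kappa> = 1 / (\<beta>\<^sub>0 T\<^sub>n)\<close>
  and \<open>W = \<parallel>A\<parallel>\<^sup>2\<close>.\<close>

locale sketched_step = prob_space M for M :: "'a measure" +
  fixes x y e D t :: "'a \<Rightarrow> real" and m \<mu> K r :: nat and \<kappa> W \<tau> \<delta> \<eta> :: real
  assumes sketch: "\<And>c. 0 < c \<Longrightarrow>
      {\<omega> \<in> space M. sketch_factor m (\<mu> + K) \<mu> c * y \<omega> < x \<omega>} \<in> events \<and>
      prob {\<omega> \<in> space M. sketch_factor m (\<mu> + K) \<mu> c * y \<omega> < x \<omega>} \<le> sketch_failure (K + 1) m (\<mu> + K) c"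
    and error: "\<And>\<omega>. \<omega> \<in> space M \<Longrightarrow> e \<omega> \<le> x \<omega> + sqrt (real r) * D \<omega>"
    and gram: "\<And>s. 0 < s \<Longrightarrow> {\<omega> \<in> space M. s \<le> (D \<omega>)\<^sup>2} \<in> events \<and>
      prob {\<omega> \<in> space M. s \<le> (D \<omega>)\<^sup>2} \<le> \<kappa> * W\<^sup>2 / s"
    and tail: "\<And>s. 0 < s \<Longrightarrow> {\<omega> \<in> space M. s \<le> y \<omega>} \<in> events \<and>
      prob {\<omega> \<in> space M. s \<le> y \<omega>} \<le> \<tau> / s"
    and tail_variance: "\<And>s. 0 < s \<Longrightarrow> {\<omega> \<in> space M. s \<le> (y \<omega> - t \<omega>)\<^sup>2} \<in> events \<and>
      prob {\<omega> \<in> space M. s \<le> (y \<omega> - t \<omega>)\<^sup>2} \<le> \<kappa> * W * \<tau> / s"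
    and t_le: "\<And>\<omega>. \<omega> \<in> space M \<Longrightarrow> t \<omega> \<le> \<tau>"
    and low_rank: "\<And>\<omega>. r \<le> \<mu> \<Longrightarrow> \<omega> \<in> space M \<Longrightarrow> y \<omega> = 0"
    and \<mu>: "0 < \<mu>" and K: "0 < K" and m: "\<mu> + K < m" and r: "0 < r"
    and \<kappa>: "0 < \<kappa>" and W: "0 < W" and \<tau>: "\<mu> < r \<Longrightarrow> 0 < \<tau>"
    and \<delta>: "0 < \<delta>" "\<delta> < 1" and \<eta>: "\<eta> = 1 + sqrt (8 / \<delta> * ln (1 / \<delta>))"
    and small: "real r * \<eta> * sqrt \<kappa> < 1"
begin

text \<open>The part of the bound that stems from \<open>\<phi>\<close>, with
  \<open>sqrt \<kappa>\<close> for \<open>1 / sqrt (\<beta>\<^sub>0 T)\<close> and with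
  \<open>r\<close> in place of the rank.\<close>

definition R :: real where "R = real r * \<eta> * sqrt \<kappa> * W"

abbreviation "a \<equiv> budget_factor m (\<mu> + K) \<mu>"

abbreviation "h c \<equiv> sketch_factor m (\<mu> + K) \<mu> c"

lemma \<eta>_ge: "1 \<le> \<eta>" and \<eta>2: "8 / \<delta> - 7 \<le> \<eta>\<^sup>2" and \<eta>\<delta>: "8 * ln (1 / \<delta>) \<le> \<eta>\<^sup>2 * \<delta>"
  using confidence_factor_bounds[OF \<delta> \<eta>] by auto

lemma R_pos: "0 < R"
  unfolding R_def using r \<kappa> W \<eta>_ge by (intro mult_pos_pos) auto

lemma R_sq: "R\<^sup>2 = (real r)\<^sup>2 * \<eta>\<^sup>2 * \<kappa> * W\<^sup>2"
  using \<kappa> by (simp add: R_def power_mult_distrib)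

lemma h_pos: "0 < c \<Longrightarrow> 1 \<le> h c"
  by (simp add: sketch_factor_def)

text \<open>\<open>\<theta>\<close> is the share of \<open>R\<close> reserved for the Gram matrix
  error: all of it or one half. Because \<open>R\<close> is proportional to
  \<open>sqrt \<kappa> W\<close>, both \<open>\<kappa>\<close> and \<open>W\<close> cancel from the
  Markov bound.\<close>

lemma gram_event:
  assumes "0 < \<theta>"
  shows "{\<omega> \<in> space M. (\<theta> * R)\<^sup>2 / real r \<le> (D \<omega>)\<^sup>2} \<in> events"
    and "prob {\<omega> \<in> space M. (\<theta> * R)\<^sup>2 / real r \<le> (D \<omega>)\<^sup>2} \<le> 1 / (\<theta>\<^sup>2 * real r * \<eta>\<^sup>2)"
proof -
  have s: "0 < (\<theta> * R)\<^sup>2 / real r" using assms R_pos r by simp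
  from gram[OF s] show "{\<omega> \<in> space M. (\<theta> * R)\<^sup>2 / real r \<le> (D \<omega>)\<^sup>2} \<in> events" by blast
  from gram[OF s] have "prob {\<omega> \<in> space M. (\<theta> * R)\<^sup>2 / real r \<le> (D \<omega>)\<^sup>2} \<le> \<kappa> * W\<^sup>2 / ((\<theta> * R)\<^sup>2 / real r)" by blast
  also have "\<dots> = 1 / (\<theta>\<^sup>2 * real r * \<eta>\<^sup>2)"
    using \<kappa> W r \<eta>_ge assms unfolding power_mult_distrib R_sq by (simp add: power2_eq_square field_simps)
  finally show "prob {\<omega> \<in> space M. (\<theta> * R)\<^sup>2 / real r \<le> (D \<omega>)\<^sup>2} \<le> 1 / (\<theta>\<^sup>2 * real r * \<eta>\<^sup>2)" .
qed

lemma not_gram_event: "0 < \<theta> \<Longrightarrow> (D \<omega>)\<^sup>2 < (\<theta> * R)\<^sup>2 / real r \<Longrightarrow> sqrt (real r) * D \<omega> < \<theta> * R"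
  using R_pos r by (intro sqrt_mult_less) auto

lemma one_pos: "0 < (1::real)" and half_pos: "0 < (1 / 2 :: real)"
  by simp_all

abbreviation "stirling \<equiv> 1 / sqrt (2 * pi * real (K + 1)) * (exp 1 / real (K + 1)) ^ (K + 1)"

lemma sketch_le_stirling: "sketch_failure (K + 1) m (\<mu> + K) (real (K + 2)) \<le> stirling"
  using sketch_failure_le_stirling[of "K + 1" "\<mu> + K" m] K \<mu> m by simp

text \<open>The sampled tail \<open>y\<close> is zero here, so off the sketch failure
  \<open>x \<le> 0\<close> and only the Gram error competes with \<open>R\<close>; its probability
  is at most \<open>1 / \<eta>\<^sup>2 \<le> \<delta>\<close>.\<close>

lemma failure_low_rank:
  assumes "r \<le> \<mu>"
  shows "prob {\<omega> \<in> space M. R < e \<omega>} \<le> stirling + \<delta>"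
proof -
  have c: "0 < real (K + 2)" by simp
  have "prob {\<omega> \<in> space M. R < e \<omega>} \<le> sketch_failure (K + 1) m (\<mu> + K) (real (K + 2)) + 0 + 1 / (1\<^sup>2 * real r * \<eta>\<^sup>2)"
  proof (rule prob_Un3_le[where B = "{}"])
    show "{\<omega> \<in> space M. R < e \<omega>} \<subseteq> {\<omega> \<in> space M. h (real (K + 2)) * y \<omega> < x \<omega>} \<union> {} \<union>
      {\<omega> \<in> space M. (1 * R)\<^sup>2 / real r \<le> (D \<omega>)\<^sup>2}"
    proof
      fix \<omega> assume \<omega>: "\<omega> \<in> {\<omega> \<in> space M. R < e \<omega>}"
      show "\<omega> \<in> {\<omega> \<in> space M. h (real (K + 2)) * y \<omega> < x \<omega>} \<union> {} \<union> {\<omega> \<in> space M. (1 * R)\<^sup>2 / real r \<le> (D \<omega>)\<^sup>2}"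
      proof (rule ccontr)
        assume "\<not> ?thesis"
        then have "x \<omega> \<le> 0" "(D \<omega>)\<^sup>2 < (1 * R)\<^sup>2 / real r" using \<omega> low_rank[OF assms, of \<omega>] by auto
        then show False using not_gram_event[of 1 \<omega>] error[of \<omega>] \<omega> by auto
      qed
    qed
  qed (simp_all only: sketch[OF c] gram_event[OF one_pos] sets.empty_sets measure_empty order_refl)
  also have "1 / (1\<^sup>2 * real r * \<eta>\<^sup>2) \<le> \<delta>"
  proof -
    have "1 / \<delta> \<le> 8 / \<delta> - 7" using \<delta> by (simp add: field_simps)
    then have "1 / \<delta> \<le> \<eta>\<^sup>2" using \<eta>2 by linarith
    also have "\<eta>\<^sup>2 \<le> real r * \<eta>\<^sup>2" using r by (simp add: mult_le_cancel_right1)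
    finally show ?thesis using \<delta> r \<eta>_ge by (simp add: field_simps)
  qed
  finally show ?thesis using sketch_le_stirling by linarith
qed

text \<open>Markov's inequality for \<open>y\<close> costs \<open>h / a \<le> 1/3\<close>,
  affordable only for large \<open>\<delta>\<close>. The Gram error receives all of
  \<open>R\<close>; by \<open>r \<ge> 2\<close> and the logarithm-free bound on
  \<open>\<eta>\<^sup>2\<close>, its probability fits into \<open>\<delta> - 1/3\<close>.\<close>

lemma failure_markov:
  assumes r\<mu>: "\<mu> < r" and big: "2 / 5 \<le> \<delta>"
  shows "prob {\<omega> \<in> space M. a * \<tau> + R < e \<omega>} \<le> stirling + \<delta>"
proof -
  define c where "c = real (K + 2)"
  have c: "0 < c" by (simp add: c_def)
  have h1: "1 \<le> h c" by (rule h_pos[OF c])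
  have ha: "3 * h c \<le> a" by (rule sketch_factor_le[OF \<mu> K m c]) (simp add: c_def)
  have \<tau>0: "0 < \<tau>" by (rule \<tau>[OF r\<mu>])
  have s: "0 < a * \<tau> / h c" using h1 ha \<tau>0 by (intro divide_pos_pos mult_pos_pos) auto
  have "prob {\<omega> \<in> space M. a * \<tau> + R < e \<omega>} \<le> sketch_failure (K + 1) m (\<mu> + K) c + \<tau> / (a * \<tau> / h c) + 1 / (1\<^sup>2 * real r * \<eta>\<^sup>2)"
  proof (rule prob_Un3_le)
    show "{\<omega> \<in> space M. a * \<tau> + R < e \<omega>} \<subseteq> {\<omega> \<in> space M. h c * y \<omega> < x \<omega>} \<union>
      {\<omega> \<in> space M. a * \<tau> / h c \<le> y \<omega>} \<union> {\<omega> \<in> space M. (1 * R)\<^sup>2 / real r \<le> (D \<omega>)\<^sup>2}"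
    proof
      fix \<omega> assume \<omega>: "\<omega> \<in> {\<omega> \<in> space M. a * \<tau> + R < e \<omega>}"
      show "\<omega> \<in> {\<omega> \<in> space M. h c * y \<omega> < x \<omega>} \<union>
        {\<omega> \<in> space M. a * \<tau> / h c \<le> y \<omega>} \<union> {\<omega> \<in> space M. (1 * R)\<^sup>2 / real r \<le> (D \<omega>)\<^sup>2}"
      proof (rule ccontr)
        assume "\<not> ?thesis"
        then have "x \<omega> \<le> h c * y \<omega>" "y \<omega> < a * \<tau> / h c" "(D \<omega>)\<^sup>2 < (1 * R)\<^sup>2 / real r" using \<omega> by auto
        moreover from this(2) have "h c * y \<omega> < a * \<tau>" using h1 by (simp add: pos_less_divide_eq mult.commute)
        moreover have "sqrt (real r) * D \<omega> < 1 * R"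
          by (rule not_gram_event) (use calculation(3) in simp_all)
        moreover have "e \<omega> \<le> x \<omega> + sqrt (real r) * D \<omega>" "a * \<tau> + R < e \<omega>" using error \<omega> by auto
        ultimately show False by linarith
      qed
    qed
  qed (simp_all only: sketch[OF c] gram_event[OF one_pos] tail[OF s])
  also have "\<tau> / (a * \<tau> / h c) = h c / a" using \<tau>0 h1 by simp
  also have "h c / a \<le> 1 / 3" using h1 ha by (simp add: pos_divide_le_eq)
  also have "1 / (1\<^sup>2 * real r * \<eta>\<^sup>2) \<le> \<delta> / (16 - 14 * \<delta>)"
  proof -
    have "2 \<le> real r" using r\<mu> \<mu> by simp
    then have "2 * (8 / \<delta> - 7) \<le> real r * \<eta>\<^sup>2" using \<eta>2 \<delta> by (intro mult_mono) (auto simp: field_simps)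
    moreover have "2 * (8 / \<delta> - 7) = (16 - 14 * \<delta>) / \<delta>" using \<delta> by (simp add: field_simps)
    moreover have "0 < (16 - 14 * \<delta>) / \<delta>" using \<delta> by simp
    ultimately have "1 / (real r * \<eta>\<^sup>2) \<le> 1 / ((16 - 14 * \<delta>) / \<delta>)" by (intro frac_le) auto
    then show ?thesis by simp
  qed
  \<comment> \<open>After clearing the denominator this is a quadratic inequality; 14 times the
    product \<open>(\<delta> - 2/5) (1 - \<delta>)\<close> matches its square term.\<close>
  also have "\<delta> / (16 - 14 * \<delta>) \<le> \<delta> - 1 / 3"
  proof -
    have "0 \<le> (\<delta> - 2 / 5) * (1 - \<delta>)" using big \<delta> by (intro mult_nonneg_nonneg) auto
    moreover have "(\<delta> - 2 / 5) * (1 - \<delta>) = 7 / 5 * \<delta> - 2 / 5 - \<delta> * \<delta>" by (simp add: field_simps)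
    moreover have "(\<delta> - 1 / 3) * (16 - 14 * \<delta>) = 62 / 3 * \<delta> - 16 / 3 - 14 * (\<delta> * \<delta>)" by (simp add: field_simps)
    ultimately have "\<delta> \<le> (\<delta> - 1 / 3) * (16 - 14 * \<delta>)" using big by linarith
    then show ?thesis using \<delta> by (simp add: pos_divide_le_eq)
  qed
  finally show ?thesis using sketch_le_stirling unfolding c_def by linarith
qed

text \<open>\<open>R\<close> is shared equally between the Gram error and the fluctuation of
  \<open>y\<close> around its conditional mean, which is at most \<open>\<tau>\<close>. Of
  \<open>a \<tau>\<close> the amount \<open>h \<tau>\<close> covers the mean and
  \<open>(a - h) \<tau>\<close> goes to the fluctuation. The Gram error then costs
  \<open>2 / \<eta>\<^sup>2\<close>, the fluctuation
  \<open>(3/5) c / \<eta>\<^sup>2\<close>.\<close>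

lemma failure_chebyshev:
  assumes r\<mu>: "\<mu> < r" and c: "3 \<le> c" "c \<le> real (K + 2)"
  shows "prob {\<omega> \<in> space M. a * \<tau> + R < e \<omega>} \<le>
    sketch_failure (K + 1) m (\<mu> + K) c + (2 + 3 / 5 * c) / \<eta>\<^sup>2"
proof -
  have c0: "0 < c" using c by simp
  have h1: "1 \<le> h c" by (rule h_pos[OF c0])
  have ha: "3 * h c \<le> a" by (rule sketch_factor_le[OF \<mu> K m c0 c(2)])
  have \<tau>0: "0 < \<tau>" by (rule \<tau>[OF r\<mu>])
  define b where "b = a - h c"
  have b: "0 < b" using h1 ha by (simp add: b_def)
  \<comment> \<open>Chosen so that \<open>h (\<tau> + s) = a \<tau> + R / 2\<close>.\<close>
  define s where "s = (b * \<tau> + R / 2) / h c"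
  have s: "0 < s" using b \<tau>0 R_pos h1 unfolding s_def by (intro divide_pos_pos add_pos_pos mult_pos_pos) auto
  have "prob {\<omega> \<in> space M. a * \<tau> + R < e \<omega>} \<le> sketch_failure (K + 1) m (\<mu> + K) c + \<kappa> * W * \<tau> / s\<^sup>2 + 1 / ((1 / 2)\<^sup>2 * real r * \<eta>\<^sup>2)"
  proof (rule prob_Un3_le)
    show "{\<omega> \<in> space M. a * \<tau> + R < e \<omega>} \<subseteq> {\<omega> \<in> space M. h c * y \<omega> < x \<omega>} \<union>
      {\<omega> \<in> space M. s\<^sup>2 \<le> (y \<omega> - t \<omega>)\<^sup>2} \<union> {\<omega> \<in> space M. (1 / 2 * R)\<^sup>2 / real r \<le> (D \<omega>)\<^sup>2}"
    proof
      fix \<omega> assume \<omega>: "\<omega> \<in> {\<omega> \<in> space M. a * \<tau> + R < e \<omega>}"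
      show "\<omega> \<in> {\<omega> \<in> space M. h c * y \<omega> < x \<omega>} \<union>
        {\<omega> \<in> space M. s\<^sup>2 \<le> (y \<omega> - t \<omega>)\<^sup>2} \<union> {\<omega> \<in> space M. (1 / 2 * R)\<^sup>2 / real r \<le> (D \<omega>)\<^sup>2}"
      proof (rule ccontr)
        assume "\<not> ?thesis"
        then have 1: "x \<omega> \<le> h c * y \<omega>" and 2: "(y \<omega> - t \<omega>)\<^sup>2 < s\<^sup>2"
          and 3: "(D \<omega>)\<^sup>2 < (1 / 2 * R)\<^sup>2 / real r" using \<omega> by auto
        have "y \<omega> - t \<omega> < s" by (rule power2_less_imp_less[OF 2]) (use s in simp)
        then have "y \<omega> < \<tau> + s" using t_le[of \<omega>] \<omega> by simp
        then have "h c * y \<omega> < h c * (\<tau> + s)" using h1 by simp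
        also have "\<dots> = h c * \<tau> + (b * \<tau> + R / 2)"
        proof -
          have "h c \<noteq> 0" using h1 by linarith
          from nonzero_eq_divide_eq[OF this, THEN iffD1, OF s_def]
          show ?thesis by (simp only: distrib_left mult.commute[of s])
        qed
        also have "\<dots> = a * \<tau> + R / 2" by (simp add: b_def algebra_simps)
        finally have "x \<omega> < a * \<tau> + R / 2" using 1 by simp
        moreover have "sqrt (real r) * D \<omega> < 1 / 2 * R" by (rule not_gram_event[OF _ 3]) simp
        moreover have "e \<omega> \<le> x \<omega> + sqrt (real r) * D \<omega>" "a * \<tau> + R < e \<omega>" using error \<omega> by auto
        ultimately show False by linarith
      qed
    qed
  qed (simp_all only: sketch[OF c0] gram_event[OF half_pos] tail_variance[OF zero_less_power[OF s]])
  also have "\<kappa> * W * \<tau> / s\<^sup>2 \<le> (h c)\<^sup>2 / (2 * b * (real r)\<^sup>2) / \<eta>\<^sup>2"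
  proof -
    \<comment> \<open>The arithmetic-geometric inequality: it makes the denominator linear in
      \<open>\<tau>\<close> like the variance, so that \<open>\<tau>\<close> cancels.\<close>
    have "0 \<le> (b * \<tau> - R / 2)\<^sup>2" by simp
    then have "2 * b * \<tau> * R \<le> (b * \<tau> + R / 2)\<^sup>2" by (simp add: power2_eq_square algebra_simps)
    moreover have "0 < 2 * b * \<tau> * R" using b \<tau>0 R_pos by simp
    ultimately have "\<kappa> * W * \<tau> * (h c)\<^sup>2 / (b * \<tau> + R / 2)\<^sup>2 \<le> \<kappa> * W * \<tau> * (h c)\<^sup>2 / (2 * b * \<tau> * R)"
      using \<kappa> W \<tau>0 by (intro frac_le) auto
    moreover have "\<kappa> * W * \<tau> / s\<^sup>2 = \<kappa> * W * \<tau> * (h c)\<^sup>2 / (b * \<tau> + R / 2)\<^sup>2"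
      by (simp add: s_def power_divide)
    moreover have "\<kappa> * W * \<tau> * (h c)\<^sup>2 / (2 * b * \<tau> * R) = (h c)\<^sup>2 / (2 * b) * (\<kappa> * W / R)"
      using \<tau>0 b R_pos by (simp add: field_simps)
    \<comment> \<open>Here \<open>small\<close> enters, in the form
      \<open>sqrt \<kappa> < 1 / (r \<eta>)\<close>.\<close>
    moreover have "\<kappa> * W / R \<le> 1 / ((real r)\<^sup>2 * \<eta>\<^sup>2)"
    proof -
      have re: "0 < real r * \<eta>" using r \<eta>_ge by simp
      have "\<kappa> * W / R = sqrt \<kappa> / (real r * \<eta>)"
        using \<kappa> W r \<eta>_ge unfolding R_def by (simp add: field_simps) 
      also have "\<dots> \<le> (1 / (real r * \<eta>)) / (real r * \<eta>)"
        using small re by (intro divide_right_mono) (auto simp: pos_le_divide_eq mult_ac)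
      finally show ?thesis by (simp add: power2_eq_square mult_ac)
    qed
    then have "(h c)\<^sup>2 / (2 * b) * (\<kappa> * W / R) \<le> (h c)\<^sup>2 / (2 * b) * (1 / ((real r)\<^sup>2 * \<eta>\<^sup>2))"
      using b by (intro mult_left_mono) auto
    ultimately show ?thesis by simp
  qed
  also have "(h c)\<^sup>2 / (2 * b * (real r)\<^sup>2) / \<eta>\<^sup>2 \<le> (3 / 5 * c) / \<eta>\<^sup>2"
    unfolding b_def by (intro divide_right_mono chebyshev_constant_le[OF \<mu> K m c r\<mu> refl refl]) simp
  also have "1 / ((1 / 2)\<^sup>2 * real r * \<eta>\<^sup>2) \<le> 2 / \<eta>\<^sup>2"
  proof -
    have "2 \<le> real r" using r\<mu> \<mu> by simp
    then have "1 / ((1 / 2)\<^sup>2 * real r) \<le> 2" by (simp add: power2_eq_square field_simps)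
    then have "1 / ((1 / 2)\<^sup>2 * real r) / \<eta>\<^sup>2 \<le> 2 / \<eta>\<^sup>2" by (intro divide_right_mono) auto
    then show ?thesis by simp
  qed
  finally show ?thesis by (simp add: add_divide_distrib)
qed

text \<open>With \<open>c = K + 2\<close> the sketch failure is covered by the term \<open>stirling\<close>, but the Chebyshev terms fit into \<open>\<delta>\<close>
  only if \<open>K\<close> is small compared with \<open>ln (1 / \<delta>)\<close>. Otherwise \<open>c = 4\<close> suffices, as then the sketch failure is at most
  \<open>\<delta> / 4\<close>.\<close>

lemma failure_high_rank:
  assumes r\<mu>: "\<mu> < r"
  shows "prob {\<omega> \<in> space M. a * \<tau> + R < e \<omega>} \<le> stirling + \<delta>"
proof (cases "2 / 5 \<le> \<delta>")
  case True
  then show ?thesis by (rule failure_markov[OF r\<mu>])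
next
  case small_\<delta>: False
  define s where "s = ln (1 / \<delta>)"
  have \<eta>0: "0 < \<eta>\<^sup>2" using \<eta>_ge by simp
  show ?thesis
  proof (cases "2 + 3 / 5 * real (K + 2) \<le> 8 * s")
    case True
    have "(2 + 3 / 5 * real (K + 2)) / \<eta>\<^sup>2 \<le> \<delta>"
      using True \<eta>\<delta> \<eta>0 by (simp add: s_def pos_divide_le_eq mult.commute)
    moreover have "3 \<le> real (K + 2)" using K by simp
    ultimately show ?thesis
      using failure_chebyshev[OF r\<mu>, of "real (K + 2)"] sketch_le_stirling by linarith
  next
    case False
    \<comment> \<open>The aim is \<open>ln (1 / \<delta>) > 17/20\<close> from
      \<open>\<delta> < 2/5\<close>, that is \<open>exp (17/20) \<le> 5/2\<close>; it results from
      dividing the upper bound for \<open>exp 1\<close> by a lower bound for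
      \<open>exp (3/20)\<close>.\<close>
    have "exp (17 / 20 :: real) * exp (3 / 20) = exp 1" by (simp add: exp_add[symmetric])
    moreover have "1 + 3 / 20 + (3 / 20)\<^sup>2 / 2 \<le> exp (3 / 20 :: real)" by (rule exp_lower_Taylor_quadratic) simp
    then have "exp (17 / 20 :: real) * (1 + 3 / 20 + (3 / 20)\<^sup>2 / 2) \<le> exp (17 / 20) * exp (3 / 20)"
      by (intro mult_left_mono) auto
    ultimately have "exp (17 / 20 :: real) * (1 + 3 / 20 + (3 / 20)\<^sup>2 / 2) \<le> 288 / 100"
      using exp_1_bounds(2) by linarith
    then have "exp (17 / 20 :: real) \<le> 5 / 2" by (simp add: power2_eq_square)
    also have "5 / 2 < 1 / \<delta>" using small_\<delta> \<delta> by (simp add: field_simps)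
    also have "1 / \<delta> = exp s" using \<delta> by (simp add: s_def)
    finally have s: "17 / 20 < s" by simp
    moreover have "8 * s < 2 + 3 / 5 * (real K + 2)" using False by (simp add: add.commute)
    \<comment> \<open>Since \<open>8 s > 34/5\<close>, the failure of the first case forces
      \<open>K\<close> to be large enough for the estimate with \<open>c = 4\<close>.\<close>
    moreover have "6 < k" if "17 / 20 < s" "8 * s < 2 + 3 / 5 * (k + 2)" for k :: real
      using that by (simp add: distrib_left)
    ultimately have "6 < real K" by blast
    then have K8: "8 \<le> K + 1" by simp
    have "prob {\<omega> \<in> space M. a * \<tau> + R < e \<omega>} \<le>
      sketch_failure (K + 1) m (\<mu> + K) 4 + (2 + 3 / 5 * 4) / \<eta>\<^sup>2"
      using failure_chebyshev[OF r\<mu>, of 4] K8 by simp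
    also have "sketch_failure (K + 1) m (\<mu> + K) 4 \<le> exp (- s) / 4"
      using False K8 \<mu> m by (intro sketch_failure_4_le) auto
    also have "exp (- s) = \<delta>" using \<delta> by (simp add: s_def exp_minus)
    \<comment> \<open>\<open>\<eta>\<^sup>2 \<delta> \<ge> 8 s > 34/5\<close>, and three quarters of
      this exceed 22/5.\<close>
    also have "(2 + 3 / 5 * 4) / \<eta>\<^sup>2 \<le> 3 / 4 * \<delta>"
      using s \<eta>\<delta> \<eta>0 by (simp add: s_def pos_divide_le_eq mult.commute)
    finally have "prob {\<omega> \<in> space M. a * \<tau> + R < e \<omega>} \<le> \<delta>" by simp
    moreover have "0 \<le> stirling" by simp
    ultimately show ?thesis by linarith
  qed
qed

end

section \<open>The algorithm\<close>

lemma frob_norm_zeroD: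
  assumes X: "X \<in> carrier_mat m n" and 0: "frob_norm X = 0"
  shows "X = 0\<^sub>m m n"
proof (rule eq_matI)
  have "(\<Sum>i<m. \<Sum>j<n. (X $$ (i, j))\<^sup>2) = 0" using frob_norm_sq[OF X] 0 by simp
  then have "\<forall>i\<in>{..<m}. (\<Sum>j<n. (X $$ (i, j))\<^sup>2) = 0"
    by (subst (asm) sum_nonneg_eq_0_iff) (auto intro: sum_nonneg)
  moreover fix i j assume "i < dim_row (0\<^sub>m m n :: real mat)" "j < dim_col (0\<^sub>m m n :: real mat)"
  ultimately have "(\<Sum>j<n. (X $$ (i, j))\<^sup>2) = 0" "i < m" "j < n" by auto
  then have "(X $$ (i, j))\<^sup>2 = 0" using sum_nonneg_eq_0_iff[of "{..<n}" "\<lambda>j. (X $$ (i, j))\<^sup>2"] by auto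
  then show "X $$ (i, j) = 0\<^sub>m m n $$ (i, j)" using \<open>i < m\<close> \<open>j < n\<close> by simp
qed (use carrier_matD[OF X] in auto)

lemma (in orthonormal_mat) res_eq_mult: "X \<in> carrier_mat m n \<Longrightarrow> res Q X = res Q (1\<^sub>m m) * X"
  using res_mult[OF one_carrier_mat, of X n] by simp

text \<open>As \<open>X = U U\<^sup>T X\<close>, the squared residual is a linear function of
  \<open>X X\<^sup>T\<close>, paired with a matrix of only \<open>r\<close> columns.\<close>

lemma frob_norm_res_gram:
  assumes QA: "orthonormal_mat m \<mu> Q" and UA: "orthonormal_mat m r U"
    and X: "X \<in> carrier_mat m n" and XU: "frob_norm (res U X) = 0"
  shows "(frob_norm (res Q X))\<^sup>2 = fip (res Q U) ((X * transpose_mat X) * U)"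
proof -
  interpret Q: orthonormal_mat m \<mu> Q by (rule QA)
  interpret U: orthonormal_mat m r U by (rule UA)
  have UX: "transpose_mat U * X \<in> carrier_mat r n" by (rule U.Qt_mult_carrier[OF X])
  have Xt: "transpose_mat X \<in> carrier_mat n m" using X by simp
  have "res U X = 0\<^sub>m m n" by (rule frob_norm_zeroD[OF U.res_carrier[OF X] XU])
  then have X_eq: "X = U * (transpose_mat U * X)" using U.split_res[OF X] U.Q_mult_carrier[OF UX] by simp
  have rQ: "res Q X = res Q U * (transpose_mat U * X)"
    by (subst X_eq) (rule Q.res_mult[OF U.Q UX])
  have "(frob_norm (res Q X))\<^sup>2 = fip (res Q X) X" by (rule Q.fip_res_self[OF X, symmetric])
  also have "\<dots> = fip (res Q U * (transpose_mat U * X)) X" unfolding rQ ..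
  also have "\<dots> = fip (res Q U) (X * transpose_mat (transpose_mat U * X))"
    by (rule fip_mult_right[OF Q.res_carrier[OF U.Q] UX X])
  also have "transpose_mat (transpose_mat U * X) = transpose_mat X * U"
    by (subst transpose_mult[OF U.Qt X]) simp
  also have "X * (transpose_mat X * U) = (X * transpose_mat X) * U"
    by (rule assoc_mult_mat[OF X Xt U.Q, symmetric])
  finally show ?thesis .
qed

text \<open>By linearity in the Gram matrix the two squared residuals differ by one inner product
  with \<open>(C C\<^sup>T - B B\<^sup>T) U\<close>. Cauchy-Schwarz against \<open>res Q U\<close>,
  of norm at most \<open>sqrt r\<close>, gives the factor.\<close>

lemma residual_transfer:
  assumes QA: "orthonormal_mat m \<mu> Q" and UA: "orthonormal_mat m r U"
    and B: "B \<in> carrier_mat m n" and C: "C \<in> carrier_mat m n'"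
    and BU: "frob_norm (res U B) = 0" and CU: "frob_norm (res U C) = 0"
  shows "(frob_norm (res Q B))\<^sup>2 \<le> (frob_norm (res Q C))\<^sup>2 +
    sqrt (real r) * frob_norm (C * transpose_mat C - B * transpose_mat B)"
proof -
  interpret Q: orthonormal_mat m \<mu> Q by (rule QA)
  interpret U: orthonormal_mat m r U by (rule UA)
  define E where "E = C * transpose_mat C - B * transpose_mat B"
  have BB: "B * transpose_mat B \<in> carrier_mat m m" and CC: "C * transpose_mat C \<in> carrier_mat m m"
    using B C by auto
  have E: "E \<in> carrier_mat m m" unfolding E_def by (rule minus_carrier_mat[OF BB])
  have Et: "transpose_mat E = E"
    unfolding E_def using B C by (simp add: transpose_minus[OF CC BB] transpose_mult[of _ m _ _ m])
  have EU: "E * U = C * transpose_mat C * U - B * transpose_mat B * U"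
    unfolding E_def by (rule minus_mult_distrib_mat[OF CC BB U.Q])
  have cs: "C * transpose_mat C * U \<in> carrier_mat m r" "B * transpose_mat B * U \<in> carrier_mat m r"
    using BB CC U.Q by auto
  have rU: "res Q U \<in> carrier_mat m r" by (rule Q.res_carrier[OF U.Q])
  have "(frob_norm (res Q C))\<^sup>2 - (frob_norm (res Q B))\<^sup>2 = fip (res Q U) (E * U)"
    unfolding frob_norm_res_gram[OF QA UA B BU] frob_norm_res_gram[OF QA UA C CU] EU
    by (rule fip_diff_right[OF rU cs, symmetric])
  moreover have "\<bar>fip (res Q U) (E * U)\<bar> \<le> frob_norm (res Q U) * frob_norm (E * U)"
    by (rule fip_Cauchy_Schwarz[OF rU mult_carrier_mat[OF E U.Q]])
  moreover have "frob_norm (res Q U) * frob_norm (E * U) \<le> sqrt (real r) * frob_norm E"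
  proof (rule mult_mono)
    show "frob_norm (res Q U) \<le> sqrt (real r)" using Q.frob_norm_res_le[OF U.Q] U.frob_norm_Q by simp
    have "frob_norm (E * U) = frob_norm (transpose_mat (E * U))" by (rule frob_norm_transpose[symmetric])
    also have "transpose_mat (E * U) = transpose_mat U * E" by (simp add: transpose_mult[OF E U.Q] Et)
    also have "frob_norm \<dots> \<le> frob_norm E" by (rule U.frob_norm_Qt_le[OF E])
    finally show "frob_norm (E * U) \<le> frob_norm E" .
  qed auto
  ultimately show ?thesis unfolding E_def by linarith
qed

context thin_svd_loc begin

text \<open>Cauchy-Schwarz over the \<open>r - \<mu>\<close> nonzero tail values, then
  \<open>4 \<mu> (r - \<mu>) \<le> r\<^sup>2\<close>.\<close>

lemma tail_le_Delta1:
  assumes "\<mu> < r"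
  shows "2 * sqrt (real \<mu>) * (\<Sum>j=\<mu>..<r. (s j)\<^sup>2) \<le> real r * Delta1 (\<mu> + 1) A"
proof (rule power2_le_imp_le)
  define \<tau> where "\<tau> = (\<Sum>j=\<mu>..<r. (s j)\<^sup>2)"
  have rmn: "r \<le> min m n" using rm rn by simp
  have "(\<Sum>i = \<mu> + 1..min m n. sigma i A ^ 4) = (\<Sum>j = \<mu>..<min m n. sigma (Suc j) A ^ 4)"
    using sum.shift_bounds_Suc_ivl[of "\<lambda>i. sigma i A ^ 4" \<mu> "min m n"]
    by (simp add: atLeastLessThanSuc_atLeastAtMost)
  also have "\<dots> = (\<Sum>j = \<mu>..<r. sigma (Suc j) A ^ 4)"
    using rmn by (intro sum.mono_neutral_right) (auto simp: sig)
  also have "\<dots> = (\<Sum>j = \<mu>..<r. ((s j)\<^sup>2)\<^sup>2)" by (intro sum.cong) (auto simp: sig)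
  finally have D: "(Delta1 (\<mu> + 1) A)\<^sup>2 = (\<Sum>j = \<mu>..<r. ((s j)\<^sup>2)\<^sup>2)"
    using carrier_matD[OF A] by (simp add: Delta1_def sum_nonneg)
  have "\<tau>\<^sup>2 \<le> (Delta1 (\<mu> + 1) A)\<^sup>2 * real (r - \<mu>)"
    unfolding D \<tau>_def using sum_squared_le_sum_of_squares[of "\<lambda>j. (s j)\<^sup>2" "{\<mu>..<r}"] by simp
  then have "4 * real \<mu> * \<tau>\<^sup>2 \<le> 4 * real \<mu> * ((Delta1 (\<mu> + 1) A)\<^sup>2 * real (r - \<mu>))"
    by (intro mult_left_mono) auto
  also have "\<dots> = (4 * real \<mu> * (real r - real \<mu>)) * (Delta1 (\<mu> + 1) A)\<^sup>2"
    using assms by (simp add: of_nat_diff)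
  also have "\<dots> \<le> (real r)\<^sup>2 * (Delta1 (\<mu> + 1) A)\<^sup>2"
  proof (rule mult_right_mono)
    have "0 \<le> (real r - 2 * real \<mu>)\<^sup>2" by simp
    then show "4 * real \<mu> * (real r - real \<mu>) \<le> (real r)\<^sup>2" by (simp add: power2_eq_square algebra_simps)
  qed simp
  finally show "(2 * sqrt (real \<mu>) * (\<Sum>j=\<mu>..<r. (s j)\<^sup>2))\<^sup>2 \<le> (real r * Delta1 (\<mu> + 1) A)\<^sup>2"
    by (simp add: \<tau>_def power_mult_distrib)
qed (auto simp: Delta1_def intro!: mult_nonneg_nonneg sum_nonneg)

lemma tail_pos: "\<mu> < r \<Longrightarrow> 0 < (\<Sum>j=\<mu>..<r. (s j)\<^sup>2)"
  using s_pos by (intro sum_pos) (auto simp: less_imp_neq[symmetric])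

lemma left_singular:
  defines "V \<equiv> \<lambda>k. mat_of_family m (min k r) u"
  shows "orthonormal_mat m (min k r) (V k)" and "(frob_norm (res (V k) A))\<^sup>2 \<le> (\<Sum>j=k..<r. (s j)\<^sup>2)"
proof -
  have "orthonormal_family m (min k r) u" using u by (auto simp: orthonormal_family_def)
  then show "orthonormal_mat m (min k r) (V k)" unfolding V_def by (rule orthonormal_mat_of_family)
  show "(frob_norm (res (V k) A))\<^sup>2 \<le> (\<Sum>j=k..<r. (s j)\<^sup>2)"
    unfolding V_def by (rule top_family) (use \<open>orthonormal_family m (min k r) u\<close> in auto)
qed

end

section \<open>Measurability along a run of the algorithm\<close>

locale single_power_sthosvd = sampled_randomized_sthosvd M N I \<mu> T K 1 A H H' p \<xi> G Q
  for M :: "'w measure" and N I \<mu> T K A H H' p \<xi> G Q +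
  assumes pos: "\<And>n. n \<in> {1..N} \<Longrightarrow> 0 < \<mu> n \<and> 0 < I n \<and> 0 < T n"
    and K_pos: "0 < K" and over: "\<And>n. n \<in> {1..N} \<Longrightarrow> \<mu> n + K < I n"
begin

abbreviation "J n \<equiv> step_cols N I \<mu> n"
abbreviation "B n \<omega> \<equiv> step_unfolding N I \<mu> A (\<lambda>k. Q k \<omega>) n"
abbreviation "C n \<omega> \<equiv> B n \<omega> * sampling_mat (J n) (T n) (p n \<omega>) (\<lambda>j. \<xi> n j \<omega>)"
abbreviation "An n \<equiv> unfolding_mat N I n A"
abbreviation "W \<equiv> (tensor_norm N I A)\<^sup>2"

lemma B_carrier: "B n \<omega> \<in> carrier_mat (I n) (J n)"
  by (simp add: step_unfolding_def step_cols_def unfolding_mat_def step_dims_def)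

lemma C_carrier: "C n \<omega> \<in> carrier_mat (I n) (T n)"
  by (rule mult_carrier_mat[OF B_carrier]) (simp add: sampling_mat_def)

lemma G_carrier: "n \<in> {1..N} \<Longrightarrow> \<omega> \<in> space M \<Longrightarrow> G n \<omega> \<in> carrier_mat (I n) (\<mu> n + K)"
  using gaussian by (auto simp: standard_gaussian_mat_def)

lemma basis_eq:
  assumes n: "n \<in> {1..N}" and \<omega>: "\<omega> \<in> space M"
  shows "range_basis (\<mu> n) K (C n \<omega> * (transpose_mat (C n \<omega>) * G n \<omega>)) (Q n \<omega>)"
proof -
  note C = C_carrier[of \<omega> n]
  have Ct: "transpose_mat (C n \<omega>) \<in> carrier_mat (T n) (I n)" using C by simp
  have "(C n \<omega> * transpose_mat (C n \<omega>)) ^\<^sub>m 1 = C n \<omega> * transpose_mat (C n \<omega>)"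
    using left_mult_one_mat[OF mult_carrier_mat[OF C Ct]] carrier_matD[OF C] by simp
  then have "(C n \<omega> * transpose_mat (C n \<omega>)) ^\<^sub>m 1 * G n \<omega> = C n \<omega> * (transpose_mat (C n \<omega>) * G n \<omega>)"
    using assoc_mult_mat[OF C Ct G_carrier[OF n \<omega>]] by simp
  then show ?thesis using basis[OF n \<omega>] unfolding Let_def by simp
qed

lemma Q_orth:
  assumes n: "n \<in> {1..N}" and \<omega>: "\<omega> \<in> space M"
  shows "orthonormal_mat (I n) (\<mu> n) (Q n \<omega>)"
  using basis_eq[OF n \<omega>] carrier_matD[OF C_carrier[of \<omega> n]]
  by (intro orthonormal_matI) (auto simp: range_basis_def)

lemma compressed: "\<omega> \<in> space M \<Longrightarrow> compressed_tensor N I \<mu> (\<lambda>k. Q k \<omega>)"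
  by (rule compressed_tensor.intro) (use pos Q_orth in auto)

lemma history_chain:
  assumes n: "n \<in> {1..N}"
  shows "subalgebra M (H n)" "subalgebra M (H' n)" "subalgebra (H' n) (H n)"
    and "subalgebra M (H (Suc n))" "subalgebra (H (Suc n)) (H' n)"
  using history[OF n] by (auto simp: subalgebra_def)

lemma history_mono:
  assumes "k \<in> {1..N}" "k < n" "n \<le> N"
  shows "subalgebra (H n) (H (Suc k))"
proof -
  have "Suc k \<le> n" using assms by simp
  then show ?thesis using assms(3)
  proof (induction n rule: dec_induct)
    case base
    then show ?case by (simp add: subalgebra_def)
  next
    case (step n)
    then have "n \<in> {1..N}" using assms(1) by auto
    from history_chain(3,5)[OF this] step show ?case by (auto simp: subalgebra_def)
  qed
qed

lemma Q_measurable_next: "n \<in> {1..N} \<Longrightarrow> meas.mat_valued (H (Suc n)) (I n) (\<mu> n) (Q n)"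
proof (rule meas.mat_valuedI)
  assume n: "n \<in> {1..N}"
  then have "space (H (Suc n)) = space M" using history_chain(4)[OF n] by (simp add: subalgebra_def)
  then show "Q n \<omega> \<in> carrier_mat (I n) (\<mu> n)" if "\<omega> \<in> space (H (Suc n))" for \<omega>
    using orthonormal_mat.Q[OF Q_orth[OF n]] that by simp
qed (use basis_measurable in auto)

lemma Q_measurable_M: "n \<in> {1..N} \<Longrightarrow> meas.mat_valued M (I n) (\<mu> n) (Q n)"
  by (rule meas_mat_valued_subalgebra[OF Q_measurable_next history_chain(4)])

lemma Q_measurable: "k \<in> {1..N} \<Longrightarrow> k < n \<Longrightarrow> n \<le> N \<Longrightarrow> meas.mat_valued (H n) (I k) (\<mu> k) (Q k)"
  by (rule meas_mat_valued_subalgebra[OF Q_measurable_next history_mono])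

text \<open>By \<open>mode_prods_eq\<close> the entry is a polynomial in entries of the
  factors.\<close>

lemma core_measurable:
  assumes Q: "\<And>k. k \<in> {1..n} \<Longrightarrow> meas.mat_valued F (d k) (d' k) (P k)"
    and i: "\<And>k. k \<in> {1..n} \<Longrightarrow> i k < d k"
  shows "(\<lambda>\<omega>. mode_prods X (\<lambda>k. P k \<omega>) n i) \<in> borel_measurable F"
proof (rule meas.cong)
  show "(\<lambda>\<omega>. \<Sum>j\<in>(\<Pi>\<^sub>E k\<in>{1..n}. {..<d' k}). X (override n j i) * (\<Prod>k\<in>{1..n}. P k \<omega> $$ (i k, j k))) \<in> borel_measurable F"
  proof (intro meas.sum meas.mult meas.const meas.prod finite_PiE)
    fix j k assume "j \<in> (\<Pi>\<^sub>E k\<in>{1..n}. {..<d' k})" "k \<in> {1..n}"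
    then show "(\<lambda>\<omega>. P k \<omega> $$ (i k, j k)) \<in> borel_measurable F"
      by (intro meas.mat_valuedD(2)[OF Q] i) (auto simp: PiE_iff)
  qed auto
  fix \<omega> assume \<omega>: "\<omega> \<in> space F"
  have "(\<Pi>\<^sub>E k\<in>{1..n}. {..<dim_col (P k \<omega>)}) = (\<Pi>\<^sub>E k\<in>{1..n}. {..<d' k})"
    by (rule PiE_cong) (simp add: carrier_matD(2)[OF meas.mat_valuedD(1)[OF Q \<omega>]])
  then show "mode_prods X (\<lambda>k. P k \<omega>) n i =
    (\<Sum>j\<in>(\<Pi>\<^sub>E k\<in>{1..n}. {..<d' k}). X (override n j i) * (\<Prod>k\<in>{1..n}. P k \<omega> $$ (i k, j k)))"
    unfolding mode_prods_eq by simp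
qed

lemma B_measurable:
  assumes n: "n \<in> {1..N}"
  shows "meas.mat_valued (H n) (I n) (J n) (B n)"
proof (rule meas.mat_valuedI)
  fix i j assume ij: "i < I n" "j < J n"
  let ?i = "(fiber_index N (step_dims I \<mu> n) n j)(n := i)"
  have "(\<lambda>\<omega>. B n \<omega> $$ (i, j)) = (\<lambda>\<omega>. mode_prods A (\<lambda>k. transpose_mat (Q k \<omega>)) (n - 1) ?i)"
    using ij by (simp add: step_unfolding_def unfolding_mat_def step_cols_def step_dims_def)
  also have "\<dots> \<in> borel_measurable (H n)"
  proof (rule core_measurable[of "n - 1" "H n" \<mu> I])
    fix k assume k: "k \<in> {1..n - 1}"
    then have k': "k \<in> {1..N}" "k < n" "n \<le> N" "k \<in> {1..N} - {n}" using n by auto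
    show "meas.mat_valued (H n) (\<mu> k) (I k) (\<lambda>\<omega>. transpose_mat (Q k \<omega>))"
      by (rule meas.mat_valued_transpose[OF Q_measurable[OF k'(1-3)]])
    have "?i k = (j div (\<Prod>m\<in>{1..<k} - {n}. step_dims I \<mu> n m)) mod \<mu> k"
      using k' by (simp add: fiber_index_def step_dims_def)
    then show "?i k < \<mu> k" using pos[OF k'(1)] by simp
  qed
  finally show "(\<lambda>\<omega>. B n \<omega> $$ (i, j)) \<in> borel_measurable (H n)" .
qed (rule B_carrier)

text \<open>Stated for general \<open>F\<close> and \<open>v\<close>, since it serves both the
  actual draws, known in \<open>H' n\<close>, and a fixed outcome of the draws, for which the
  history \<open>H n\<close> suffices.\<close>

lemma sampled_measurable:
  assumes n: "n \<in> {1..N}" and F: "subalgebra F (H n)"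
    and v: "\<And>j. j < T n \<Longrightarrow> (\<lambda>\<omega>. v \<omega> j) \<in> measurable F (count_space {..<J n})"
  shows "meas.mat_valued F (I n) (T n) (\<lambda>\<omega>. B n \<omega> * sampling_mat (J n) (T n) (p n \<omega>) (v \<omega>))"
proof (rule meas.mat_valued_mult[OF meas_mat_valued_subalgebra[OF B_measurable[OF n] F]])
  show "meas.mat_valued F (J n) (T n) (\<lambda>\<omega>. sampling_mat (J n) (T n) (p n \<omega>) (v \<omega>))"
  proof (rule meas.mat_valuedI)
    fix i j assume ij: "i < J n" "j < T n"
    have [measurable]: "(\<lambda>\<omega>. p n \<omega> i) \<in> borel_measurable F"
      by (rule measurable_from_subalg[OF F probs_measurable[OF n ij(1)]])
    have "{\<omega> \<in> space F. v \<omega> j = i} = (\<lambda>\<omega>. v \<omega> j) -` {i} \<inter> space F" by auto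
    also have "\<dots> \<in> sets F" by (rule measurable_sets[OF v[OF ij(2)]]) (use ij in simp)
    finally have [measurable]: "Measurable.pred F (\<lambda>\<omega>. v \<omega> j = i)" by (simp only: pred_def)
    have "(\<lambda>\<omega>. if v \<omega> j = i then 1 / sqrt (real (T n) * p n \<omega> i) else 0) \<in> borel_measurable F"
      by measurable
    then show "(\<lambda>\<omega>. sampling_mat (J n) (T n) (p n \<omega>) (v \<omega>) $$ (i, j)) \<in> borel_measurable F"
      using ij by (simp add: sampling_mat_def)
  qed (simp add: sampling_mat_def)
qed

lemma C_measurable:
  assumes n: "n \<in> {1..N}"
  shows "meas.mat_valued (H' n) (I n) (T n) (C n)"
  by (rule sampled_measurable[OF n history_chain(3)[OF n]]) (rule draws_measurable[OF n])

text \<open>Passes from expectations computed for each fixed history to an unconditional tail bound.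
  \<open>f\<close> may depend on \<open>\<omega>\<close>, because the unsampled matrix with which
  the sample is compared does.\<close>

lemma draws_tail:
  assumes n: "n \<in> {1..N}"
    and f: "\<And>X. meas.mat_valued (H n) (I n) (T n) X \<Longrightarrow> (\<lambda>\<omega>. f \<omega> (X \<omega>)) \<in> borel_measurable (H n)"
    and f0: "\<And>\<omega> X. 0 \<le> f \<omega> X"
    and le: "\<And>\<omega>. \<omega> \<in> space M \<Longrightarrow> weighted_draws.expect (J n) (T n) (p n \<omega>)
      (\<lambda>v. f \<omega> (B n \<omega> * sampling_mat (J n) (T n) (p n \<omega>) v)) \<le> b"
    and s: "0 < s"
  shows "{\<omega> \<in> space M. s \<le> f \<omega> (C n \<omega>)} \<in> events \<and> prob {\<omega> \<in> space M. s \<le> f \<omega> (C n \<omega>)} \<le> b / s"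
proof -
  define V where "V = {..<T n} \<rightarrow>\<^sub>E {..<J n}"
  \<comment> \<open>The draws, restricted to the indices that matter, become one variable with
    finitely many values.\<close>
  define X where "X \<omega> = (\<lambda>j\<in>{..<T n}. \<xi> n j \<omega>)" for \<omega>
  define g where "g v \<omega> = f \<omega> (B n \<omega> * sampling_mat (J n) (T n) (p n \<omega>) v)" for v \<omega>
  define w where "w v \<omega> = (\<Prod>j<T n. p n \<omega> (v j))" for v \<omega>
  note hc = history_chain[OF n]
  have spH: "space (H' n) = space M" "space (H n) = space M" using hc(1,2) by (auto simp: subalgebra_def)
  have xi: "\<xi> n j \<omega> \<in> {..<J n}" if "\<omega> \<in> space M" "j < T n" for j \<omega>
    using measurable_space[OF draws_measurable[OF n that(2)]] that spH by simp
  have fin: "finite V" unfolding V_def by (intro finite_PiE) auto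
  have XV: "X \<omega> \<in> V" if "\<omega> \<in> space M" for \<omega>
    unfolding X_def V_def using xi[OF that] by (intro restrict_PiE_iff[THEN iffD2]) auto
  have Xv: "{\<omega> \<in> space M. X \<omega> = v} = {\<omega> \<in> space M. \<forall>j<T n. \<xi> n j \<omega> = v j}" if v: "v \<in> V" for v
  proof -
    have "X \<omega> = v \<longleftrightarrow> (\<forall>j<T n. \<xi> n j \<omega> = v j)" for \<omega>
    proof
      show "X \<omega> = v \<Longrightarrow> \<forall>j<T n. \<xi> n j \<omega> = v j" by (auto simp: X_def)
      show "\<forall>j<T n. \<xi> n j \<omega> = v j \<Longrightarrow> X \<omega> = v"
        using v unfolding X_def V_def by (intro ext) (auto simp: PiE_iff extensional_def)
    qed
    then show ?thesis by simp
  qed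
  have gX: "g (X \<omega>) \<omega> = f \<omega> (C n \<omega>)" for \<omega>
  proof -
    have "sampling_mat (J n) (T n) (p n \<omega>) (X \<omega>) = sampling_mat (J n) (T n) (p n \<omega>) (\<lambda>j. \<xi> n j \<omega>)"
      unfolding sampling_mat_def X_def by (rule cong_mat) auto
    then show ?thesis by (simp only: g_def)
  qed
  have vj: "v j < J n" if "v \<in> V" "j < T n" for v j using that by (auto simp: V_def PiE_iff)
  have ev: "{\<omega> \<in> space M. X \<omega> = v} \<in> events" if v: "v \<in> V" for v
  proof -
    have "{\<omega> \<in> space M. \<forall>j<T n. \<xi> n j \<omega> = v j} = space M \<inter> (\<Inter>j\<in>{..<T n}. \<xi> n j -` {v j} \<inter> space (H' n))"
      using pos[OF n] by (auto simp: spH)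
    also have "\<dots> \<in> events"
    proof (rule sets.Int[OF sets.top], rule sets.finite_INT)
      fix j assume j: "j \<in> {..<T n}"
      then have "\<xi> n j -` {v j} \<inter> space (H' n) \<in> sets (H' n)"
        using vj[OF v] by (intro measurable_sets[OF draws_measurable[OF n]]) auto
      then show "\<xi> n j -` {v j} \<inter> space (H' n) \<in> events" using hc(2) by (auto simp: subalgebra_def)
    qed (use pos[OF n] in auto)
    finally show ?thesis unfolding Xv[OF v] .
  qed
  have wm: "w v \<in> borel_measurable (H n)" if "v \<in> V" for v
    unfolding w_def using vj[OF that] by (intro meas.prod probs_measurable[OF n]) auto
  have cond: "AE \<omega> in M. real_cond_exp M (H n) (indicator {\<omega> \<in> space M. X \<omega> = v}) \<omega> = w v \<omega>" if v: "v \<in> V" for v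
    unfolding Xv[OF v] w_def by (rule draws[OF n]) (use vj[OF v] in auto)
  have gm: "g v \<in> borel_measurable (H n)" if "v \<in> V" for v
    unfolding g_def using vj[OF that]
    by (intro f sampled_measurable[OF n]) (auto simp: subalgebra_def)
  have w0: "0 \<le> w v \<omega>" if "v \<in> V" "\<omega> \<in> space M" for v \<omega>
    unfolding w_def using probs[OF n that(2)] vj[OF that(1)] by (intro prod_nonneg) (auto simp: prob_vector_def)
  have g0: "0 \<le> g v \<omega>" for v \<omega> by (simp add: g_def f0)
  have le': "(\<Sum>v\<in>V. w v \<omega> * g v \<omega>) \<le> b" if \<omega>: "\<omega> \<in> space M" for \<omega>
  proof -
    interpret weighted_draws "J n" "T n" "p n \<omega>"
      by (rule weighted_draws.intro) (use probs[OF n \<omega>] pos[OF n] in auto)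
    show ?thesis using le[OF \<omega>] by (simp add: expect_def V_def w_def g_def)
  qed
  have "{\<omega> \<in> space M. s \<le> g (X \<omega>) \<omega>} \<in> events \<and> prob {\<omega> \<in> space M. s \<le> g (X \<omega>) \<omega>} \<le> b / s"
    by (rule conjI; rule markov_draws[OF hc(1) fin XV ev wm w0 cond gm g0 le' s])
  then show ?thesis by (simp only: gX)
qed

end

section \<open>Failure probability of one step and of the whole run\<close>

context single_power_sthosvd begin

lemma An_carrier: "An n \<in> carrier_mat (I n) (unfold_cols N I n)"
  by simp

lemma sampling_mat_carrier: "sampling_mat (J n) (T n) q v \<in> carrier_mat (J n) (T n)"
  by (simp add: sampling_mat_def)

lemma frob_norm_An: "n \<in> {1..N} \<Longrightarrow> (frob_norm (An n))\<^sup>2 = W"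
  by (rule frob_norm_unfolding) (use pos in blast)+

lemma frob_norm_res_B_le:
  assumes n: "n \<in> {1..N}" and \<omega>: "\<omega> \<in> space M" and V: "orthonormal_mat (I n) k V"
  shows "frob_norm (res V (B n \<omega>)) \<le> frob_norm (res V (An n))"
proof -
  interpret V: orthonormal_mat "I n" k V by (rule V)
  have Z: "res V (1\<^sub>m (I n)) \<in> carrier_mat (I n) (I n)" by (rule V.res_carrier) simp
  show ?thesis
    using compressed_tensor.frob_norm_mult_step_unfolding_le[OF compressed[OF \<omega>] n Z, of A]
    by (simp only: V.res_eq_mult[OF B_carrier, symmetric] V.res_eq_mult[OF An_carrier, symmetric])
qed

lemma frob_norm_B_le:
  assumes n: "n \<in> {1..N}" and \<omega>: "\<omega> \<in> space M"
  shows "(frob_norm (B n \<omega>))\<^sup>2 \<le> W"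
proof -
  have "frob_norm (1\<^sub>m (I n) * B n \<omega>) \<le> frob_norm (1\<^sub>m (I n) * An n)"
    by (rule compressed_tensor.frob_norm_mult_step_unfolding_le[OF compressed[OF \<omega>] n one_carrier_mat])
  then have "frob_norm (B n \<omega>) \<le> frob_norm (An n)"
    by (simp only: left_mult_one_mat[OF B_carrier] left_mult_one_mat[OF An_carrier])
  then have "(frob_norm (B n \<omega>))\<^sup>2 \<le> (frob_norm (An n))\<^sup>2" by (rule power_mono) simp
  then show ?thesis by (simp only: frob_norm_An[OF n])
qed

lemma res_C:
  assumes V: "orthonormal_mat (I n) k V"
  shows "res V (B n \<omega> * sampling_mat (J n) (T n) q v) = res V (B n \<omega>) * sampling_mat (J n) (T n) q v"
  by (rule orthonormal_mat.res_mult[OF V B_carrier sampling_mat_carrier])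

lemma step_error_measurable:
  "n \<in> {1..N} \<Longrightarrow> (\<lambda>\<omega>. (frob_norm (res (Q n \<omega>) (B n \<omega>)))\<^sup>2) \<in> borel_measurable M"
  by (rule meas.frob_norm_sq_mem[OF meas.mat_valued_res[OF Q_measurable_M
      meas_mat_valued_subalgebra[OF B_measurable history_chain(1)]]])

text \<open>The three probabilistic inputs of \<open>sketched_step\<close>. Norms of the random
  \<open>B\<close> are replaced by the deterministic \<open>W\<close> and \<open>\<tau>\<close>,
  which dominate them because compression does not increase residual norms.\<close>

lemma nearly_optimal_tails:
  assumes n: "n \<in> {1..N}" and \<beta>\<^sub>0: "0 < \<beta>\<^sub>0"
    and opt: "\<And>\<omega>. \<omega> \<in> space M \<Longrightarrow> nearly_optimal \<beta>\<^sub>0 (B n \<omega>) (p n \<omega>)"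
    and V: "orthonormal_mat (I n) k V" and \<tau>: "(frob_norm (res V (An n)))\<^sup>2 \<le> \<tau>"
    and s: "0 < s"
  defines "\<kappa> \<equiv> 1 / (\<beta>\<^sub>0 * real (T n))"
  shows "{\<omega> \<in> space M. s \<le> (frob_norm (C n \<omega> * transpose_mat (C n \<omega>) - B n \<omega> * transpose_mat (B n \<omega>)))\<^sup>2} \<in> events \<and>
      prob {\<omega> \<in> space M. s \<le> (frob_norm (C n \<omega> * transpose_mat (C n \<omega>) - B n \<omega> * transpose_mat (B n \<omega>)))\<^sup>2} \<le> \<kappa> * W\<^sup>2 / s"
    and "{\<omega> \<in> space M. s \<le> (frob_norm (res V (C n \<omega>)))\<^sup>2} \<in> events \<and>
      prob {\<omega> \<in> space M. s \<le> (frob_norm (res V (C n \<omega>)))\<^sup>2} \<le> \<tau> / s"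
    and "{\<omega> \<in> space M. s \<le> ((frob_norm (res V (C n \<omega>)))\<^sup>2 - (frob_norm (res V (B n \<omega>)))\<^sup>2)\<^sup>2} \<in> events \<and>
      prob {\<omega> \<in> space M. s \<le> ((frob_norm (res V (C n \<omega>)))\<^sup>2 - (frob_norm (res V (B n \<omega>)))\<^sup>2)\<^sup>2} \<le> \<kappa> * W * \<tau> / s"
proof -
  note Bm = B_measurable[OF n]
  note VC = orthonormal_mat.Q[OF V]
  have \<kappa>: "0 \<le> \<kappa>" using \<beta>\<^sub>0 by (simp add: \<kappa>_def)
  have nod: "nearly_optimal_draws (J n) (T n) (p n \<omega>) (I n) (B n \<omega>) \<beta>\<^sub>0" if "\<omega> \<in> space M" for \<omega>
    by (intro nearly_optimal_draws.intro weighted_draws.intro nearly_optimal_draws_axioms.intro)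
      (use probs[OF n that] pos[OF n] B_carrier \<beta>\<^sub>0 opt[OF that] in auto)
  have t: "(frob_norm (res V (B n \<omega>)))\<^sup>2 \<le> \<tau>" if "\<omega> \<in> space M" for \<omega>
    using power_mono[OF frob_norm_res_B_le[OF n that V] frob_norm_nonneg, of 2] \<tau> by linarith
  have ym: "(\<lambda>\<omega>. (frob_norm (res V (X \<omega>)))\<^sup>2) \<in> borel_measurable (H n)"
    if "meas.mat_valued (H n) (I n) k' X" for X k'
    by (rule meas.frob_norm_sq_mem[OF meas.mat_valued_res[OF meas.mat_valued_const[OF VC] that]])
  show "{\<omega> \<in> space M. s \<le> (frob_norm (C n \<omega> * transpose_mat (C n \<omega>) - B n \<omega> * transpose_mat (B n \<omega>)))\<^sup>2} \<in> events \<and>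
      prob {\<omega> \<in> space M. s \<le> (frob_norm (C n \<omega> * transpose_mat (C n \<omega>) - B n \<omega> * transpose_mat (B n \<omega>)))\<^sup>2} \<le> \<kappa> * W\<^sup>2 / s"
  proof (rule draws_tail[OF n, where f = "\<lambda>\<omega> X. (frob_norm (X * transpose_mat X - B n \<omega> * transpose_mat (B n \<omega>)))\<^sup>2", OF _ _ _ s])
    fix X assume X: "meas.mat_valued (H n) (I n) (T n) X"
    show "(\<lambda>\<omega>. (frob_norm (X \<omega> * transpose_mat (X \<omega>) - B n \<omega> * transpose_mat (B n \<omega>)))\<^sup>2) \<in> borel_measurable (H n)"
      by (rule meas.frob_norm_sq_mem[OF meas.mat_valued_minus[OF
            meas.mat_valued_mult[OF X meas.mat_valued_transpose[OF X]]
            meas.mat_valued_mult[OF Bm meas.mat_valued_transpose[OF Bm]]]])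
  next
    fix \<omega> assume \<omega>: "\<omega> \<in> space M"
    interpret nearly_optimal_draws "J n" "T n" "p n \<omega>" "I n" "B n \<omega>" \<beta>\<^sub>0 by (rule nod[OF \<omega>])
    note expect_gram_error
    also have "frob_norm (B n \<omega>) ^ 4 / (\<beta>\<^sub>0 * real (T n)) = ((frob_norm (B n \<omega>))\<^sup>2)\<^sup>2 * \<kappa>"
      by (simp add: \<kappa>_def)
    also have "\<dots> \<le> W\<^sup>2 * \<kappa>"
      by (intro mult_right_mono power_mono frob_norm_B_le[OF n \<omega>] \<kappa>) simp
    finally show "expect (\<lambda>v. (frob_norm (B n \<omega> * sampling_mat (J n) (T n) (p n \<omega>) v * transpose_mat (B n \<omega> * sampling_mat (J n) (T n) (p n \<omega>) v)
        - B n \<omega> * transpose_mat (B n \<omega>)))\<^sup>2) \<le> \<kappa> * W\<^sup>2" by (simp only: mult.commute)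
  qed simp
  show "{\<omega> \<in> space M. s \<le> (frob_norm (res V (C n \<omega>)))\<^sup>2} \<in> events \<and>
      prob {\<omega> \<in> space M. s \<le> (frob_norm (res V (C n \<omega>)))\<^sup>2} \<le> \<tau> / s"
  proof (rule draws_tail[OF n, where f = "\<lambda>\<omega> X. (frob_norm (res V X))\<^sup>2", OF ym _ _ s])
    fix \<omega> assume \<omega>: "\<omega> \<in> space M"
    interpret nearly_optimal_draws "J n" "T n" "p n \<omega>" "I n" "B n \<omega>" \<beta>\<^sub>0 by (rule nod[OF \<omega>])
    have "expect (\<lambda>v. (frob_norm (res V (B n \<omega>) * sampling_mat (J n) (T n) (p n \<omega>) v))\<^sup>2) = (frob_norm (res V (B n \<omega>)))\<^sup>2"
      by (rule expect_sampled_norm(1)[OF orthonormal_mat.res_carrier[OF V B_carrier] colsq_res_le[OF V]])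
    then show "expect (\<lambda>v. (frob_norm (res V (B n \<omega> * sampling_mat (J n) (T n) (p n \<omega>) v)))\<^sup>2) \<le> \<tau>"
      unfolding res_C[OF V] using t[OF \<omega>] by simp
  qed simp_all
  show "{\<omega> \<in> space M. s \<le> ((frob_norm (res V (C n \<omega>)))\<^sup>2 - (frob_norm (res V (B n \<omega>)))\<^sup>2)\<^sup>2} \<in> events \<and>
      prob {\<omega> \<in> space M. s \<le> ((frob_norm (res V (C n \<omega>)))\<^sup>2 - (frob_norm (res V (B n \<omega>)))\<^sup>2)\<^sup>2} \<le> \<kappa> * W * \<tau> / s"
  proof (rule draws_tail[OF n, where f = "\<lambda>\<omega> X. ((frob_norm (res V X))\<^sup>2 - (frob_norm (res V (B n \<omega>)))\<^sup>2)\<^sup>2", OF _ _ _ s])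
    fix X assume X: "meas.mat_valued (H n) (I n) (T n) X"
    note [measurable] = ym[OF X] ym[OF Bm]
    show "(\<lambda>\<omega>. ((frob_norm (res V (X \<omega>)))\<^sup>2 - (frob_norm (res V (B n \<omega>)))\<^sup>2)\<^sup>2) \<in> borel_measurable (H n)"
      by measurable
  next
    fix \<omega> assume \<omega>: "\<omega> \<in> space M"
    interpret nearly_optimal_draws "J n" "T n" "p n \<omega>" "I n" "B n \<omega>" \<beta>\<^sub>0 by (rule nod[OF \<omega>])
    have "expect (\<lambda>v. ((frob_norm (res V (B n \<omega>) * sampling_mat (J n) (T n) (p n \<omega>) v))\<^sup>2 - (frob_norm (res V (B n \<omega>)))\<^sup>2)\<^sup>2)
      \<le> (frob_norm (B n \<omega>))\<^sup>2 * (frob_norm (res V (B n \<omega>)))\<^sup>2 / (\<beta>\<^sub>0 * real (T n))"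
      by (rule expect_sampled_norm(2)[OF orthonormal_mat.res_carrier[OF V B_carrier] colsq_res_le[OF V]])
    also have "\<dots> = \<kappa> * ((frob_norm (B n \<omega>))\<^sup>2 * (frob_norm (res V (B n \<omega>)))\<^sup>2)" by (simp add: \<kappa>_def)
    also have "\<dots> \<le> \<kappa> * (W * \<tau>)"
      by (intro mult_left_mono mult_mono frob_norm_B_le[OF n \<omega>] t[OF \<omega>] \<kappa>) auto
    finally show "expect (\<lambda>v. ((frob_norm (res V (B n \<omega> * sampling_mat (J n) (T n) (p n \<omega>) v)))\<^sup>2 - (frob_norm (res V (B n \<omega>)))\<^sup>2)\<^sup>2) \<le> \<kappa> * W * \<tau>"
      unfolding res_C[OF V] by (simp only: mult.assoc)
  qed simp
qed

text \<open>Instantiates \<open>sketched_step\<close> with a singular value decomposition of the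
  unfolding; what remains is that the bound for mode \<open>n\<close> dominates
  \<open>a \<tau> + R\<close>, or \<open>R\<close> alone when \<open>r \<le> \<mu>\<close>.\<close>

lemma step_failure:
  assumes n: "n \<in> {1..N}" and \<beta>\<^sub>0: "0 < \<beta>\<^sub>0"
    and opt: "\<And>\<omega>. \<omega> \<in> space M \<Longrightarrow> nearly_optimal \<beta>\<^sub>0 (B n \<omega>) (p n \<omega>)"
    and W: "0 < W" and \<delta>: "0 < \<delta>" "\<delta> < 1" and \<eta>: "\<eta> = 1 + sqrt (8 / \<delta> * ln (1 / \<delta>))"
    and \<Lambda>: "sqrt (2 * real (\<mu> n + K)) * (sqrt (real (\<mu> n + K)) + sqrt (real (I n))) \<le> \<Lambda>"
    and small: "real (mat_rank (An n)) * (\<eta> / sqrt (\<beta>\<^sub>0 * real (T n))) < 1"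
  shows "prob {\<omega> \<in> space M. real (mat_rank (An n)) * (2 * (1 + \<Lambda>) * real (I n) * Delta1 (\<mu> n + 1) (An n)
      + \<eta> / sqrt (\<beta>\<^sub>0 * real (T n)) * W) < (frob_norm (res (Q n \<omega>) (B n \<omega>)))\<^sup>2}
    \<le> 1 / sqrt (2 * pi * real (K + 1)) * (exp 1 / real (K + 1)) ^ (K + 1) + \<delta>"
    (is "prob {\<omega> \<in> space M. ?bud < _} \<le> _")
proof -
  obtain r u s where svd: "thin_svd_loc (I n) (unfold_cols N I n) r (An n) u s"
    using ex_thin_svd[OF An_carrier[of n]] by (elim exE)
  interpret S: thin_svd_loc "I n" "unfold_cols N I n" r "An n" u s by (rule svd)
  define \<kappa> where "\<kappa> = 1 / (\<beta>\<^sub>0 * real (T n))"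
  define \<tau> where "\<tau> = (\<Sum>j=\<mu> n..<r. (s j)\<^sup>2)"
  \<comment> \<open>\<open>V\<close> carries the leading directions and measures the tail.
    \<open>U\<close> carries all of them, so the residuals of \<open>B\<close> and \<open>C\<close>
    with respect to \<open>U\<close> vanish and \<open>residual_transfer\<close> applies with
    \<open>r\<close> columns.\<close>
  define V where "V = mat_of_family (I n) (min (\<mu> n) r) u"
  define U where "U = mat_of_family (I n) (min r r) u"
  have V: "orthonormal_mat (I n) (min (\<mu> n) r) V" and V\<tau>: "(frob_norm (res V (An n)))\<^sup>2 \<le> \<tau>"
    unfolding V_def \<tau>_def by (rule S.left_singular)+
  have U: "orthonormal_mat (I n) r U" using S.left_singular(1)[of r] by (simp add: U_def)
  have "(frob_norm (res U (An n)))\<^sup>2 \<le> (\<Sum>j=r..<r. (s j)\<^sup>2)" unfolding U_def by (rule S.left_singular)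
  then have UA: "frob_norm (res U (An n)) = 0" by simp
  have UB: "frob_norm (res U (B n \<omega>)) = 0" if "\<omega> \<in> space M" for \<omega>
    using frob_norm_res_B_le[OF n that U] UA frob_norm_nonneg[of "res U (B n \<omega>)"] by linarith
  have zero_C: "frob_norm (res V' (C n \<omega>)) = 0" if V': "orthonormal_mat (I n) k V'" and 0: "frob_norm (res V' (B n \<omega>)) = 0" for V' k \<omega>
  proof -
    have "frob_norm (res V' (C n \<omega>)) \<le> frob_norm (res V' (B n \<omega>)) * frob_norm (sampling_mat (J n) (T n) (p n \<omega>) (\<lambda>j. \<xi> n j \<omega>))"
      unfolding res_C[OF V'] by (rule frob_norm_mult[OF orthonormal_mat.res_carrier[OF V' B_carrier] sampling_mat_carrier])
    then show ?thesis using 0 frob_norm_nonneg[of "res V' (C n \<omega>)"] by simp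
  qed
  have r0: "0 < r"
  proof (rule ccontr)
    assume "\<not> 0 < r"
    then have "(frob_norm (An n))\<^sup>2 = 0" using S.frob_norm_sq_A by simp
    then show False using frob_norm_An[OF n] W by simp
  qed
  have \<kappa>0: "0 < \<kappa>" using \<beta>\<^sub>0 pos[OF n] by (simp add: \<kappa>_def)
  have sq\<kappa>: "sqrt \<kappa> = 1 / sqrt (\<beta>\<^sub>0 * real (T n))" by (simp add: \<kappa>_def real_sqrt_divide)
  have \<eta>1: "1 \<le> \<eta>" by (rule confidence_factor_bounds(3)[OF \<delta> \<eta>])
  have rk: "real r \<le> real (mat_rank (An n))" using S.rank by simp
  have \<phi>0: "0 \<le> \<eta> / sqrt (\<beta>\<^sub>0 * real (T n))" using \<eta>1 \<beta>\<^sub>0 by simp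
  have small_r: "real r * \<eta> * sqrt \<kappa> < 1"
  proof -
    have "real r * (\<eta> / sqrt (\<beta>\<^sub>0 * real (T n))) \<le> real (mat_rank (An n)) * (\<eta> / sqrt (\<beta>\<^sub>0 * real (T n)))"
      by (rule mult_right_mono[OF rk \<phi>0])
    then show ?thesis using small by (simp add: sq\<kappa>)
  qed
  note hc = history_chain[OF n]
  note tails = nearly_optimal_tails[OF n \<beta>\<^sub>0 opt V V\<tau>, folded \<kappa>_def]
  have \<mu>0: "0 < \<mu> n" using pos[OF n] by blast
  interpret Sk: sketched_step M "\<lambda>\<omega>. (frob_norm (res (Q n \<omega>) (C n \<omega>)))\<^sup>2" "\<lambda>\<omega>. (frob_norm (res V (C n \<omega>)))\<^sup>2"
    "\<lambda>\<omega>. (frob_norm (res (Q n \<omega>) (B n \<omega>)))\<^sup>2"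
    "\<lambda>\<omega>. frob_norm (C n \<omega> * transpose_mat (C n \<omega>) - B n \<omega> * transpose_mat (B n \<omega>))"
    "\<lambda>\<omega>. (frob_norm (res V (B n \<omega>)))\<^sup>2" "I n" "\<mu> n" K r \<kappa> W \<tau> \<delta> \<eta>
  proof (intro sketched_step.intro sketched_step_axioms.intro prob_space_axioms)
    fix c :: real assume c: "0 < c"
    have "min (\<mu> n) r \<le> \<mu> n" "0 < \<mu> n" "\<mu> n \<le> I n" using pos[OF n] over[OF n] by auto
    note st = sketch_tail[OF hc(2) C_measurable[OF n] gaussian[OF n] gaussian_fresh[OF n] Q_measurable_M[OF n]
        basis_eq[OF n] V this K_pos c]
    show "{\<omega> \<in> space M. sketch_factor (I n) (\<mu> n + K) (\<mu> n) c * (frob_norm (res V (C n \<omega>)))\<^sup>2 < (frob_norm (res (Q n \<omega>) (C n \<omega>)))\<^sup>2} \<in> events \<and>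
      prob {\<omega> \<in> space M. sketch_factor (I n) (\<mu> n + K) (\<mu> n) c * (frob_norm (res V (C n \<omega>)))\<^sup>2 < (frob_norm (res (Q n \<omega>) (C n \<omega>)))\<^sup>2}
        \<le> sketch_failure (K + 1) (I n) (\<mu> n + K) c"
      by (rule conjI; rule st)
  next
    fix \<omega> assume \<omega>: "\<omega> \<in> space M"
    show "(frob_norm (res (Q n \<omega>) (B n \<omega>)))\<^sup>2 \<le> (frob_norm (res (Q n \<omega>) (C n \<omega>)))\<^sup>2 +
      sqrt (real r) * frob_norm (C n \<omega> * transpose_mat (C n \<omega>) - B n \<omega> * transpose_mat (B n \<omega>))"
      by (rule residual_transfer[OF Q_orth[OF n \<omega>] U B_carrier C_carrier UB[OF \<omega>] zero_C[OF U UB[OF \<omega>]]])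
    show "(frob_norm (res V (B n \<omega>)))\<^sup>2 \<le> \<tau>"
      using power_mono[OF frob_norm_res_B_le[OF n \<omega> V] frob_norm_nonneg, of 2] V\<tau> by linarith
    moreover assume "r \<le> \<mu> n"
    then have "\<tau> = 0" by (simp add: \<tau>_def)
    ultimately have "frob_norm (res V (B n \<omega>)) = 0" by simp
    then show "(frob_norm (res V (C n \<omega>)))\<^sup>2 = 0" using zero_C[OF V] by simp
  next
    show "\<mu> n < r \<Longrightarrow> 0 < \<tau>" unfolding \<tau>_def by (rule S.tail_pos)
  qed (assumption | rule tails \<mu>0 K_pos over[OF n] r0 \<kappa>0 W \<delta> \<eta> small_r)+
  have \<Lambda>0: "0 \<le> \<Lambda>" by (rule order_trans[OF _ \<Lambda>]) simp
  have D0: "0 \<le> Delta1 (\<mu> n + 1) (An n)" unfolding Delta1_def by (intro real_sqrt_ge_zero sum_nonneg) simp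
  have budR: "Sk.R \<le> real (mat_rank (An n)) * (\<eta> / sqrt (\<beta>\<^sub>0 * real (T n)) * W)"
  proof -
    have "Sk.R = real r * (\<eta> / sqrt (\<beta>\<^sub>0 * real (T n)) * W)" by (simp add: Sk.R_def sq\<kappa>)
    also have "\<dots> \<le> real (mat_rank (An n)) * (\<eta> / sqrt (\<beta>\<^sub>0 * real (T n)) * W)"
      using \<phi>0 W by (intro mult_right_mono[OF rk] mult_nonneg_nonneg) auto
    finally show ?thesis .
  qed
  have em: "{\<omega> \<in> space M. b < (frob_norm (res (Q n \<omega>) (B n \<omega>)))\<^sup>2} \<in> events" for b
    using step_error_measurable[OF n] by measurable
  have mono: "prob {\<omega> \<in> space M. ?bud < (frob_norm (res (Q n \<omega>) (B n \<omega>)))\<^sup>2} \<le> prob {\<omega> \<in> space M. b < (frob_norm (res (Q n \<omega>) (B n \<omega>)))\<^sup>2}"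
    if "b \<le> ?bud" for b
    using that by (intro finite_measure_mono em) auto
  have split: "?bud = real (mat_rank (An n)) * (2 * (1 + \<Lambda>) * real (I n) * Delta1 (\<mu> n + 1) (An n)) +
      real (mat_rank (An n)) * (\<eta> / sqrt (\<beta>\<^sub>0 * real (T n)) * W)"
    by (rule distrib_left)
  show ?thesis
  proof (cases "\<mu> n < r")
    case False
    have "0 \<le> real (mat_rank (An n)) * (2 * (1 + \<Lambda>) * real (I n) * Delta1 (\<mu> n + 1) (An n))"
      using \<Lambda>0 D0 by (intro mult_nonneg_nonneg) auto
    then have "Sk.R \<le> ?bud" using budR unfolding split by linarith
    from mono[OF this] Sk.failure_low_rank False show ?thesis by simp
  next
    case True
    \<comment> \<open>The \<open>2 sqrt \<mu>\<close> inside \<open>a\<close> is regrouped with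
      \<open>\<tau>\<close>, where \<open>tail_le_Delta1\<close> applies.\<close>
    have "Sk.a * \<tau> = 2 * (1 + sqrt (2 * real (\<mu> n + K)) * (sqrt (real (\<mu> n + K)) + sqrt (real (I n)))) * real (I n) * (2 * sqrt (real (\<mu> n)) * \<tau>)"
      by (simp add: budget_factor_def)
    also have "\<dots> \<le> 2 * (1 + \<Lambda>) * real (I n) * (real r * Delta1 (\<mu> n + 1) (An n))"
    proof (rule mult_mono)
      show "2 * (1 + sqrt (2 * real (\<mu> n + K)) * (sqrt (real (\<mu> n + K)) + sqrt (real (I n)))) * real (I n) \<le> 2 * (1 + \<Lambda>) * real (I n)"
        using \<Lambda> by (intro mult_right_mono mult_left_mono) auto
      show "2 * sqrt (real (\<mu> n)) * \<tau> \<le> real r * Delta1 (\<mu> n + 1) (An n)"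
        unfolding \<tau>_def by (rule S.tail_le_Delta1[OF True])
      show "0 \<le> 2 * sqrt (real (\<mu> n)) * \<tau>" using S.tail_pos[OF True] by (simp add: \<tau>_def)
    qed (use \<Lambda>0 in simp)
    also have "\<dots> = real r * (2 * (1 + \<Lambda>) * real (I n) * Delta1 (\<mu> n + 1) (An n))" by (simp only: mult_ac)
    also have "\<dots> \<le> real (mat_rank (An n)) * (2 * (1 + \<Lambda>) * real (I n) * Delta1 (\<mu> n + 1) (An n))"
      using \<Lambda>0 D0 by (intro mult_right_mono[OF rk] mult_nonneg_nonneg) auto
    finally have "Sk.a * \<tau> + Sk.R \<le> ?bud" using budR unfolding split by linarith
    from mono[OF this] Sk.failure_high_rank[OF True] show ?thesis by linarith
  qed
qed

lemma error_le_total: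
  assumes \<omega>: "\<omega> \<in> space M"
  shows "(tensor_norm N I (\<lambda>i. A i - hosvd_approx N A (\<lambda>k. Q k \<omega>) i))\<^sup>2 \<le> W"
  by (rule compressed_tensor.error_le[OF compressed[OF \<omega>]])

lemma error_sum:
  assumes \<omega>: "\<omega> \<in> space M"
  shows "(tensor_norm N I (\<lambda>i. A i - hosvd_approx N A (\<lambda>k. Q k \<omega>) i))\<^sup>2 =
    (\<Sum>n = 1..N. (frob_norm (res (Q n \<omega>) (B n \<omega>)))\<^sup>2)"
  by (rule compressed_tensor.error_eq_sum[OF compressed[OF \<omega>]])

text \<open>If every step stays within its share \<open>b n\<close>, the exact error identity keeps
  the total within the sum; so the failure event lies in the union of the step failures.\<close>

lemma union_bound:
  assumes "\<And>n. n \<in> {1..N} \<Longrightarrow> prob {\<omega> \<in> space M. b n < (frob_norm (res (Q n \<omega>) (B n \<omega>)))\<^sup>2} \<le> f n"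
  shows "1 - (\<Sum>n = 1..N. f n) \<le> prob {\<omega> \<in> space M.
    (tensor_norm N I (\<lambda>i. A i - hosvd_approx N A (\<lambda>k. Q k \<omega>) i))\<^sup>2 \<le> (\<Sum>n = 1..N. b n)}"
    (is "_ \<le> prob ?S")
proof -
  let ?F = "\<lambda>n. {\<omega> \<in> space M. b n < (frob_norm (res (Q n \<omega>) (B n \<omega>)))\<^sup>2}"
  have Fm: "?F n \<in> events" if "n \<in> {1..N}" for n using step_error_measurable[OF that] by measurable
  have "?S = {\<omega> \<in> space M. (\<Sum>n = 1..N. (frob_norm (res (Q n \<omega>) (B n \<omega>)))\<^sup>2) \<le> (\<Sum>n = 1..N. b n)}"
    by (auto simp: error_sum)
  moreover have "(\<lambda>\<omega>. \<Sum>n = 1..N. (frob_norm (res (Q n \<omega>) (B n \<omega>)))\<^sup>2) \<in> borel_measurable M"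
    by (intro meas.sum step_error_measurable) auto
  then have "{\<omega> \<in> space M. (\<Sum>n = 1..N. (frob_norm (res (Q n \<omega>) (B n \<omega>)))\<^sup>2) \<le> (\<Sum>n = 1..N. b n)} \<in> events"
    by measurable
  ultimately have Sm: "?S \<in> events" by simp
  have sub: "space M - ?S \<subseteq> (\<Union>n\<in>{1..N}. ?F n)"
  proof
    fix \<omega> assume \<omega>: "\<omega> \<in> space M - ?S"
    show "\<omega> \<in> (\<Union>n\<in>{1..N}. ?F n)"
    proof (rule ccontr)
      assume "\<not> ?thesis"
      then have "(frob_norm (res (Q n \<omega>) (B n \<omega>)))\<^sup>2 \<le> b n" if "n \<in> {1..N}" for n
        using \<omega> that by (auto simp: not_less)
      then have "(\<Sum>n = 1..N. (frob_norm (res (Q n \<omega>) (B n \<omega>)))\<^sup>2) \<le> (\<Sum>n = 1..N. b n)" by (intro sum_mono)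
      then show False using \<omega> by (auto simp: error_sum)
    qed
  qed
  have "1 - prob ?S = prob (space M - ?S)" by (rule prob_compl[OF Sm, symmetric])
  also have "\<dots> \<le> prob (\<Union>n\<in>{1..N}. ?F n)"
    by (rule finite_measure_mono[OF sub]) (intro sets.finite_UN finite_atLeastAtMost Fm)
  also have "\<dots> \<le> (\<Sum>n = 1..N. prob (?F n))"
    by (rule finite_measure_subadditive_finite) (use Fm in auto)
  also have "\<dots> \<le> (\<Sum>n = 1..N. f n)" by (intro sum_mono assms)
  finally show ?thesis by linarith
qed

lemma sure_bound:
  assumes "W \<le> b"
  shows "prob {\<omega> \<in> space M. (tensor_norm N I (\<lambda>i. A i - hosvd_approx N A (\<lambda>k. Q k \<omega>) i))\<^sup>2 \<le> b} = 1"
proof -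
  have "{\<omega> \<in> space M. (tensor_norm N I (\<lambda>i. A i - hosvd_approx N A (\<lambda>k. Q k \<omega>) i))\<^sup>2 \<le> b} = space M"
    using error_le_total assms by (auto intro: order_trans)
  then show ?thesis by (simp add: prob_space)
qed

text \<open>A nonzero matrix has a positive singular value, and the number of these is at most the
  rank.\<close>

lemma mat_rank_pos:
  assumes n: "n \<in> {1..N}" and W: "0 < W"
  shows "1 \<le> mat_rank (An n)"
proof (rule ccontr)
  obtain r u s where svd: "thin_svd_loc (I n) (unfold_cols N I n) r (An n) u s"
    using ex_thin_svd[OF An_carrier[of n]] by (elim exE)
  interpret S: thin_svd_loc "I n" "unfold_cols N I n" r "An n" u s by (rule svd)
  assume "\<not> 1 \<le> mat_rank (An n)"
  then have "r = 0" using S.rank by simp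
  then have "(frob_norm (An n))\<^sup>2 = 0" using S.frob_norm_sq_A by simp
  then show False using frob_norm_An[OF n] W by simp
qed

end

section \<open>The error bound for both kinds of sampling probabilities\<close>

theorem corollary7:
  fixes M :: "'w measure"
    and N K :: nat
    and I \<mu> T I2 I4 :: "nat \<Rightarrow> nat"
    and A :: tensor
    and H H' :: "nat \<Rightarrow> 'w measure"
    and P :: "nat \<Rightarrow> 'w \<Rightarrow> nat \<Rightarrow> real"
    and \<xi> :: "nat \<Rightarrow> nat \<Rightarrow> 'w \<Rightarrow> nat"
    and G Q :: "nat \<Rightarrow> 'w \<Rightarrow> real mat"
    and \<beta> \<gamma> p :: real
    and \<delta> lam :: "nat \<Rightarrow> real"
    and bound :: "(nat \<Rightarrow> real) \<Rightarrow> real"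
  defines "I2 \<equiv> \<lambda>n. min (I n) (T n)"
    and "I4 \<equiv> \<lambda>n. min ((\<Prod>k = 1..<n. \<mu> k) * (\<Prod>k = n + 1..N. I k)) (T n)"
    and "p \<equiv> 1 - (\<Sum>n = 1..N.
             1 / (4 * (\<gamma>\<^sup>2 - 1) * sqrt (pi * max (real (I2 n) - real (\<mu> n)) (real (\<mu> n + K)) * \<gamma>\<^sup>2))
               * (2 * \<gamma>\<^sup>2 / exp (\<gamma>\<^sup>2 - 1))\<^sup>2
           + 1 / sqrt (2 * pi * real (K + 1)) * (exp 1 / real (K + 1)) ^ (K + 1)
           + 1 / (4 * (\<gamma>\<^sup>2 - 1) * sqrt (pi * real (I n) * \<gamma>\<^sup>2)) * (2 * \<gamma>\<^sup>2 / exp (\<gamma>\<^sup>2 - 1))\<^sup>2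
           + \<delta> n)"
    and "lam \<equiv> \<lambda>n. (sqrt (max (real (I2 n) - real (\<mu> n)) (real (\<mu> n + K))) + sqrt (real (I n)))
                    * sqrt (2 * real (\<mu> n + K)) * \<gamma> * \<beta>"
    and "bound \<equiv> \<lambda>\<phi>. \<Sum>n = 1..N. real (mat_rank (unfolding_mat N I n A)) *
             (2 * (1 + lam n) * real (I n) * Delta1 (\<mu> n + 1) (unfolding_mat N I n A)
               + \<phi> n * (tensor_norm N I A)\<^sup>2)"
  assumes "1 \<le> N" and "0 < K"
    and "\<And>n. n \<in> {1..N} \<Longrightarrow> 0 < \<mu> n \<and> 0 < I n \<and> 0 < T n"
    and "\<And>n. n \<in> {1..N} \<Longrightarrow> \<mu> n + K < min (I2 n) (I4 n)"
    and "\<beta> > 1" and "\<gamma> > 1"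
    and "\<And>n. n \<in> {1..N} \<Longrightarrow> 0 < \<delta> n \<and> \<delta> n < 1"
    and "0 \<le> p"
    and "sampled_randomized_sthosvd M N I \<mu> T K 1 A H H' P \<xi> G Q"
  shows
    "(\<forall>\<beta>\<^sub>0. 0 < \<beta>\<^sub>0 \<and> \<beta>\<^sub>0 \<le> 1 \<and>
        (\<forall>n\<in>{1..N}. \<forall>\<omega>\<in>space M. nearly_optimal \<beta>\<^sub>0 (step_unfolding N I \<mu> A (\<lambda>k. Q k \<omega>) n) (P n \<omega>))
      \<longrightarrow> measure M {\<omega> \<in> space M.
            (tensor_norm N I (\<lambda>i. A i - hosvd_approx N A (\<lambda>k. Q k \<omega>) i))\<^sup>2
              \<le> bound (\<lambda>n. (1 + sqrt (8 / \<delta> n * ln (1 / \<delta> n))) / sqrt (\<beta>\<^sub>0 * real (T n)))} \<ge> p)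
   \<and> ((\<forall>n\<in>{1..N}. \<forall>\<omega>\<in>space M. uniform_probs (step_cols N I \<mu> n) (P n \<omega>))
      \<longrightarrow> measure M {\<omega> \<in> space M.
            (tensor_norm N I (\<lambda>i. A i - hosvd_approx N A (\<lambda>k. Q k \<omega>) i))\<^sup>2
              \<le> bound (\<lambda>n. 1 + sqrt (real (I4 n) / real (T n))
                             + real (I4 n) / sqrt (real (T n)) * sqrt (8 * ln (1 / \<delta> n)))} \<ge> p)"
proof -
  note over = assms(9) and \<beta> = assms(10) and \<gamma> = assms(11) and \<delta> = assms(12)
  interpret single_power_sthosvd M N I \<mu> T K A H H' P \<xi> G Q
  proof (intro single_power_sthosvd.intro single_power_sthosvd_axioms.intro assms(14) assms(7))
    show "n \<in> {1..N} \<Longrightarrow> 0 < \<mu> n \<and> 0 < I n \<and> 0 < T n" for n by (rule assms(8))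
    show "n \<in> {1..N} \<Longrightarrow> \<mu> n + K < I n" for n using over[of n] by (simp add: I2_def)
  qed
  define stir where "stir = 1 / sqrt (2 * pi * real (K + 1)) * (exp 1 / real (K + 1)) ^ (K + 1)"
  have stir0: "0 \<le> stir" by (simp add: stir_def)
  have \<gamma>2: "0 < \<gamma>\<^sup>2 - 1" using \<gamma> one_less_power[of \<gamma> 2] by simp
  have p_le: "p \<le> 1 - (\<Sum>n = 1..N. stir + \<delta> n)"
    unfolding p_def stir_def
  proof (intro diff_left_mono sum_mono add_right_mono)
    fix n
    have nn: "0 \<le> 1 / (4 * (\<gamma>\<^sup>2 - 1) * sqrt (pi * x * \<gamma>\<^sup>2)) * (2 * \<gamma>\<^sup>2 / exp (\<gamma>\<^sup>2 - 1))\<^sup>2" if "0 \<le> x" for x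
      using \<gamma>2 that by (intro mult_nonneg_nonneg divide_nonneg_nonneg) auto
    show "s \<le> 1 / (4 * (\<gamma>\<^sup>2 - 1) * sqrt (pi * max (real (I2 n) - real (\<mu> n)) (real (\<mu> n + K)) * \<gamma>\<^sup>2))
          * (2 * \<gamma>\<^sup>2 / exp (\<gamma>\<^sup>2 - 1))\<^sup>2 + s
        + 1 / (4 * (\<gamma>\<^sup>2 - 1) * sqrt (pi * real (I n) * \<gamma>\<^sup>2)) * (2 * \<gamma>\<^sup>2 / exp (\<gamma>\<^sup>2 - 1))\<^sup>2" for s
      using nn[of "max (real (I2 n) - real (\<mu> n)) (real (\<mu> n + K))"] nn[of "real (I n)"]
      by (simp add: le_max_iff_disj)
  qed
  have p1: "p \<le> 1"
    using p_le stir0 \<delta> sum_nonneg[of "{1..N}" "\<lambda>n. stir + \<delta> n"] by fastforce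
  \<comment> \<open>The maximum in \<open>lam\<close> is at least \<open>\<mu> + K\<close>, and
    \<open>\<gamma> \<beta> \<ge> 1\<close>.\<close>
  have lam: "sqrt (2 * real (\<mu> n + K)) * (sqrt (real (\<mu> n + K)) + sqrt (real (I n))) \<le> lam n" for n
  proof -
    let ?x = "(sqrt (max (real (I2 n) - real (\<mu> n)) (real (\<mu> n + K))) + sqrt (real (I n))) * sqrt (2 * real (\<mu> n + K))"
    have "sqrt (2 * real (\<mu> n + K)) * (sqrt (real (\<mu> n + K)) + sqrt (real (I n))) \<le> ?x"
      unfolding mult.commute[of "sqrt (2 * real (\<mu> n + K))"]
      by (intro mult_right_mono add_right_mono real_sqrt_le_mono) auto
    also have "?x * 1 \<le> ?x * (\<gamma> * \<beta>)"
    proof (rule mult_left_mono)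
      have "1 * 1 \<le> \<gamma> * \<beta>" using \<gamma> \<beta> by (intro mult_mono) auto
      then show "1 \<le> \<gamma> * \<beta>" by simp
      show "0 \<le> ?x" by (intro mult_nonneg_nonneg add_nonneg_nonneg real_sqrt_ge_zero) (auto simp: le_max_iff_disj)
    qed
    finally show ?thesis by (simp add: lam_def mult.assoc)
  qed
  have lam0: "0 \<le> lam n" for n by (rule order_trans[OF _ lam]) simp
  have Del0: "0 \<le> Delta1 k X" for k X unfolding Delta1_def by (intro real_sqrt_ge_zero sum_nonneg) simp
  have term0: "0 \<le> real (mat_rank (An n)) * (2 * (1 + lam n) * real (I n) * Delta1 (\<mu> n + 1) (An n) + f * W)"
    if "0 \<le> f" for n f
    using that lam0 Del0 by (intro mult_nonneg_nonneg add_nonneg_nonneg) auto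
  \<comment> \<open>One mode for which rank times \<open>\<phi>\<close> reaches 1 already
    contributes all of \<open>W\<close>, and no summand is negative.\<close>
  have bound_ge: "W \<le> bound \<phi>"
    if n: "n \<in> {1..N}" and \<phi>: "\<And>n. n \<in> {1..N} \<Longrightarrow> 0 \<le> \<phi> n" and big: "W = 0 \<or> 1 \<le> real (mat_rank (An n)) * \<phi> n" for n \<phi>
  proof -
    have "W \<le> real (mat_rank (An n)) * \<phi> n * W"
      using big mult_right_mono[of 1 "real (mat_rank (An n)) * \<phi> n" W] by auto
    also have "\<dots> \<le> real (mat_rank (An n)) * (2 * (1 + lam n) * real (I n) * Delta1 (\<mu> n + 1) (An n) + \<phi> n * W)"
      unfolding distrib_left mult.assoc[symmetric]
      using lam0 Del0 by (intro le_add_same_cancel2[THEN iffD2] mult_nonneg_nonneg) auto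
    also have "\<dots> \<le> bound \<phi>"
      unfolding bound_def using \<phi> by (intro member_le_sum[OF n] term0) auto
    finally show ?thesis .
  qed
  have sure: "p \<le> prob {\<omega> \<in> space M. (tensor_norm N I (\<lambda>i. A i - hosvd_approx N A (\<lambda>k. Q k \<omega>) i))\<^sup>2 \<le> bound \<phi>}"
    if "W \<le> bound \<phi>" for \<phi>
    unfolding sure_bound[OF that] by (rule p1)
  show ?thesis
  proof (intro conjI allI impI)
    fix \<beta>\<^sub>0 :: real
    assume "0 < \<beta>\<^sub>0 \<and> \<beta>\<^sub>0 \<le> 1 \<and> (\<forall>n\<in>{1..N}. \<forall>\<omega>\<in>space M. nearly_optimal \<beta>\<^sub>0 (B n \<omega>) (P n \<omega>))"
    then have \<beta>\<^sub>0: "0 < \<beta>\<^sub>0" and opt: "\<And>n \<omega>. n \<in> {1..N} \<Longrightarrow> \<omega> \<in> space M \<Longrightarrow> nearly_optimal \<beta>\<^sub>0 (B n \<omega>) (P n \<omega>)" by auto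
    define \<phi> where "\<phi> = (\<lambda>n. (1 + sqrt (8 / \<delta> n * ln (1 / \<delta> n))) / sqrt (\<beta>\<^sub>0 * real (T n)))"
    have \<phi>0: "0 \<le> \<phi> n" if "n \<in> {1..N}" for n
      using confidence_factor_bounds(3)[of "\<delta> n" "1 + sqrt (8 / \<delta> n * ln (1 / \<delta> n))"] \<delta>[OF that] \<beta>\<^sub>0
      unfolding \<phi>_def by (intro divide_nonneg_nonneg) auto
    have "p \<le> prob {\<omega> \<in> space M. (tensor_norm N I (\<lambda>i. A i - hosvd_approx N A (\<lambda>k. Q k \<omega>) i))\<^sup>2 \<le> bound \<phi>}"
    proof (cases "W = 0 \<or> (\<exists>n\<in>{1..N}. 1 \<le> real (mat_rank (An n)) * \<phi> n)")
      case True
      \<comment> \<open>If \<open>W = 0\<close>, any mode serves as witness; there is one because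
        \<open>1 \<le> N\<close>.\<close>
      then obtain n where n: "n \<in> {1..N}" "W = 0 \<or> 1 \<le> real (mat_rank (An n)) * \<phi> n"
        using assms(6) by (metis atLeastAtMost_iff order_refl)
      show ?thesis by (intro sure bound_ge[OF n(1) \<phi>0] n(2))
    next
      case False
      then have W: "0 < W" by (simp add: less_le)
      have small: "real (mat_rank (An n)) * \<phi> n < 1" if "n \<in> {1..N}" for n using False that by (auto simp: not_le)
      note p_le
      also have "1 - (\<Sum>n = 1..N. stir + \<delta> n) \<le> prob {\<omega> \<in> space M.
        (tensor_norm N I (\<lambda>i. A i - hosvd_approx N A (\<lambda>k. Q k \<omega>) i))\<^sup>2 \<le> bound \<phi>}"
        unfolding bound_def
      proof (rule union_bound)
        fix n assume n: "n \<in> {1..N}"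
        show "prob {\<omega> \<in> space M. real (mat_rank (An n)) * (2 * (1 + lam n) * real (I n) * Delta1 (\<mu> n + 1) (An n) + \<phi> n * W)
            < (frob_norm (res (Q n \<omega>) (B n \<omega>)))\<^sup>2} \<le> stir + \<delta> n"
          unfolding \<phi>_def stir_def
          by (rule step_failure[OF n \<beta>\<^sub>0 opt[OF n] W _ _ refl lam small[OF n, unfolded \<phi>_def]]) (use \<delta>[OF n] in auto)
      qed
      finally show ?thesis .
    qed
    then show "p \<le> prob {\<omega> \<in> space M. (tensor_norm N I (\<lambda>i. A i - hosvd_approx N A (\<lambda>k. Q k \<omega>) i))\<^sup>2
        \<le> bound (\<lambda>n. (1 + sqrt (8 / \<delta> n * ln (1 / \<delta> n))) / sqrt (\<beta>\<^sub>0 * real (T n)))}"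
      unfolding \<phi>_def .
  next
    define \<phi> where "\<phi> = (\<lambda>n. 1 + sqrt (real (I4 n) / real (T n)) + real (I4 n) / sqrt (real (T n)) * sqrt (8 * ln (1 / \<delta> n)))"
    have \<phi>1: "1 \<le> \<phi> n" if "n \<in> {1..N}" for n
    proof -
      have "0 \<le> ln (1 / \<delta> n)" using \<delta>[OF that] by simp
      then have "0 \<le> sqrt (real (I4 n) / real (T n)) + real (I4 n) / sqrt (real (T n)) * sqrt (8 * ln (1 / \<delta> n))"
        by (intro add_nonneg_nonneg mult_nonneg_nonneg) auto
      then show ?thesis by (simp add: \<phi>_def)
    qed
    have n1: "1 \<in> {1..N}" using assms(6) by simp
    have "W = 0 \<or> 1 \<le> real (mat_rank (An 1)) * \<phi> 1"
    proof (cases "W = 0")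
      case False
      then have "1 * 1 \<le> real (mat_rank (An 1)) * \<phi> 1"
        using mat_rank_pos[OF n1] \<phi>1[OF n1] by (intro mult_mono) (auto simp: less_le)
      then show ?thesis by simp
    qed simp
    moreover have "0 \<le> \<phi> n" if "n \<in> {1..N}" for n using \<phi>1[OF that] by simp
    ultimately have "W \<le> bound \<phi>" by (intro bound_ge[OF n1])
    from sure[OF this] show "p \<le> prob {\<omega> \<in> space M. (tensor_norm N I (\<lambda>i. A i - hosvd_approx N A (\<lambda>k. Q k \<omega>) i))\<^sup>2
        \<le> bound (\<lambda>n. 1 + sqrt (real (I4 n) / real (T n)) + real (I4 n) / sqrt (real (T n)) * sqrt (8 * ln (1 / \<delta> n)))}"
      unfolding \<phi>_def .
  qed
qed

end
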